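(* Let $R$ be a commutative Noetherian local ring, and let $M$, $N$ be finitely generated $R$-modules with $\operatorname{depth} R > \operatorname{depth}_R M$. (i) If $\operatorname{Tor}^R_{\gg 0}(M/(x_1,\ldots,x_i)M, N) = 0$ for all $i = 0,\ldots,\operatorname{depth}_R M + 1$ and all $R$-regular sequences $x_1,\ldots,x_i$, then $\operatorname{pd}_R N < \infty$. (ii) If $\operatorname{Ext}_R^{\gg 0}(M/(x_1,\ldots,x_i)M, N) = 0$ for all $i = 0,\ldots,\operatorname{depth}_R M + 1$ and all $R$-regular sequences $x_1,\ldots,x_i$, then $\operatorname{id}_R N < \infty$.
   Context: $\operatorname{Tor}^R_{\gg 0}(X,N)=0$ means that there is an integer $n_0$ (which may depend on $X$) such that $\operatorname{Tor}^R_n(X,N)=0$ for all $n\ge n_0$; similarly $\operatorname{Ext}_R^{\gg 0}(X,N)=0$ means $\operatorname{Ext}_R^n(X,N)=0$ for all sufficiently large $n$. $\operatorname{pd}_R$ and $\operatorname{id}_R$ denote projective and injective dimension. Regular sequences consist of elements of the maximal ideal of $R$; for $i=0$ the sequence is empty and $M/(x_1,\ldots,x_i)M=M$. The zero module has depth $\infty$, and its projective and injective dimensions count as finite ($<\infty$). *)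

theory Defs
  imports "HOL-Algebra.Ring_Divisibility" "HOL-Algebra.Module" "HOL-Library.Extended_Nat"
begin

section \<open>Modules\<close>

text \<open>
  The record type of modules inherits \<open>mult\<close> and \<open>one\<close> from rings; the locale
  \<^locale>\<open>module\<close> ignores these two fields, and they are left \<^term>\<open>undefined\<close> below.
\<close>

definition trivial_module :: "('a, 'b, 'm) module_scheme \<Rightarrow> bool" where
  "trivial_module M \<longleftrightarrow> carrier M = {\<zero>\<^bsub>M\<^esub>}"

definition module_hom ::
    "('a, 'r) ring_scheme \<Rightarrow> ('a, 'b, 'm) module_scheme \<Rightarrow> ('a, 'c, 'n) module_scheme \<Rightarrow> ('b \<Rightarrow> 'c) set"
  where
  "module_hom R A B = {f \<in> carrier A \<rightarrow> carrier B.
     (\<forall>x\<in>carrier A. \<forall>y\<in>carrier A. f (x \<oplus>\<^bsub>A\<^esub> y) = f x \<oplus>\<^bsub>B\<^esub> f y) \<and>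
     (\<forall>r\<in>carrier R. \<forall>x\<in>carrier A. f (r \<odot>\<^bsub>A\<^esub> x) = r \<odot>\<^bsub>B\<^esub> f x)}"

definition module_span :: "('a, 'r) ring_scheme \<Rightarrow> ('a, 'b, 'm) module_scheme \<Rightarrow> 'b set \<Rightarrow> 'b set" where
  "module_span R M S = \<Inter>{H. submodule H R M \<and> S \<subseteq> H}"

definition fin_gen_module :: "('a, 'r) ring_scheme \<Rightarrow> ('a, 'b, 'm) module_scheme \<Rightarrow> bool" where
  "fin_gen_module R M \<longleftrightarrow>
     module R M \<and> (\<exists>S. finite S \<and> S \<subseteq> carrier M \<and> module_span R M S = carrier M)"

definition quot_module :: "('a, 'b, 'm) module_scheme \<Rightarrow> 'b set \<Rightarrow> ('a, 'b set) module" where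
  "quot_module M H =
     \<lparr>carrier = a_rcosets\<^bsub>M\<^esub> H, mult = undefined, one = undefined,
      zero = H, add = set_add M,
      smult = (\<lambda>r K. \<Union>x\<in>K. H +>\<^bsub>M\<^esub> (r \<odot>\<^bsub>M\<^esub> x))\<rparr>"

definition self_module :: "('a, 'r) ring_scheme \<Rightarrow> ('a, 'a) module" where
  "self_module R =
     \<lparr>carrier = carrier R, mult = mult R, one = one R, zero = zero R, add = add R,
      smult = mult R\<rparr>"

definition free_module :: "('a, 'r) ring_scheme \<Rightarrow> 'i set \<Rightarrow> ('a, 'i \<Rightarrow> 'a) module" where
  "free_module R S =
     \<lparr>carrier = {c. range c \<subseteq> carrier R \<and> finite {s. c s \<noteq> \<zero>\<^bsub>R\<^esub>} \<and> {s. c s \<noteq> \<zero>\<^bsub>R\<^esub>} \<subseteq> S},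
      mult = undefined, one = undefined,
      zero = (\<lambda>s. \<zero>\<^bsub>R\<^esub>), add = (\<lambda>c d s. c s \<oplus>\<^bsub>R\<^esub> d s),
      smult = (\<lambda>r c s. r \<otimes>\<^bsub>R\<^esub> c s)\<rparr>"

definition free_gen :: "('a, 'r) ring_scheme \<Rightarrow> 'i \<Rightarrow> 'i \<Rightarrow> 'a" where
  "free_gen R s = (\<lambda>t. if t = s then \<one>\<^bsub>R\<^esub> else \<zero>\<^bsub>R\<^esub>)"

definition hom_module ::
    "('a, 'r) ring_scheme \<Rightarrow> ('a, 'b, 'm) module_scheme \<Rightarrow> ('a, 'c, 'n) module_scheme \<Rightarrow> ('a, 'b \<Rightarrow> 'c) module"
  where
  "hom_module R A B =
     \<lparr>carrier = module_hom R A B \<inter> extensional (carrier A), mult = undefined, one = undefined,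
      zero = (\<lambda>x\<in>carrier A. \<zero>\<^bsub>B\<^esub>), add = (\<lambda>f g. \<lambda>x\<in>carrier A. f x \<oplus>\<^bsub>B\<^esub> g x),
      smult = (\<lambda>r f. \<lambda>x\<in>carrier A. r \<odot>\<^bsub>B\<^esub> f x)\<rparr>"


section \<open>Tensor products\<close>

definition tensor_relations ::
    "('a, 'r) ring_scheme \<Rightarrow> ('a, 'b, 'm) module_scheme \<Rightarrow> ('a, 'c, 'n) module_scheme \<Rightarrow> ('b \<times> 'c \<Rightarrow> 'a) set"
  where
  "tensor_relations R A B =
     (let F = free_module R (carrier A \<times> carrier B); e = (\<lambda>a b. free_gen R (a, b)) in
      module_span R F
       ({e (a \<oplus>\<^bsub>A\<^esub> a') b \<ominus>\<^bsub>F\<^esub> (e a b \<oplus>\<^bsub>F\<^esub> e a' b) | a a' b.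
            a \<in> carrier A \<and> a' \<in> carrier A \<and> b \<in> carrier B} \<union>
        {e a (b \<oplus>\<^bsub>B\<^esub> b') \<ominus>\<^bsub>F\<^esub> (e a b \<oplus>\<^bsub>F\<^esub> e a b') | a b b'.
            a \<in> carrier A \<and> b \<in> carrier B \<and> b' \<in> carrier B} \<union>
        {e (r \<odot>\<^bsub>A\<^esub> a) b \<ominus>\<^bsub>F\<^esub> (r \<odot>\<^bsub>F\<^esub> e a b) | r a b.
            r \<in> carrier R \<and> a \<in> carrier A \<and> b \<in> carrier B} \<union>
        {e a (r \<odot>\<^bsub>B\<^esub> b) \<ominus>\<^bsub>F\<^esub> (r \<odot>\<^bsub>F\<^esub> e a b) | r a b.
            r \<in> carrier R \<and> a \<in> carrier A \<and> b \<in> carrier B}))"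

definition tensor_module ::
    "('a, 'r) ring_scheme \<Rightarrow> ('a, 'b, 'm) module_scheme \<Rightarrow> ('a, 'c, 'n) module_scheme \<Rightarrow>
     ('a, ('b \<times> 'c \<Rightarrow> 'a) set) module"
  where
  "tensor_module R A B =
     quot_module (free_module R (carrier A \<times> carrier B)) (tensor_relations R A B)"

definition pure_tensor ::
    "('a, 'r) ring_scheme \<Rightarrow> ('a, 'b, 'm) module_scheme \<Rightarrow> ('a, 'c, 'n) module_scheme \<Rightarrow>
     'b \<Rightarrow> 'c \<Rightarrow> ('b \<times> 'c \<Rightarrow> 'a) set"
  where
  "pure_tensor R A B a b =
     tensor_relations R A B +>\<^bsub>free_module R (carrier A \<times> carrier B)\<^esub> free_gen R (a, b)"

text \<open>
  For \<open>f \<in> module_hom R A A'\<close>, the induced map from the tensor product of \<open>A\<close> and \<open>B\<close> to that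
  of \<open>A'\<close> and \<open>B\<close>.
\<close>

definition tensor_map ::
    "('a, 'r) ring_scheme \<Rightarrow> ('a, 'b, 'm) module_scheme \<Rightarrow> ('a, 'd, 'k) module_scheme \<Rightarrow>
     ('a, 'c, 'n) module_scheme \<Rightarrow> ('b \<Rightarrow> 'd) \<Rightarrow> ('b \<times> 'c \<Rightarrow> 'a) set \<Rightarrow> ('d \<times> 'c \<Rightarrow> 'a) set"
  where
  "tensor_map R A A' B f =
     (THE h. h \<in> module_hom R (tensor_module R A B) (tensor_module R A' B) \<and>
        h \<in> extensional (carrier (tensor_module R A B)) \<and>
        (\<forall>a\<in>carrier A. \<forall>b\<in>carrier B. h (pure_tensor R A B a b) = pure_tensor R A' B (f a) b))"


section \<open>Projective and injective modules and resolutions\<close>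

text \<open>
  A definition in HOL cannot quantify over the modules on all types. Every quantifier over modules
  that the textbook definitions need is therefore taken over the modules whose carrier lies in the
  following type, where \<open>'a\<close> is the type of the ring elements and \<open>'b\<close> the one carrying the module
  under consideration. By the constructor \<open>Fun\<close>, each of finite lists over this type, countable
  sequences in it, and functions from the ring to it can be embedded into it. Hence, up to
  isomorphism, the modules with carriers in this type are closed under submodules, quotients, free
  modules on subsets, and the functor of additive maps from the ring into an abelian group; they
  include all modules on \<open>'a\<close> and on \<open>'b\<close>. So there are enough projectives and enough injectives
  among them, and testing the lifting properties on them is as strong as testing on all modules
  (the free cover of \<open>P\<close> and the ideals of the ring are among the test modules).
\<close>

datatype ('a, 'b) univ = Scalar 'a | Elem 'b | Fun "'a list \<Rightarrow> ('a, 'b) univ"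

definition projective_module :: "('a, 'r) ring_scheme \<Rightarrow> ('a, 'b, 'm) module_scheme \<Rightarrow> bool" where
  "projective_module R P \<longleftrightarrow> module R P \<and>
     (\<forall>(A :: ('a, ('a, 'b) univ) module) (B :: ('a, ('a, 'b) univ) module) g f.
        module R A \<and> module R B \<and> g \<in> module_hom R A B \<and> g ` carrier A = carrier B \<and>
        f \<in> module_hom R P B \<longrightarrow>
        (\<exists>h\<in>module_hom R P A. \<forall>x\<in>carrier P. g (h x) = f x))"

definition injective_module :: "('a, 'r) ring_scheme \<Rightarrow> ('a, 'b, 'm) module_scheme \<Rightarrow> bool" where
  "injective_module R E \<longleftrightarrow> module R E \<and>
     (\<forall>(A :: ('a, ('a, 'b) univ) module) (B :: ('a, ('a, 'b) univ) module) g f.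
        module R A \<and> module R B \<and> g \<in> module_hom R A B \<and> inj_on g (carrier A) \<and>
        f \<in> module_hom R A E \<longrightarrow>
        (\<exists>h\<in>module_hom R B E. \<forall>x\<in>carrier A. h (g x) = f x))"

text \<open>\<open>\<dots> \<rightarrow> P 2 \<rightarrow> P 1 \<rightarrow> P 0 \<rightarrow> X \<rightarrow> 0\<close> with differentials \<open>d n : P (n + 1) \<rightarrow> P n\<close> and augmentation \<open>e\<close>.\<close>

definition projective_resolution ::
    "('a, 'r) ring_scheme \<Rightarrow> ('a, 'b, 'm) module_scheme \<Rightarrow> (nat \<Rightarrow> ('a, 'p) module) \<Rightarrow>
     (nat \<Rightarrow> 'p \<Rightarrow> 'p) \<Rightarrow> ('p \<Rightarrow> 'b) \<Rightarrow> bool"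
  where
  "projective_resolution R X P d e \<longleftrightarrow>
     (\<forall>n. projective_module R (P n)) \<and>
     e \<in> module_hom R (P 0) X \<and> (\<forall>n. d n \<in> module_hom R (P (Suc n)) (P n)) \<and>
     e ` carrier (P 0) = carrier X \<and>
     d 0 ` carrier (P 1) = a_kernel (P 0) X e \<and>
     (\<forall>n. d (Suc n) ` carrier (P (Suc (Suc n))) = a_kernel (P (Suc n)) (P n) (d n))"

text \<open>\<open>0 \<rightarrow> X \<rightarrow> E 0 \<rightarrow> E 1 \<rightarrow> E 2 \<rightarrow> \<dots>\<close> with differentials \<open>d n : E n \<rightarrow> E (n + 1)\<close> and coaugmentation \<open>e\<close>.\<close>

definition injective_resolution ::
    "('a, 'r) ring_scheme \<Rightarrow> ('a, 'b, 'm) module_scheme \<Rightarrow> (nat \<Rightarrow> ('a, 'q) module) \<Rightarrow>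
     (nat \<Rightarrow> 'q \<Rightarrow> 'q) \<Rightarrow> ('b \<Rightarrow> 'q) \<Rightarrow> bool"
  where
  "injective_resolution R X E d e \<longleftrightarrow>
     (\<forall>n. injective_module R (E n)) \<and>
     e \<in> module_hom R X (E 0) \<and> (\<forall>n. d n \<in> module_hom R (E n) (E (Suc n))) \<and>
     inj_on e (carrier X) \<and>
     e ` carrier X = a_kernel (E 0) (E 1) (d 0) \<and>
     (\<forall>n. d n ` carrier (E n) = a_kernel (E (Suc n)) (E (Suc (Suc n))) (d (Suc n)))"

text \<open>The infimum of the empty set is \<open>\<infinity>\<close>; the zero module gets dimension \<open>0\<close>.\<close>

definition proj_dim :: "('a, 'r) ring_scheme \<Rightarrow> ('a, 'b, 'm) module_scheme \<Rightarrow> enat" where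
  "proj_dim R X = Inf {enat n | n. \<exists>(P :: nat \<Rightarrow> ('a, ('a, 'b) univ) module) d e.
     projective_resolution R X P d e \<and> (\<forall>i>n. trivial_module (P i))}"

definition inj_dim :: "('a, 'r) ring_scheme \<Rightarrow> ('a, 'b, 'm) module_scheme \<Rightarrow> enat" where
  "inj_dim R X = Inf {enat n | n. \<exists>(E :: nat \<Rightarrow> ('a, ('a, 'b) univ) module) d e.
     injective_resolution R X E d e \<and> (\<forall>i>n. trivial_module (E i))}"


section \<open>Tor and Ext\<close>

text \<open>An arbitrary but fixed projective resolution (its modules and differentials).\<close>

definition some_resolution ::
    "('a, 'r) ring_scheme \<Rightarrow> ('a, 'b, 'm) module_scheme \<Rightarrow>
     (nat \<Rightarrow> ('a, ('a, 'b) univ) module) \<times> (nat \<Rightarrow> ('a, 'b) univ \<Rightarrow> ('a, 'b) univ)"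
  where
  "some_resolution R X = (SOME (P, d). \<exists>e. projective_resolution R X P d e)"

definition Tor ::
    "('a, 'r) ring_scheme \<Rightarrow> nat \<Rightarrow> ('a, 'b, 'm) module_scheme \<Rightarrow> ('a, 'c, 'n) module_scheme \<Rightarrow>
     ('a, (('a, 'b) univ \<times> 'c \<Rightarrow> 'a) set set) module"
  where
  "Tor R n X N =
     (let P = fst (some_resolution R X); d = snd (some_resolution R X);
          C = (\<lambda>k. tensor_module R (P k) N);
          \<delta> = (\<lambda>k. tensor_map R (P (Suc k)) (P k) N (d k));
          cycles = (case n of 0 \<Rightarrow> carrier (C 0) | Suc k \<Rightarrow> a_kernel (C (Suc k)) (C k) (\<delta> k));
          boundaries = \<delta> n ` carrier (C (Suc n))
      in quot_module ((C n)\<lparr>carrier := cycles\<rparr>) boundaries)"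

definition Ext ::
    "('a, 'r) ring_scheme \<Rightarrow> nat \<Rightarrow> ('a, 'b, 'm) module_scheme \<Rightarrow> ('a, 'c, 'n) module_scheme \<Rightarrow>
     ('a, (('a, 'b) univ \<Rightarrow> 'c) set) module"
  where
  "Ext R n X N =
     (let P = fst (some_resolution R X); d = snd (some_resolution R X);
          C = (\<lambda>k. hom_module R (P k) N);
          \<delta> = (\<lambda>k f. compose (carrier (P (Suc k))) f (d k));
          cocycles = a_kernel (C n) (C (Suc n)) (\<delta> n);
          coboundaries = (case n of 0 \<Rightarrow> {\<zero>\<^bsub>C 0\<^esub>} | Suc k \<Rightarrow> \<delta> k ` carrier (C k))
      in quot_module ((C n)\<lparr>carrier := cocycles\<rparr>) coboundaries)"

definition Tor_eventually_zero ::
    "('a, 'r) ring_scheme \<Rightarrow> ('a, 'b, 'm) module_scheme \<Rightarrow> ('a, 'c, 'n) module_scheme \<Rightarrow> bool"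
  where
  "Tor_eventually_zero R X N \<longleftrightarrow> (\<exists>n0. \<forall>n\<ge>n0. trivial_module (Tor R n X N))"

definition Ext_eventually_zero ::
    "('a, 'r) ring_scheme \<Rightarrow> ('a, 'b, 'm) module_scheme \<Rightarrow> ('a, 'c, 'n) module_scheme \<Rightarrow> bool"
  where
  "Ext_eventually_zero R X N \<longleftrightarrow> (\<exists>n0. \<forall>n\<ge>n0. trivial_module (Ext R n X N))"


section \<open>Local rings, regular sequences and depth\<close>

definition local_ring :: "('a, 'r) ring_scheme \<Rightarrow> bool" where
  "local_ring R \<longleftrightarrow> cring R \<and> (\<exists>!\<mm>. maximalideal \<mm> R)"

definition max_ideal :: "('a, 'r) ring_scheme \<Rightarrow> 'a set" where
  "max_ideal R = (THE \<mm>. maximalideal \<mm> R)"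

definition ideal_times_module :: "('a, 'r) ring_scheme \<Rightarrow> 'a set \<Rightarrow> ('a, 'b, 'm) module_scheme \<Rightarrow> 'b set" where
  "ideal_times_module R I M = module_span R M {a \<odot>\<^bsub>M\<^esub> x | a x. a \<in> I \<and> x \<in> carrier M}"

definition quot_by_seq :: "('a, 'r) ring_scheme \<Rightarrow> ('a, 'b, 'm) module_scheme \<Rightarrow> 'a list \<Rightarrow> ('a, 'b set) module"
  where
  "quot_by_seq R M xs = quot_module M (ideal_times_module R (Idl\<^bsub>R\<^esub> (set xs)) M)"

definition regular_seq :: "('a, 'r) ring_scheme \<Rightarrow> ('a, 'b, 'm) module_scheme \<Rightarrow> 'a list \<Rightarrow> bool" where
  "regular_seq R M xs \<longleftrightarrow> set xs \<subseteq> max_ideal R \<and>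
     (\<forall>i<length xs. let Q = quot_by_seq R M (take i xs) in
        \<forall>q\<in>carrier Q. (xs ! i) \<odot>\<^bsub>Q\<^esub> q = \<zero>\<^bsub>Q\<^esub> \<longrightarrow> q = \<zero>\<^bsub>Q\<^esub>) \<and>
     \<not> trivial_module (quot_by_seq R M xs)"

text \<open>The usual notion for finitely generated modules over a Noetherian local ring.\<close>

definition depth :: "('a, 'r) ring_scheme \<Rightarrow> ('a, 'b, 'm) module_scheme \<Rightarrow> enat" where
  "depth R M = (if trivial_module M then \<infinity>
                else Sup {enat (length xs) | xs. regular_seq R M xs})"

end

theory Submission
  imports Defs "HOL-Algebra.IntRing"
begin

text \<open>
  Vanishing of Tor or Ext in high degrees is carried over from the quotients of \<open>M\<close> by regular
  sequences to the residue field \<open>k\<close>, and vanishing on \<open>k\<close> bounds the homological dimensions of \<open>N\<close>.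

  \<^bold>\<open>Reaching the residue field.\<close> Since \<open>depth M < depth R\<close>, there is an \<open>R\<close>-regular sequence \<open>xs\<close> of
  length at most \<open>depth M\<close> such that \<open>\<mm>\<close> annihilates a nonzero element of \<open>M/xs M\<close> but none of
  \<open>R/xs R\<close> (\<open>exists_regular_seq_to_socle\<close>). Put \<open>K = xs M\<close>. For each \<open>u \<in> \<mm>\<close> regular on \<open>R/xs R\<close>, the
  sequence \<open>xs, u\<close> is again allowed, so the functor vanishes in high degrees on \<open>M/K\<close> and on
  \<open>M/(K + u M)\<close>. By the exact sequences of \<open>0 \<rightarrow> (K : u)/K \<rightarrow> M/K \<rightarrow> u (M/K) \<rightarrow> 0\<close> and
  \<open>0 \<rightarrow> u (M/K) \<rightarrow> M/K \<rightarrow> M/(K + u M) \<rightarrow> 0\<close> it vanishes in high degrees on \<open>(K : u)/K\<close>. For \<open>u\<close> regular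
  also modulo the \<open>\<mm>\<close>-power torsion \<open>L/K\<close> of \<open>M/K\<close>, the submodule \<open>(K : u)\<close> lies in \<open>L\<close>, and it is all of
  \<open>L\<close> for a high power of such an element; hence the functor vanishes in high degrees also on
  \<open>u (L/K)\<close>. By prime avoidance such elements generate \<open>\<mm>\<close>. If \<open>(K : u)\<close> is maximal among those that
  do not contain \<open>L\<close>, with \<open>u = 1\<close> admitted, each of them annihilates \<open>u (L/K)\<close>, and so does \<open>\<mm>\<close>.
  Then \<open>u (L/K)\<close> is a nonzero vector space over \<open>k\<close> (\<open>ext_vanishes_on_socle_part\<close>), so \<open>k\<close> is a direct summand of it.

  \<^bold>\<open>One functor for both parts.\<close> The argument is carried out for the cohomology of homomorphisms into
  an exact complex \<open>E\<close> of injective modules: an injective resolution of \<open>N\<close> in (ii), and in (i) the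
  complex \<open>Hom(F, E(k))\<close>, where \<open>F\<close> is a minimal free resolution of \<open>N\<close> and \<open>E(k)\<close> an injective module
  that contains \<open>k\<close>. In degree \<open>n\<close> it computes \<open>Ext(X, N)\<close> in the first case and \<open>Hom(Tor(X, N), E(k))\<close> in
  the second. A double complex compares it with the projective resolution by which Ext and Tor are
  defined (\<open>balance\<close>, \<open>ext_eventually_vanishes_of_Ext\<close>, \<open>ext_eventually_vanishes_of_Tor\<close>). Vanishing on
  \<open>k\<close> in high degrees means that the elements of \<open>E n\<close> annihilated by \<open>\<mm>\<close> form an exact complex there
  (\<open>socle_exact\<close>).

  \<^bold>\<open>Projective dimension.\<close> On homomorphisms annihilated by \<open>\<mm>\<close> the differential of \<open>Hom(F, E(k))\<close> is
  zero, because the entries of the differential of \<open>F\<close> lie in \<open>\<mm>\<close>. So there are no such homomorphisms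
  in high degrees, and \<open>F\<close> is zero there (\<open>proj_dim_finite\<close>).

  \<^bold>\<open>Injective dimension.\<close> Vanishing of Ext into the finitely generated module \<open>N\<close> passes from \<open>k\<close> to
  every \<open>R/I\<close> in the same range of degrees, by Noetherian induction and Nakayama's lemma
  (\<open>ext_vanishes_cyclic\<close>); by Baer's criterion the cocycles in that degree are injective
  (\<open>inj_dim_le_of_ext_vanishes\<close>).
\<close>

section \<open>Homomorphisms, spans and quotients of modules\<close>

abbreviation hom_kernel :: "('a, 'b, 'm) module_scheme \<Rightarrow> ('a, 'c, 'n) module_scheme \<Rightarrow> ('b \<Rightarrow> 'c) \<Rightarrow> 'b set" where
  "hom_kernel A B f \<equiv> {x \<in> carrier A. f x = \<zero>\<^bsub>B\<^esub>}"

lemma module_homI: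
  assumes "\<And>x. x \<in> carrier A \<Longrightarrow> f x \<in> carrier B"
    and "\<And>x y. x \<in> carrier A \<Longrightarrow> y \<in> carrier A \<Longrightarrow> f (x \<oplus>\<^bsub>A\<^esub> y) = f x \<oplus>\<^bsub>B\<^esub> f y"
    and "\<And>r x. r \<in> carrier R \<Longrightarrow> x \<in> carrier A \<Longrightarrow> f (r \<odot>\<^bsub>A\<^esub> x) = r \<odot>\<^bsub>B\<^esub> f x"
  shows "f \<in> module_hom R A B"
  using assms by (auto simp: module_hom_def)

lemma module_hom_closed: "f \<in> module_hom R A B \<Longrightarrow> x \<in> carrier A \<Longrightarrow> f x \<in> carrier B"
  by (auto simp: module_hom_def)

lemma module_hom_add:
  "f \<in> module_hom R A B \<Longrightarrow> x \<in> carrier A \<Longrightarrow> y \<in> carrier A \<Longrightarrow> f (x \<oplus>\<^bsub>A\<^esub> y) = f x \<oplus>\<^bsub>B\<^esub> f y"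
  by (auto simp: module_hom_def)

lemma module_hom_smult:
  "f \<in> module_hom R A B \<Longrightarrow> r \<in> carrier R \<Longrightarrow> x \<in> carrier A \<Longrightarrow> f (r \<odot>\<^bsub>A\<^esub> x) = r \<odot>\<^bsub>B\<^esub> f x"
  by (auto simp: module_hom_def)

lemma module_zero_closed [simp]: "module R A \<Longrightarrow> \<zero>\<^bsub>A\<^esub> \<in> carrier A"
  by (meson abelian_group_def abelian_monoid.zero_closed module.axioms(2))

lemma module_hom_zero:
  assumes "module R A" "module R B" "f \<in> module_hom R A B"
  shows "f \<zero>\<^bsub>A\<^esub> = \<zero>\<^bsub>B\<^esub>"
proof -
  interpret A: module R A by fact
  interpret B: module R B by fact
  have "f (\<zero>\<^bsub>R\<^esub> \<odot>\<^bsub>A\<^esub> \<zero>\<^bsub>A\<^esub>) = \<zero>\<^bsub>R\<^esub> \<odot>\<^bsub>B\<^esub> f \<zero>\<^bsub>A\<^esub>"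
    using assms(3) by (intro module_hom_smult) auto
  then show ?thesis using module_hom_closed[OF assms(3), of "\<zero>\<^bsub>A\<^esub>"] by simp
qed

lemma module_hom_uminus:
  assumes "module R A" "module R B" "f \<in> module_hom R A B" "x \<in> carrier A"
  shows "f (\<ominus>\<^bsub>A\<^esub> x) = \<ominus>\<^bsub>B\<^esub> f x"
proof -
  interpret A: module R A by fact
  interpret B: module R B by fact
  have "f (\<ominus>\<^bsub>R\<^esub> \<one>\<^bsub>R\<^esub> \<odot>\<^bsub>A\<^esub> x) = \<ominus>\<^bsub>R\<^esub> \<one>\<^bsub>R\<^esub> \<odot>\<^bsub>B\<^esub> f x"
    using assms(3,4) by (intro module_hom_smult) auto
  then show ?thesis
    using assms(4) module_hom_closed[OF assms(3), of x]
    by (simp add: A.smult_l_minus B.smult_l_minus)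
qed

lemma module_hom_minus:
  assumes "module R A" "module R B" "f \<in> module_hom R A B" "x \<in> carrier A" "y \<in> carrier A"
  shows "f (x \<ominus>\<^bsub>A\<^esub> y) = f x \<ominus>\<^bsub>B\<^esub> f y"
proof -
  interpret A: module R A by fact
  show ?thesis
    using assms by (simp add: a_minus_def module_hom_add module_hom_uminus)
qed

lemma module_hom_comp:
  "f \<in> module_hom R A B \<Longrightarrow> g \<in> module_hom R B C \<Longrightarrow> (\<lambda>x. g (f x)) \<in> module_hom R A C"
  by (auto simp: module_hom_def Pi_iff)

lemma module_hom_plus:
  assumes "module R B" "f \<in> module_hom R A B" "g \<in> module_hom R A B"
  shows "(\<lambda>x. f x \<oplus>\<^bsub>B\<^esub> g x) \<in> module_hom R A B"
proof -
  interpret B: module R B by fact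
  show ?thesis
    by (rule module_homI)
      (use assms in \<open>auto simp: module_hom_closed module_hom_add module_hom_smult B.smult_r_distr B.M.a_ac\<close>)
qed

lemma module_hom_scale:
  assumes "module R B" "f \<in> module_hom R A B" "r \<in> carrier R"
  shows "(\<lambda>x. r \<odot>\<^bsub>B\<^esub> f x) \<in> module_hom R A B"
proof -
  interpret B: module R B by fact
  show ?thesis
    by (rule module_homI)
      (use assms in \<open>auto simp: module_hom_closed module_hom_add module_hom_smult B.smult_r_distr
         B.smult_assoc1[symmetric] B.R.m_comm\<close>)
qed

lemma module_hom_diff:
  assumes "module R B" "f \<in> module_hom R A B" "g \<in> module_hom R A B"
  shows "(\<lambda>x. f x \<ominus>\<^bsub>B\<^esub> g x) \<in> module_hom R A B"
proof -
  interpret B: module R B by fact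
  show ?thesis
    by (rule module_homI)
      (use assms in \<open>auto simp: module_hom_closed module_hom_add module_hom_smult B.smult_r_distr
         B.smult_r_minus a_minus_def B.M.minus_add B.M.a_ac\<close>)
qed

lemma module_hom_zero_map: "module R B \<Longrightarrow> (\<lambda>x. \<zero>\<^bsub>B\<^esub>) \<in> module_hom R A B"
proof -
  assume "module R B"
  then interpret B: module R B .
  show ?thesis by (rule module_homI) auto
qed

lemma module_hom_cong:
  assumes "module R A" "f \<in> module_hom R A B" "\<And>x. x \<in> carrier A \<Longrightarrow> g x = f x"
  shows "g \<in> module_hom R A B"
proof -
  interpret A: module R A by fact
  show ?thesis
    by (rule module_homI) (use assms in \<open>auto simp: module_hom_closed module_hom_add module_hom_smult\<close>)
qed

lemma submodule_subset: "submodule H R M \<Longrightarrow> H \<subseteq> carrier M"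
  by (simp add: subgroup.subset[OF submodule.axioms(1), simplified])

lemma submodule_module: "module R M \<Longrightarrow> submodule H R M \<Longrightarrow> module R (M\<lparr>carrier := H\<rparr>)"
  by (rule submodule.submodule_is_module)

lemma submodule_zero: "module R M \<Longrightarrow> submodule H R M \<Longrightarrow> \<zero>\<^bsub>M\<^esub> \<in> H"
  using subgroup.one_closed[OF submodule.axioms(1)] by fastforce

lemma submodule_add: "submodule H R M \<Longrightarrow> x \<in> H \<Longrightarrow> y \<in> H \<Longrightarrow> x \<oplus>\<^bsub>M\<^esub> y \<in> H"
  using subgroup.m_closed[OF submodule.axioms(1), of H R M x y] by simp

lemma submodule_smult: "submodule H R M \<Longrightarrow> r \<in> carrier R \<Longrightarrow> x \<in> H \<Longrightarrow> r \<odot>\<^bsub>M\<^esub> x \<in> H"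
  by (rule submodule.smult_closed)

lemma submodule_uminus: "module R M \<Longrightarrow> submodule H R M \<Longrightarrow> x \<in> H \<Longrightarrow> \<ominus>\<^bsub>M\<^esub> x \<in> H"
  by (rule module.submoduleE(3))

lemma submodule_minus: "module R M \<Longrightarrow> submodule H R M \<Longrightarrow> x \<in> H \<Longrightarrow> y \<in> H \<Longrightarrow> x \<ominus>\<^bsub>M\<^esub> y \<in> H"
  by (simp add: a_minus_def submodule_uminus submodule_add)

text \<open>Closure under negation is automatic: it is the action of \<open>-1\<close>.\<close>

lemma submoduleI':
  assumes "module R M" "H \<subseteq> carrier M" "\<zero>\<^bsub>M\<^esub> \<in> H"
    and "\<And>x y. x \<in> H \<Longrightarrow> y \<in> H \<Longrightarrow> x \<oplus>\<^bsub>M\<^esub> y \<in> H"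
    and "\<And>r x. r \<in> carrier R \<Longrightarrow> x \<in> H \<Longrightarrow> r \<odot>\<^bsub>M\<^esub> x \<in> H"
  shows "submodule H R M"
proof -
  interpret M: module R M by fact
  show ?thesis
  proof (rule M.submoduleI)
    fix a assume "a \<in> H"
    then have "(\<ominus>\<^bsub>R\<^esub> \<one>\<^bsub>R\<^esub>) \<odot>\<^bsub>M\<^esub> a \<in> H" by (intro assms(5)) auto
    then show "\<ominus>\<^bsub>M\<^esub> a \<in> H" using \<open>a \<in> H\<close> assms(2) by (simp add: M.smult_l_minus subset_iff)
  qed (use assms in auto)
qed

lemma hom_preimage_submodule:
  assumes "module R A" "module R B" "f \<in> module_hom R A B" "submodule H R B"
  shows "submodule {x \<in> carrier A. f x \<in> H} R A"
proof -
  interpret A: module R A by fact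
  show ?thesis
    by (rule submoduleI')
      (use assms in \<open>auto simp: module_hom_zero module_hom_add module_hom_smult submodule_zero
         submodule_add submodule_smult\<close>)
qed

lemma zero_submodule: "module R M \<Longrightarrow> submodule {\<zero>\<^bsub>M\<^esub>} R M"
proof -
  assume "module R M"
  then interpret M: module R M .
  show ?thesis by (rule submoduleI'[OF M.module_axioms]) auto
qed

lemma hom_kernel_submodule:
  assumes "module R A" "module R B" "f \<in> module_hom R A B"
  shows "submodule (hom_kernel A B f) R A"
  using hom_preimage_submodule[OF assms zero_submodule[OF assms(2)]] by simp

lemma hom_image_submodule:
  assumes "module R A" "module R B" "f \<in> module_hom R A B" "submodule H R A"
  shows "submodule (f ` H) R B"
proof -
  note H = submodule_subset[OF assms(4)]
  show ?thesis
  proof (rule submoduleI'[OF assms(2)])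
    show "f ` H \<subseteq> carrier B" using H assms(3) by (auto simp: module_hom_closed subset_iff)
    show "\<zero>\<^bsub>B\<^esub> \<in> f ` H"
      using module_hom_zero[OF assms(1-3)] submodule_zero[OF assms(1,4)] by force
    show "x \<oplus>\<^bsub>B\<^esub> y \<in> f ` H" if xy: "x \<in> f ` H" "y \<in> f ` H" for x y
    proof -
      obtain a b where ab: "a \<in> H" "b \<in> H" "x = f a" "y = f b" using xy by auto
      then have "x \<oplus>\<^bsub>B\<^esub> y = f (a \<oplus>\<^bsub>A\<^esub> b)" using H assms(3) by (simp add: module_hom_add subset_iff)
      then show ?thesis using ab submodule_add[OF assms(4)] by blast
    qed
    show "r \<odot>\<^bsub>B\<^esub> x \<in> f ` H" if x: "r \<in> carrier R" "x \<in> f ` H" for r x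
    proof -
      obtain a where a: "a \<in> H" "x = f a" using x by auto
      then have "r \<odot>\<^bsub>B\<^esub> x = f (r \<odot>\<^bsub>A\<^esub> a)" using H assms(3) x by (simp add: module_hom_smult subset_iff)
      then show ?thesis using a x submodule_smult[OF assms(4)] by blast
    qed
  qed
qed

lemma a_kernel_eq: "a_kernel A B f = hom_kernel A B f"
  by (simp add: a_kernel_def kernel_def)

lemma module_minus_eq_zero_iff:
  assumes "module R A" "x \<in> carrier A" "y \<in> carrier A"
  shows "x \<ominus>\<^bsub>A\<^esub> y = \<zero>\<^bsub>A\<^esub> \<longleftrightarrow> x = y"
proof -
  interpret A: module R A by fact
  have "x \<ominus>\<^bsub>A\<^esub> y \<oplus>\<^bsub>A\<^esub> y = x"
    using assms(2,3) by (simp add: a_minus_def A.M.a_assoc A.M.l_neg)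
  moreover have "x \<ominus>\<^bsub>A\<^esub> x = \<zero>\<^bsub>A\<^esub>"
    using assms(2) by (simp add: a_minus_def A.M.r_neg)
  ultimately show ?thesis using assms(2,3) by (metis A.M.l_zero)
qed

subsection \<open>Spans\<close>

lemma Inter_submodule:
  assumes "module R M" "S \<noteq> {}" "\<And>H. H \<in> S \<Longrightarrow> submodule H R M"
  shows "submodule (\<Inter>S) R M"
proof (rule submoduleI'[OF assms(1)])
  show "\<Inter>S \<subseteq> carrier M" using assms(2,3) submodule_subset by blast
  show "\<zero>\<^bsub>M\<^esub> \<in> \<Inter>S" using submodule_zero[OF assms(1)] assms(3) by blast
  show "x \<oplus>\<^bsub>M\<^esub> y \<in> \<Inter>S" if "x \<in> \<Inter>S" "y \<in> \<Inter>S" for x y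
    using that submodule_add[OF assms(3)] by blast
  show "r \<odot>\<^bsub>M\<^esub> x \<in> \<Inter>S" if "r \<in> carrier R" "x \<in> \<Inter>S" for r x
    using that submodule_smult[OF assms(3)] by blast
qed

lemma span_submodule:
  assumes "module R M" "S \<subseteq> carrier M"
  shows "submodule (module_span R M S) R M"
  unfolding module_span_def
  using assms module.carrier_is_submodule[OF assms(1)] by (intro Inter_submodule) auto

lemma span_superset: "S \<subseteq> module_span R M S"
  by (auto simp: module_span_def)

lemma span_least: "submodule H R M \<Longrightarrow> S \<subseteq> H \<Longrightarrow> module_span R M S \<subseteq> H"
  by (auto simp: module_span_def)

lemma span_mono: "S \<subseteq> T \<Longrightarrow> module_span R M S \<subseteq> module_span R M T"
  by (auto simp: module_span_def)

lemma span_sub_carrier: "module R M \<Longrightarrow> S \<subseteq> carrier M \<Longrightarrow> module_span R M S \<subseteq> carrier M"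
  by (simp add: span_least module.carrier_is_submodule)

text \<open>Two homomorphisms agreeing on generators agree, because their equalizer is a submodule.\<close>

lemma hom_eq_on_span:
  assumes "module R A" "module R B" "f \<in> module_hom R A B" "g \<in> module_hom R A B"
    and "S \<subseteq> carrier A" "\<And>s. s \<in> S \<Longrightarrow> f s = g s" "x \<in> module_span R A S"
  shows "f x = g x"
proof -
  interpret B: module R B by fact
  have "submodule {x \<in> carrier A. f x \<ominus>\<^bsub>B\<^esub> g x = \<zero>\<^bsub>B\<^esub>} R A"
    by (intro hom_kernel_submodule[OF assms(1,2)] module_hom_diff assms)
  moreover have "S \<subseteq> {x \<in> carrier A. f x \<ominus>\<^bsub>B\<^esub> g x = \<zero>\<^bsub>B\<^esub>}"
    using assms(3-6) module_minus_eq_zero_iff[OF assms(2)] by (auto simp: module_hom_closed subset_iff)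
  ultimately have "x \<in> {x \<in> carrier A. f x \<ominus>\<^bsub>B\<^esub> g x = \<zero>\<^bsub>B\<^esub>}"
    using span_least assms(7) by blast
  then show ?thesis
    using assms(3,4) module_minus_eq_zero_iff[OF assms(2)] by (auto simp: module_hom_closed)
qed

subsection \<open>Quotient modules\<close>

definition proj_quot :: "('a, 'b, 'm) module_scheme \<Rightarrow> 'b set \<Rightarrow> 'b \<Rightarrow> 'b set" where
  "proj_quot M H x = H +>\<^bsub>M\<^esub> x"

context
  fixes R :: "('a, 'r) ring_scheme" and M :: "('a, 'b, 'm) module_scheme" and H :: "'b set"
  assumes M: "module R M" and H: "submodule H R M"
begin

interpretation M: module R M by (rule M)
interpretation H: abelian_subgroup H M
  by (rule abelian_subgroupI3)
    (auto intro: additive_subgroupI submodule.axioms(1) H M.abelian_group_axioms)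

lemma quot_carrier: "carrier (quot_module M H) = proj_quot M H ` carrier M"
  by (auto simp: quot_module_def proj_quot_def A_RCOSETS_def')

lemma quot_zero: "\<zero>\<^bsub>quot_module M H\<^esub> = H"
  by (simp add: quot_module_def)

lemma proj_quot_add:
  "x \<in> carrier M \<Longrightarrow> y \<in> carrier M \<Longrightarrow>
    proj_quot M H x \<oplus>\<^bsub>quot_module M H\<^esub> proj_quot M H y = proj_quot M H (x \<oplus>\<^bsub>M\<^esub> y)"
  by (simp add: quot_module_def proj_quot_def H.a_rcos_sum)

lemma proj_quot_eq_iff:
  assumes "x \<in> carrier M" "y \<in> carrier M"
  shows "proj_quot M H x = proj_quot M H y \<longleftrightarrow> x \<ominus>\<^bsub>M\<^esub> y \<in> H"
proof
  assume "proj_quot M H x = proj_quot M H y"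
  then have "H +>\<^bsub>M\<^esub> (x \<oplus>\<^bsub>M\<^esub> \<ominus>\<^bsub>M\<^esub> y) = H"
    using assms by (intro M.M.a_coset_add_inv2) (auto simp: proj_quot_def H.a_subset)
  then show "x \<ominus>\<^bsub>M\<^esub> y \<in> H"
    using assms by (auto simp: a_minus_def intro: M.M.a_coset_join1 H.a_subgroup)
next
  assume "x \<ominus>\<^bsub>M\<^esub> y \<in> H"
  then have "H +>\<^bsub>M\<^esub> (x \<oplus>\<^bsub>M\<^esub> \<ominus>\<^bsub>M\<^esub> y) = H"
    using assms unfolding a_minus_def by (intro M.M.a_coset_join2 H.a_subgroup) auto
  then show "proj_quot M H x = proj_quot M H y"
    unfolding proj_quot_def using assms H.a_subset by (intro M.M.a_coset_add_inv1) auto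
qed

lemma proj_quot_smult:
  assumes r: "r \<in> carrier R" and x: "x \<in> carrier M"
  shows "r \<odot>\<^bsub>quot_module M H\<^esub> proj_quot M H x = proj_quot M H (r \<odot>\<^bsub>M\<^esub> x)"
proof -
  have *: "H +>\<^bsub>M\<^esub> (r \<odot>\<^bsub>M\<^esub> y) = proj_quot M H (r \<odot>\<^bsub>M\<^esub> x)" if y: "y \<in> proj_quot M H x" for y
  proof -
    obtain h where h: "h \<in> H" "y = h \<oplus>\<^bsub>M\<^esub> x" using y by (auto simp: proj_quot_def a_r_coset_def')
    then have hM: "h \<in> carrier M" using H.a_subset by blast
    have "r \<odot>\<^bsub>M\<^esub> y \<ominus>\<^bsub>M\<^esub> r \<odot>\<^bsub>M\<^esub> x = r \<odot>\<^bsub>M\<^esub> h"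
      using h hM r x by (simp add: M.smult_r_distr a_minus_def M.M.a_assoc M.M.r_neg)
    then have "r \<odot>\<^bsub>M\<^esub> y \<ominus>\<^bsub>M\<^esub> r \<odot>\<^bsub>M\<^esub> x \<in> H" using h r submodule_smult[OF H] by simp
    then show ?thesis
      using proj_quot_eq_iff[of "r \<odot>\<^bsub>M\<^esub> y" "r \<odot>\<^bsub>M\<^esub> x"] r x h hM by (simp add: proj_quot_def)
  qed
  have "\<zero>\<^bsub>M\<^esub> \<oplus>\<^bsub>M\<^esub> x \<in> proj_quot M H x"
    using H.zero_closed unfolding proj_quot_def a_r_coset_def' by blast
  with * show ?thesis by (auto simp: quot_module_def)
qed

lemma proj_quot_eq_zero_iff:
  "x \<in> carrier M \<Longrightarrow> proj_quot M H x = \<zero>\<^bsub>quot_module M H\<^esub> \<longleftrightarrow> x \<in> H"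
  using M.M.a_coset_join1[of H x] M.M.a_coset_join2[of x H] H.a_subgroup
  by (auto simp: quot_zero proj_quot_def)

lemma quot_module_module: "module R (quot_module M H)"
proof (rule moduleI)
  let ?Q = "quot_module M H"
  note simps = quot_carrier proj_quot_add proj_quot_smult
  have zero: "\<zero>\<^bsub>?Q\<^esub> = proj_quot M H \<zero>\<^bsub>M\<^esub>" using proj_quot_eq_zero_iff[of "\<zero>\<^bsub>M\<^esub>"] by simp
  show "cring R" by (rule M.R.is_cring)
  show "abelian_group ?Q"
  proof (rule abelian_groupI)
    fix x assume "x \<in> carrier ?Q"
    then obtain y where y: "y \<in> carrier M" "x = proj_quot M H y" by (auto simp: simps)
    then have "proj_quot M H (\<ominus>\<^bsub>M\<^esub> y) \<oplus>\<^bsub>?Q\<^esub> x = \<zero>\<^bsub>?Q\<^esub>" by (simp add: simps zero M.M.l_neg)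
    then show "\<exists>y\<in>carrier ?Q. y \<oplus>\<^bsub>?Q\<^esub> x = \<zero>\<^bsub>?Q\<^esub>" using y by (auto simp: simps)
  qed (auto simp: simps zero M.M.a_ac)
qed (auto simp: quot_carrier proj_quot_add proj_quot_smult M.smult_l_distr M.smult_r_distr M.smult_assoc1)

lemma proj_quot_hom: "proj_quot M H \<in> module_hom R M (quot_module M H)"
  by (rule module_homI) (auto simp: quot_carrier proj_quot_add proj_quot_smult)

end

section \<open>Extension of homomorphisms into Baer modules\<close>

text \<open>
  Baer's condition speaks about ideals only, so unlike the definition of an injective module it does
  not depend on a choice of a type for the test modules; the extension theorem below recovers
  injectivity against modules on arbitrary types.
\<close>

definition baer_module :: "('a, 'r) ring_scheme \<Rightarrow> ('a, 'b, 'm) module_scheme \<Rightarrow> bool" where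
  "baer_module R E \<longleftrightarrow> module R E \<and>
     (\<forall>I f. ideal I R \<and> f \<in> I \<rightarrow> carrier E \<and>
        (\<forall>a\<in>I. \<forall>b\<in>I. f (a \<oplus>\<^bsub>R\<^esub> b) = f a \<oplus>\<^bsub>E\<^esub> f b) \<and>
        (\<forall>r\<in>carrier R. \<forall>a\<in>I. f (r \<otimes>\<^bsub>R\<^esub> a) = r \<odot>\<^bsub>E\<^esub> f a) \<longrightarrow>
        (\<exists>e\<in>carrier E. \<forall>a\<in>I. f a = a \<odot>\<^bsub>E\<^esub> e))"

lemma baer_moduleD: "baer_module R E \<Longrightarrow> module R E"
  by (simp add: baer_module_def)

lemma baer_moduleE:
  assumes "baer_module R E" "ideal I R" "\<And>a. a \<in> I \<Longrightarrow> f a \<in> carrier E"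
    "\<And>a b. a \<in> I \<Longrightarrow> b \<in> I \<Longrightarrow> f (a \<oplus>\<^bsub>R\<^esub> b) = f a \<oplus>\<^bsub>E\<^esub> f b"
    "\<And>r a. r \<in> carrier R \<Longrightarrow> a \<in> I \<Longrightarrow> f (r \<otimes>\<^bsub>R\<^esub> a) = r \<odot>\<^bsub>E\<^esub> f a"
  obtains e where "e \<in> carrier E" "\<And>a. a \<in> I \<Longrightarrow> f a = a \<odot>\<^bsub>E\<^esub> e"
  using assms unfolding baer_module_def Pi_iff by metis

lemma (in cring) idealI':
  assumes "I \<subseteq> carrier R" "\<zero> \<in> I" "\<And>a b. a \<in> I \<Longrightarrow> b \<in> I \<Longrightarrow> a \<oplus> b \<in> I"
    "\<And>r a. r \<in> carrier R \<Longrightarrow> a \<in> I \<Longrightarrow> r \<otimes> a \<in> I"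
  shows "ideal I R"
proof (rule idealI)
  show "ring R" by (rule ring_axioms)
  show "subgroup I (add_monoid R)"
  proof (rule add.subgroupI)
    show "\<ominus> a \<in> I" if "a \<in> I" for a
    proof -
      have "(\<ominus> \<one>) \<otimes> a \<in> I" using that by (intro assms(4)) auto
      then show ?thesis using that assms(1) by (simp add: l_minus subset_iff)
    qed
  qed (use assms in auto)
  show "a \<otimes> x \<in> I" "x \<otimes> a \<in> I" if "a \<in> I" "x \<in> carrier R" for a x
    using that assms(1) assms(4)[of x a] m_comm[of x a] by (auto simp: subset_iff)
qed

text \<open>
  Zorn's lemma is applied to graphs of partial homomorphisms from submodules of \<open>B\<close>; the kernel
  condition says that the graph of the map \<open>\<phi> x \<mapsto> f x\<close> is single-valued.
\<close>

theorem baer_extend: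
  assumes E: "baer_module R E" and A: "module R A" and B: "module R B"
    and \<phi>: "\<phi> \<in> module_hom R A B" and f: "f \<in> module_hom R A E"
    and ker: "\<And>x. x \<in> carrier A \<Longrightarrow> \<phi> x = \<zero>\<^bsub>B\<^esub> \<Longrightarrow> f x = \<zero>\<^bsub>E\<^esub>"
  obtains h where "h \<in> module_hom R B E" "\<And>x. x \<in> carrier A \<Longrightarrow> h (\<phi> x) = f x"
proof -
  have Em: "module R E" using E by (rule baer_moduleD)
  interpret A: module R A by fact
  interpret B: module R B by fact
  interpret E: module R E by fact
  define good where "good = {G. G \<subseteq> carrier B \<times> carrier E \<and> (\<forall>x\<in>carrier A. (\<phi> x, f x) \<in> G) \<and>
      (\<forall>p\<in>G. \<forall>q\<in>G. (fst p \<oplus>\<^bsub>B\<^esub> fst q, snd p \<oplus>\<^bsub>E\<^esub> snd q) \<in> G) \<and>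
      (\<forall>r\<in>carrier R. \<forall>p\<in>G. (r \<odot>\<^bsub>B\<^esub> fst p, r \<odot>\<^bsub>E\<^esub> snd p) \<in> G) \<and>
      (\<forall>y. (\<zero>\<^bsub>B\<^esub>, y) \<in> G \<longrightarrow> y = \<zero>\<^bsub>E\<^esub>)}"
  have "\<exists>G\<in>good. \<forall>X\<in>good. G \<subseteq> X \<longrightarrow> X = G"
  proof (rule subset_Zorn_nonempty)
    define G0 where "G0 = {(\<phi> x, f x) | x. x \<in> carrier A}"
    have "G0 \<in> good"
      unfolding good_def
    proof (intro CollectI conjI ballI allI impI)
      fix p q assume "p \<in> G0" "q \<in> G0"
      then obtain x y where "x \<in> carrier A" "y \<in> carrier A" "p = (\<phi> x, f x)" "q = (\<phi> y, f y)" by (auto simp: G0_def)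
      then have "x \<oplus>\<^bsub>A\<^esub> y \<in> carrier A \<and>
          (fst p \<oplus>\<^bsub>B\<^esub> fst q, snd p \<oplus>\<^bsub>E\<^esub> snd q) = (\<phi> (x \<oplus>\<^bsub>A\<^esub> y), f (x \<oplus>\<^bsub>A\<^esub> y))"
        using \<phi> f by (simp add: module_hom_add)
      then show "(fst p \<oplus>\<^bsub>B\<^esub> fst q, snd p \<oplus>\<^bsub>E\<^esub> snd q) \<in> G0" unfolding G0_def by blast
    next
      fix r p assume r: "r \<in> carrier R" and "p \<in> G0"
      then obtain x where "x \<in> carrier A" "p = (\<phi> x, f x)" by (auto simp: G0_def)
      then have "r \<odot>\<^bsub>A\<^esub> x \<in> carrier A \<and>
          (r \<odot>\<^bsub>B\<^esub> fst p, r \<odot>\<^bsub>E\<^esub> snd p) = (\<phi> (r \<odot>\<^bsub>A\<^esub> x), f (r \<odot>\<^bsub>A\<^esub> x))"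
        using \<phi> f r by (simp add: module_hom_smult)
      then show "(r \<odot>\<^bsub>B\<^esub> fst p, r \<odot>\<^bsub>E\<^esub> snd p) \<in> G0" unfolding G0_def by blast
    qed (use \<phi> f ker in \<open>auto simp: module_hom_closed G0_def\<close>)
    then show "good \<noteq> {}" by blast
  next
    fix \<C> assume ne: "\<C> \<noteq> {}" and ch: "subset.chain good \<C>"
    have sub: "G \<in> good" if "G \<in> \<C>" for G using ch that by (auto simp: subset.chain_def)
    have lin: "G \<subseteq> G' \<or> G' \<subseteq> G" if "G \<in> \<C>" "G' \<in> \<C>" for G G'
      using ch that by (auto simp: subset_chain_def)
    show "\<Union>\<C> \<in> good"
      unfolding good_def
    proof (intro CollectI conjI ballI allI impI)
      show "\<Union>\<C> \<subseteq> carrier B \<times> carrier E" using sub unfolding good_def by blast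
      show "(\<phi> x, f x) \<in> \<Union>\<C>" if "x \<in> carrier A" for x
        using ne sub that unfolding good_def by blast
      show "y = \<zero>\<^bsub>E\<^esub>" if "(\<zero>\<^bsub>B\<^esub>, y) \<in> \<Union>\<C>" for y
        using sub that unfolding good_def by blast
      show "(r \<odot>\<^bsub>B\<^esub> fst p, r \<odot>\<^bsub>E\<^esub> snd p) \<in> \<Union>\<C>" if "r \<in> carrier R" "p \<in> \<Union>\<C>" for r p
        using sub that unfolding good_def by blast
      show "(fst p \<oplus>\<^bsub>B\<^esub> fst q, snd p \<oplus>\<^bsub>E\<^esub> snd q) \<in> \<Union>\<C>" if pq: "p \<in> \<Union>\<C>" "q \<in> \<Union>\<C>" for p q
      proof -
        obtain G G' where G: "G \<in> \<C>" "G' \<in> \<C>" "p \<in> G" "q \<in> G'" using pq by auto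
        then obtain G'' where "G'' \<in> \<C>" "p \<in> G''" "q \<in> G''" using lin[of G G'] by auto
        then show ?thesis using sub[of G''] unfolding good_def by blast
      qed
    qed
  qed
  then obtain G where G: "G \<in> good" and max: "\<And>X. X \<in> good \<Longrightarrow> G \<subseteq> X \<Longrightarrow> X = G" by blast
  have Gsub: "fst p \<in> carrier B" "snd p \<in> carrier E" if "p \<in> G" for p
    using G that unfolding good_def by auto
  have G0: "(\<phi> x, f x) \<in> G" if "x \<in> carrier A" for x using G that unfolding good_def by auto
  have Gadd: "(b \<oplus>\<^bsub>B\<^esub> b', e \<oplus>\<^bsub>E\<^esub> e') \<in> G" if "(b, e) \<in> G" "(b', e') \<in> G" for b e b' e'
  proof -
    have "\<forall>p\<in>G. \<forall>q\<in>G. (fst p \<oplus>\<^bsub>B\<^esub> fst q, snd p \<oplus>\<^bsub>E\<^esub> snd q) \<in> G" using G unfolding good_def by blast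
    with that show ?thesis by fastforce
  qed
  have Gsm: "(r \<odot>\<^bsub>B\<^esub> b, r \<odot>\<^bsub>E\<^esub> e) \<in> G" if "r \<in> carrier R" "(b, e) \<in> G" for r b e
  proof -
    have "\<forall>r\<in>carrier R. \<forall>p\<in>G. (r \<odot>\<^bsub>B\<^esub> fst p, r \<odot>\<^bsub>E\<^esub> snd p) \<in> G" using G unfolding good_def by blast
    with that show ?thesis by fastforce
  qed
  have Gz: "y = \<zero>\<^bsub>E\<^esub>" if "(\<zero>\<^bsub>B\<^esub>, y) \<in> G" for y using G that unfolding good_def by auto
  have Gdiff: "(b \<ominus>\<^bsub>B\<^esub> b', e \<ominus>\<^bsub>E\<^esub> e') \<in> G" if "(b, e) \<in> G" "(b', e') \<in> G" for b e b' e'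
    using Gadd[OF that(1) Gsm[OF _ that(2), of "\<ominus>\<^bsub>R\<^esub> \<one>\<^bsub>R\<^esub>"]] Gsub[OF that(2)]
    by (simp add: a_minus_def B.smult_l_minus E.smult_l_minus)
  have Gfun: "e = e'" if "(b, e) \<in> G" "(b, e') \<in> G" for b e e'
    using Gdiff[OF that] Gz[of "e \<ominus>\<^bsub>E\<^esub> e'"] Gsub[OF that(1)] Gsub[OF that(2)]
      module_minus_eq_zero_iff[OF Em, of e e'] module_minus_eq_zero_iff[OF B, of b b] by simp
  have dom: "\<exists>e. (b, e) \<in> G" if b: "b \<in> carrier B" for b
  proof -
    define I where "I = {r \<in> carrier R. \<exists>e. (r \<odot>\<^bsub>B\<^esub> b, e) \<in> G}"
    define v where "v r = (THE e. (r \<odot>\<^bsub>B\<^esub> b, e) \<in> G)" for r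
    have v: "v r = e" if "(r \<odot>\<^bsub>B\<^esub> b, e) \<in> G" for r e
      unfolding v_def using Gfun that by blast
    have vG: "(r \<odot>\<^bsub>B\<^esub> b, v r) \<in> G" if "r \<in> I" for r using that v by (auto simp: I_def)
    have IR: "r \<in> carrier R" if "r \<in> I" for r using that by (simp add: I_def)
    have addG: "((r \<oplus>\<^bsub>R\<^esub> s) \<odot>\<^bsub>B\<^esub> b, v r \<oplus>\<^bsub>E\<^esub> v s) \<in> G" if "r \<in> I" "s \<in> I" for r s
      using Gadd[OF vG[OF that(1)] vG[OF that(2)]] IR that b by (simp add: B.smult_l_distr)
    have smG: "((r \<otimes>\<^bsub>R\<^esub> s) \<odot>\<^bsub>B\<^esub> b, r \<odot>\<^bsub>E\<^esub> v s) \<in> G" if "r \<in> carrier R" "s \<in> I" for r s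
      using Gsm[OF that(1) vG[OF that(2)]] IR that b by (simp add: B.smult_assoc1)
    have zG: "(\<zero>\<^bsub>B\<^esub>, \<zero>\<^bsub>E\<^esub>) \<in> G"
      using G0[of "\<zero>\<^bsub>A\<^esub>"] module_hom_zero[OF A B \<phi>] module_hom_zero[OF A Em f] by simp
    have I: "ideal I R"
    proof (rule A.R.idealI')
      show "\<zero>\<^bsub>R\<^esub> \<in> I" using zG b by (auto simp: I_def)
      show "r \<oplus>\<^bsub>R\<^esub> s \<in> I" if "r \<in> I" "s \<in> I" for r s
        using addG[OF that] IR that by (auto simp: I_def)
      show "r \<otimes>\<^bsub>R\<^esub> s \<in> I" if "r \<in> carrier R" "s \<in> I" for r s
        using smG[OF that] IR that by (auto simp: I_def)
    qed (auto simp: I_def)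
    obtain e where e: "e \<in> carrier E" "\<And>r. r \<in> I \<Longrightarrow> v r = r \<odot>\<^bsub>E\<^esub> e"
    proof (rule baer_moduleE[OF E I, of v])
      show "v r \<in> carrier E" if "r \<in> I" for r using Gsub[OF vG[OF that]] by simp
      show "v (r \<oplus>\<^bsub>R\<^esub> s) = v r \<oplus>\<^bsub>E\<^esub> v s" if "r \<in> I" "s \<in> I" for r s
        using v[OF addG[OF that]] .
      show "v (r \<otimes>\<^bsub>R\<^esub> s) = r \<odot>\<^bsub>E\<^esub> v s" if "r \<in> carrier R" "s \<in> I" for r s
        using v[OF smG[OF that]] .
    qed blast
    \<comment> \<open>adjoin the pair \<open>(b, e)\<close> to the maximal graph\<close>
    define G' where "G' = {(x \<oplus>\<^bsub>B\<^esub> r \<odot>\<^bsub>B\<^esub> b, y \<oplus>\<^bsub>E\<^esub> r \<odot>\<^bsub>E\<^esub> e) | x y r. (x, y) \<in> G \<and> r \<in> carrier R}"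
    have G'I: "(x \<oplus>\<^bsub>B\<^esub> r \<odot>\<^bsub>B\<^esub> b, y \<oplus>\<^bsub>E\<^esub> r \<odot>\<^bsub>E\<^esub> e) \<in> G'" if "(x, y) \<in> G" "r \<in> carrier R" for x y r
      using that by (auto simp: G'_def)
    have GG': "G \<subseteq> G'"
    proof (rule subsetI, clarify)
      fix x y assume xy: "(x, y) \<in> G"
      show "(x, y) \<in> G'" using G'I[OF xy, of "\<zero>\<^bsub>R\<^esub>"] Gsub[OF xy] b e by simp
    qed
    have "G' \<in> good"
      unfolding good_def
    proof (intro CollectI conjI ballI allI impI)
      show "G' \<subseteq> carrier B \<times> carrier E" using Gsub b e by (auto simp: G'_def)
      show "(\<phi> x, f x) \<in> G'" if "x \<in> carrier A" for x using GG' G0[OF that] by blast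
      show "y = \<zero>\<^bsub>E\<^esub>" if y: "(\<zero>\<^bsub>B\<^esub>, y) \<in> G'" for y
      proof -
        obtain x y' r where xr: "\<zero>\<^bsub>B\<^esub> = x \<oplus>\<^bsub>B\<^esub> r \<odot>\<^bsub>B\<^esub> b" "y = y' \<oplus>\<^bsub>E\<^esub> r \<odot>\<^bsub>E\<^esub> e" "(x, y') \<in> G" "r \<in> carrier R"
          using y by (auto simp: G'_def)
        have xB: "x \<in> carrier B" "y' \<in> carrier E" using Gsub[OF xr(3)] by auto
        have rb: "(\<ominus>\<^bsub>R\<^esub> r) \<odot>\<^bsub>B\<^esub> b = x"
          using xr(1,4) xB b by (metis B.M.minus_equality B.smult_closed B.smult_l_minus)
        then have "\<ominus>\<^bsub>R\<^esub> r \<in> I" using xr by (auto simp: I_def)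
        then have "y' = (\<ominus>\<^bsub>R\<^esub> r) \<odot>\<^bsub>E\<^esub> e" using e(2) v[of "\<ominus>\<^bsub>R\<^esub> r" y'] rb xr(3) by simp
        then show ?thesis using xr e by (simp add: E.smult_l_minus E.M.l_neg)
      qed
      show "(r \<odot>\<^bsub>B\<^esub> fst p, r \<odot>\<^bsub>E\<^esub> snd p) \<in> G'" if r: "r \<in> carrier R" and p: "p \<in> G'" for r p
      proof -
        obtain x y s where xs: "p = (x \<oplus>\<^bsub>B\<^esub> s \<odot>\<^bsub>B\<^esub> b, y \<oplus>\<^bsub>E\<^esub> s \<odot>\<^bsub>E\<^esub> e)" "(x, y) \<in> G" "s \<in> carrier R"
          using p by (auto simp: G'_def)
        show ?thesis
          using G'I[OF Gsm[OF r xs(2)], of "r \<otimes>\<^bsub>R\<^esub> s"] xs r b e Gsub[OF xs(2)]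
          by (simp add: B.smult_r_distr E.smult_r_distr B.smult_assoc1 E.smult_assoc1)
      qed
      show "(fst p \<oplus>\<^bsub>B\<^esub> fst q, snd p \<oplus>\<^bsub>E\<^esub> snd q) \<in> G'" if p: "p \<in> G'" and q: "q \<in> G'" for p q
      proof -
        obtain x y s where xs: "p = (x \<oplus>\<^bsub>B\<^esub> s \<odot>\<^bsub>B\<^esub> b, y \<oplus>\<^bsub>E\<^esub> s \<odot>\<^bsub>E\<^esub> e)" "(x, y) \<in> G" "s \<in> carrier R"
          using p by (auto simp: G'_def)
        obtain x' y' s' where xs': "q = (x' \<oplus>\<^bsub>B\<^esub> s' \<odot>\<^bsub>B\<^esub> b, y' \<oplus>\<^bsub>E\<^esub> s' \<odot>\<^bsub>E\<^esub> e)" "(x', y') \<in> G" "s' \<in> carrier R"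
          using q by (auto simp: G'_def)
        have "x \<oplus>\<^bsub>B\<^esub> x' \<oplus>\<^bsub>B\<^esub> (s \<oplus>\<^bsub>R\<^esub> s') \<odot>\<^bsub>B\<^esub> b = x \<oplus>\<^bsub>B\<^esub> s \<odot>\<^bsub>B\<^esub> b \<oplus>\<^bsub>B\<^esub> (x' \<oplus>\<^bsub>B\<^esub> s' \<odot>\<^bsub>B\<^esub> b)"
          "y \<oplus>\<^bsub>E\<^esub> y' \<oplus>\<^bsub>E\<^esub> (s \<oplus>\<^bsub>R\<^esub> s') \<odot>\<^bsub>E\<^esub> e = y \<oplus>\<^bsub>E\<^esub> s \<odot>\<^bsub>E\<^esub> e \<oplus>\<^bsub>E\<^esub> (y' \<oplus>\<^bsub>E\<^esub> s' \<odot>\<^bsub>E\<^esub> e)"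
          using xs xs' b e Gsub[OF xs(2)] Gsub[OF xs'(2)]
          by (simp_all add: B.smult_l_distr E.smult_l_distr B.M.a_ac E.M.a_ac)
        then show ?thesis
          using G'I[OF Gadd[OF xs(2) xs'(2)], of "s \<oplus>\<^bsub>R\<^esub> s'"] xs xs' by simp
      qed
    qed
    then have "G' = G" using max GG' by blast
    moreover have "(\<zero>\<^bsub>B\<^esub> \<oplus>\<^bsub>B\<^esub> \<one>\<^bsub>R\<^esub> \<odot>\<^bsub>B\<^esub> b, \<zero>\<^bsub>E\<^esub> \<oplus>\<^bsub>E\<^esub> \<one>\<^bsub>R\<^esub> \<odot>\<^bsub>E\<^esub> e) \<in> G'" using G'I[OF zG] by simp
    ultimately show ?thesis using b e by auto
  qed
  define h where "h b = (THE e. (b, e) \<in> G)" for b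
  have h: "h b = e" if "(b, e) \<in> G" for b e
    unfolding h_def using Gfun that by blast
  have hG: "(b, h b) \<in> G" if "b \<in> carrier B" for b using dom[OF that] h by auto
  show thesis
  proof (rule that)
    show "h \<in> module_hom R B E"
      by (rule module_homI)
        (auto intro!: h Gadd Gsm hG dest: Gsub[OF hG])
    show "h (\<phi> x) = f x" if "x \<in> carrier A" for x using h[OF G0[OF that]] .
  qed
qed

text \<open>Injectivity is extension along maps with kernel zero.\<close>

lemma baer_injective:
  assumes "baer_module R E"
  shows "injective_module R E"
  unfolding injective_module_def
proof (intro conjI allI impI)
  show E: "module R E" using assms by (rule baer_moduleD)
  fix A B :: "('a, ('a, 'c) univ) module" and g f
  assume *: "module R A \<and> module R B \<and> g \<in> module_hom R A B \<and> inj_on g (carrier A) \<and>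
     f \<in> module_hom R A E"
  have "x = \<zero>\<^bsub>A\<^esub>" if "x \<in> carrier A" "g x = \<zero>\<^bsub>B\<^esub>" for x
    using * that module_hom_zero[of R A B g] module_zero_closed[of R A] unfolding inj_on_def by metis
  then have "f x = \<zero>\<^bsub>E\<^esub>" if "x \<in> carrier A" "g x = \<zero>\<^bsub>B\<^esub>" for x
    using * that E module_hom_zero[of R A E f] by auto
  then obtain h where "h \<in> module_hom R B E" "\<And>x. x \<in> carrier A \<Longrightarrow> h (g x) = f x"
    using baer_extend[OF assms, of A B g f] * by blast
  then show "\<exists>h\<in>module_hom R B E. \<forall>x\<in>carrier A. h (g x) = f x" by blast
qed

section \<open>Transport of structure\<close>

text \<open>
  The operations on the image of a carrier under an injective coding. They move modules into the
  types over which projectivity, injectivity and the homological dimensions quantify.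
\<close>

definition transport_module :: "('b \<Rightarrow> 'c) \<Rightarrow> ('a, 'b, 'm) module_scheme \<Rightarrow> ('a, 'c) module" where
  "transport_module i A =
     (let j = inv_into (carrier A) i in
      \<lparr>carrier = i ` carrier A, mult = undefined, one = undefined,
       zero = i \<zero>\<^bsub>A\<^esub>, add = (\<lambda>x y. i (j x \<oplus>\<^bsub>A\<^esub> j y)), smult = (\<lambda>r x. i (r \<odot>\<^bsub>A\<^esub> j x))\<rparr>)"

context
  fixes R :: "('a, 'r) ring_scheme" and A :: "('a, 'b, 'm) module_scheme" and i :: "'b \<Rightarrow> 'c"
  assumes A: "module R A" and inj: "inj_on i (carrier A)"
begin

interpretation A: module R A by (rule A)

lemma transport_carrier: "carrier (transport_module i A) = i ` carrier A"
  by (simp add: transport_module_def Let_def)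

lemma transport_zero: "\<zero>\<^bsub>transport_module i A\<^esub> = i \<zero>\<^bsub>A\<^esub>"
  by (simp add: transport_module_def Let_def)

lemma transport_add:
  "x \<in> carrier A \<Longrightarrow> y \<in> carrier A \<Longrightarrow> i x \<oplus>\<^bsub>transport_module i A\<^esub> i y = i (x \<oplus>\<^bsub>A\<^esub> y)"
  by (simp add: transport_module_def Let_def inv_into_f_f[OF inj])

lemma transport_smult:
  "x \<in> carrier A \<Longrightarrow> r \<odot>\<^bsub>transport_module i A\<^esub> i x = i (r \<odot>\<^bsub>A\<^esub> x)"
  by (simp add: transport_module_def Let_def inv_into_f_f[OF inj])

lemma transport_module_module: "module R (transport_module i A)"
proof (rule moduleI)
  let ?T = "transport_module i A"
  note simps = transport_carrier transport_add transport_zero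
  show "cring R" by (rule A.R.is_cring)
  show "abelian_group ?T"
  proof (rule abelian_groupI)
    fix x assume "x \<in> carrier ?T"
    then obtain y where y: "y \<in> carrier A" "x = i y" by (auto simp: simps)
    then have "i (\<ominus>\<^bsub>A\<^esub> y) \<oplus>\<^bsub>?T\<^esub> x = \<zero>\<^bsub>?T\<^esub>" by (simp add: simps A.M.l_neg)
    then show "\<exists>y\<in>carrier ?T. y \<oplus>\<^bsub>?T\<^esub> x = \<zero>\<^bsub>?T\<^esub>" using y by (auto simp: simps)
  qed (auto simp: simps A.M.a_ac)
qed (auto simp: transport_carrier transport_add transport_smult A.smult_l_distr A.smult_r_distr A.smult_assoc1)

lemma transport_hom: "i \<in> module_hom R A (transport_module i A)"
  by (rule module_homI) (auto simp: transport_carrier transport_add transport_smult)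

lemma transport_inv_hom: "inv_into (carrier A) i \<in> module_hom R (transport_module i A) A"
  by (rule module_homI)
    (auto simp: transport_carrier transport_add transport_smult inv_into_f_f[OF inj])

lemma transport_baer:
  assumes "baer_module R A"
  shows "baer_module R (transport_module i A)"
  unfolding baer_module_def
proof (intro conjI allI impI transport_module_module, elim conjE)
  let ?T = "transport_module i A" and ?j = "inv_into (carrier A) i"
  fix I and f :: "'a \<Rightarrow> 'c"
  assume I: "ideal I R" and f: "f \<in> I \<rightarrow> carrier ?T"
    and add: "\<forall>a\<in>I. \<forall>b\<in>I. f (a \<oplus>\<^bsub>R\<^esub> b) = f a \<oplus>\<^bsub>?T\<^esub> f b"
    and sm: "\<forall>r\<in>carrier R. \<forall>a\<in>I. f (r \<otimes>\<^bsub>R\<^esub> a) = r \<odot>\<^bsub>?T\<^esub> f a"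
  have fT: "f a \<in> carrier ?T" if "a \<in> I" for a using f that by auto
  obtain e where e: "e \<in> carrier A" "\<And>a. a \<in> I \<Longrightarrow> ?j (f a) = a \<odot>\<^bsub>A\<^esub> e"
  proof (rule baer_moduleE[OF assms I, of "\<lambda>a. ?j (f a)"])
    show "?j (f a) \<in> carrier A" if "a \<in> I" for a
      using module_hom_closed[OF transport_inv_hom fT[OF that]] .
    show "?j (f (a \<oplus>\<^bsub>R\<^esub> b)) = ?j (f a) \<oplus>\<^bsub>A\<^esub> ?j (f b)" if "a \<in> I" "b \<in> I" for a b
      using module_hom_add[OF transport_inv_hom fT[OF that(1)] fT[OF that(2)]] add that by simp
    show "?j (f (r \<otimes>\<^bsub>R\<^esub> a)) = r \<odot>\<^bsub>A\<^esub> ?j (f a)" if "r \<in> carrier R" "a \<in> I" for r a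
      using module_hom_smult[OF transport_inv_hom that(1) fT[OF that(2)]] sm that by simp
  qed blast
  have "f a = a \<odot>\<^bsub>?T\<^esub> i e" if "a \<in> I" for a
  proof -
    have "f a = i (?j (f a))" using fT[OF that] by (simp add: transport_carrier f_inv_into_f)
    then show ?thesis using e that by (simp add: transport_smult)
  qed
  then show "\<exists>e\<in>carrier ?T. \<forall>a\<in>I. f a = a \<odot>\<^bsub>?T\<^esub> e" using e by (auto simp: transport_carrier)
qed

end

section \<open>Free and projective modules\<close>

definition free_lift :: "('a, 'r) ring_scheme \<Rightarrow> ('a, 'b, 'm) module_scheme \<Rightarrow> ('i \<Rightarrow> 'b) \<Rightarrow> ('i \<Rightarrow> 'a) \<Rightarrow> 'b" where
  "free_lift R A x c = (\<Oplus>\<^bsub>A\<^esub>s\<in>{s. c s \<noteq> \<zero>\<^bsub>R\<^esub>}. c s \<odot>\<^bsub>A\<^esub> x s)"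

lemma free_carrier_iff:
  "c \<in> carrier (free_module R S) \<longleftrightarrow>
     (\<forall>s. c s \<in> carrier R) \<and> finite {s. c s \<noteq> \<zero>\<^bsub>R\<^esub>} \<and> {s. c s \<noteq> \<zero>\<^bsub>R\<^esub>} \<subseteq> S"
  by (auto simp: free_module_def)

lemma free_module_simps:
  "\<zero>\<^bsub>free_module R S\<^esub> = (\<lambda>s. \<zero>\<^bsub>R\<^esub>)"
  "c \<oplus>\<^bsub>free_module R S\<^esub> d = (\<lambda>s. c s \<oplus>\<^bsub>R\<^esub> d s)"
  "r \<odot>\<^bsub>free_module R S\<^esub> c = (\<lambda>s. r \<otimes>\<^bsub>R\<^esub> c s)"
  by (auto simp: free_module_def)

context cring
begin

lemma free_module_module: "module R (free_module R S)"
proof (rule moduleI)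
  let ?F = "free_module R S"
  have add: "c \<oplus>\<^bsub>?F\<^esub> d \<in> carrier ?F" if "c \<in> carrier ?F" "d \<in> carrier ?F" for c d
  proof -
    have "{s. c s \<oplus> d s \<noteq> \<zero>} \<subseteq> {s. c s \<noteq> \<zero>} \<union> {s. d s \<noteq> \<zero>}" by auto
    then show ?thesis
      using that by (auto simp: free_carrier_iff free_module_simps intro: finite_subset)
  qed
  have sm: "r \<odot>\<^bsub>?F\<^esub> c \<in> carrier ?F" if "r \<in> carrier R" "c \<in> carrier ?F" for r c
  proof -
    have "{s. r \<otimes> c s \<noteq> \<zero>} \<subseteq> {s. c s \<noteq> \<zero>}" using that by auto
    then show ?thesis
      using that by (auto simp: free_carrier_iff free_module_simps intro: finite_subset)
  qed
  show "cring R" by (rule is_cring)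
  show "abelian_group ?F"
  proof (rule abelian_groupI)
    fix c assume c: "c \<in> carrier ?F"
    have "(\<ominus> \<one>) \<odot>\<^bsub>?F\<^esub> c \<oplus>\<^bsub>?F\<^esub> c = \<zero>\<^bsub>?F\<^esub>"
      using c by (simp add: free_carrier_iff free_module_simps l_minus l_neg)
    then show "\<exists>y\<in>carrier ?F. y \<oplus>\<^bsub>?F\<^esub> c = \<zero>\<^bsub>?F\<^esub>" using sm[OF _ c, of "\<ominus> \<one>"] by auto
  qed (auto simp: add, auto simp: free_carrier_iff free_module_simps a_ac)
qed (auto simp: free_carrier_iff free_module_simps l_distr r_distr m_assoc
      intro: finite_subset[where B = "{s. _ s \<noteq> \<zero>}"] elim: finite_subset[rotated])

lemma free_gen_closed: "s \<in> S \<Longrightarrow> free_gen R s \<in> carrier (free_module R S)"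
  by (auto simp: free_carrier_iff free_gen_def intro: finite_subset[where B = "{s}"])

lemma free_gen_span: "module_span R (free_module R S) (free_gen R ` S) = carrier (free_module R S)"
proof
  let ?F = "free_module R S"
  note F = free_module_module[of S]
  have gens: "free_gen R ` S \<subseteq> carrier ?F" using free_gen_closed by auto
  note span = span_submodule[OF F gens]
  show "module_span R ?F (free_gen R ` S) \<subseteq> carrier ?F" by (rule submodule_subset[OF span])
  show "carrier ?F \<subseteq> module_span R ?F (free_gen R ` S)"
  proof
    fix c assume "c \<in> carrier ?F"
    then have "finite {s. c s \<noteq> \<zero>}" by (simp add: free_carrier_iff)
    moreover have "c \<in> module_span R ?F (free_gen R ` S)"
      if "finite T" "{s. c s \<noteq> \<zero>} \<subseteq> T" "T \<subseteq> S" "c \<in> carrier ?F" for T c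
      using that
    proof (induction T arbitrary: c rule: finite_induct)
      case empty
      then have "c = \<zero>\<^bsub>?F\<^esub>" by (auto simp: free_module_simps)
      then show ?case using submodule_zero[OF F span] by simp
    next
      case (insert t T)
      let ?c = "c(t := \<zero>)"
      have "{s. ?c s \<noteq> \<zero>} \<subseteq> {s. c s \<noteq> \<zero>}" by auto
      then have "finite {s. ?c s \<noteq> \<zero>}"
        using insert.prems by (auto simp: free_carrier_iff elim: finite_subset simp del: fun_upd_apply)
      then have "?c \<in> carrier ?F" using insert.prems by (auto simp: free_carrier_iff)
      moreover have "{s. ?c s \<noteq> \<zero>} \<subseteq> T" using insert.prems by auto
      ultimately have "?c \<in> module_span R ?F (free_gen R ` S)" using insert.IH insert.prems by blast
      moreover have "c t \<odot>\<^bsub>?F\<^esub> free_gen R t \<in> module_span R ?F (free_gen R ` S)"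
      proof (rule submodule_smult[OF span])
        show "c t \<in> carrier R" using insert.prems by (simp add: free_carrier_iff)
        show "free_gen R t \<in> module_span R ?F (free_gen R ` S)"
          using insert.prems span_superset[of "free_gen R ` S" R ?F] by auto
      qed
      ultimately have "?c \<oplus>\<^bsub>?F\<^esub> c t \<odot>\<^bsub>?F\<^esub> free_gen R t \<in> module_span R ?F (free_gen R ` S)"
        by (rule submodule_add[OF span])
      moreover have "?c \<oplus>\<^bsub>?F\<^esub> c t \<odot>\<^bsub>?F\<^esub> free_gen R t = c"
        using insert.prems by (auto simp: free_carrier_iff free_module_simps free_gen_def)
      ultimately show ?case by simp
    qed
    ultimately show "c \<in> module_span R ?F (free_gen R ` S)"
      using \<open>c \<in> carrier ?F\<close> by (auto simp: free_carrier_iff)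
  qed
qed

lemma free_hom_eqI:
  assumes "module R B" "f \<in> module_hom R (free_module R S) B" "g \<in> module_hom R (free_module R S) B"
    and "\<And>s. s \<in> S \<Longrightarrow> f (free_gen R s) = g (free_gen R s)" "c \<in> carrier (free_module R S)"
  shows "f c = g c"
  by (rule hom_eq_on_span[OF free_module_module assms(1-3), of "free_gen R ` S"])
    (use assms in \<open>auto simp: free_gen_closed free_gen_span\<close>)

context
  fixes A :: "('a, 'c, 'm) module_scheme" and S :: "'i set" and x :: "'i \<Rightarrow> 'c"
  assumes A: "module R A" and x: "\<And>s. s \<in> S \<Longrightarrow> x s \<in> carrier A"
begin

interpretation A: module R A by (rule A)

lemma free_lift_eq:
  assumes "c \<in> carrier (free_module R S)" "finite T" "{s. c s \<noteq> \<zero>} \<subseteq> T" "T \<subseteq> S"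
  shows "free_lift R A x c = (\<Oplus>\<^bsub>A\<^esub>s\<in>T. c s \<odot>\<^bsub>A\<^esub> x s)"
  unfolding free_lift_def
  by (rule A.M.add.finprod_mono_neutral_cong_left)
    (use assms x in \<open>auto simp: free_carrier_iff subset_iff\<close>)

lemma free_lift_hom: "free_lift R A x \<in> module_hom R (free_module R S) A"
proof (rule module_homI)
  let ?F = "free_module R S"
  interpret F: module R ?F by (rule free_module_module)
  show "free_lift R A x c \<in> carrier A" if "c \<in> carrier ?F" for c
    unfolding free_lift_def
    using that x by (intro A.M.finsum_closed) (auto simp: free_carrier_iff)
  show "free_lift R A x (c \<oplus>\<^bsub>?F\<^esub> d) = free_lift R A x c \<oplus>\<^bsub>A\<^esub> free_lift R A x d"
    if cd: "c \<in> carrier ?F" "d \<in> carrier ?F" for c d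
  proof -
    let ?T = "{s. c s \<noteq> \<zero>} \<union> {s. d s \<noteq> \<zero>}"
    have T: "finite ?T" "?T \<subseteq> S" using cd by (auto simp: free_carrier_iff)
    have e: "free_lift R A x e = (\<Oplus>\<^bsub>A\<^esub>s\<in>?T. e s \<odot>\<^bsub>A\<^esub> x s)" if "e \<in> {c, d, c \<oplus>\<^bsub>?F\<^esub> d}" for e
    proof (rule free_lift_eq)
      show "e \<in> carrier ?F" using that cd by auto
    qed (use that T in \<open>auto simp: free_module_simps\<close>)
    have "(\<Oplus>\<^bsub>A\<^esub>s\<in>?T. (c \<oplus>\<^bsub>?F\<^esub> d) s \<odot>\<^bsub>A\<^esub> x s) = (\<Oplus>\<^bsub>A\<^esub>s\<in>?T. c s \<odot>\<^bsub>A\<^esub> x s \<oplus>\<^bsub>A\<^esub> d s \<odot>\<^bsub>A\<^esub> x s)"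
      using cd T x
      by (intro A.M.finsum_cong') (auto simp: free_module_simps free_carrier_iff A.smult_l_distr subset_iff)
    also have "\<dots> = (\<Oplus>\<^bsub>A\<^esub>s\<in>?T. c s \<odot>\<^bsub>A\<^esub> x s) \<oplus>\<^bsub>A\<^esub> (\<Oplus>\<^bsub>A\<^esub>s\<in>?T. d s \<odot>\<^bsub>A\<^esub> x s)"
      using cd T x by (intro A.M.finsum_addf) (auto simp: free_carrier_iff subset_iff)
    finally show ?thesis using e by simp
  qed
  show "free_lift R A x (r \<odot>\<^bsub>?F\<^esub> c) = r \<odot>\<^bsub>A\<^esub> free_lift R A x c"
    if c: "r \<in> carrier R" "c \<in> carrier ?F" for r c
  proof -
    let ?T = "{s. c s \<noteq> \<zero>}"
    have T: "finite ?T" "?T \<subseteq> S" using c by (auto simp: free_carrier_iff)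
    have e: "free_lift R A x e = (\<Oplus>\<^bsub>A\<^esub>s\<in>?T. e s \<odot>\<^bsub>A\<^esub> x s)" if "e \<in> {c, r \<odot>\<^bsub>?F\<^esub> c}" for e
    proof (rule free_lift_eq)
      show "e \<in> carrier ?F" using that c by auto
    qed (use that T c in \<open>auto simp: free_module_simps\<close>)
    have "(\<Oplus>\<^bsub>A\<^esub>s\<in>?T. (r \<odot>\<^bsub>?F\<^esub> c) s \<odot>\<^bsub>A\<^esub> x s) = (\<Oplus>\<^bsub>A\<^esub>s\<in>?T. r \<odot>\<^bsub>A\<^esub> (c s \<odot>\<^bsub>A\<^esub> x s))"
      using c T x
      by (intro A.M.finsum_cong') (auto simp: free_module_simps free_carrier_iff A.smult_assoc1 subset_iff)
    also have "\<dots> = r \<odot>\<^bsub>A\<^esub> (\<Oplus>\<^bsub>A\<^esub>s\<in>?T. c s \<odot>\<^bsub>A\<^esub> x s)"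
      using c T x by (intro A.finsum_smult_ldistr[symmetric]) (auto simp: free_carrier_iff subset_iff)
    finally show ?thesis using e by simp
  qed
qed

lemma free_lift_gen:
  assumes s: "s \<in> S"
  shows "free_lift R A x (free_gen R s) = x s"
proof -
  have "free_lift R A x (free_gen R s) = (\<Oplus>\<^bsub>A\<^esub>t\<in>{s}. free_gen R s t \<odot>\<^bsub>A\<^esub> x t)"
    by (rule free_lift_eq[OF free_gen_closed[OF s]]) (use s in \<open>auto simp: free_gen_def\<close>)
  also have "\<dots> = free_gen R s s \<odot>\<^bsub>A\<^esub> x s"
    using x[OF s] by (subst A.M.finsum_insert) (auto simp: free_gen_def)
  finally show ?thesis using x[OF s] by (simp add: free_gen_def)
qed

end

lemma free_lifting:
  assumes A: "module R A" and B: "module R B" and g: "g \<in> module_hom R A B"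
    and surj: "g ` carrier A = carrier B" and f: "f \<in> module_hom R (free_module R S) B"
  obtains h where "h \<in> module_hom R (free_module R S) A"
    "\<And>c. c \<in> carrier (free_module R S) \<Longrightarrow> g (h c) = f c"
proof -
  have "\<exists>y\<in>carrier A. g y = f (free_gen R s)" if "s \<in> S" for s
    using surj module_hom_closed[OF f free_gen_closed[OF that]] by (metis imageE)
  then obtain x where x: "\<And>s. s \<in> S \<Longrightarrow> x s \<in> carrier A" "\<And>s. s \<in> S \<Longrightarrow> g (x s) = f (free_gen R s)"
    by metis
  show thesis
  proof (rule that)
    show h: "free_lift R A x \<in> module_hom R (free_module R S) A" by (rule free_lift_hom[OF A x(1)])
    show "g (free_lift R A x c) = f c" if "c \<in> carrier (free_module R S)" for c
      by (rule free_hom_eqI[OF B module_hom_comp[OF h g] f _ that])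
        (simp add: free_lift_gen[OF A x(1)] x)
  qed
qed

end

subsection \<open>Coding finitely supported functions\<close>

text \<open>
  Finite lists of codes are coded by their length and the map that picks an entry by the length of
  its argument; finitely supported functions by the list of their support and values. These codes
  give free modules and divisible groups a copy on the test type.
\<close>

definition nat_code :: "nat \<Rightarrow> ('a, 'b) univ" where
  "nat_code n = Fun (\<lambda>l. if length l = n then Scalar undefined else Fun (\<lambda>_. Scalar undefined))"

definition list_code :: "('a, 'b) univ list \<Rightarrow> ('a, 'b) univ" where
  "list_code xs = Fun (\<lambda>l. case l of [] \<Rightarrow> nat_code (length xs)
     | _ # l' \<Rightarrow> if length l' < length xs then xs ! length l' else Scalar undefined)"

lemma nat_code_inj:
  assumes "nat_code n = nat_code m"
  shows "n = m"
  using fun_cong[OF assms[unfolded nat_code_def univ.inject], of "replicate n undefined"]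
  by (simp split: if_splits)

lemma list_code_inj:
  fixes xs ys :: "('a, 'b) univ list"
  assumes "list_code xs = list_code ys"
  shows "xs = ys"
proof -
  have *: "(case l of [] \<Rightarrow> nat_code (length xs)
     | _ # l' \<Rightarrow> if length l' < length xs then xs ! length l' else Scalar undefined) =
    (case l of [] \<Rightarrow> nat_code (length ys)
     | _ # l' \<Rightarrow> if length l' < length ys then ys ! length l' else Scalar undefined)" for l :: "'a list"
    using fun_cong[OF assms[unfolded list_code_def univ.inject], of l] .
  from *[of "[]"] have len: "length xs = length ys" by (auto dest: nat_code_inj)
  show ?thesis
  proof (rule nth_equalityI[OF len])
    fix i assume "i < length xs"
    then show "xs ! i = ys ! i" using *[of "undefined # replicate i undefined"] len by simp
  qed
qed

definition finsupp_code ::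
    "('i \<Rightarrow> ('a, 'b) univ) \<Rightarrow> ('v \<Rightarrow> ('a, 'b) univ) \<Rightarrow> 'v \<Rightarrow> ('i \<Rightarrow> 'v) \<Rightarrow> ('a, 'b) univ" where
  "finsupp_code i k z c =
     list_code (map (\<lambda>s. list_code [i s, k (c s)]) (SOME xs. set xs = {s. c s \<noteq> z}))"

lemma finsupp_code_inj:
  assumes i: "inj_on i S" and k: "inj_on k V"
    and C: "\<And>c. c \<in> C \<Longrightarrow> finite {s. c s \<noteq> z} \<and> {s. c s \<noteq> z} \<subseteq> S \<and> range c \<subseteq> V"
  shows "inj_on (finsupp_code i k z) C"
proof (rule inj_onI)
  fix c d assume c: "c \<in> C" and d: "d \<in> C" and eq: "finsupp_code i k z c = finsupp_code i k z d"
  have set: "set (SOME xs. set xs = {s. e s \<noteq> z}) = {s. e s \<noteq> z}" if "e \<in> C" for e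
    by (rule someI_ex, rule finite_list) (use C[OF that] in auto)
  have "(\<lambda>s. list_code [i s, k (c s)]) ` {s. c s \<noteq> z} = (\<lambda>s. list_code [i s, k (d s)]) ` {s. d s \<noteq> z}"
    using arg_cong[OF list_code_inj[OF eq[unfolded finsupp_code_def]], of set]
    by (simp only: set_map set[OF c] set[OF d])
  then have "(\<lambda>p. list_code [fst p, snd p]) ` ((\<lambda>s. (i s, k (c s))) ` {s. c s \<noteq> z}) =
      (\<lambda>p. list_code [fst p, snd p]) ` ((\<lambda>s. (i s, k (d s))) ` {s. d s \<noteq> z})"
    by (simp only: image_image fst_conv snd_conv)
  moreover have "inj (\<lambda>p. list_code [fst p, snd p] :: ('b, 'c) univ)"
    by (rule injI, drule list_code_inj) (simp add: prod_eq_iff)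
  ultimately have *: "(\<lambda>s. (i s, k (c s))) ` {s. c s \<noteq> z} = (\<lambda>s. (i s, k (d s))) ` {s. d s \<noteq> z}"
    by (simp only: inj_image_eq_iff)
  have sub: "c s = d s" if e: "c \<in> C" "d \<in> C" "c s \<noteq> z"
      "(\<lambda>s. (i s, k (c s))) ` {s. c s \<noteq> z} = (\<lambda>s. (i s, k (d s))) ` {s. d s \<noteq> z}" for c d s
  proof -
    have "(i s, k (c s)) \<in> (\<lambda>s. (i s, k (d s))) ` {s. d s \<noteq> z}" unfolding e(4)[symmetric] using e(3) by (rule imageI[OF CollectI])
    then obtain t where t: "d t \<noteq> z" "i t = i s" "k (d t) = k (c s)" by auto
    have "t = s" using inj_onD[OF i t(2)] t(1) e(3) C[OF e(1)] C[OF e(2)] by blast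
    moreover have "d t \<in> V" "c s \<in> V" using C[OF e(1)] C[OF e(2)] by (auto simp: image_subset_iff)
    then have "d t = c s" using inj_onD[OF k t(3)] by blast
    ultimately show ?thesis by simp
  qed
  show "c = d"
  proof
    fix s
    show "c s = d s"
      using sub[OF c d _ *, of s] sub[OF d c _ *[symmetric], of s] by (metis (full_types))
  qed
qed

subsection \<open>Projective modules lift against surjections on all types\<close>

text \<open>
  The free cover of \<open>P\<close> has a copy on the test type, so a projective module is a retract of that
  cover, and the lifting property of free modules is inherited.
\<close>

lemma projective_lifting:
  fixes P :: "('a, 'p, 'm) module_scheme"
  assumes P: "projective_module R P" and A: "module R A" and B: "module R B"
    and g: "g \<in> module_hom R A B" and surj: "g ` carrier A = carrier B" and f: "f \<in> module_hom R P B"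
  obtains h where "h \<in> module_hom R P A" "\<And>x. x \<in> carrier P \<Longrightarrow> g (h x) = f x"
proof -
  have Pm: "module R P" using P by (simp add: projective_module_def)
  interpret P: module R P by fact
  define F where "F = free_module R (carrier P)"
  have F: "module R F" unfolding F_def by (rule P.R.free_module_module)
  define i :: "('p \<Rightarrow> 'a) \<Rightarrow> ('a, 'p) univ" where "i = finsupp_code Elem Scalar \<zero>\<^bsub>R\<^esub>"
  have i: "inj_on i (carrier F)"
    unfolding i_def by (rule finsupp_code_inj[where V = "carrier R" and S = "carrier P"])
      (auto simp: F_def free_carrier_iff inj_on_def)
  have E: "inj_on (Elem :: 'p \<Rightarrow> ('a, 'p) univ) (carrier P)" by (auto simp: inj_on_def)
  let ?T = "transport_module i F" and ?Q = "transport_module Elem P :: ('a, ('a, 'p) univ) module"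
  let ?j = "inv_into (carrier F) i"
  define \<pi> where "\<pi> = free_lift R P (\<lambda>x. x)"
  have \<pi>: "\<pi> \<in> module_hom R F P" unfolding \<pi>_def F_def by (rule P.R.free_lift_hom[OF Pm])
  have \<pi>g: "\<pi> (free_gen R x) = x" if "x \<in> carrier P" for x
    unfolding \<pi>_def using that by (intro P.R.free_lift_gen[OF Pm]) auto
  have "(\<lambda>t. Elem (\<pi> (?j t))) \<in> module_hom R ?T ?Q"
    by (intro module_hom_comp[OF _ transport_hom[OF Pm E]] module_hom_comp[OF _ \<pi>]
        transport_inv_hom[OF F i])
  moreover have "(\<lambda>t. Elem (\<pi> (?j t))) ` carrier ?T = carrier ?Q"
  proof -
    have "\<pi> ` carrier F = carrier P"
    proof
      show "\<pi> ` carrier F \<subseteq> carrier P" using module_hom_closed[OF \<pi>] by blast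
      show "carrier P \<subseteq> \<pi> ` carrier F"
        using \<pi>g P.R.free_gen_closed[of _ "carrier P"] unfolding F_def by (metis image_eqI subsetI)
    qed
    then show ?thesis by (auto simp: transport_carrier[OF F i] transport_carrier[OF Pm E] inv_into_f_f[OF i] image_image
        simp flip: \<open>\<pi> ` carrier F = carrier P\<close>)
  qed
  ultimately obtain s where s: "s \<in> module_hom R P ?T"
      and s_eq: "\<And>x. x \<in> carrier P \<Longrightarrow> Elem (\<pi> (?j (s x))) = (Elem x :: ('a, 'p) univ)"
    using P transport_module_module[OF F i] transport_module_module[OF Pm E] transport_hom[OF Pm E]
    unfolding projective_module_def by blast
  obtain k where k: "k \<in> module_hom R F A" "\<And>c. c \<in> carrier F \<Longrightarrow> g (k c) = f (\<pi> c)"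
    using P.R.free_lifting[OF A B g surj module_hom_comp[OF \<pi>[unfolded F_def] f]] F_def by metis
  have js: "(\<lambda>x. ?j (s x)) \<in> module_hom R P F" by (rule module_hom_comp[OF s transport_inv_hom[OF F i]])
  show thesis
  proof (rule that)
    show "(\<lambda>x. k (?j (s x))) \<in> module_hom R P A" by (rule module_hom_comp[OF js k(1)])
    show "g (k (?j (s x))) = f x" if "x \<in> carrier P" for x
      using k(2)[OF module_hom_closed[OF js that]] s_eq[OF that] by simp
  qed
qed

lemma (in cring) transport_free_projective:
  assumes i: "inj_on i (carrier (free_module R S))"
  shows "projective_module R (transport_module i (free_module R S))"
  unfolding projective_module_def
proof (intro conjI allI impI, goal_cases)
  case 1
  show ?case by (rule transport_module_module[OF free_module_module i])
next
  case (2 A B g f)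
  note F = free_module_module[of S]
  obtain h where h: "h \<in> module_hom R (free_module R S) A"
      "\<And>c. c \<in> carrier (free_module R S) \<Longrightarrow> g (h c) = f (i c)"
    using free_lifting[of A B g "\<lambda>x. f (i x)" S] 2 module_hom_comp[OF transport_hom[OF F i], of f B] by blast
  show ?case
    by (rule bexI[OF _ module_hom_comp[OF transport_inv_hom[OF F i] h(1)]])
      (auto simp: transport_carrier[OF F i] inv_into_f_f[OF i] h(2))
qed

section \<open>Modules of homomorphisms\<close>

lemma hom_module_carrier_iff:
  "f \<in> carrier (hom_module R A B) \<longleftrightarrow> f \<in> module_hom R A B \<and> f \<in> extensional (carrier A)"
  by (simp add: hom_module_def)

lemma hom_module_simps:
  "\<zero>\<^bsub>hom_module R A B\<^esub> = (\<lambda>x\<in>carrier A. \<zero>\<^bsub>B\<^esub>)"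
  "f \<oplus>\<^bsub>hom_module R A B\<^esub> g = (\<lambda>x\<in>carrier A. f x \<oplus>\<^bsub>B\<^esub> g x)"
  "r \<odot>\<^bsub>hom_module R A B\<^esub> f = (\<lambda>x\<in>carrier A. r \<odot>\<^bsub>B\<^esub> f x)"
  by (simp_all add: hom_module_def)

lemma hom_module_restrict:
  assumes "module R A" "f \<in> module_hom R A B"
  shows "restrict f (carrier A) \<in> carrier (hom_module R A B)"
  unfolding hom_module_carrier_iff using module_hom_cong[OF assms] by simp

lemma hom_module_module:
  assumes A: "module R A" and B: "module R B"
  shows "module R (hom_module R A B)"
proof -
  interpret B: module R B by fact
  let ?H = "hom_module R A B"
  note eqI = extensionalityI[where A = "carrier A"]
  have val: "f x \<in> carrier B" if "f \<in> carrier ?H" "x \<in> carrier A" for f x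
    using that by (auto simp: hom_module_carrier_iff module_hom_closed)
  have ext: "f \<in> extensional (carrier A)" if "f \<in> carrier ?H" for f
    using that by (simp add: hom_module_carrier_iff)
  have add: "f \<oplus>\<^bsub>?H\<^esub> g \<in> carrier ?H" if "f \<in> carrier ?H" "g \<in> carrier ?H" for f g
    unfolding hom_module_simps using that
    by (intro hom_module_restrict[OF A] module_hom_plus B) (auto simp: hom_module_carrier_iff)
  have sm: "r \<odot>\<^bsub>?H\<^esub> f \<in> carrier ?H" if "r \<in> carrier R" "f \<in> carrier ?H" for r f
    unfolding hom_module_simps using that
    by (intro hom_module_restrict[OF A] module_hom_scale B) (auto simp: hom_module_carrier_iff)
  have zero: "\<zero>\<^bsub>?H\<^esub> \<in> carrier ?H"
    unfolding hom_module_simps by (intro hom_module_restrict[OF A] module_hom_zero_map B)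
  note ss = hom_module_simps val add[unfolded hom_module_simps] sm[unfolded hom_module_simps]
    zero[unfolded hom_module_simps]
  interpret A: module R A by fact
  show ?thesis
  proof (rule moduleI)
    show "cring R" by (rule B.R.is_cring)
    show "abelian_group ?H"
    proof (rule abelian_groupI)
      fix f assume f: "f \<in> carrier ?H"
      have "(\<ominus>\<^bsub>R\<^esub> \<one>\<^bsub>R\<^esub>) \<odot>\<^bsub>?H\<^esub> f \<oplus>\<^bsub>?H\<^esub> f = \<zero>\<^bsub>?H\<^esub>"
        using val[OF f] by (intro eqI) (auto simp: ss B.smult_l_minus B.M.l_neg)
      then show "\<exists>g\<in>carrier ?H. g \<oplus>\<^bsub>?H\<^esub> f = \<zero>\<^bsub>?H\<^esub>" using sm[OF _ f] B.R.a_inv_closed B.R.one_closed by blast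
    next
      fix f assume f: "f \<in> carrier ?H"
      show "\<zero>\<^bsub>?H\<^esub> \<oplus>\<^bsub>?H\<^esub> f = f" using ext[OF f] val[OF f] by (intro eqI) (auto simp: ss)
    qed (auto intro!: eqI add zero simp: ss B.M.a_ac A.smult_closed)
  next
    fix f assume f: "f \<in> carrier ?H"
    show "\<one>\<^bsub>R\<^esub> \<odot>\<^bsub>?H\<^esub> f = f" using ext[OF f] val[OF f] by (intro eqI) (auto simp: ss)
  qed (auto intro!: eqI add sm simp: ss B.smult_l_distr B.smult_r_distr B.smult_assoc1)
qed

text \<open>\<open>Hom(F, E)\<close> is a product of copies of \<open>E\<close>, indexed by the basis of \<open>F\<close>.\<close>

lemma hom_module_free_baer:
  assumes E: "baer_module R E"
  shows "baer_module R (hom_module R (free_module R S) E)"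
proof -
  have Em: "module R E" by (rule baer_moduleD[OF E])
  interpret E: module R E by fact
  let ?F = "free_module R S"
  let ?H = "hom_module R ?F E"
  have F: "module R ?F" by (rule E.R.free_module_module)
  have H: "module R ?H" by (rule hom_module_module[OF F Em])
  show ?thesis
    unfolding baer_module_def
  proof (intro conjI allI impI H, elim conjE)
    fix I f
    assume I: "ideal I R" and "f \<in> I \<rightarrow> carrier ?H"
      and add: "\<forall>a\<in>I. \<forall>b\<in>I. f (a \<oplus>\<^bsub>R\<^esub> b) = f a \<oplus>\<^bsub>?H\<^esub> f b"
      and sm: "\<forall>r\<in>carrier R. \<forall>a\<in>I. f (r \<otimes>\<^bsub>R\<^esub> a) = r \<odot>\<^bsub>?H\<^esub> f a"
    then have fh: "f a \<in> module_hom R ?F E" "f a \<in> extensional (carrier ?F)" if "a \<in> I" for a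
      using that by (auto simp: hom_module_carrier_iff)
    have "\<exists>e\<in>carrier E. \<forall>a\<in>I. f a (free_gen R s) = a \<odot>\<^bsub>E\<^esub> e" if s: "s \<in> S" for s
    proof -
      note gs = E.R.free_gen_closed[OF s]
      show ?thesis
        by (rule baer_moduleE[OF E I, of "\<lambda>a. f a (free_gen R s)"])
          (use add sm gs in \<open>auto simp: module_hom_closed[OF fh(1)] hom_module_simps\<close>)
    qed
    then obtain e where e: "\<And>s. s \<in> S \<Longrightarrow> e s \<in> carrier E"
        "\<And>s a. s \<in> S \<Longrightarrow> a \<in> I \<Longrightarrow> f a (free_gen R s) = a \<odot>\<^bsub>E\<^esub> e s"
      by metis
    define g where "g = restrict (free_lift R E e) (carrier ?F)"
    have gH: "g \<in> carrier ?H"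
      unfolding g_def by (intro hom_module_restrict[OF F] E.R.free_lift_hom Em e(1))
    have "f a = a \<odot>\<^bsub>?H\<^esub> g" if a: "a \<in> I" for a
    proof (rule extensionalityI)
      have aR: "a \<in> carrier R" using a ideal.Icarr[OF I] by auto
      show "f a \<in> extensional (carrier ?F)" by (rule fh(2)[OF a])
      show "a \<odot>\<^bsub>?H\<^esub> g \<in> extensional (carrier ?F)" by (simp add: hom_module_simps)
      fix c assume c: "c \<in> carrier ?F"
      have gh: "free_lift R E e \<in> module_hom R ?F E" by (rule E.R.free_lift_hom[OF Em e(1)])
      have "f a c = a \<odot>\<^bsub>E\<^esub> free_lift R E e c"
        by (rule E.R.free_hom_eqI[OF Em fh(1)[OF a] module_hom_scale[OF Em gh aR] _ c])
          (simp add: e a E.R.free_lift_gen[OF Em e(1)])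
      then show "f a c = (a \<odot>\<^bsub>?H\<^esub> g) c" using c by (simp add: hom_module_simps g_def)
    qed
    then show "\<exists>e\<in>carrier ?H. \<forall>a\<in>I. f a = a \<odot>\<^bsub>?H\<^esub> e" using gH by blast
  qed
qed

section \<open>Submodules, colons and multiples\<close>

definition smult_image :: "('a, 'b, 'm) module_scheme \<Rightarrow> 'a \<Rightarrow> 'b set \<Rightarrow> 'b set" where
  "smult_image M a H = (\<lambda>x. a \<odot>\<^bsub>M\<^esub> x) ` H"

abbreviation multiples :: "('a, 'b, 'm) module_scheme \<Rightarrow> 'a \<Rightarrow> 'b set" where
  "multiples M a \<equiv> smult_image M a (carrier M)"

definition colon :: "('a, 'b, 'm) module_scheme \<Rightarrow> 'b set \<Rightarrow> 'a \<Rightarrow> 'b set" where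
  "colon M K a = {x \<in> carrier M. a \<odot>\<^bsub>M\<^esub> x \<in> K}"

definition annihilator :: "('a, 'r) ring_scheme \<Rightarrow> ('a, 'b, 'm) module_scheme \<Rightarrow> 'b set \<Rightarrow> 'b \<Rightarrow> 'a set" where
  "annihilator R M K z = {r \<in> carrier R. r \<odot>\<^bsub>M\<^esub> z \<in> K}"

definition nonzerodivisor :: "('a, 'b, 'm) module_scheme \<Rightarrow> 'b set \<Rightarrow> 'a \<Rightarrow> bool" where
  "nonzerodivisor M K a \<longleftrightarrow> (\<forall>z\<in>carrier M. a \<odot>\<^bsub>M\<^esub> z \<in> K \<longrightarrow> z \<in> K)"

lemma nonzerodivisorD: "nonzerodivisor M K a \<Longrightarrow> z \<in> carrier M \<Longrightarrow> a \<odot>\<^bsub>M\<^esub> z \<in> K \<Longrightarrow> z \<in> K"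
  by (simp add: nonzerodivisor_def)

lemma set_add_iff: "x \<in> H <+>\<^bsub>M\<^esub> K \<longleftrightarrow> (\<exists>h\<in>H. \<exists>k\<in>K. x = h \<oplus>\<^bsub>M\<^esub> k)"
  by (auto simp: set_add_def')

context module
begin

lemma smult_self_hom: "a \<in> carrier R \<Longrightarrow> (\<lambda>x. a \<odot>\<^bsub>M\<^esub> x) \<in> module_hom R M M"
  by (rule module_homI) (auto simp: smult_r_distr smult_assoc1[symmetric] m_comm)

lemma smult_point_hom: "x \<in> carrier M \<Longrightarrow> (\<lambda>a. a \<odot>\<^bsub>M\<^esub> x) \<in> module_hom R (self_module R) M"
  by (rule module_homI) (auto simp: self_module_def smult_l_distr smult_assoc1)

lemma smult_image_submodule: "a \<in> carrier R \<Longrightarrow> submodule H R M \<Longrightarrow> submodule (smult_image M a H) R M"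
  unfolding smult_image_def
  by (rule hom_image_submodule[OF module_axioms module_axioms smult_self_hom])

lemma colon_submodule: "a \<in> carrier R \<Longrightarrow> submodule K R M \<Longrightarrow> submodule (colon M K a) R M"
  unfolding colon_def
  by (rule hom_preimage_submodule[OF module_axioms module_axioms smult_self_hom])

lemma colon_superset: "a \<in> carrier R \<Longrightarrow> submodule K R M \<Longrightarrow> K \<subseteq> colon M K a"
  using submodule_subset submodule_smult by (fastforce simp: colon_def)

lemma sum_submodule:
  assumes H: "submodule H R M" and K: "submodule K R M"
  shows "submodule (H <+>\<^bsub>M\<^esub> K) R M"
proof (rule submoduleI'[OF module_axioms])
  note Hc = submodule_subset[OF H] and Kc = submodule_subset[OF K]
  show "H <+>\<^bsub>M\<^esub> K \<subseteq> carrier M" using Hc Kc by (auto simp: set_add_iff subset_iff)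
  show "\<zero>\<^bsub>M\<^esub> \<in> H <+>\<^bsub>M\<^esub> K"
    using submodule_zero[OF module_axioms H] submodule_zero[OF module_axioms K]
    by (auto simp: set_add_iff intro!: bexI[of _ "\<zero>\<^bsub>M\<^esub>"])
  show "x \<oplus>\<^bsub>M\<^esub> y \<in> H <+>\<^bsub>M\<^esub> K" if xy: "x \<in> H <+>\<^bsub>M\<^esub> K" "y \<in> H <+>\<^bsub>M\<^esub> K" for x y
  proof -
    obtain h k h' k' where hk: "h \<in> H" "k \<in> K" "h' \<in> H" "k' \<in> K" "x = h \<oplus>\<^bsub>M\<^esub> k" "y = h' \<oplus>\<^bsub>M\<^esub> k'"
      using xy unfolding set_add_iff by blast
    then have "x \<oplus>\<^bsub>M\<^esub> y = (h \<oplus>\<^bsub>M\<^esub> h') \<oplus>\<^bsub>M\<^esub> (k \<oplus>\<^bsub>M\<^esub> k')"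
      using Hc Kc by (simp add: subset_iff M.a_ac)
    then show ?thesis
      using hk submodule_add[OF H] submodule_add[OF K] unfolding set_add_iff by blast
  qed
  show "r \<odot>\<^bsub>M\<^esub> x \<in> H <+>\<^bsub>M\<^esub> K" if rx: "r \<in> carrier R" "x \<in> H <+>\<^bsub>M\<^esub> K" for r x
  proof -
    obtain h k where hk: "h \<in> H" "k \<in> K" "x = h \<oplus>\<^bsub>M\<^esub> k"
      using rx unfolding set_add_iff by blast
    then have "r \<odot>\<^bsub>M\<^esub> x = r \<odot>\<^bsub>M\<^esub> h \<oplus>\<^bsub>M\<^esub> r \<odot>\<^bsub>M\<^esub> k"
      using Hc Kc rx by (simp add: subset_iff smult_r_distr)
    then show ?thesis
      using hk rx submodule_smult[OF H] submodule_smult[OF K] unfolding set_add_iff by blast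
  qed
qed

lemma sum_superset:
  assumes H: "submodule H R M" and K: "submodule K R M"
  shows "H \<subseteq> H <+>\<^bsub>M\<^esub> K" "K \<subseteq> H <+>\<^bsub>M\<^esub> K"
proof -
  have "h = h \<oplus>\<^bsub>M\<^esub> \<zero>\<^bsub>M\<^esub>" if "h \<in> H" for h using that submodule_subset[OF H] by auto
  then show "H \<subseteq> H <+>\<^bsub>M\<^esub> K" using submodule_zero[OF module_axioms K] unfolding set_add_iff subset_iff by blast
  have "k = \<zero>\<^bsub>M\<^esub> \<oplus>\<^bsub>M\<^esub> k" if "k \<in> K" for k using that submodule_subset[OF K] by auto
  then show "K \<subseteq> H <+>\<^bsub>M\<^esub> K" using submodule_zero[OF module_axioms H] unfolding set_add_iff subset_iff by blast
qed

lemma sum_least: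
  "submodule L R M \<Longrightarrow> H \<subseteq> L \<Longrightarrow> K \<subseteq> L \<Longrightarrow> H <+>\<^bsub>M\<^esub> K \<subseteq> L"
  by (auto simp: set_add_iff subset_iff submodule_add)

lemma sum_right_comm:
  assumes "submodule H R M" "submodule K R M" "submodule L R M"
  shows "(H <+>\<^bsub>M\<^esub> K) <+>\<^bsub>M\<^esub> L = (H <+>\<^bsub>M\<^esub> L) <+>\<^bsub>M\<^esub> K"
  by (intro equalityI sum_least sum_submodule assms order_trans[OF sum_superset(1) sum_superset(1)]
      order_trans[OF sum_superset(2) sum_superset(1)] sum_superset(2))

lemma cyclic_submodule:
  assumes "z \<in> carrier M"
  shows "submodule ((\<lambda>r. r \<odot>\<^bsub>M\<^esub> z) ` carrier R) R M"
proof (rule submoduleI'[OF module_axioms])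
  show "\<zero>\<^bsub>M\<^esub> \<in> (\<lambda>r. r \<odot>\<^bsub>M\<^esub> z) ` carrier R" using assms by (force intro: image_eqI[of _ _ "\<zero>"])
  show "x \<oplus>\<^bsub>M\<^esub> y \<in> (\<lambda>r. r \<odot>\<^bsub>M\<^esub> z) ` carrier R"
    if "x \<in> (\<lambda>r. r \<odot>\<^bsub>M\<^esub> z) ` carrier R" "y \<in> (\<lambda>r. r \<odot>\<^bsub>M\<^esub> z) ` carrier R" for x y
    using that assms by (auto simp: smult_l_distr[symmetric])
  show "s \<odot>\<^bsub>M\<^esub> x \<in> (\<lambda>r. r \<odot>\<^bsub>M\<^esub> z) ` carrier R"
    if "s \<in> carrier R" "x \<in> (\<lambda>r. r \<odot>\<^bsub>M\<^esub> z) ` carrier R" for s x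
    using that assms by (auto simp: smult_assoc1[symmetric])
qed (use assms in auto)

lemma annihilator_ideal:
  assumes K: "submodule K R M" and z: "z \<in> carrier M"
  shows "ideal (annihilator R M K z) R"
  by (rule R.idealI')
    (use z submodule_zero[OF module_axioms K] in
      \<open>auto simp: annihilator_def smult_l_distr smult_assoc1 submodule_add[OF K] submodule_smult[OF K]\<close>)

lemma quot_trivial_iff:
  assumes "submodule H R M"
  shows "trivial_module (quot_module M H) \<longleftrightarrow> H = carrier M"
proof -
  have "trivial_module (quot_module M H) \<longleftrightarrow> (\<forall>x\<in>carrier M. proj_quot M H x = \<zero>\<^bsub>quot_module M H\<^esub>)"
    unfolding trivial_module_def quot_carrier[OF module_axioms assms] by auto
  also have "\<dots> \<longleftrightarrow> (\<forall>x\<in>carrier M. x \<in> H)"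
    using proj_quot_eq_zero_iff[OF module_axioms assms] by blast
  finally show ?thesis using submodule_subset[OF assms] by blast
qed

end

lemma self_module_simps [simp]:
  "carrier (self_module R) = carrier R" "\<zero>\<^bsub>self_module R\<^esub> = \<zero>\<^bsub>R\<^esub>"
  "x \<oplus>\<^bsub>self_module R\<^esub> y = x \<oplus>\<^bsub>R\<^esub> y" "x \<odot>\<^bsub>self_module R\<^esub> y = x \<otimes>\<^bsub>R\<^esub> y"
  by (auto simp: self_module_def)

lemma (in cring) self_module_module: "module R (self_module R)"
proof (rule moduleI)
  show "abelian_group (self_module R)"
  proof (rule abelian_groupI)
    show "\<exists>y\<in>carrier (self_module R). y \<oplus>\<^bsub>self_module R\<^esub> x = \<zero>\<^bsub>self_module R\<^esub>"
      if "x \<in> carrier (self_module R)" for x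
      using that by (intro bexI[of _ "\<ominus> x"]) (auto simp: l_neg)
  qed (auto simp: a_ac)
qed (auto simp: l_distr r_distr m_assoc is_cring)

lemma (in cring) self_submodule_iff: "submodule I R (self_module R) \<longleftrightarrow> ideal I R"
proof
  assume I: "submodule I R (self_module R)"
  show "ideal I R"
    by (rule idealI')
      (use submodule_subset[OF I] submodule_zero[OF self_module_module I] submodule_add[OF I]
        submodule_smult[OF I] in auto)
next
  assume I: "ideal I R"
  interpret I: ideal I R by fact
  show "submodule I R (self_module R)"
    by (rule submoduleI'[OF self_module_module]) (auto simp: I.I_l_closed I.a_subset)
qed

section \<open>Noetherian modules\<close>

definition noetherian_module :: "('a, 'r) ring_scheme \<Rightarrow> ('a, 'b, 'm) module_scheme \<Rightarrow> bool" where
  "noetherian_module R M \<longleftrightarrow> module R M \<and>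
     (\<forall>H. submodule H R M \<longrightarrow> (\<exists>S. finite S \<and> S \<subseteq> carrier M \<and> module_span R M S = H))"

lemma noetherian_moduleD: "noetherian_module R M \<Longrightarrow> module R M"
  by (simp add: noetherian_module_def)

lemma (in module) span_insert_decomp:
  assumes S: "S \<subseteq> carrier M" and s: "s \<in> carrier M" and x: "x \<in> module_span R M (insert s S)"
  obtains r where "r \<in> carrier R" "x \<ominus>\<^bsub>M\<^esub> r \<odot>\<^bsub>M\<^esub> s \<in> module_span R M S"
proof -
  let ?C = "(\<lambda>r. r \<odot>\<^bsub>M\<^esub> s) ` carrier R"
  note C = cyclic_submodule[OF s] and sp = span_submodule[OF module_axioms S]
  have "s \<in> ?C" using s by (force intro: image_eqI[of _ _ \<one>])
  then have "insert s S \<subseteq> module_span R M S <+>\<^bsub>M\<^esub> ?C"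
    using sum_superset[OF sp C] span_superset[of S R M] by blast
  then have "x \<in> module_span R M S <+>\<^bsub>M\<^esub> ?C"
    using span_least[OF sum_submodule[OF sp C]] x by blast
  then obtain y r where y: "y \<in> module_span R M S" "r \<in> carrier R" "x = y \<oplus>\<^bsub>M\<^esub> r \<odot>\<^bsub>M\<^esub> s"
    by (auto simp: set_add_iff)
  moreover from y have "x \<ominus>\<^bsub>M\<^esub> r \<odot>\<^bsub>M\<^esub> s = y"
    using submodule_subset[OF sp] s by (simp add: a_minus_def M.a_assoc M.r_neg subset_iff)
  ultimately show thesis using that by simp
qed

lemma (in module) smult_minus_distr:
  assumes "r \<in> carrier R" "s \<in> carrier R" "x \<in> carrier M" "y \<in> carrier M" "z \<in> carrier M"
  shows "(x \<oplus>\<^bsub>M\<^esub> y) \<ominus>\<^bsub>M\<^esub> (r \<oplus> s) \<odot>\<^bsub>M\<^esub> z = (x \<ominus>\<^bsub>M\<^esub> r \<odot>\<^bsub>M\<^esub> z) \<oplus>\<^bsub>M\<^esub> (y \<ominus>\<^bsub>M\<^esub> s \<odot>\<^bsub>M\<^esub> z)"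
    and "r \<odot>\<^bsub>M\<^esub> x \<ominus>\<^bsub>M\<^esub> (r \<otimes> s) \<odot>\<^bsub>M\<^esub> z = r \<odot>\<^bsub>M\<^esub> (x \<ominus>\<^bsub>M\<^esub> s \<odot>\<^bsub>M\<^esub> z)"
  using assms
  by (simp_all add: a_minus_def smult_l_distr smult_r_distr smult_assoc1 smult_r_minus M.minus_add M.a_ac)

lemma (in abelian_group) minus_minus_cancel:
  assumes "x \<in> carrier G" "y \<in> carrier G" "w \<in> carrier G"
  shows "(x \<ominus> w) \<ominus> (y \<ominus> w) = x \<ominus> y"
proof -
  have "(x \<ominus> w) \<ominus> (y \<ominus> w) = x \<oplus> (\<ominus> w \<oplus> (\<ominus> y \<oplus> w))"
    using assms by (simp add: a_minus_def minus_add a_assoc)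
  also have "\<ominus> w \<oplus> (\<ominus> y \<oplus> w) = \<ominus> y"
    using assms a_comm[of "\<ominus> y" w] by (simp add: r_neg1)
  finally show ?thesis by (simp add: a_minus_def)
qed

text \<open>
  Induction on the number of generators: with one generator \<open>s\<close> split off, a submodule \<open>H\<close> is
  generated by generators of its part in the smaller span together with elements whose
  \<open>s\<close>-coefficients generate the ideal of all such coefficients.
\<close>

theorem fin_gen_noetherian:
  assumes R: "noetherian_ring R" and fg: "fin_gen_module R M"
  shows "noetherian_module R M"
proof -
  have M: "module R M" using fg by (simp add: fin_gen_module_def)
  interpret M: module R M by fact
  interpret N: noetherian_ring R by fact
  have main: "\<exists>T. finite T \<and> T \<subseteq> carrier M \<and> module_span R M T = H"
    if "finite S" "S \<subseteq> carrier M" "submodule H R M" "H \<subseteq> module_span R M S" for S H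
    using that
  proof (induction S arbitrary: H rule: finite_induct)
    case empty
    then have "module_span R M {} = H" using span_least[OF empty.prems(2)] by blast
    then show ?case by blast
  next
    case (insert s S)
    note H = insert.prems(2)
    have S: "S \<subseteq> carrier M" and s: "s \<in> carrier M" using insert.prems by auto
    note sp = span_submodule[OF M S]
    have Hc: "H \<subseteq> carrier M" by (rule submodule_subset[OF H])
    have lead_ideal: "ideal {r \<in> carrier R. \<exists>h\<in>H'. h \<ominus>\<^bsub>M\<^esub> r \<odot>\<^bsub>M\<^esub> s \<in> module_span R M S} R"
      if H': "submodule H' R M" for H'
    proof (rule M.R.idealI')
      note H'c = submodule_subset[OF H']
      let ?I = "{r \<in> carrier R. \<exists>h\<in>H'. h \<ominus>\<^bsub>M\<^esub> r \<odot>\<^bsub>M\<^esub> s \<in> module_span R M S}"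
      show "\<zero>\<^bsub>R\<^esub> \<in> ?I"
        using submodule_zero[OF M H'] submodule_minus[OF M sp submodule_zero[OF M sp] submodule_zero[OF M sp]] s
        by simp blast
      show "a \<oplus>\<^bsub>R\<^esub> b \<in> ?I" if "a \<in> ?I" "b \<in> ?I" for a b
      proof -
        from that obtain h k where "h \<in> H'" "h \<ominus>\<^bsub>M\<^esub> a \<odot>\<^bsub>M\<^esub> s \<in> module_span R M S"
          "k \<in> H'" "k \<ominus>\<^bsub>M\<^esub> b \<odot>\<^bsub>M\<^esub> s \<in> module_span R M S" by blast
        moreover from this have "(h \<oplus>\<^bsub>M\<^esub> k) \<ominus>\<^bsub>M\<^esub> (a \<oplus>\<^bsub>R\<^esub> b) \<odot>\<^bsub>M\<^esub> s \<in> module_span R M S"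
          using that H'c s submodule_add[OF sp] by (subst M.smult_minus_distr) auto
        ultimately show ?thesis using that submodule_add[OF H'] by blast
      qed
      show "r \<otimes>\<^bsub>R\<^esub> a \<in> ?I" if "r \<in> carrier R" "a \<in> ?I" for r a
      proof -
        from that obtain h where "h \<in> H'" "h \<ominus>\<^bsub>M\<^esub> a \<odot>\<^bsub>M\<^esub> s \<in> module_span R M S" by blast
        moreover from this have "r \<odot>\<^bsub>M\<^esub> h \<ominus>\<^bsub>M\<^esub> (r \<otimes>\<^bsub>R\<^esub> a) \<odot>\<^bsub>M\<^esub> s \<in> module_span R M S"
          using that H'c s submodule_smult[OF sp] by (subst M.smult_minus_distr) auto
        ultimately show ?thesis using that submodule_smult[OF H'] by blast
      qed
    qed auto
    let ?I = "\<lambda>H'. {r \<in> carrier R. \<exists>h\<in>H'. h \<ominus>\<^bsub>M\<^esub> r \<odot>\<^bsub>M\<^esub> s \<in> module_span R M S}"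
    obtain A where A: "A \<subseteq> carrier R" "finite A" "?I H = Idl\<^bsub>R\<^esub> A"
      using N.finetely_gen[OF lead_ideal[OF H]] by blast
    then have "A \<subseteq> ?I H" using M.R.genideal_self[OF A(1)] by blast
    then have "\<forall>a\<in>A. \<exists>h. h \<in> H \<and> h \<ominus>\<^bsub>M\<^esub> a \<odot>\<^bsub>M\<^esub> s \<in> module_span R M S" by blast
    then obtain g where "\<forall>a\<in>A. g a \<in> H \<and> g a \<ominus>\<^bsub>M\<^esub> a \<odot>\<^bsub>M\<^esub> s \<in> module_span R M S"
      by (rule bchoice[THEN exE])
    then have g: "\<And>a. a \<in> A \<Longrightarrow> g a \<in> H" "\<And>a. a \<in> A \<Longrightarrow> g a \<ominus>\<^bsub>M\<^esub> a \<odot>\<^bsub>M\<^esub> s \<in> module_span R M S"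
      by blast+
    have gc: "g ` A \<subseteq> carrier M" using g Hc by auto
    note spg = span_submodule[OF M gc]
    have gH: "module_span R M (g ` A) \<subseteq> H" using g by (intro span_least[OF H]) auto
    have "A \<subseteq> ?I (module_span R M (g ` A))"
      using A(1) g(2) span_superset[of "g ` A" R M] by blast
    then have lead: "?I H \<subseteq> ?I (module_span R M (g ` A))"
      unfolding A(3) by (rule M.R.genideal_minimal[OF lead_ideal[OF spg]])
    have "submodule (\<Inter>{H, module_span R M S}) R M"
      using H sp by (intro Inter_submodule[OF M]) auto
    then obtain T where T: "finite T" "T \<subseteq> carrier M" "module_span R M T = H \<inter> module_span R M S"
      using insert.IH[OF S, of "H \<inter> module_span R M S"] by auto
    have UT: "g ` A \<union> T \<subseteq> carrier M" using gc T by auto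
    have "module_span R M (g ` A \<union> T) = H"
    proof
      show "module_span R M (g ` A \<union> T) \<subseteq> H"
        using g T span_superset[of T R M] by (intro span_least[OF H]) auto
      show "H \<subseteq> module_span R M (g ` A \<union> T)"
      proof
        fix h assume h: "h \<in> H"
        then have "h \<in> module_span R M (insert s S)" using insert.prems(3) by blast
        then obtain r where r: "r \<in> carrier R" "h \<ominus>\<^bsub>M\<^esub> r \<odot>\<^bsub>M\<^esub> s \<in> module_span R M S"
          by (rule M.span_insert_decomp[OF S s])
        then have "r \<in> ?I H" using h by blast
        then obtain y where y: "y \<in> module_span R M (g ` A)" "y \<ominus>\<^bsub>M\<^esub> r \<odot>\<^bsub>M\<^esub> s \<in> module_span R M S"
          using lead by blast
        have yc: "y \<in> carrier M" "h \<in> carrier M" using y gH h Hc by auto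
        have "h \<ominus>\<^bsub>M\<^esub> y = (h \<ominus>\<^bsub>M\<^esub> r \<odot>\<^bsub>M\<^esub> s) \<ominus>\<^bsub>M\<^esub> (y \<ominus>\<^bsub>M\<^esub> r \<odot>\<^bsub>M\<^esub> s)"
          using yc r s by (simp add: M.M.minus_minus_cancel)
        then have "h \<ominus>\<^bsub>M\<^esub> y \<in> module_span R M S"
          using submodule_minus[OF M sp] r y by simp
        moreover have "h \<ominus>\<^bsub>M\<^esub> y \<in> H" using submodule_minus[OF M H] h y gH by blast
        ultimately have "h \<ominus>\<^bsub>M\<^esub> y \<in> module_span R M (g ` A \<union> T)"
          using T span_mono[of T "g ` A \<union> T" R M] by blast
        moreover have "y \<in> module_span R M (g ` A \<union> T)"
          using y span_mono[of "g ` A" "g ` A \<union> T" R M] by blast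
        ultimately have "(h \<ominus>\<^bsub>M\<^esub> y) \<oplus>\<^bsub>M\<^esub> y \<in> module_span R M (g ` A \<union> T)"
          by (rule submodule_add[OF span_submodule[OF M UT]])
        then show "h \<in> module_span R M (g ` A \<union> T)"
          using yc by (simp add: a_minus_def M.M.a_assoc M.M.l_neg)
      qed
    qed
    then show ?case using T(1) A(2) UT by (intro exI[of _ "g ` A \<union> T"]) simp
  qed
  obtain S where "finite S" "S \<subseteq> carrier M" "module_span R M S = carrier M"
    using fg by (auto simp: fin_gen_module_def)
  then show ?thesis
    unfolding noetherian_module_def using M main[of S] submodule_subset by metis
qed

lemma noetherian_module_maximal:
  assumes M: "noetherian_module R M" and ne: "\<F> \<noteq> {}" and sub: "\<And>H. H \<in> \<F> \<Longrightarrow> submodule H R M"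
  obtains H where "H \<in> \<F>" "\<And>K. K \<in> \<F> \<Longrightarrow> H \<subseteq> K \<Longrightarrow> K = H"
proof -
  note Mm = noetherian_moduleD[OF M]
  have "\<exists>H\<in>\<F>. \<forall>X\<in>\<F>. H \<subseteq> X \<longrightarrow> X = H"
  proof (rule subset_Zorn_nonempty[OF ne])
    fix \<C> assume ne: "\<C> \<noteq> {}" and ch: "subset.chain \<F> \<C>"
    have lin: "G \<subseteq> G' \<or> G' \<subseteq> G" if "G \<in> \<C>" "G' \<in> \<C>" for G G'
      using ch that by (auto simp: subset_chain_def)
    have sC: "submodule G R M" if "G \<in> \<C>" for G using ch that sub by (auto simp: subset.chain_def)
    have U: "submodule (\<Union>\<C>) R M"
    proof (rule submoduleI'[OF Mm])
      show "\<Union>\<C> \<subseteq> carrier M" using submodule_subset[OF sC] by blast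
      show "\<zero>\<^bsub>M\<^esub> \<in> \<Union>\<C>" using ne submodule_zero[OF Mm sC] by blast
      show "r \<odot>\<^bsub>M\<^esub> x \<in> \<Union>\<C>" if "r \<in> carrier R" "x \<in> \<Union>\<C>" for r x
        using that submodule_smult[OF sC] by blast
      show "x \<oplus>\<^bsub>M\<^esub> y \<in> \<Union>\<C>" if xy: "x \<in> \<Union>\<C>" "y \<in> \<Union>\<C>" for x y
      proof -
        obtain G G' where G: "G \<in> \<C>" "G' \<in> \<C>" "x \<in> G" "y \<in> G'" using xy by auto
        then obtain G'' where "G'' \<in> \<C>" "x \<in> G''" "y \<in> G''" using lin[of G G'] by auto
        then show ?thesis using submodule_add[OF sC] by blast
      qed
    qed
    then obtain S where S: "finite S" "module_span R M S = \<Union>\<C>"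
      using M by (auto simp: noetherian_module_def)
    then have "S \<subseteq> \<Union>\<C>" using span_superset[of S R M] by simp
    then obtain G where "G \<in> \<C>" "S \<subseteq> G"
      using finite_subset_Union_chain[OF S(1) _ ne ch] by blast
    then have "\<Union>\<C> = G" using span_least[OF sC, of G S] S(2) by blast
    then show "\<Union>\<C> \<in> \<F>" using \<open>G \<in> \<C>\<close> ch by (auto simp: subset.chain_def)
  qed
  then show thesis using that by blast
qed

section \<open>Prime avoidance\<close>

lemma (in cring) prime_avoids_intersection:
  assumes p: "primeideal p R" and "finite T" "\<And>J. J \<in> T \<Longrightarrow> ideal J R" "\<And>J. J \<in> T \<Longrightarrow> \<not> J \<subseteq> p"
  obtains w where "w \<in> carrier R" "w \<notin> p" "\<And>J. J \<in> T \<Longrightarrow> w \<in> J"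
proof -
  interpret p: primeideal p R by fact
  have "\<exists>w\<in>carrier R. w \<notin> p \<and> (\<forall>J\<in>T. w \<in> J)"
    using assms(2-)
  proof (induction T rule: finite_induct)
    case empty
    have "\<one> \<notin> p" using p.I_notcarr p.one_imp_carrier by blast
    then show ?case by blast
  next
    case (insert J T)
    then obtain w where w: "w \<in> carrier R" "w \<notin> p" "\<forall>J\<in>T. w \<in> J" by auto
    interpret J: ideal J R using insert.prems by simp
    obtain v where v: "v \<in> J" "v \<notin> p" using insert.prems(2)[of J] by auto
    have "v \<otimes> w \<notin> p" using p.I_prime[of v w] w v J.Icarr by blast
    moreover have "v \<otimes> w \<in> K" if "K \<in> insert J T" for K
      using that ideal.I_l_closed[of K R w v] ideal.I_r_closed[of J R v w] insert.prems(1) w v J.Icarr by auto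
    ultimately show ?case using w v J.Icarr by blast
  qed
  then show thesis using that by blast
qed

text \<open>
  One of the ideals to be avoided may be arbitrary. The induction removes a minimal prime, so that
  no remaining one is contained in it.
\<close>

theorem (in cring) prime_avoidance:
  assumes "finite P" "\<And>p. p \<in> P \<Longrightarrow> primeideal p R" "ideal I R" "ideal J R" "\<not> I \<subseteq> J"
    "\<And>p. p \<in> P \<Longrightarrow> \<not> I \<subseteq> p"
  obtains y where "y \<in> I" "y \<notin> J" "\<And>p. p \<in> P \<Longrightarrow> y \<notin> p"
proof -
  interpret I: ideal I R by fact
  have "\<exists>y\<in>I. y \<notin> J \<and> (\<forall>p\<in>P. y \<notin> p)"
    using assms(1,2,4-)
  proof (induction "card P" arbitrary: P J)
    case 0
    then show ?case by auto
  next
    case (Suc n)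
    then have "P \<noteq> {}" by auto
    then obtain p where p: "p \<in> P" and pmin: "\<And>q. q \<in> P \<Longrightarrow> q \<subseteq> p \<Longrightarrow> p = q"
      using finite_has_minimal[OF Suc.prems(1)] by blast
    interpret p: primeideal p R using Suc.prems p by blast
    interpret J: ideal J R by fact
    have P': "n = card (P - {p})" "finite (P - {p})" using Suc.hyps(2) Suc.prems(1) p by auto
    show ?case
    proof (cases "J \<subseteq> p")
      case True
      have "\<exists>y\<in>I. y \<notin> p \<and> (\<forall>q\<in>P - {p}. y \<notin> q)"
        using Suc.prems p by (intro Suc.hyps(1)[OF P']) (auto intro: p.ideal_axioms)
      then show ?thesis using True by blast
    next
      case False
      have "\<exists>y\<in>I. y \<notin> J \<and> (\<forall>q\<in>P - {p}. y \<notin> q)"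
        using Suc.prems by (intro Suc.hyps(1)[OF P']) auto
      then obtain y where y: "y \<in> I" "y \<notin> J" "\<And>q. q \<in> P - {p} \<Longrightarrow> y \<notin> q" by blast
      show ?thesis
      proof (cases "y \<in> p")
        case False
        then show ?thesis using y by blast
      next
        case yp: True
        obtain w where w: "w \<in> carrier R" "w \<notin> p" "\<And>K. K \<in> {I, J} \<union> (P - {p}) \<Longrightarrow> w \<in> K"
        proof (rule prime_avoids_intersection[OF p.primeideal_axioms, of "{I, J} \<union> (P - {p})"])
          show "finite ({I, J} \<union> (P - {p}))" using P' by auto
          show "ideal K R" if "K \<in> {I, J} \<union> (P - {p})" for K
            using that Suc.prems(2) I.ideal_axioms J.ideal_axioms by (auto dest: primeideal.axioms(1))
          show "\<not> K \<subseteq> p" if "K \<in> {I, J} \<union> (P - {p})" for K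
            using that Suc.prems(5) p pmin False by auto
        qed blast
        have sumnot: "y \<oplus> w \<notin> K" if K: "ideal K R" and yw: "y \<in> K \<longleftrightarrow> w \<notin> K" for K
        proof
          interpret K: ideal K R by fact
          assume s: "y \<oplus> w \<in> K"
          have yR: "y \<in> carrier R" using y I.Icarr by auto
          show False
          proof (cases "y \<in> K")
            case True
            then have "\<ominus> y \<oplus> (y \<oplus> w) \<in> K" using s by auto
            then show False using yw True yR w(1) by (simp add: r_neg1)
          next
            case False
            then have "(y \<oplus> w) \<oplus> \<ominus> w \<in> K" using s yw by auto
            then show False using False yR w(1) by (simp add: a_assoc r_neg)
          qed
        qed
        have "y \<oplus> w \<notin> q" if q: "q \<in> P" for q
        proof (cases "q = p")
          case True
          then show ?thesis using sumnot[OF p.ideal_axioms] yp w by auto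
        next
          case False
          then show ?thesis
            using q y(3)[of q] w(3)[of q] by (intro sumnot primeideal.axioms(1)[OF Suc.prems(2)]) auto
        qed
        moreover have "y \<oplus> w \<notin> J" using y w by (intro sumnot J.ideal_axioms) auto
        moreover have "y \<oplus> w \<in> I" using y w by auto
        ultimately show ?thesis by blast
      qed
    qed
  qed
  then show thesis using that by blast
qed

section \<open>Noetherian local rings\<close>

locale noetherian_local_ring = cring R + noetherian_ring R for R :: "('a, 'r) ring_scheme" (structure) +
  fixes \<mm>
  assumes max: "maximalideal \<mm> R" and max_unique: "\<And>J. maximalideal J R \<Longrightarrow> J = \<mm>"
begin

sublocale m: maximalideal \<mm> R by (rule max)

lemma self_noetherian: "noetherian_module R (self_module R)"
proof (rule fin_gen_noetherian[OF noetherian_ring_axioms])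
  note S = self_module_module
  have "module_span R (self_module R) {\<one>} = carrier R"
  proof
    show "carrier R \<subseteq> module_span R (self_module R) {\<one>}"
    proof
      fix r assume r: "r \<in> carrier R"
      have "r \<odot>\<^bsub>self_module R\<^esub> \<one> \<in> module_span R (self_module R) {\<one>}"
        using r span_superset[of "{\<one>}" R "self_module R"]
        by (intro submodule_smult[OF span_submodule[OF S]]) auto
      then show "r \<in> module_span R (self_module R) {\<one>}" using r by simp
    qed
  qed (use span_sub_carrier[OF S, of "{\<one>}"] in auto)
  then show "fin_gen_module R (self_module R)"
    using S by (auto simp: fin_gen_module_def intro!: exI[of _ "{\<one>}"])
qed

lemma one_notin_m: "\<one> \<notin> \<mm>"
  using m.I_notcarr m.one_imp_carrier by blast

lemma proper_ideal_le_m: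
  assumes I: "ideal I R" and "I \<noteq> carrier R"
  shows "I \<subseteq> \<mm>"
proof -
  obtain J where J: "J \<in> {J. ideal J R \<and> I \<subseteq> J \<and> J \<noteq> carrier R}"
      and Jmax: "\<And>K. K \<in> {J. ideal J R \<and> I \<subseteq> J \<and> J \<noteq> carrier R} \<Longrightarrow> J \<subseteq> K \<Longrightarrow> K = J"
    by (rule noetherian_module_maximal[OF self_noetherian, of "{J. ideal J R \<and> I \<subseteq> J \<and> J \<noteq> carrier R}"])
      (use assms in \<open>auto simp: self_submodule_iff\<close>)
  have "maximalideal J R"
    using J Jmax by (intro maximalidealI) blast+
  then show ?thesis using J max_unique by blast
qed

lemma m_unit:
  assumes "a \<in> carrier R" "a \<notin> \<mm>"
  obtains b where "b \<in> carrier R" "b \<otimes> a = \<one>"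
proof -
  have "PIdl a = carrier R"
    using proper_ideal_le_m[OF cgenideal_ideal[OF assms(1)]] cgenideal_self[OF assms(1)] assms(2) by blast
  then have "\<one> \<in> PIdl a" by simp
  then show thesis using that by (auto simp: cgenideal_def)
qed

lemma ann_le_m:
  assumes M: "module R M" and K: "submodule K R M" and z: "z \<in> carrier M" "z \<notin> K"
  shows "annihilator R M K z \<subseteq> \<mm>"
proof (rule proper_ideal_le_m[OF module.annihilator_ideal[OF M K z(1)]])
  interpret M: module R M by fact
  show "annihilator R M K z \<noteq> carrier R"
    using z one_closed by (metis (no_types, lifting) M.smult_one annihilator_def mem_Collect_eq)
qed

text \<open>
  A submodule that is maximal among those below \<open>H\<close> has a simple quotient in \<open>H\<close>, that is, a copy of
  the residue field.
\<close>

lemma exists_residue_quotient: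
  assumes M: "noetherian_module R M" and K: "submodule K R M" and H: "submodule H R M"
    and KH: "K \<subseteq> H" "K \<noteq> H"
  obtains L where "submodule L R M" "K \<subseteq> L" "L \<subseteq> H" "L \<noteq> H"
    "\<And>a h. a \<in> \<mm> \<Longrightarrow> h \<in> H \<Longrightarrow> a \<odot>\<^bsub>M\<^esub> h \<in> L"
    "\<And>z h. z \<in> H \<Longrightarrow> z \<notin> L \<Longrightarrow> h \<in> H \<Longrightarrow> \<exists>r\<in>carrier R. \<exists>l\<in>L. h = l \<oplus>\<^bsub>M\<^esub> r \<odot>\<^bsub>M\<^esub> z"
proof -
  note Mm = noetherian_moduleD[OF M]
  interpret M: module R M by fact
  let ?F = "{L. submodule L R M \<and> K \<subseteq> L \<and> L \<subseteq> H \<and> L \<noteq> H}"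
  obtain L where L: "L \<in> ?F" and Lmax: "\<And>L'. L' \<in> ?F \<Longrightarrow> L \<subseteq> L' \<Longrightarrow> L' = L"
    by (rule noetherian_module_maximal[OF M, of ?F]) (use K KH in auto)
  have Ls: "submodule L R M" using L by simp
  have Hc: "H \<subseteq> carrier M" by (rule submodule_subset[OF H])
  have dec: "\<exists>r\<in>carrier R. \<exists>l\<in>L. h = l \<oplus>\<^bsub>M\<^esub> r \<odot>\<^bsub>M\<^esub> z" if z: "z \<in> H" "z \<notin> L" and h: "h \<in> H" for z h
  proof -
    let ?C = "(\<lambda>r. r \<odot>\<^bsub>M\<^esub> z) ` carrier R"
    have C: "submodule ?C R M" using z Hc by (intro M.cyclic_submodule) auto
    have zC: "z \<in> ?C" using z Hc by (force intro: image_eqI[of _ _ \<one>])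
    have "L <+>\<^bsub>M\<^esub> ?C = H"
    proof (rule ccontr)
      assume "L <+>\<^bsub>M\<^esub> ?C \<noteq> H"
      moreover have "L <+>\<^bsub>M\<^esub> ?C \<subseteq> H"
        using L z submodule_smult[OF H] by (intro M.sum_least[OF H]) auto
      ultimately have "L <+>\<^bsub>M\<^esub> ?C \<in> ?F"
        using L M.sum_submodule[OF Ls C] M.sum_superset(1)[OF Ls C] by blast
      then have "L <+>\<^bsub>M\<^esub> ?C = L" using Lmax M.sum_superset(1)[OF Ls C] by blast
      then show False using zC z M.sum_superset(2)[OF Ls C] by blast
    qed
    then have "h \<in> L <+>\<^bsub>M\<^esub> ?C" using h by simp
    then show ?thesis by (auto simp: set_add_iff)
  qed
  have mH: "a \<odot>\<^bsub>M\<^esub> h \<in> L" if a: "a \<in> \<mm>" and h: "h \<in> H" for a h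
  proof (rule ccontr)
    assume n: "a \<odot>\<^bsub>M\<^esub> h \<notin> L"
    have aR: "a \<in> carrier R" and hM: "h \<in> carrier M" using a h m.Icarr Hc by auto
    have "a \<odot>\<^bsub>M\<^esub> h \<in> H" using submodule_smult[OF H aR h] .
    then obtain r l where r: "r \<in> carrier R" "l \<in> L" "h = l \<oplus>\<^bsub>M\<^esub> r \<odot>\<^bsub>M\<^esub> (a \<odot>\<^bsub>M\<^esub> h)"
      using dec[OF _ n h] by blast
    have lM: "l \<in> carrier M" using submodule_subset[OF Ls] r by auto
    have "(\<one> \<ominus> r \<otimes> a) \<odot>\<^bsub>M\<^esub> h = l"
    proof -
      have "(\<one> \<ominus> r \<otimes> a) \<odot>\<^bsub>M\<^esub> h = h \<ominus>\<^bsub>M\<^esub> r \<odot>\<^bsub>M\<^esub> (a \<odot>\<^bsub>M\<^esub> h)"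
        using r aR hM by (simp add: a_minus_def M.smult_l_distr M.smult_l_minus M.smult_assoc1)
      also have "\<dots> = (l \<oplus>\<^bsub>M\<^esub> r \<odot>\<^bsub>M\<^esub> (a \<odot>\<^bsub>M\<^esub> h)) \<ominus>\<^bsub>M\<^esub> r \<odot>\<^bsub>M\<^esub> (a \<odot>\<^bsub>M\<^esub> h)" using r(3) by simp
      also have "\<dots> = l"
        using lM hM aR r(1) by (simp add: a_minus_def M.M.a_assoc M.M.r_neg)
      finally show ?thesis .
    qed
    moreover have "\<one> \<ominus> r \<otimes> a \<notin> \<mm>"
    proof
      assume "\<one> \<ominus> r \<otimes> a \<in> \<mm>"
      moreover have "r \<otimes> a \<in> \<mm>" using a r m.I_l_closed by blast
      ultimately have "(\<one> \<ominus> r \<otimes> a) \<oplus> r \<otimes> a \<in> \<mm>" by auto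
      then show False using one_notin_m r aR by (simp add: a_minus_def a_assoc l_neg)
    qed
    then obtain b where b: "b \<in> carrier R" "b \<otimes> (\<one> \<ominus> r \<otimes> a) = \<one>"
      using m_unit[of "\<one> \<ominus> r \<otimes> a"] r aR by auto
    ultimately have "h = b \<odot>\<^bsub>M\<^esub> l"
      using hM r aR M.smult_assoc1[of b "\<one> \<ominus> r \<otimes> a" h] by simp
    then have "h \<in> L" using submodule_smult[OF Ls] b r by simp
    then show False using n submodule_smult[OF Ls aR] by blast
  qed
  show thesis using that[of L] L dec mH by blast
qed

text \<open>
  Otherwise the sum of \<open>H\<close> and \<open>K\<close> has a submodule that contains \<open>K\<close> and has the residue field as
  quotient; it contains \<open>\<mm> H\<close>, hence \<open>H\<close>.
\<close>

lemma nakayama: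
  assumes M: "noetherian_module R M" and K: "submodule K R M" and H: "submodule H R M"
    and dec: "\<And>L. submodule L R M \<Longrightarrow> K \<subseteq> L \<Longrightarrow> (\<And>a h. a \<in> \<mm> \<Longrightarrow> h \<in> H \<Longrightarrow> a \<odot>\<^bsub>M\<^esub> h \<in> L) \<Longrightarrow> H \<subseteq> L"
  shows "H \<subseteq> K"
proof (rule ccontr)
  assume n: "\<not> H \<subseteq> K"
  note Mm = noetherian_moduleD[OF M]
  interpret M: module R M by fact
  note KH = M.sum_submodule[OF K H]
  note sup = M.sum_superset[OF K H]
  obtain L where L: "submodule L R M" "K \<subseteq> L" "L \<subseteq> K <+>\<^bsub>M\<^esub> H" "L \<noteq> K <+>\<^bsub>M\<^esub> H"
    "\<And>a h. a \<in> \<mm> \<Longrightarrow> h \<in> K <+>\<^bsub>M\<^esub> H \<Longrightarrow> a \<odot>\<^bsub>M\<^esub> h \<in> L"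
    by (rule exists_residue_quotient[OF M K KH]) (use sup n in auto)
  have "H \<subseteq> L" using L sup by (intro dec) auto
  then show False using M.sum_least[OF L(1,2)] L by blast
qed

text \<open>The zero divisors modulo \<open>K\<close> lie in finitely many primes, the maximal annihilators.\<close>

lemma zero_divisor_primes:
  assumes M: "noetherian_module R M" and K: "submodule K R M"
    and nosocle: "\<And>z. z \<in> carrier M \<Longrightarrow> (\<And>a. a \<in> \<mm> \<Longrightarrow> a \<odot>\<^bsub>M\<^esub> z \<in> K) \<Longrightarrow> z \<in> K"
  obtains P where "finite P" "\<And>p. p \<in> P \<Longrightarrow> primeideal p R" "\<And>p. p \<in> P \<Longrightarrow> \<not> \<mm> \<subseteq> p"
    "\<And>y. y \<in> carrier R \<Longrightarrow> (\<And>p. p \<in> P \<Longrightarrow> y \<notin> p) \<Longrightarrow> nonzerodivisor M K y"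
proof -
  note Mm = noetherian_moduleD[OF M]
  interpret M: module R M by fact
  let ?ann = "annihilator R M K"
  define Z where "Z = {z \<in> carrier M - K. \<forall>w\<in>carrier M - K. ?ann z \<subseteq> ?ann w \<longrightarrow> ?ann w = ?ann z}"
  have Zprime: "primeideal (?ann z) R" if z: "z \<in> Z" for z
  proof (rule primeidealI)
    have zM: "z \<in> carrier M" "z \<notin> K" using z by (auto simp: Z_def)
    show "ideal (?ann z) R" by (rule M.annihilator_ideal[OF K zM(1)])
    show "cring R" by (rule is_cring)
    show "carrier R \<noteq> ?ann z"
      using zM one_closed by (metis (no_types, lifting) M.smult_one annihilator_def mem_Collect_eq)
    fix a b assume ab: "a \<in> carrier R" "b \<in> carrier R" "a \<otimes> b \<in> ?ann z"
    show "a \<in> ?ann z \<or> b \<in> ?ann z"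
    proof (cases "b \<in> ?ann z")
      case False
      then have bz: "b \<odot>\<^bsub>M\<^esub> z \<in> carrier M - K" using ab zM by (auto simp: annihilator_def)
      have "?ann z \<subseteq> ?ann (b \<odot>\<^bsub>M\<^esub> z)"
      proof
        fix r assume r: "r \<in> ?ann z"
        then have "r \<odot>\<^bsub>M\<^esub> (b \<odot>\<^bsub>M\<^esub> z) = b \<odot>\<^bsub>M\<^esub> (r \<odot>\<^bsub>M\<^esub> z)"
          using ab zM by (simp add: annihilator_def M.smult_assoc1[symmetric] m_comm)
        then show "r \<in> ?ann (b \<odot>\<^bsub>M\<^esub> z)"
          using r ab submodule_smult[OF K] by (simp add: annihilator_def)
      qed
      then have "?ann (b \<odot>\<^bsub>M\<^esub> z) = ?ann z" using z bz unfolding Z_def by blast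
      moreover have "a \<in> ?ann (b \<odot>\<^bsub>M\<^esub> z)"
        using ab zM by (simp add: annihilator_def M.smult_assoc1)
      ultimately show ?thesis by simp
    qed simp
  qed
  have le_Z: "\<exists>w\<in>Z. ?ann z \<subseteq> ?ann w" if z: "z \<in> carrier M - K" for z
  proof -
    let ?F = "{?ann w | w. w \<in> carrier M - K \<and> ?ann z \<subseteq> ?ann w}"
    obtain J where J: "J \<in> ?F" and Jmax: "\<And>J'. J' \<in> ?F \<Longrightarrow> J \<subseteq> J' \<Longrightarrow> J' = J"
      by (rule noetherian_module_maximal[OF self_noetherian, of ?F])
        (use z in \<open>auto simp: self_submodule_iff M.annihilator_ideal[OF K]\<close>)
    obtain w where w: "w \<in> carrier M - K" "?ann z \<subseteq> ?ann w" "J = ?ann w" using J by auto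
    have "?ann v = ?ann w" if v: "v \<in> carrier M - K" "?ann w \<subseteq> ?ann v" for v
    proof -
      have "?ann v \<in> ?F" using v w(2) by blast
      then show ?thesis using Jmax v(2) w(3) by blast
    qed
    then have "w \<in> Z" using w(1) by (auto simp: Z_def)
    then show ?thesis using w(2) by blast
  qed
  have ZM: "Z \<subseteq> carrier M" by (auto simp: Z_def)
  let ?G = "{module_span R M T | T. finite T \<and> T \<subseteq> Z}"
  obtain H where H: "H \<in> ?G" and Hmax: "\<And>H'. H' \<in> ?G \<Longrightarrow> H \<subseteq> H' \<Longrightarrow> H' = H"
  proof (rule noetherian_module_maximal[OF M, of ?G])
    show "?G \<noteq> {}" by blast
    show "submodule H R M" if "H \<in> ?G" for H using that ZM by (auto intro!: span_submodule[OF Mm])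
  qed blast
  then obtain T where T: "finite T" "T \<subseteq> Z" "H = module_span R M T" by auto
  have ann_T: "?ann z \<in> ?ann ` T" if z: "z \<in> Z" for z
  proof -
    have "module_span R M (insert z T) \<in> ?G" using T z by blast
    then have "module_span R M (insert z T) = H" using Hmax span_mono[of T "insert z T" R M] T(3) by blast
    then have zT: "z \<in> module_span R M T" using T(3) span_superset[of "insert z T" R M] by blast
    have "\<exists>t\<in>T. ?ann t \<subseteq> ?ann z"
    proof (rule ccontr)
      assume "\<not> (\<exists>t\<in>T. ?ann t \<subseteq> ?ann z)"
      then have no: "\<not> ?ann t \<subseteq> ?ann z" if "t \<in> T" for t using that by simp
      obtain w where w: "w \<in> carrier R" "w \<notin> ?ann z" "\<And>J. J \<in> ?ann ` T \<Longrightarrow> w \<in> J"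
      proof (rule prime_avoids_intersection[OF Zprime[OF z], of "?ann ` T"])
        show "finite (?ann ` T)" using T by simp
        show "ideal J R" if "J \<in> ?ann ` T" for J using that T ZM M.annihilator_ideal[OF K] by auto
        show "\<not> J \<subseteq> ?ann z" if "J \<in> ?ann ` T" for J using that no by auto
      qed blast
      have "T \<subseteq> colon M K w"
      proof
        fix t assume t: "t \<in> T"
        then have "w \<in> ?ann t" by (intro w(3) imageI)
        then show "t \<in> colon M K w" using t T(2) ZM by (auto simp: colon_def annihilator_def)
      qed
      then have "z \<in> colon M K w" using span_least[OF M.colon_submodule[OF w(1) K]] zT by blast
      then show False using w(1,2) by (simp add: colon_def annihilator_def)
    qed
    then obtain t where "t \<in> T" "?ann t \<subseteq> ?ann z" by blast
    moreover have "t \<in> Z" "z \<in> carrier M - K" using \<open>t \<in> T\<close> T z by (auto simp: Z_def)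
    ultimately have "?ann z = ?ann t" by (simp add: Z_def)
    then show ?thesis using \<open>t \<in> T\<close> by simp
  qed
  show thesis
  proof (rule that[of "?ann ` T"])
    show "finite (?ann ` T)" using T by simp
    show "primeideal p R" if "p \<in> ?ann ` T" for p using that T Zprime by blast
    show "\<not> \<mm> \<subseteq> p" if "p \<in> ?ann ` T" for p
    proof
      assume mp: "\<mm> \<subseteq> p"
      obtain t where t: "t \<in> carrier M" "t \<notin> K" "p = ?ann t" using \<open>p \<in> ?ann ` T\<close> T by (auto simp: Z_def)
      have "t \<in> K" by (rule nosocle[OF t(1)]) (use mp t(3) in \<open>auto simp: annihilator_def\<close>)
      then show False using t by simp
    qed
    show "nonzerodivisor M K y" if y: "y \<in> carrier R" "\<And>p. p \<in> ?ann ` T \<Longrightarrow> y \<notin> p" for y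
      unfolding nonzerodivisor_def
    proof (intro ballI impI, rule ccontr)
      fix z assume z: "z \<in> carrier M" "y \<odot>\<^bsub>M\<^esub> z \<in> K" "z \<notin> K"
      then obtain w where w: "w \<in> Z" "?ann z \<subseteq> ?ann w" using le_Z by blast
      have "y \<in> ?ann z" using z y by (simp add: annihilator_def)
      then show False using y(2)[OF ann_T[OF w(1)]] w(2) by blast
    qed
  qed
qed

end

section \<open>Regular sequences and depth\<close>

abbreviation seq_submodule :: "('a, 'r) ring_scheme \<Rightarrow> ('a, 'b, 'm) module_scheme \<Rightarrow> 'a list \<Rightarrow> 'b set" where
  "seq_submodule R M xs \<equiv> ideal_times_module R (Idl\<^bsub>R\<^esub> (set xs)) M"

lemma ideal_times_genideal:
  assumes M: "module R M" and S: "S \<subseteq> carrier R"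
  shows "ideal_times_module R (Idl\<^bsub>R\<^esub> S) M = module_span R M {a \<odot>\<^bsub>M\<^esub> x | a x. a \<in> S \<and> x \<in> carrier M}"
    (is "_ = ?K")
proof
  interpret M: module R M by fact
  have "{a \<odot>\<^bsub>M\<^esub> x | a x. a \<in> S \<and> x \<in> carrier M} \<subseteq> carrier M" using S by auto
  then have K: "submodule ?K R M" by (rule span_submodule[OF M])
  have "ideal {a \<in> carrier R. \<forall>x\<in>carrier M. a \<odot>\<^bsub>M\<^esub> x \<in> ?K} R"
  proof (rule M.R.idealI')
    show "r \<otimes>\<^bsub>R\<^esub> a \<in> {a \<in> carrier R. \<forall>x\<in>carrier M. a \<odot>\<^bsub>M\<^esub> x \<in> ?K}"
      if "r \<in> carrier R" "a \<in> {a \<in> carrier R. \<forall>x\<in>carrier M. a \<odot>\<^bsub>M\<^esub> x \<in> ?K}" for r a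
      using that submodule_smult[OF K] by (simp add: M.smult_assoc1)
    show "a \<oplus>\<^bsub>R\<^esub> b \<in> {a \<in> carrier R. \<forall>x\<in>carrier M. a \<odot>\<^bsub>M\<^esub> x \<in> ?K}"
      if "a \<in> {a \<in> carrier R. \<forall>x\<in>carrier M. a \<odot>\<^bsub>M\<^esub> x \<in> ?K}"
        "b \<in> {a \<in> carrier R. \<forall>x\<in>carrier M. a \<odot>\<^bsub>M\<^esub> x \<in> ?K}" for a b
      using that submodule_add[OF K] by (simp add: M.smult_l_distr)
    show "\<zero>\<^bsub>R\<^esub> \<in> {a \<in> carrier R. \<forall>x\<in>carrier M. a \<odot>\<^bsub>M\<^esub> x \<in> ?K}"
      using submodule_zero[OF M K] by simp
  qed blast
  moreover have "S \<subseteq> {a \<in> carrier R. \<forall>x\<in>carrier M. a \<odot>\<^bsub>M\<^esub> x \<in> ?K}"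
    using S span_superset[of "{a \<odot>\<^bsub>M\<^esub> x | a x. a \<in> S \<and> x \<in> carrier M}" R M] by blast
  ultimately have "Idl\<^bsub>R\<^esub> S \<subseteq> {a \<in> carrier R. \<forall>x\<in>carrier M. a \<odot>\<^bsub>M\<^esub> x \<in> ?K}"
    by (rule M.R.genideal_minimal)
  then show "ideal_times_module R (Idl\<^bsub>R\<^esub> S) M \<subseteq> ?K"
    unfolding ideal_times_module_def by (intro span_least[OF K]) auto
  show "?K \<subseteq> ideal_times_module R (Idl\<^bsub>R\<^esub> S) M"
    unfolding ideal_times_module_def using M.R.genideal_self[OF S] by (intro span_mono) blast
qed

lemma seq_submodule_submodule:
  assumes M: "module R M" and "set xs \<subseteq> carrier R"
  shows "submodule (seq_submodule R M xs) R M"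
proof -
  interpret M: module R M by fact
  show ?thesis
    unfolding ideal_times_genideal[OF assms] using assms(2) by (intro span_submodule[OF M]) auto
qed

lemma seq_submodule_snoc:
  assumes M: "module R M" and xs: "set xs \<subseteq> carrier R" and x: "x \<in> carrier R"
  shows "seq_submodule R M (xs @ [x]) = seq_submodule R M xs <+>\<^bsub>M\<^esub> multiples M x"
proof -
  interpret M: module R M by fact
  let ?G = "\<lambda>S. {a \<odot>\<^bsub>M\<^esub> y | a y. a \<in> S \<and> y \<in> carrier M}"
  have G: "?G (set xs) \<subseteq> carrier M" "?G (set (xs @ [x])) \<subseteq> carrier M" using xs x by auto
  note sp = span_submodule[OF M G(1)] span_submodule[OF M G(2)]
  note sx = M.smult_image_submodule[OF x M.carrier_is_submodule]
  have "module_span R M (?G (set (xs @ [x]))) = module_span R M (?G (set xs)) <+>\<^bsub>M\<^esub> multiples M x"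
  proof
    have "?G (set (xs @ [x])) \<subseteq> ?G (set xs) \<union> multiples M x"
      by (auto simp: smult_image_def)
    then show "module_span R M (?G (set (xs @ [x]))) \<subseteq> module_span R M (?G (set xs)) <+>\<^bsub>M\<^esub> multiples M x"
      using M.sum_superset[OF sp(1) sx] span_superset[of "?G (set xs)" R M]
      by (intro span_least[OF M.sum_submodule[OF sp(1) sx]]) blast
    show "module_span R M (?G (set xs)) <+>\<^bsub>M\<^esub> multiples M x \<subseteq> module_span R M (?G (set (xs @ [x])))"
    proof (rule M.sum_least[OF sp(2)])
      show "module_span R M (?G (set xs)) \<subseteq> module_span R M (?G (set (xs @ [x])))"
        by (rule span_mono) auto
      have "multiples M x \<subseteq> ?G (set (xs @ [x]))" by (auto simp: smult_image_def)
      then show "multiples M x \<subseteq> module_span R M (?G (set (xs @ [x])))"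
        using span_superset by (rule order_trans)
    qed
  qed
  then show ?thesis using ideal_times_genideal[OF M] xs x by simp
qed

text \<open>
  \<open>socle_after M \<mm> n K\<close>: after dividing \<open>M/K\<close> by some regular sequence of length \<open>n\<close> the maximal
  ideal annihilates a nonzero element, that is, \<open>M/K\<close> has a maximal regular sequence of length \<open>n\<close>.
\<close>

primrec socle_after :: "('a, 'b, 'm) module_scheme \<Rightarrow> 'a set \<Rightarrow> nat \<Rightarrow> 'b set \<Rightarrow> bool" where
  "socle_after M \<mm> 0 K \<longleftrightarrow> (\<exists>z\<in>carrier M. z \<notin> K \<and> (\<forall>a\<in>\<mm>. a \<odot>\<^bsub>M\<^esub> z \<in> K))"
| "socle_after M \<mm> (Suc n) K \<longleftrightarrow>
     (\<exists>x\<in>\<mm>. nonzerodivisor M K x \<and> socle_after M \<mm> n (K <+>\<^bsub>M\<^esub> multiples M x))"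

context module
begin

lemma smult_image_sum_iff:
  "v \<in> K <+>\<^bsub>M\<^esub> multiples M x \<longleftrightarrow> (\<exists>k\<in>K. \<exists>w\<in>carrier M. v = k \<oplus>\<^bsub>M\<^esub> x \<odot>\<^bsub>M\<^esub> w)"
  by (auto simp: set_add_iff smult_image_def)

text \<open>
  If \<open>x a = k + z b\<close> with \<open>k \<in> K\<close>, then \<open>b = k' + x b'\<close> with \<open>k' \<in> K\<close>, because \<open>z\<close> is regular modulo
  \<open>K + x M\<close>; cancelling \<open>x\<close> puts \<open>a - z b'\<close> into \<open>K\<close>.
\<close>

lemma nonzerodivisor_swap:
  assumes K: "submodule K R M" and x: "x \<in> carrier R" "nonzerodivisor M K x"
    and z: "z \<in> carrier R" "nonzerodivisor M K z"
    and zx: "nonzerodivisor M (K <+>\<^bsub>M\<^esub> multiples M x) z"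
  shows "nonzerodivisor M (K <+>\<^bsub>M\<^esub> multiples M z) x"
  unfolding nonzerodivisor_def
proof (intro ballI impI)
  note Kc = submodule_subset[OF K]
  fix a assume a: "a \<in> carrier M" "x \<odot>\<^bsub>M\<^esub> a \<in> K <+>\<^bsub>M\<^esub> multiples M z"
  then obtain k b where b: "k \<in> K" "b \<in> carrier M" "x \<odot>\<^bsub>M\<^esub> a = k \<oplus>\<^bsub>M\<^esub> z \<odot>\<^bsub>M\<^esub> b"
    by (auto simp: smult_image_sum_iff)
  have kM: "k \<in> carrier M" using b Kc by auto
  have "z \<odot>\<^bsub>M\<^esub> b = \<ominus>\<^bsub>M\<^esub> k \<oplus>\<^bsub>M\<^esub> x \<odot>\<^bsub>M\<^esub> a"
    using b kM z by (simp add: M.r_neg1)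
  then have "z \<odot>\<^bsub>M\<^esub> b \<in> K <+>\<^bsub>M\<^esub> multiples M x"
    using a b submodule_uminus[OF module_axioms K] unfolding smult_image_sum_iff by blast
  then have "b \<in> K <+>\<^bsub>M\<^esub> multiples M x"
    using nonzerodivisorD[OF zx b(2)] by blast
  then obtain k' b' where b': "k' \<in> K" "b' \<in> carrier M" "b = k' \<oplus>\<^bsub>M\<^esub> x \<odot>\<^bsub>M\<^esub> b'"
    by (auto simp: smult_image_sum_iff)
  have k'M: "k' \<in> carrier M" using b' Kc by auto
  have xz: "z \<odot>\<^bsub>M\<^esub> (x \<odot>\<^bsub>M\<^esub> b') = x \<odot>\<^bsub>M\<^esub> (z \<odot>\<^bsub>M\<^esub> b')"
    using x z b' by (simp add: smult_assoc1[symmetric] m_comm)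
  have "x \<odot>\<^bsub>M\<^esub> (a \<ominus>\<^bsub>M\<^esub> z \<odot>\<^bsub>M\<^esub> b') = x \<odot>\<^bsub>M\<^esub> a \<ominus>\<^bsub>M\<^esub> x \<odot>\<^bsub>M\<^esub> (z \<odot>\<^bsub>M\<^esub> b')"
    using a b' x z by (simp add: a_minus_def smult_r_distr smult_r_minus)
  also have "\<dots> = (k \<oplus>\<^bsub>M\<^esub> z \<odot>\<^bsub>M\<^esub> k') \<oplus>\<^bsub>M\<^esub> x \<odot>\<^bsub>M\<^esub> (z \<odot>\<^bsub>M\<^esub> b') \<ominus>\<^bsub>M\<^esub> x \<odot>\<^bsub>M\<^esub> (z \<odot>\<^bsub>M\<^esub> b')"
    using b(3) b' kM k'M x z by (simp add: smult_r_distr xz M.a_assoc)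
  also have "\<dots> = k \<oplus>\<^bsub>M\<^esub> z \<odot>\<^bsub>M\<^esub> k'"
    using b b' kM k'M x z by (simp add: a_minus_def M.a_assoc M.r_neg)
  finally have "x \<odot>\<^bsub>M\<^esub> (a \<ominus>\<^bsub>M\<^esub> z \<odot>\<^bsub>M\<^esub> b') \<in> K"
    using submodule_add[OF K] submodule_smult[OF K] b b' z by simp
  then have "a \<ominus>\<^bsub>M\<^esub> z \<odot>\<^bsub>M\<^esub> b' \<in> K" using nonzerodivisorD[OF x(2)] a b' z by simp
  moreover have "a = (a \<ominus>\<^bsub>M\<^esub> z \<odot>\<^bsub>M\<^esub> b') \<oplus>\<^bsub>M\<^esub> z \<odot>\<^bsub>M\<^esub> b'"
    using a b' z by (simp add: a_minus_def M.a_assoc M.l_neg)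
  ultimately show "a \<in> K <+>\<^bsub>M\<^esub> multiples M z"
    using b' unfolding smult_image_sum_iff by blast
qed

text \<open>
  If \<open>z\<close> is a socle element modulo \<open>x\<close> and \<open>y z = x w\<close>, then \<open>w\<close> is a socle element modulo \<open>y\<close>.
\<close>

lemma socle_swap:
  assumes K: "submodule K R M" and m: "\<mm> \<subseteq> carrier R"
    and x: "x \<in> \<mm>" "nonzerodivisor M K x" and y: "y \<in> \<mm>" "nonzerodivisor M K y"
    and s: "socle_after M \<mm> 0 (K <+>\<^bsub>M\<^esub> multiples M x)"
  shows "socle_after M \<mm> 0 (K <+>\<^bsub>M\<^esub> multiples M y)"
proof -
  note Kc = submodule_subset[OF K]
  have xR: "x \<in> carrier R" and yR: "y \<in> carrier R" using x y m by auto
  obtain z where z: "z \<in> carrier M" "z \<notin> K <+>\<^bsub>M\<^esub> multiples M x"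
      "\<And>a. a \<in> \<mm> \<Longrightarrow> a \<odot>\<^bsub>M\<^esub> z \<in> K <+>\<^bsub>M\<^esub> multiples M x"
    using s by auto
  obtain k w where w: "k \<in> K" "w \<in> carrier M" "y \<odot>\<^bsub>M\<^esub> z = k \<oplus>\<^bsub>M\<^esub> x \<odot>\<^bsub>M\<^esub> w"
    using z(3)[OF y(1)] by (auto simp: smult_image_sum_iff)
  have kM: "k \<in> carrier M" using w Kc by auto
  have "w \<notin> K <+>\<^bsub>M\<^esub> multiples M y"
  proof
    assume "w \<in> K <+>\<^bsub>M\<^esub> multiples M y"
    then obtain k' w' where w': "k' \<in> K" "w' \<in> carrier M" "w = k' \<oplus>\<^bsub>M\<^esub> y \<odot>\<^bsub>M\<^esub> w'"
      by (auto simp: smult_image_sum_iff)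
    have k'M: "k' \<in> carrier M" using w' Kc by auto
    have xy: "x \<odot>\<^bsub>M\<^esub> (y \<odot>\<^bsub>M\<^esub> w') = y \<odot>\<^bsub>M\<^esub> (x \<odot>\<^bsub>M\<^esub> w')"
      using xR yR w' by (simp add: smult_assoc1[symmetric] m_comm)
    have "y \<odot>\<^bsub>M\<^esub> (z \<ominus>\<^bsub>M\<^esub> x \<odot>\<^bsub>M\<^esub> w') = y \<odot>\<^bsub>M\<^esub> z \<ominus>\<^bsub>M\<^esub> y \<odot>\<^bsub>M\<^esub> (x \<odot>\<^bsub>M\<^esub> w')"
      using z w' xR yR by (simp add: a_minus_def smult_r_distr smult_r_minus)
    also have "\<dots> = (k \<oplus>\<^bsub>M\<^esub> x \<odot>\<^bsub>M\<^esub> k') \<oplus>\<^bsub>M\<^esub> y \<odot>\<^bsub>M\<^esub> (x \<odot>\<^bsub>M\<^esub> w') \<ominus>\<^bsub>M\<^esub> y \<odot>\<^bsub>M\<^esub> (x \<odot>\<^bsub>M\<^esub> w')"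
      using w w' kM k'M xR yR by (simp add: smult_r_distr xy M.a_assoc)
    also have "\<dots> = k \<oplus>\<^bsub>M\<^esub> x \<odot>\<^bsub>M\<^esub> k'"
      using w w' kM k'M xR yR by (simp add: a_minus_def M.a_assoc M.r_neg)
    finally have "y \<odot>\<^bsub>M\<^esub> (z \<ominus>\<^bsub>M\<^esub> x \<odot>\<^bsub>M\<^esub> w') \<in> K"
      using submodule_add[OF K] submodule_smult[OF K] w w' xR by simp
    then have "z \<ominus>\<^bsub>M\<^esub> x \<odot>\<^bsub>M\<^esub> w' \<in> K" using nonzerodivisorD[OF y(2)] z w' xR by simp
    moreover have "z = (z \<ominus>\<^bsub>M\<^esub> x \<odot>\<^bsub>M\<^esub> w') \<oplus>\<^bsub>M\<^esub> x \<odot>\<^bsub>M\<^esub> w'"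
      using z w' xR by (simp add: a_minus_def M.a_assoc M.l_neg)
    ultimately show False using z(2) w' unfolding smult_image_sum_iff by blast
  qed
  moreover have "a \<odot>\<^bsub>M\<^esub> w \<in> K <+>\<^bsub>M\<^esub> multiples M y" if a: "a \<in> \<mm>" for a
  proof -
    have aR: "a \<in> carrier R" using a m by auto
    obtain l v where v: "l \<in> K" "v \<in> carrier M" "a \<odot>\<^bsub>M\<^esub> z = l \<oplus>\<^bsub>M\<^esub> x \<odot>\<^bsub>M\<^esub> v"
      using z(3)[OF a] by (auto simp: smult_image_sum_iff)
    have lM: "l \<in> carrier M" using v Kc by auto
    have e1: "a \<odot>\<^bsub>M\<^esub> (y \<odot>\<^bsub>M\<^esub> z) = a \<odot>\<^bsub>M\<^esub> k \<oplus>\<^bsub>M\<^esub> x \<odot>\<^bsub>M\<^esub> (a \<odot>\<^bsub>M\<^esub> w)"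
      using w kM aR xR by (simp add: smult_r_distr smult_assoc1[symmetric] m_comm)
    have e2: "a \<odot>\<^bsub>M\<^esub> (y \<odot>\<^bsub>M\<^esub> z) = y \<odot>\<^bsub>M\<^esub> l \<oplus>\<^bsub>M\<^esub> x \<odot>\<^bsub>M\<^esub> (y \<odot>\<^bsub>M\<^esub> v)"
    proof -
      have "a \<odot>\<^bsub>M\<^esub> (y \<odot>\<^bsub>M\<^esub> z) = y \<odot>\<^bsub>M\<^esub> (a \<odot>\<^bsub>M\<^esub> z)"
        using aR yR z(1) by (simp add: smult_assoc1[symmetric] m_comm)
      also have "\<dots> = y \<odot>\<^bsub>M\<^esub> l \<oplus>\<^bsub>M\<^esub> x \<odot>\<^bsub>M\<^esub> (y \<odot>\<^bsub>M\<^esub> v)"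
        using v lM yR xR by (simp add: smult_r_distr smult_assoc1[symmetric] m_comm)
      finally show ?thesis .
    qed
    have ak: "a \<odot>\<^bsub>M\<^esub> k \<in> K" "y \<odot>\<^bsub>M\<^esub> l \<in> K" using w v aR yR submodule_smult[OF K] by auto
    have "x \<odot>\<^bsub>M\<^esub> (a \<odot>\<^bsub>M\<^esub> w \<ominus>\<^bsub>M\<^esub> y \<odot>\<^bsub>M\<^esub> v) = x \<odot>\<^bsub>M\<^esub> (a \<odot>\<^bsub>M\<^esub> w) \<ominus>\<^bsub>M\<^esub> x \<odot>\<^bsub>M\<^esub> (y \<odot>\<^bsub>M\<^esub> v)"
      using w v aR xR yR by (simp add: a_minus_def smult_r_distr smult_r_minus)
    also have "\<dots> = y \<odot>\<^bsub>M\<^esub> l \<ominus>\<^bsub>M\<^esub> a \<odot>\<^bsub>M\<^esub> k"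
    proof -
      let ?p = "a \<odot>\<^bsub>M\<^esub> k" and ?q = "x \<odot>\<^bsub>M\<^esub> (a \<odot>\<^bsub>M\<^esub> w)" and ?r = "y \<odot>\<^bsub>M\<^esub> l" and ?s = "x \<odot>\<^bsub>M\<^esub> (y \<odot>\<^bsub>M\<^esub> v)"
      have c: "?p \<in> carrier M" "?q \<in> carrier M" "?r \<in> carrier M" "?s \<in> carrier M"
        using w v kM lM aR xR yR by auto
      have "?q = \<ominus>\<^bsub>M\<^esub> ?p \<oplus>\<^bsub>M\<^esub> (?r \<oplus>\<^bsub>M\<^esub> ?s)" using c e1 e2 by (metis M.r_neg1)
      then have "?q \<ominus>\<^bsub>M\<^esub> ?s = \<ominus>\<^bsub>M\<^esub> ?p \<oplus>\<^bsub>M\<^esub> ?r"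
        using c by (simp add: a_minus_def M.a_assoc M.r_neg)
      then show ?thesis using c M.a_comm[of "\<ominus>\<^bsub>M\<^esub> ?p" ?r] by (simp add: a_minus_def)
    qed
    finally have "x \<odot>\<^bsub>M\<^esub> (a \<odot>\<^bsub>M\<^esub> w \<ominus>\<^bsub>M\<^esub> y \<odot>\<^bsub>M\<^esub> v) \<in> K"
      using submodule_minus[OF module_axioms K ak(2,1)] by simp
    then have "a \<odot>\<^bsub>M\<^esub> w \<ominus>\<^bsub>M\<^esub> y \<odot>\<^bsub>M\<^esub> v \<in> K"
      using nonzerodivisorD[OF x(2)] w v aR yR by simp
    moreover have "a \<odot>\<^bsub>M\<^esub> w = (a \<odot>\<^bsub>M\<^esub> w \<ominus>\<^bsub>M\<^esub> y \<odot>\<^bsub>M\<^esub> v) \<oplus>\<^bsub>M\<^esub> y \<odot>\<^bsub>M\<^esub> v"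
      using w v aR yR by (simp add: a_minus_def M.a_assoc M.l_neg)
    ultimately show ?thesis using v unfolding smult_image_sum_iff by blast
  qed
  ultimately show ?thesis using w(2) by auto
qed

end

lemma nonzerodivisor_no_socle:
  assumes "x \<in> \<mm>" "nonzerodivisor M K x"
  shows "\<not> socle_after M \<mm> 0 K"
  using assms by (auto simp: nonzerodivisor_def)

context noetherian_local_ring
begin

lemma max_ideal_eq: "max_ideal R = \<mm>"
  unfolding max_ideal_def using max max_unique by (rule the_equality)

lemma m_sub: "\<mm> \<subseteq> carrier R"
  by (rule m.a_subset)

lemma zero_divisor_primes_family:
  assumes M: "noetherian_module R M" and "finite \<K>" "\<And>K. K \<in> \<K> \<Longrightarrow> submodule K R M"
    "\<And>K. K \<in> \<K> \<Longrightarrow> \<not> socle_after M \<mm> 0 K"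
  obtains P where "finite P" "\<forall>p\<in>P. primeideal p R \<and> \<not> \<mm> \<subseteq> p"
    "\<forall>K\<in>\<K>. \<forall>y\<in>carrier R. (\<forall>p\<in>P. y \<notin> p) \<longrightarrow> nonzerodivisor M K y"
proof -
  have "\<exists>P. finite P \<and> (\<forall>p\<in>P. primeideal p R \<and> \<not> \<mm> \<subseteq> p) \<and>
      (\<forall>y\<in>carrier R. (\<forall>p\<in>P. y \<notin> p) \<longrightarrow> nonzerodivisor M K y)" if K: "K \<in> \<K>" for K
  proof -
    obtain P where P: "finite P" "\<And>p. p \<in> P \<Longrightarrow> primeideal p R" "\<And>p. p \<in> P \<Longrightarrow> \<not> \<mm> \<subseteq> p"
      "\<And>y. y \<in> carrier R \<Longrightarrow> (\<And>p. p \<in> P \<Longrightarrow> y \<notin> p) \<Longrightarrow> nonzerodivisor M K y"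
    proof (rule zero_divisor_primes[OF M assms(3)[OF K]])
      fix z assume "z \<in> carrier M" "\<And>a. a \<in> \<mm> \<Longrightarrow> a \<odot>\<^bsub>M\<^esub> z \<in> K"
      then show "z \<in> K" using assms(4)[OF K] unfolding socle_after.simps by blast
    next
      fix P assume "finite P" "\<And>p. p \<in> P \<Longrightarrow> primeideal p R" "\<And>p. p \<in> P \<Longrightarrow> \<not> \<mm> \<subseteq> p"
        "\<And>y. y \<in> carrier R \<Longrightarrow> (\<And>p. p \<in> P \<Longrightarrow> y \<notin> p) \<Longrightarrow> nonzerodivisor M K y"
      then show thesis by (rule that)
    qed
    then show ?thesis by (intro exI[of _ P]) simp
  qed
  then obtain P where P: "\<forall>K\<in>\<K>. finite (P K) \<and> (\<forall>p\<in>P K. primeideal p R \<and> \<not> \<mm> \<subseteq> p) \<and>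
      (\<forall>y\<in>carrier R. (\<forall>p\<in>P K. y \<notin> p) \<longrightarrow> nonzerodivisor M K y)" by metis
  show thesis
  proof (rule that[of "\<Union>(P ` \<K>)"])
    show "finite (\<Union>(P ` \<K>))" using P assms(2) by simp
    show "\<forall>p\<in>\<Union>(P ` \<K>). primeideal p R \<and> \<not> \<mm> \<subseteq> p" using P by simp
    show "\<forall>K\<in>\<K>. \<forall>y\<in>carrier R. (\<forall>p\<in>\<Union>(P ` \<K>). y \<notin> p) \<longrightarrow> nonzerodivisor M K y"
      using P by (simp add: ball_UN)
  qed
qed

text \<open>
  By prime avoidance, an element of \<open>\<mm>\<close> outside \<open>J\<close> and outside the finitely many primes that
  contain the zero divisors of the given quotients; none of these primes is \<open>\<mm>\<close>.
\<close>

lemma common_nonzerodivisor: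
  assumes M: "noetherian_module R M" "finite \<K>" "\<And>K. K \<in> \<K> \<Longrightarrow> submodule K R M"
      "\<And>K. K \<in> \<K> \<Longrightarrow> \<not> socle_after M \<mm> 0 K"
    and A: "noetherian_module R A" "finite \<L>" "\<And>L. L \<in> \<L> \<Longrightarrow> submodule L R A"
      "\<And>L. L \<in> \<L> \<Longrightarrow> \<not> socle_after A \<mm> 0 L"
    and J: "ideal J R" "\<not> \<mm> \<subseteq> J"
  obtains y where "y \<in> \<mm>" "y \<notin> J" "\<And>K. K \<in> \<K> \<Longrightarrow> nonzerodivisor M K y"
    "\<And>L. L \<in> \<L> \<Longrightarrow> nonzerodivisor A L y"
proof -
  obtain P where P: "finite P" "\<forall>p\<in>P. primeideal p R \<and> \<not> \<mm> \<subseteq> p"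
    "\<forall>K\<in>\<K>. \<forall>y\<in>carrier R. (\<forall>p\<in>P. y \<notin> p) \<longrightarrow> nonzerodivisor M K y"
    by (rule zero_divisor_primes_family[OF M])
  obtain Q where Q: "finite Q" "\<forall>p\<in>Q. primeideal p R \<and> \<not> \<mm> \<subseteq> p"
    "\<forall>K\<in>\<L>. \<forall>y\<in>carrier R. (\<forall>p\<in>Q. y \<notin> p) \<longrightarrow> nonzerodivisor A K y"
    by (rule zero_divisor_primes_family[OF A])
  obtain y where y: "y \<in> \<mm>" "y \<notin> J" "\<And>p. p \<in> P \<union> Q \<Longrightarrow> y \<notin> p"
  proof (rule prime_avoidance[of "P \<union> Q" \<mm> J])
    show "primeideal p R" if "p \<in> P \<union> Q" for p using that P(2) Q(2) by blast
    show "\<not> \<mm> \<subseteq> p" if "p \<in> P \<union> Q" for p using that P(2) Q(2) by blast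
    fix y assume "y \<in> \<mm>" "y \<notin> J" "\<And>p. p \<in> P \<union> Q \<Longrightarrow> y \<notin> p"
    then show thesis by (rule that)
  qed (use P(1) Q(1) J m.ideal_axioms in \<open>simp_all\<close>)
  have yR: "y \<in> carrier R" using y(1) m_sub by auto
  show thesis
  proof (rule that[OF y(1,2)])
    show "nonzerodivisor M K y" if "K \<in> \<K>" for K using P(3) that yR y(3) by blast
    show "nonzerodivisor A L y" if "L \<in> \<L>" for L using Q(3) that yR y(3) by blast
  qed
qed

lemma no_socle_m_nonzero:
  assumes "module R M" "submodule K R M" "K \<noteq> carrier M" "\<not> socle_after M \<mm> 0 K"
  shows "\<not> \<mm> \<subseteq> {\<zero>}"
proof
  interpret M: module R M by fact
  assume "\<mm> \<subseteq> {\<zero>}"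
  then have "a \<odot>\<^bsub>M\<^esub> z \<in> K" if "a \<in> \<mm>" "z \<in> carrier M" for a z
    using that submodule_zero[OF assms(1,2)] by auto
  then show False using assms(3,4) submodule_subset[OF assms(2)] by auto
qed

text \<open>
  Exchange: the first element of a maximal regular sequence may be replaced by any regular element.
  A third element that is regular modulo both is moved to the front to compare them.
\<close>

lemma socle_after_exchange:
  assumes M: "noetherian_module R M"
  shows "submodule K R M \<Longrightarrow> y \<in> \<mm> \<Longrightarrow> nonzerodivisor M K y \<Longrightarrow> socle_after M \<mm> (Suc n) K \<Longrightarrow>
    socle_after M \<mm> n (K <+>\<^bsub>M\<^esub> multiples M y)"
proof (induction n arbitrary: K y)
  case 0
  have "module R M" using M by (simp add: noetherian_module_def)
  then interpret M: module R M .
  obtain x where "x \<in> \<mm>" "nonzerodivisor M K x"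
      "socle_after M \<mm> 0 (K <+>\<^bsub>M\<^esub> multiples M x)"
    using 0 by auto
  then show ?case using M.socle_swap[OF 0(1) m_sub _ _ 0(2,3)] by blast
next
  case (Suc n)
  note Mm = noetherian_moduleD[OF M]
  interpret M: module R M by fact
  let ?q = "\<lambda>K x. K <+>\<^bsub>M\<^esub> multiples M x"
  note K = Suc.prems(1) and y = Suc.prems(2,3)
  obtain x where x: "x \<in> \<mm>" "nonzerodivisor M K x" "socle_after M \<mm> (Suc n) (?q K x)"
    using Suc.prems(4) by auto
  have R: "x \<in> carrier R" "y \<in> carrier R" using x y m_sub by auto
  note im = M.smult_image_submodule[OF _ M.carrier_is_submodule]
  have q: "submodule (?q L a) R M" if "submodule L R M" "a \<in> carrier R" for L a
    using that by (intro M.sum_submodule im)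
  have ns: "\<not> socle_after M \<mm> 0 K" by (rule nonzerodivisor_no_socle[OF y])
  have nsx: "\<not> socle_after M \<mm> 0 (?q K x)"
  proof -
    obtain v where "v \<in> \<mm>" "nonzerodivisor M (?q K x) v" using x(3) by (auto simp del: socle_after.simps(1))
    then show ?thesis by (rule nonzerodivisor_no_socle)
  qed
  have nsy: "\<not> socle_after M \<mm> 0 (?q K y)"
    using M.socle_swap[OF K m_sub y x(1,2)] nsx by blast
  have Kne: "K \<noteq> carrier M"
  proof
    assume KM: "K = carrier M"
    have "carrier M \<subseteq> ?q K a" if "a \<in> carrier R" for a
      using M.sum_superset(1)[OF K im[OF that]] KM by simp
    then have full: "?q K a = carrier M" if "a \<in> carrier R" for a
      using submodule_subset[OF q[OF K that]] that by blast
    have "\<not> socle_after M \<mm> j (carrier M)" for j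
    proof (induction j)
      case 0
      show ?case by simp
    next
      case (Suc j)
      show ?case
      proof
        assume "socle_after M \<mm> (Suc j) (carrier M)"
        then obtain a where a: "a \<in> \<mm>" "socle_after M \<mm> j (?q (carrier M) a)" by auto
        have "?q (carrier M) a = carrier M" using full[of a] a(1) m_sub KM by blast
        then show False using a(2) Suc.IH by simp
      qed
    qed
    then have "\<not> socle_after M \<mm> (Suc n) (?q K x)"
      using full[OF R(1)] by (simp del: socle_after.simps)
    then show False using x(3) by (rule notE)
  qed
  obtain z where z: "z \<in> \<mm>" "\<And>L. L \<in> {K, ?q K x, ?q K y} \<Longrightarrow> nonzerodivisor M L z"
  proof (rule common_nonzerodivisor[OF M, of "{K, ?q K x, ?q K y}" "self_module R" "{}" "{\<zero>}"])
    show "\<not> \<mm> \<subseteq> {\<zero>}" by (rule no_socle_m_nonzero[OF Mm K Kne ns])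
    show "submodule L R M" if "L \<in> {K, ?q K x, ?q K y}" for L using that K q R by auto
    show "\<not> socle_after M \<mm> 0 L" if "L \<in> {K, ?q K x, ?q K y}" for L using that ns nsx nsy by blast
    show "ideal {\<zero>} R" by (rule zeroideal)
    show "noetherian_module R (self_module R)" by (rule self_noetherian)
    show "submodule L R (self_module R)" if "L \<in> {}" for L using that by simp
    show "\<not> socle_after (self_module R) \<mm> 0 L" if "L \<in> {}" for L using that by simp
    fix z assume "z \<in> \<mm>" "\<And>L. L \<in> {K, ?q K x, ?q K y} \<Longrightarrow> nonzerodivisor M L z"
    then show thesis by (rule that)
  next
    show "finite {K, ?q K x, ?q K y}" by simp
    show "finite {}" by simp
  qed
  have zR: "z \<in> carrier R" using z(1) m_sub by auto
  have z': "nonzerodivisor M K z" "nonzerodivisor M (?q K x) z" "nonzerodivisor M (?q K y) z" using z(2) by auto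
  have "socle_after M \<mm> n (?q (?q K x) z)"
    by (rule Suc.IH[OF q[OF K R(1)] z(1) z'(2) x(3)])
  moreover have "?q (?q K x) z = ?q (?q K z) x"
    by (rule M.sum_right_comm[OF K im[OF R(1)] im[OF zR]])
  moreover have "nonzerodivisor M (?q K z) x"
    by (rule M.nonzerodivisor_swap[OF K R(1) x(2) zR z'(1,2)])
  ultimately have "socle_after M \<mm> (Suc n) (?q K z)" using x(1) by auto
  moreover have "nonzerodivisor M (?q K z) y"
    by (rule M.nonzerodivisor_swap[OF K R(2) y(2) zR z'(1,3)])
  ultimately have "socle_after M \<mm> n (?q (?q K z) y)"
    by (intro Suc.IH q K zR y(1))
  moreover have "?q (?q K z) y = ?q (?q K y) z"
    by (rule M.sum_right_comm[OF K im[OF zR] im[OF R(2)]])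
  ultimately show ?case using z(1) z'(3) by auto
qed

lemma regular_seq_iff:
  assumes M: "module R M"
  shows "regular_seq R M xs \<longleftrightarrow> set xs \<subseteq> \<mm> \<and>
    (\<forall>i<length xs. nonzerodivisor M (seq_submodule R M (take i xs)) (xs ! i)) \<and>
    seq_submodule R M xs \<noteq> carrier M"
proof (cases "set xs \<subseteq> \<mm>")
  case True
  then have xsR: "set xs \<subseteq> carrier R" using m_sub by blast
  interpret M: module R M by fact
  have "(\<forall>q\<in>carrier (quot_by_seq R M (take i xs)).
           xs ! i \<odot>\<^bsub>quot_by_seq R M (take i xs)\<^esub> q = \<zero>\<^bsub>quot_by_seq R M (take i xs)\<^esub> \<longrightarrow>
           q = \<zero>\<^bsub>quot_by_seq R M (take i xs)\<^esub>)
        \<longleftrightarrow> nonzerodivisor M (seq_submodule R M (take i xs)) (xs ! i)" if i: "i < length xs" for i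
  proof -
    have sR: "set (take i xs) \<subseteq> carrier R" and xiR: "xs ! i \<in> carrier R"
      using xsR i set_take_subset[of i xs] by auto
    note H = seq_submodule_submodule[OF M sR]
    show ?thesis
      unfolding quot_by_seq_def quot_carrier[OF M H] nonzerodivisor_def
      using xiR by (simp add: proj_quot_smult[OF M H xiR] proj_quot_eq_zero_iff[OF M H])
  qed
  then show ?thesis
    unfolding regular_seq_def Let_def max_ideal_eq
    using M.quot_trivial_iff[OF seq_submodule_submodule[OF M xsR]]
    by (simp add: quot_by_seq_def[of R M xs])
qed (simp add: regular_seq_def max_ideal_eq)

declare socle_after.simps [simp del]

lemma regular_seq_snoc:
  assumes M: "module R M" and xs: "regular_seq R M xs" and x: "x \<in> \<mm>"
    "nonzerodivisor M (seq_submodule R M xs) x" "seq_submodule R M (xs @ [x]) \<noteq> carrier M"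
  shows "regular_seq R M (xs @ [x])"
  unfolding regular_seq_iff[OF M]
proof (intro conjI allI impI)
  show "set (xs @ [x]) \<subseteq> \<mm>" using xs x by (simp add: regular_seq_iff[OF M])
  show "nonzerodivisor M (seq_submodule R M (take i (xs @ [x]))) ((xs @ [x]) ! i)"
    if "i < length (xs @ [x])" for i
  proof (cases "i < length xs")
    case True
    then show ?thesis using xs by (simp add: regular_seq_iff[OF M] nth_append)
  next
    case False
    then have "i = length xs" using that by simp
    then show ?thesis using x(2) by simp
  qed
  show "seq_submodule R M (xs @ [x]) \<noteq> carrier M" by (rule x(3))
qed

lemma nonzerodivisor_chain_tl:
  assumes "\<forall>i<length (y # ys). nonzerodivisor M (seq_submodule R M (ps @ take i (y # ys))) ((y # ys) ! i)"
  shows "nonzerodivisor M (seq_submodule R M ps) y"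
    and "\<forall>i<length ys. nonzerodivisor M (seq_submodule R M ((ps @ [y]) @ take i ys)) (ys ! i)"
  using assms[THEN spec, of 0] assms[THEN spec, of "Suc _"] by simp_all

text \<open>
  Exchanging the given regular elements one by one for the first elements of a maximal sequence uses
  up its length; a regular element and a socle element exclude each other.
\<close>

lemma socle_after_bound:
  assumes M: "noetherian_module R M"
  shows "set ps \<subseteq> carrier R \<Longrightarrow> set ys \<subseteq> \<mm> \<Longrightarrow>
    \<forall>i<length ys. nonzerodivisor M (seq_submodule R M (ps @ take i ys)) (ys ! i) \<Longrightarrow>
    socle_after M \<mm> n (seq_submodule R M ps) \<Longrightarrow> length ys \<le> n"
proof (induction ys arbitrary: ps n)
  case Nil
  show ?case by simp
next
  case (Cons y ys)
  note Mm = noetherian_moduleD[OF M]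
  have y: "y \<in> \<mm>" "y \<in> carrier R" using Cons.prems(2) m_sub by auto
  note reg = nonzerodivisor_chain_tl[OF Cons.prems(3)]
  show ?case
  proof (cases n)
    case 0
    then show ?thesis using Cons.prems(4) nonzerodivisor_no_socle[OF y(1) reg(1)] by blast
  next
    case k: (Suc k)
    have "socle_after M \<mm> k (seq_submodule R M (ps @ [y]))"
      using socle_after_exchange[OF M seq_submodule_submodule[OF Mm Cons.prems(1)] y(1) reg(1)] Cons.prems(4)
      unfolding k seq_submodule_snoc[OF Mm Cons.prems(1) y(2)] by blast
    moreover have "set (ps @ [y]) \<subseteq> carrier R" "set ys \<subseteq> \<mm>" using Cons.prems y by auto
    ultimately have "length ys \<le> k" using reg(2) by (intro Cons.IH[of "ps @ [y]"])
    then show ?thesis using k by simp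
  qed
qed

lemma socle_after_of_regular:
  assumes M: "module R M"
  shows "set ps \<subseteq> carrier R \<Longrightarrow> set xs \<subseteq> \<mm> \<Longrightarrow>
    \<forall>i<length xs. nonzerodivisor M (seq_submodule R M (ps @ take i xs)) (xs ! i) \<Longrightarrow>
    socle_after M \<mm> 0 (seq_submodule R M (ps @ xs)) \<Longrightarrow>
    socle_after M \<mm> (length xs) (seq_submodule R M ps)"
proof (induction xs arbitrary: ps)
  case Nil
  then show ?case by (simp only: append_Nil2 list.size(3))
next
  case (Cons x xs)
  have x: "x \<in> \<mm>" "x \<in> carrier R" using Cons.prems(2) m_sub by auto
  note reg = nonzerodivisor_chain_tl[OF Cons.prems(3)]
  have "set (ps @ [x]) \<subseteq> carrier R" "set xs \<subseteq> \<mm>" using Cons.prems x by auto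
  moreover have "socle_after M \<mm> 0 (seq_submodule R M ((ps @ [x]) @ xs))" using Cons.prems(4) by simp
  ultimately have "socle_after M \<mm> (length xs) (seq_submodule R M (ps @ [x]))"
    using reg(2) by (intro Cons.IH)
  then show ?case
    using x(1) reg(1) seq_submodule_snoc[OF M Cons.prems(1) x(2)] by (auto simp: socle_after.simps(2))
qed

text \<open>
  All maximal regular sequences have the same length, so a socle element certifies the depth.
\<close>

theorem regular_seq_length_le_maximal:
  assumes M: "noetherian_module R M" and xs: "regular_seq R M xs"
    and s: "socle_after M \<mm> 0 (seq_submodule R M xs)" and ys: "regular_seq R M ys"
  shows "length ys \<le> length xs"
proof -
  note Mm = noetherian_moduleD[OF M]
  have "socle_after M \<mm> (length xs) (seq_submodule R M [])"
    using xs s by (intro socle_after_of_regular[OF Mm]) (simp_all add: regular_seq_iff[OF Mm])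
  then show ?thesis
    using ys by (intro socle_after_bound[OF M, of "[]"]) (simp_all add: regular_seq_iff[OF Mm])
qed

lemma seq_submodule_proper:
  assumes M: "noetherian_module R M" "\<not> trivial_module M" and xs: "set xs \<subseteq> \<mm>"
  shows "seq_submodule R M xs \<noteq> carrier M"
proof
  assume eq: "seq_submodule R M xs = carrier M"
  note Mm = noetherian_moduleD[OF M(1)]
  interpret M: module R M by fact
  have xsR: "set xs \<subseteq> carrier R" using xs m_sub by auto
  have "carrier M \<subseteq> {\<zero>\<^bsub>M\<^esub>}"
  proof (rule nakayama[OF M(1) zero_submodule[OF Mm] M.carrier_is_submodule])
    fix L assume L: "submodule L R M" "\<And>a h. a \<in> \<mm> \<Longrightarrow> h \<in> carrier M \<Longrightarrow> a \<odot>\<^bsub>M\<^esub> h \<in> L"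
    have "seq_submodule R M xs \<subseteq> L"
      unfolding ideal_times_genideal[OF Mm xsR]
      by (rule span_least[OF L(1)]) (use L(2) xs in blast)
    then show "carrier M \<subseteq> L" using eq by simp
  qed
  then show False using M(2) M.zero_closed by (auto simp: trivial_module_def)
qed

text \<open>
  The sequence is built to be regular on both \<open>R\<close> and \<open>M\<close>; it must stop at or before length
  \<open>depth M\<close>, and it cannot stop because of \<open>R\<close>, whose maximal regular sequences are longer.
\<close>

theorem exists_regular_seq_to_socle:
  assumes M: "noetherian_module R M" and d: "depth R M < depth R (self_module R)"
  obtains xs where "regular_seq R (self_module R) xs" "enat (length xs) \<le> depth R M"
    "socle_after M \<mm> 0 (seq_submodule R M xs)"
    "\<not> socle_after (self_module R) \<mm> 0 (seq_submodule R (self_module R) xs)"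
proof -
  let ?A = "self_module R"
  note Mm = noetherian_moduleD[OF M]
  have Am: "module R ?A" by (rule self_module_module)
  have Mnt: "\<not> trivial_module M" using d by (auto simp: depth_def)
  have "\<zero> \<noteq> \<one>" using one_notin_m m.zero_closed by metis
  then have Ant: "\<not> trivial_module ?A"
    using one_closed unfolding trivial_module_def self_module_simps by (metis singletonD)
  have upper: "enat (length xs) \<le> depth R M" if "regular_seq R M xs" for xs
    unfolding depth_def using Mnt that by (auto intro: Sup_upper)
  obtain t where t: "depth R M = enat t" using d by (cases "depth R M") auto
  obtain ys where ys: "regular_seq R ?A ys" "t < length ys"
    using d Ant unfolding t by (auto simp: depth_def less_Sup_iff)
  have longR: "\<not> socle_after ?A \<mm> 0 (seq_submodule R ?A xs)"
    if "regular_seq R ?A xs" "length xs \<le> t" for xs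
    using regular_seq_length_le_maximal[OF self_noetherian that(1) _ ys(1)] ys(2) that(2) by force
  have "\<exists>xs. regular_seq R ?A xs \<and> length xs \<le> t \<and> socle_after M \<mm> 0 (seq_submodule R M xs)"
  proof (rule ccontr)
    assume no: "\<not> ?thesis"
    have "i \<le> Suc t \<Longrightarrow> \<exists>xs. length xs = i \<and> regular_seq R M xs \<and> regular_seq R ?A xs" for i
    proof (induction i)
      case 0
      have "regular_seq R M []" "regular_seq R ?A []"
        using seq_submodule_proper[OF M Mnt, of "[]"] seq_submodule_proper[OF self_noetherian Ant, of "[]"]
        by (auto simp: regular_seq_iff Mm Am)
      then show ?case by blast
    next
      case (Suc i)
      then obtain xs where xs: "length xs = i" "regular_seq R M xs" "regular_seq R ?A xs" by auto
      have "set xs \<subseteq> \<mm>" using xs(2) by (simp add: regular_seq_iff[OF Mm])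
      then have xsR: "set xs \<subseteq> carrier R" using m_sub by blast
      note s = seq_submodule_submodule[OF Mm xsR] seq_submodule_submodule[OF Am xsR]
      have nA: "\<not> socle_after ?A \<mm> 0 (seq_submodule R ?A xs)" using longR xs Suc by simp
      have nM: "\<not> socle_after M \<mm> 0 (seq_submodule R M xs)" using no xs Suc by auto
      have nz: "\<not> \<mm> \<subseteq> {\<zero>}"
        using no_socle_m_nonzero[OF Mm s(1) _ nM] xs(2) by (simp add: regular_seq_iff[OF Mm])
      obtain y where y: "y \<in> \<mm>" "nonzerodivisor M (seq_submodule R M xs) y"
          "nonzerodivisor ?A (seq_submodule R ?A xs) y"
      proof (rule common_nonzerodivisor[OF M(1), of "{seq_submodule R M xs}" ?A "{seq_submodule R ?A xs}" "{\<zero>}"])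
        fix y assume "y \<in> \<mm>" "\<And>K. K \<in> {seq_submodule R M xs} \<Longrightarrow> nonzerodivisor M K y"
          "\<And>K. K \<in> {seq_submodule R ?A xs} \<Longrightarrow> nonzerodivisor ?A K y"
        then show thesis by (intro that) simp_all
      qed (use s nA nM nz self_noetherian zeroideal in \<open>simp_all\<close>)
      have "set (xs @ [y]) \<subseteq> \<mm>" using xs y by (auto simp: regular_seq_iff[OF Mm])
      note proper = seq_submodule_proper[OF M Mnt this] seq_submodule_proper[OF self_noetherian Ant this]
      have "regular_seq R M (xs @ [y])" "regular_seq R ?A (xs @ [y])"
        using regular_seq_snoc[OF Mm xs(2) y(1,2) proper(1)] regular_seq_snoc[OF Am xs(3) y(1,3) proper(2)]
        by simp_all
      then show ?case using xs(1) by (intro exI[of _ "xs @ [y]"]) auto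
    qed
    then obtain xs where "length xs = Suc t" "regular_seq R M xs" by blast
    then show False using upper[of xs] t by simp
  qed
  then obtain xs where "regular_seq R ?A xs" "length xs \<le> t" "socle_after M \<mm> 0 (seq_submodule R M xs)"
    by blast
  then show thesis using that[of xs] longR[of xs] t by simp
qed

end

section \<open>Minimal free resolutions\<close>

abbreviation free_rank :: "('a, 'r) ring_scheme \<Rightarrow> nat \<Rightarrow> ('a, nat \<Rightarrow> 'a) module" where
  "free_rank R n \<equiv> free_module R {..<n}"

definition free_resolution ::
    "('a, 'r) ring_scheme \<Rightarrow> ('a, 'b, 'm) module_scheme \<Rightarrow> (nat \<Rightarrow> nat) \<Rightarrow>
     (nat \<Rightarrow> (nat \<Rightarrow> 'a) \<Rightarrow> (nat \<Rightarrow> 'a)) \<Rightarrow> ((nat \<Rightarrow> 'a) \<Rightarrow> 'b) \<Rightarrow> bool"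
  where
  "free_resolution R X r d e \<longleftrightarrow>
     e \<in> module_hom R (free_rank R (r 0)) X \<and> e ` carrier (free_rank R (r 0)) = carrier X \<and>
     (\<forall>n. d n \<in> module_hom R (free_rank R (r (Suc n))) (free_rank R (r n))) \<and>
     d 0 ` carrier (free_rank R (r (Suc 0))) = hom_kernel (free_rank R (r 0)) X e \<and>
     (\<forall>n. d (Suc n) ` carrier (free_rank R (r (Suc (Suc n)))) =
       hom_kernel (free_rank R (r (Suc n))) (free_rank R (r n)) (d n))"

lemma (in cring) free_lift_image:
  assumes A: "module R A" and x: "\<And>s. s \<in> S \<Longrightarrow> x s \<in> carrier A"
  shows "free_lift R A x ` carrier (free_module R S) = module_span R A (x ` S)"
proof
  let ?F = "free_module R S" and ?\<phi> = "free_lift R A x"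
  note F = free_module_module[of S]
  have \<phi>: "?\<phi> \<in> module_hom R ?F A" by (rule free_lift_hom[OF A x])
  have xS: "x ` S \<subseteq> carrier A" using x by auto
  note sp = span_submodule[OF A xS]
  have gen: "?\<phi> (free_gen R s) = x s" if "s \<in> S" for s by (rule free_lift_gen[OF A x that])
  show "module_span R A (x ` S) \<subseteq> ?\<phi> ` carrier ?F"
  proof (rule span_least)
    show "submodule (?\<phi> ` carrier ?F) R A"
      using hom_image_submodule[OF F A \<phi> module.carrier_is_submodule[OF F]] .
    show "x ` S \<subseteq> ?\<phi> ` carrier ?F"
    proof
      fix y assume "y \<in> x ` S"
      then obtain s where s: "s \<in> S" "y = x s" by blast
      then show "y \<in> ?\<phi> ` carrier ?F" using gen[OF s(1)] free_gen_closed[OF s(1)] by (intro image_eqI) simp_all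
    qed
  qed
  have "free_gen R ` S \<subseteq> {c \<in> carrier ?F. ?\<phi> c \<in> module_span R A (x ` S)}"
  proof
    fix c assume "c \<in> free_gen R ` S"
    then obtain s where s: "s \<in> S" "c = free_gen R s" by blast
    then have "?\<phi> c \<in> x ` S" using gen[OF s(1)] by simp
    then have "?\<phi> c \<in> module_span R A (x ` S)" using span_superset[of "x ` S" R A] by (rule rev_subsetD)
    then show "c \<in> {c \<in> carrier ?F. ?\<phi> c \<in> module_span R A (x ` S)}"
      using free_gen_closed[OF s(1)] s(2) by simp
  qed
  then have "module_span R ?F (free_gen R ` S) \<subseteq> {c \<in> carrier ?F. ?\<phi> c \<in> module_span R A (x ` S)}"
    by (rule span_least[OF hom_preimage_submodule[OF F A \<phi> sp]])
  then have "carrier ?F \<subseteq> {c \<in> carrier ?F. ?\<phi> c \<in> module_span R A (x ` S)}"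
    unfolding free_gen_span .
  then show "?\<phi> ` carrier ?F \<subseteq> module_span R A (x ` S)" by blast
qed

context noetherian_local_ring
begin

lemma free_rank_noetherian: "noetherian_module R (free_rank R n)"
proof (rule fin_gen_noetherian[OF noetherian_ring_axioms])
  show "fin_gen_module R (free_rank R n)"
    unfolding fin_gen_module_def
  proof (intro conjI exI[of _ "free_gen R ` {..<n}"])
    show "free_gen R ` {..<n} \<subseteq> carrier (free_rank R n)"
      using free_gen_closed[of _ "{..<n}"] by blast
  qed (auto simp: free_module_module free_gen_span)
qed

text \<open>
  A generating set of least cardinality admits no relation with a unit coefficient, since such a
  relation would express one generator by the others.
\<close>

lemma minimal_cover:
  assumes X: "noetherian_module R X" and H: "submodule H R X"
  obtains n \<phi> where "\<phi> \<in> module_hom R (free_rank R n) X" "\<phi> ` carrier (free_rank R n) = H"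
    "\<forall>c\<in>carrier (free_rank R n). \<phi> c = \<zero>\<^bsub>X\<^esub> \<longrightarrow> range c \<subseteq> \<mm>"
proof -
  note Xm = noetherian_moduleD[OF X]
  interpret X: module R X by fact
  let ?gen = "\<lambda>S. finite S \<and> S \<subseteq> carrier X \<and> module_span R X S = H"
  have "\<exists>S. ?gen S" using X H by (auto simp: noetherian_module_def)
  then have "\<exists>S. ?gen S \<and> (\<forall>T. ?gen T \<longrightarrow> card S \<le> card T)" by (elim exE, intro ex_has_least_nat)
  then obtain S where S: "?gen S" and least: "\<And>T. ?gen T \<Longrightarrow> card S \<le> card T" by blast
  define n where "n = card S"
  obtain x where "bij_betw x {0..<card S} S" using ex_bij_betw_nat_finite[of S] S by blast
  then have x: "x ` {..<n} = S" "inj_on x {..<n}"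
    unfolding n_def bij_betw_def by (simp_all add: lessThan_atLeast0)
  have xc: "x i \<in> carrier X" if "i \<in> {..<n}" for i using x(1) S that by blast
  have img: "free_lift R X x ` carrier (free_rank R n) = module_span R X (x ` {..<n})"
    by (rule free_lift_image[OF Xm]) (rule xc)
  define \<phi> where "\<phi> = free_lift R X x"
  have \<phi>: "\<phi> \<in> module_hom R (free_rank R n) X" unfolding \<phi>_def by (rule free_lift_hom[OF Xm xc])
  show thesis
  proof (rule that[OF \<phi>])
    show "\<phi> ` carrier (free_rank R n) = H"
      unfolding \<phi>_def img x(1) using S by simp
    show "\<forall>c\<in>carrier (free_rank R n). \<phi> c = \<zero>\<^bsub>X\<^esub> \<longrightarrow> range c \<subseteq> \<mm>"
    proof (intro ballI impI subsetI, rule ccontr)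
      fix c u assume c: "c \<in> carrier (free_rank R n)" "\<phi> c = \<zero>\<^bsub>X\<^esub>" and "u \<in> range c" "u \<notin> \<mm>"
      then obtain s where s: "c s \<notin> \<mm>" by blast
      have cs: "c s \<in> carrier R" using c(1) by (simp add: free_carrier_iff)
      have "c s \<noteq> \<zero>" using s m.zero_closed by metis
      then have sn: "s \<in> {..<n}" using c(1) unfolding free_carrier_iff by blast
      obtain b where b: "b \<in> carrier R" "b \<otimes> c s = \<one>" by (rule m_unit[OF cs s])
      let ?T = "{..<n} - {s}"
      define d where "d = (\<lambda>i. if i = s then \<zero> else b \<otimes> c i)"
      have dsub: "{i. d i \<noteq> \<zero>} \<subseteq> {i. c i \<noteq> \<zero>}" using b c(1) by (auto simp: d_def free_carrier_iff)
      have dT: "d \<in> carrier (free_module R ?T)"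
        unfolding free_carrier_iff
      proof (intro conjI allI)
        show "d i \<in> carrier R" for i using b c(1) by (simp add: d_def free_carrier_iff)
        show "finite {i. d i \<noteq> \<zero>}" using dsub c(1) by (auto simp: free_carrier_iff elim: finite_subset)
        have "{i. c i \<noteq> \<zero>} \<subseteq> {..<n}" using c(1) by (simp add: free_carrier_iff)
        moreover have "s \<notin> {i. d i \<noteq> \<zero>}" by (simp add: d_def)
        ultimately show "{i. d i \<noteq> \<zero>} \<subseteq> ?T" using dsub by blast
      qed
      then have dn: "d \<in> carrier (free_rank R n)" unfolding free_carrier_iff by blast
      have gs: "free_gen R s \<in> carrier (free_rank R n)" by (rule free_gen_closed[OF sn])
      have "b \<odot>\<^bsub>free_rank R n\<^esub> c = d \<oplus>\<^bsub>free_rank R n\<^esub> free_gen R s"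
        using b c(1) by (auto simp: free_module_simps d_def free_gen_def free_carrier_iff)
      then have "\<phi> d \<oplus>\<^bsub>X\<^esub> \<phi> (free_gen R s) = b \<odot>\<^bsub>X\<^esub> \<phi> c"
        using module_hom_smult[OF \<phi> b(1) c(1)] module_hom_add[OF \<phi> dn gs] by simp
      then have "\<phi> d \<oplus>\<^bsub>X\<^esub> x s = \<zero>\<^bsub>X\<^esub>"
        using free_lift_gen[OF Xm xc sn] b c(2) by (simp add: \<phi>_def)
      then have xsd: "x s = \<ominus>\<^bsub>X\<^esub> \<phi> d"
        using X.M.minus_equality[of "x s" "\<phi> d"] module_hom_closed[OF \<phi> dn] xc[OF sn]
          X.M.a_comm[of "x s" "\<phi> d"] by simp
      have xcT: "x i \<in> carrier X" if "i \<in> ?T" for i using xc that by blast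
      have "free_lift R X x ` carrier (free_module R ?T) = module_span R X (x ` ?T)"
        by (rule free_lift_image[OF Xm]) (rule xcT)
      then have \<phi>d: "\<phi> d \<in> module_span R X (x ` ?T)"
        using dT unfolding \<phi>_def by blast
      have T: "x ` ?T = S - {x s}"
        using x sn by (simp add: inj_on_image_set_diff[OF x(2)])
      have Tc: "S - {x s} \<subseteq> carrier X" using S by blast
      note spT = span_submodule[OF Xm Tc]
      have "\<ominus>\<^bsub>X\<^esub> \<phi> d \<in> module_span R X (S - {x s})"
        using submodule_uminus[OF Xm spT] \<phi>d unfolding T by blast
      then have xs: "x s \<in> module_span R X (S - {x s})" using xsd by simp
      have "module_span R X (S - {x s}) = H"
      proof
        show "module_span R X (S - {x s}) \<subseteq> H" using span_mono[of "S - {x s}" S R X] S by blast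
        have "S \<subseteq> module_span R X (S - {x s})" using xs span_superset[of "S - {x s}" R X] by blast
        then show "H \<subseteq> module_span R X (S - {x s})" using span_least[OF spT] S by blast
      qed
      then have "card S \<le> card (S - {x s})" using least[of "S - {x s}"] S Tc by blast
      moreover have "x s \<in> S" using x(1) sn by blast
      ultimately show False using S card_Diff1_less[of S "x s"] by simp
    qed
  qed
qed

text \<open>
  Each term covers the kernel of the previous map, and minimality of the previous cover says that the
  vectors in this kernel have all entries in \<open>\<mm>\<close>.
\<close>

theorem minimal_resolution:
  assumes X: "noetherian_module R X"
  obtains r d e where "free_resolution R X r d e"
    "\<forall>n. \<forall>c\<in>carrier (free_rank R (r (Suc n))). range (d n c) \<subseteq> \<mm>"
proof -
  note Xm = noetherian_moduleD[OF X]
  have Fm: "module R (free_rank R n)" for n by (rule free_module_module)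
  obtain r0 e where e: "e \<in> module_hom R (free_rank R r0) X" "e ` carrier (free_rank R r0) = carrier X"
      "\<forall>c\<in>carrier (free_rank R r0). e c = \<zero>\<^bsub>X\<^esub> \<longrightarrow> range c \<subseteq> \<mm>"
    by (rule minimal_cover[OF X module.carrier_is_submodule[OF Xm]])
  define P where "P n x \<longleftrightarrow> (case x of (a, b, d) \<Rightarrow> d \<in> module_hom R (free_rank R b) (free_rank R a) \<and>
      (\<forall>c\<in>carrier (free_rank R b). d c = \<zero>\<^bsub>free_rank R a\<^esub> \<longrightarrow> range c \<subseteq> \<mm>) \<and>
      (\<forall>c\<in>carrier (free_rank R b). range (d c) \<subseteq> \<mm>) \<and>
      (n = 0 \<longrightarrow> a = r0 \<and> d ` carrier (free_rank R b) = hom_kernel (free_rank R r0) X e))"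
    for n :: nat and x :: "nat \<times> nat \<times> ((nat \<Rightarrow> 'a) \<Rightarrow> (nat \<Rightarrow> 'a))"
  define Q where "Q n x y \<longleftrightarrow> (case x of (a, b, d) \<Rightarrow> case y of (a', b', d') \<Rightarrow> a' = b \<and>
      d' ` carrier (free_rank R b') = hom_kernel (free_rank R b) (free_rank R a) d)"
    for n :: nat and x y :: "nat \<times> nat \<times> ((nat \<Rightarrow> 'a) \<Rightarrow> (nat \<Rightarrow> 'a))"
  have "\<exists>f. \<forall>n. P n (f n) \<and> Q n (f n) (f (Suc n))"
  proof (rule dependent_nat_choice)
    obtain b d where d: "d \<in> module_hom R (free_rank R b) (free_rank R r0)"
        "d ` carrier (free_rank R b) = hom_kernel (free_rank R r0) X e"
        "\<forall>c\<in>carrier (free_rank R b). d c = \<zero>\<^bsub>free_rank R r0\<^esub> \<longrightarrow> range c \<subseteq> \<mm>"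
      by (rule minimal_cover[OF free_rank_noetherian hom_kernel_submodule[OF Fm Xm e(1)]])
    have "range (d c) \<subseteq> \<mm>" if c: "c \<in> carrier (free_rank R b)" for c
    proof -
      have "d c \<in> hom_kernel (free_rank R r0) X e" unfolding d(2)[symmetric] using c by (rule imageI)
      then show ?thesis using e(3) by simp
    qed
    then have "P 0 (r0, b, d)" using d by (simp add: P_def)
    then show "\<exists>x. P 0 x" ..
  next
    fix x n assume Px: "P n x"
    obtain a b d where x: "x = (a, b, d)" by (cases x)
    have dh: "d \<in> module_hom R (free_rank R b) (free_rank R a)"
        "\<forall>c\<in>carrier (free_rank R b). d c = \<zero>\<^bsub>free_rank R a\<^esub> \<longrightarrow> range c \<subseteq> \<mm>"
      using Px by (simp_all add: P_def x)
    obtain b' d' where d': "d' \<in> module_hom R (free_rank R b') (free_rank R b)"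
        "d' ` carrier (free_rank R b') = hom_kernel (free_rank R b) (free_rank R a) d"
        "\<forall>c\<in>carrier (free_rank R b'). d' c = \<zero>\<^bsub>free_rank R b\<^esub> \<longrightarrow> range c \<subseteq> \<mm>"
      by (rule minimal_cover[OF free_rank_noetherian hom_kernel_submodule[OF Fm Fm dh(1)]])
    have "range (d' c) \<subseteq> \<mm>" if c: "c \<in> carrier (free_rank R b')" for c
    proof -
      have "d' c \<in> hom_kernel (free_rank R b) (free_rank R a) d"
        unfolding d'(2)[symmetric] using c by (rule imageI)
      then show ?thesis using dh(2) by simp
    qed
    then have "P (Suc n) (b, b', d') \<and> Q n x (b, b', d')"
      using d' by (simp add: P_def Q_def x)
    then show "\<exists>y. P (Suc n) y \<and> Q n x y" ..
  qed
  then obtain f where f: "\<And>n. P n (f n)" "\<And>n. Q n (f n) (f (Suc n))" by blast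
  define r where "r n = fst (f n)" for n
  define d where "d n = snd (snd (f n))" for n
  have fn: "f n = (r n, r (Suc n), d n)" for n
    using f(2)[of n] by (cases "f n"; cases "f (Suc n)") (simp add: Q_def r_def d_def)
  have Pn: "P n (r n, r (Suc n), d n)" and Qn: "Q n (r n, r (Suc n), d n) (r (Suc n), r (Suc (Suc n)), d (Suc n))" for n
    using f(1)[of n] f(2)[of n] unfolding fn by blast+
  have r0: "r 0 = r0" using Pn[of 0] by (simp add: P_def)
  show thesis
  proof (rule that)
    show "free_resolution R X r d e"
      unfolding free_resolution_def
    proof (intro conjI allI)
      show "e \<in> module_hom R (free_rank R (r 0)) X" "e ` carrier (free_rank R (r 0)) = carrier X"
        using e r0 by simp_all
      show "d n \<in> module_hom R (free_rank R (r (Suc n))) (free_rank R (r n))" for n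
        using Pn[of n] by (simp add: P_def)
      show "d 0 ` carrier (free_rank R (r (Suc 0))) = hom_kernel (free_rank R (r 0)) X e"
        using Pn[of 0] by (simp add: P_def)
      show "d (Suc n) ` carrier (free_rank R (r (Suc (Suc n)))) =
         hom_kernel (free_rank R (r (Suc n))) (free_rank R (r n)) (d n)" for n
        using Qn[of n] by (simp add: Q_def)
    qed
    show "\<forall>n. \<forall>c\<in>carrier (free_rank R (r (Suc n))). range (d n c) \<subseteq> \<mm>"
      using Pn by (simp add: P_def)
  qed
qed

end

text \<open>The coordinate vectors of the free modules of finite rank have copies on every test type.\<close>

definition vec_code :: "(nat \<Rightarrow> 'a) \<Rightarrow> ('a, 'b) univ" where
  "vec_code c = Fun (\<lambda>l. Scalar (c (length l)))"

lemma vec_code_inj: "inj vec_code"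
proof (rule injI)
  fix c d :: "nat \<Rightarrow> 'a"
  assume eq: "(vec_code c :: ('a, 'b) univ) = vec_code d"
  show "c = d"
  proof
    fix n
    have "(Scalar (c n) :: ('a, 'b) univ) = Scalar (d n)"
      using fun_cong[OF eq[unfolded vec_code_def univ.inject], of "replicate n undefined"] by simp
    then show "c n = d n" by simp
  qed
qed

lemma (in cring) free_resolution_transport:
  fixes X :: "('a, 'c, 'm) module_scheme" and r :: "nat \<Rightarrow> nat"
  assumes X: "module R X" and res: "free_resolution R X r d e"
  shows "projective_resolution R X
    (\<lambda>n. transport_module (vec_code :: _ \<Rightarrow> ('a, 'c) univ) (free_rank R (r n)))
    (\<lambda>n x. vec_code (d n (inv_into UNIV vec_code x))) (\<lambda>x. e (inv_into UNIV vec_code x))"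
proof -
  let ?i = "vec_code :: _ \<Rightarrow> ('a, 'c) univ"
  note res = res[unfolded free_resolution_def]
  have e: "e \<in> module_hom R (free_rank R (r 0)) X" "e ` carrier (free_rank R (r 0)) = carrier X"
    and d: "\<And>n. d n \<in> module_hom R (free_rank R (r (Suc n))) (free_rank R (r n))"
    and ex0: "d 0 ` carrier (free_rank R (r (Suc 0))) = hom_kernel (free_rank R (r 0)) X e"
    and ex: "\<And>n. d (Suc n) ` carrier (free_rank R (r (Suc (Suc n)))) =
       hom_kernel (free_rank R (r (Suc n))) (free_rank R (r n)) (d n)"
    using res by simp_all
  let ?P = "\<lambda>n. transport_module ?i (free_rank R (r n))"
  have Fm: "module R (free_rank R n)" for n by (rule free_module_module)
  have inj: "inj_on ?i A" for A using vec_code_inj by (rule inj_on_subset) simp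
  have inv: "inv_into UNIV ?i (?i c) = c" for c by (rule inv_f_f[OF vec_code_inj])
  have PC: "carrier (?P n) = ?i ` carrier (free_rank R (r n))" for n
    by (rule transport_carrier[OF Fm inj])
  have jh: "inv_into UNIV ?i \<in> module_hom R (?P n) (free_rank R (r n))" for n
  proof (rule module_hom_cong[OF transport_module_module[OF Fm inj] transport_inv_hom[OF Fm inj]])
    fix x assume "x \<in> carrier (?P n)"
    then show "inv_into UNIV ?i x = inv_into (carrier (free_rank R (r n))) ?i x"
      unfolding PC by (auto simp: inv inv_into_f_f[OF inj])
  qed
  have zero: "?i c = \<zero>\<^bsub>?P n\<^esub> \<longleftrightarrow> c = \<zero>\<^bsub>free_rank R (r n)\<^esub>" for c n
    unfolding transport_zero[OF Fm inj] using injD[OF vec_code_inj] by blast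
  have ker: "a_kernel (?P (Suc n)) (?P n) (\<lambda>x. ?i (d n (inv_into UNIV ?i x))) =
      ?i ` hom_kernel (free_rank R (r (Suc n))) (free_rank R (r n)) (d n)" for n
    unfolding a_kernel_eq PC zero by (auto simp: inv)
  show ?thesis
    unfolding projective_resolution_def
  proof (intro conjI allI)
    show "projective_module R (?P n)" for n by (rule transport_free_projective[OF inj])
    show "(\<lambda>x. e (inv_into UNIV ?i x)) \<in> module_hom R (?P 0) X" by (rule module_hom_comp[OF jh e(1)])
    show "(\<lambda>x. ?i (d n (inv_into UNIV ?i x))) \<in> module_hom R (?P (Suc n)) (?P n)" for n
      by (rule module_hom_comp[OF module_hom_comp[OF jh d] transport_hom[OF Fm inj]])
    show "(\<lambda>x. e (inv_into UNIV ?i x)) ` carrier (?P 0) = carrier X"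
      unfolding PC image_image inv by (rule e(2))
    have "(\<lambda>x. ?i (d 0 (inv_into UNIV ?i x))) ` carrier (?P 1) = ?i ` (d 0 ` carrier (free_rank R (r (Suc 0))))"
      unfolding One_nat_def PC image_image inv ..
    also have "\<dots> = a_kernel (?P 0) X (\<lambda>x. e (inv_into UNIV ?i x))"
      unfolding ex0 a_kernel_eq PC by (auto simp: inv)
    finally show "(\<lambda>x. ?i (d 0 (inv_into UNIV ?i x))) ` carrier (?P 1) = a_kernel (?P 0) X (\<lambda>x. e (inv_into UNIV ?i x))" .
    show "(\<lambda>x. ?i (d (Suc n) (inv_into UNIV ?i x))) ` carrier (?P (Suc (Suc n))) =
        a_kernel (?P (Suc n)) (?P n) (\<lambda>x. ?i (d n (inv_into UNIV ?i x)))" for n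
      unfolding ker ex[symmetric] unfolding PC image_image inv ..
  qed
qed

text \<open>
  The choice in \<open>some_resolution\<close> is among resolutions on the test type; a resolution by free modules
  of finite rank has a copy there.
\<close>

lemma (in noetherian_local_ring) some_resolution_resolves:
  fixes X :: "('a, 'c, 'm) module_scheme"
  assumes X: "noetherian_module R X"
  obtains e where "projective_resolution R X (fst (some_resolution R X)) (snd (some_resolution R X)) e"
proof -
  note Xm = noetherian_moduleD[OF X]
  obtain r d e where "free_resolution R X r d e"
    by (rule minimal_resolution[OF X])
  note this = free_resolution_transport[OF Xm this]
  then have "\<exists>P d e. projective_resolution R X (P :: nat \<Rightarrow> ('a, ('a, 'c) univ) module) d e"
    by (intro exI)
  then have "\<exists>p. case p of (P :: nat \<Rightarrow> ('a, ('a, 'c) univ) module, d) \<Rightarrow> \<exists>e. projective_resolution R X P d e"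
    by simp
  then have "case some_resolution R X of (P, d) \<Rightarrow> \<exists>e. projective_resolution R X P d e"
    unfolding some_resolution_def by (rule someI_ex)
  then show thesis using that by (auto simp: case_prod_unfold)
qed

section \<open>Tensor products, and vanishing of Tor and Ext\<close>

lemma quot_factor:
  assumes M: "module R M" and H: "submodule H R M" and A: "module R A"
    and f: "f \<in> module_hom R M A" and ker: "\<And>x. x \<in> H \<Longrightarrow> f x = \<zero>\<^bsub>A\<^esub>"
  obtains h where "h \<in> module_hom R (quot_module M H) A" "\<forall>x\<in>carrier M. h (proj_quot M H x) = f x"
proof -
  interpret M: module R M by fact
  let ?Q = "quot_module M H" and ?p = "proj_quot M H"
  define h where "h = (\<lambda>q. f (SOME x. x \<in> carrier M \<and> ?p x = q))"
  have h: "h (?p x) = f x" if x: "x \<in> carrier M" for x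
  proof -
    let ?y = "SOME y. y \<in> carrier M \<and> ?p y = ?p x"
    have y: "?y \<in> carrier M \<and> ?p ?y = ?p x" by (rule someI[of _ x]) (use x in simp)
    then have "?y \<ominus>\<^bsub>M\<^esub> x \<in> H" using proj_quot_eq_iff[OF M H, of ?y x] x by blast
    then have "f (?y \<ominus>\<^bsub>M\<^esub> x) = \<zero>\<^bsub>A\<^esub>" by (rule ker)
    then have "f ?y = f x"
      using y x module_hom_minus[OF M A f, of ?y x] module_minus_eq_zero_iff[OF A]
        module_hom_closed[OF f] by simp
    then show ?thesis by (simp add: h_def)
  qed
  note c = quot_carrier[OF M H]
  have "h \<in> module_hom R ?Q A"
  proof (rule module_homI)
    show "h q \<in> carrier A" if q: "q \<in> carrier ?Q" for q
    proof -
      obtain x where x: "x \<in> carrier M" "q = ?p x" using q c by blast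
      then show ?thesis using h[OF x(1)] module_hom_closed[OF f x(1)] by simp
    qed
    show "h (q \<oplus>\<^bsub>?Q\<^esub> q') = h q \<oplus>\<^bsub>A\<^esub> h q'" if q: "q \<in> carrier ?Q" "q' \<in> carrier ?Q" for q q'
    proof -
      obtain x where x: "x \<in> carrier M" "q = ?p x" using q(1) c by blast
      obtain y where y: "y \<in> carrier M" "q' = ?p y" using q(2) c by blast
      show ?thesis
        using x y h[of x] h[of y] h[of "x \<oplus>\<^bsub>M\<^esub> y"] module_hom_add[OF f x(1) y(1)]
        by (simp add: proj_quot_add[OF M H])
    qed
    show "h (r \<odot>\<^bsub>?Q\<^esub> q) = r \<odot>\<^bsub>A\<^esub> h q" if q: "r \<in> carrier R" "q \<in> carrier ?Q" for r q
    proof -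
      obtain x where x: "x \<in> carrier M" "q = ?p x" using q(2) c by blast
      show ?thesis
        using x q(1) h[of x] h[of "r \<odot>\<^bsub>M\<^esub> x"] module_hom_smult[OF f q(1) x(1)]
        by (simp add: proj_quot_smult[OF M H])
    qed
  qed
  then show thesis using that[of h] h by simp
qed

definition bilinear_map ::
    "('a, 'r) ring_scheme \<Rightarrow> ('a, 'b, 'm) module_scheme \<Rightarrow> ('a, 'c, 'n) module_scheme \<Rightarrow>
     ('a, 'd, 'k) module_scheme \<Rightarrow> ('b \<Rightarrow> 'c \<Rightarrow> 'd) \<Rightarrow> bool"
  where
  "bilinear_map R A B E \<beta> \<longleftrightarrow>
     (\<forall>b\<in>carrier B. (\<lambda>a. \<beta> a b) \<in> module_hom R A E) \<and> (\<forall>a\<in>carrier A. \<beta> a \<in> module_hom R B E)"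

context
  fixes R :: "('a, 'r) ring_scheme" and A :: "('a, 'b, 'm) module_scheme" and B :: "('a, 'c, 'n) module_scheme"
  assumes A: "module R A" and B: "module R B"
begin

interpretation A: module R A by (rule A)
interpretation B: module R B by (rule B)

private abbreviation (input) F where "F \<equiv> free_module R (carrier A \<times> carrier B)"
private abbreviation (input) rel where "rel \<equiv> tensor_relations R A B"
private abbreviation (input) ee where "ee \<equiv> \<lambda>a b. free_gen R (a, b)"

private lemma F: "module R F" by (rule A.R.free_module_module)

private lemma gen: "a \<in> carrier A \<Longrightarrow> b \<in> carrier B \<Longrightarrow> ee a b \<in> carrier F"
  by (rule A.R.free_gen_closed) simp

interpretation F: module R F by (rule F)

definition tensor_relators where
  "tensor_relators =
       {ee (a \<oplus>\<^bsub>A\<^esub> a') b \<ominus>\<^bsub>F\<^esub> (ee a b \<oplus>\<^bsub>F\<^esub> ee a' b) | a a' b.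
            a \<in> carrier A \<and> a' \<in> carrier A \<and> b \<in> carrier B} \<union>
        {ee a (b \<oplus>\<^bsub>B\<^esub> b') \<ominus>\<^bsub>F\<^esub> (ee a b \<oplus>\<^bsub>F\<^esub> ee a b') | a b b'.
            a \<in> carrier A \<and> b \<in> carrier B \<and> b' \<in> carrier B} \<union>
        {ee (r \<odot>\<^bsub>A\<^esub> a) b \<ominus>\<^bsub>F\<^esub> (r \<odot>\<^bsub>F\<^esub> ee a b) | r a b.
            r \<in> carrier R \<and> a \<in> carrier A \<and> b \<in> carrier B} \<union>
        {ee a (r \<odot>\<^bsub>B\<^esub> b) \<ominus>\<^bsub>F\<^esub> (r \<odot>\<^bsub>F\<^esub> ee a b) | r a b.
            r \<in> carrier R \<and> a \<in> carrier A \<and> b \<in> carrier B}"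

lemma tensor_relations_eq: "rel = module_span R F tensor_relators"
  unfolding tensor_relations_def tensor_relators_def Let_def ..

lemma tensor_relators_closed: "tensor_relators \<subseteq> carrier F"
  unfolding tensor_relators_def by (intro Un_least subsetI; elim CollectE exE conjE) (simp_all add: gen)

lemma tensor_relations_submodule: "submodule rel R F"
  unfolding tensor_relations_eq by (rule span_submodule[OF F tensor_relators_closed])

lemma tensor_module_module: "module R (tensor_module R A B)"
  unfolding tensor_module_def by (rule quot_module_module[OF F tensor_relations_submodule])

lemma pure_tensor_eq: "pure_tensor R A B a b = proj_quot F rel (ee a b)"
  by (simp add: pure_tensor_def proj_quot_def)

lemma pure_tensor_closed:
  "a \<in> carrier A \<Longrightarrow> b \<in> carrier B \<Longrightarrow> pure_tensor R A B a b \<in> carrier (tensor_module R A B)"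
  unfolding pure_tensor_eq tensor_module_def
  by (rule module_hom_closed[OF proj_quot_hom[OF F tensor_relations_submodule] gen])

lemma tensor_hom_eqI:
  assumes E: "module R E" and f: "f \<in> module_hom R (tensor_module R A B) E"
    and g: "g \<in> module_hom R (tensor_module R A B) E"
    and eq: "\<And>a b. a \<in> carrier A \<Longrightarrow> b \<in> carrier B \<Longrightarrow> f (pure_tensor R A B a b) = g (pure_tensor R A B a b)"
    and z: "z \<in> carrier (tensor_module R A B)"
  shows "f z = g z"
proof -
  note p = proj_quot_hom[OF F tensor_relations_submodule, folded tensor_module_def]
  obtain c where c: "c \<in> carrier F" "z = proj_quot F rel c"
    using z unfolding tensor_module_def quot_carrier[OF F tensor_relations_submodule] by blast
  have "f (proj_quot F rel c) = g (proj_quot F rel c)"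
  proof (rule A.R.free_hom_eqI[OF E module_hom_comp[OF p f] module_hom_comp[OF p g] _ c(1)])
    fix s assume "s \<in> carrier A \<times> carrier B"
    then obtain a b where "s = (a, b)" "a \<in> carrier A" "b \<in> carrier B" by blast
    then show "f (proj_quot F rel (free_gen R s)) = g (proj_quot F rel (free_gen R s))"
      using eq[of a b] by (simp add: pure_tensor_eq)
  qed
  then show ?thesis by (simp add: c(2))
qed

text \<open>
  The linear extension of \<open>\<beta>\<close> to the free module on pairs kills the relations of the tensor product,
  because \<open>\<beta>\<close> is bilinear.
\<close>

lemma tensor_lift:
  assumes E: "module R E" and \<beta>: "bilinear_map R A B E \<beta>"
  obtains h where "h \<in> module_hom R (tensor_module R A B) E"
    "\<forall>a\<in>carrier A. \<forall>b\<in>carrier B. h (pure_tensor R A B a b) = \<beta> a b"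
proof -
  let ?x = "\<lambda>s. \<beta> (fst s) (snd s)"
  let ?\<phi> = "free_lift R E ?x"
  have \<beta>l: "(\<lambda>a. \<beta> a b) \<in> module_hom R A E" if "b \<in> carrier B" for b using \<beta> that by (simp add: bilinear_map_def)
  have \<beta>r: "\<beta> a \<in> module_hom R B E" if "a \<in> carrier A" for a using \<beta> that by (simp add: bilinear_map_def)
  have x: "?x s \<in> carrier E" if "s \<in> carrier A \<times> carrier B" for s
    using that module_hom_closed[OF \<beta>r] by auto
  have \<phi>: "?\<phi> \<in> module_hom R F E" by (rule A.R.free_lift_hom[OF E x])
  have \<phi>g: "?\<phi> (ee a b) = \<beta> a b" if "a \<in> carrier A" "b \<in> carrier B" for a b
    using A.R.free_lift_gen[OF E x, where s = "(a, b)"] that by simp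
  have z: "v \<ominus>\<^bsub>E\<^esub> v = \<zero>\<^bsub>E\<^esub>" if "v \<in> carrier E" for v
    using module_minus_eq_zero_iff[OF E that that] by simp
  have "?\<phi> c = \<zero>\<^bsub>E\<^esub>" if "c \<in> tensor_relators" for c
    using that unfolding tensor_relators_def
  proof (elim UnE CollectE exE conjE)
    fix a a' b assume *: "c = ee (a \<oplus>\<^bsub>A\<^esub> a') b \<ominus>\<^bsub>F\<^esub> (ee a b \<oplus>\<^bsub>F\<^esub> ee a' b)"
      "a \<in> carrier A" "a' \<in> carrier A" "b \<in> carrier B"
    have "?\<phi> c = \<beta> (a \<oplus>\<^bsub>A\<^esub> a') b \<ominus>\<^bsub>E\<^esub> (\<beta> a b \<oplus>\<^bsub>E\<^esub> \<beta> a' b)"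
      unfolding *(1) using *(2-) by (simp add: module_hom_minus[OF F E \<phi>] module_hom_add[OF \<phi>] gen \<phi>g)
    then show ?thesis
      using module_hom_add[OF \<beta>l[OF *(4)] *(2,3)] z module_hom_closed[OF \<beta>l[OF *(4)]] *(2,3)
      by (metis A.M.a_closed)
  next
    fix a b b' assume *: "c = ee a (b \<oplus>\<^bsub>B\<^esub> b') \<ominus>\<^bsub>F\<^esub> (ee a b \<oplus>\<^bsub>F\<^esub> ee a b')"
      "a \<in> carrier A" "b \<in> carrier B" "b' \<in> carrier B"
    have "?\<phi> c = \<beta> a (b \<oplus>\<^bsub>B\<^esub> b') \<ominus>\<^bsub>E\<^esub> (\<beta> a b \<oplus>\<^bsub>E\<^esub> \<beta> a b')"
      unfolding *(1) using *(2-) by (simp add: module_hom_minus[OF F E \<phi>] module_hom_add[OF \<phi>] gen \<phi>g)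
    then show ?thesis
      using module_hom_add[OF \<beta>r[OF *(2)] *(3,4)] z module_hom_closed[OF \<beta>r[OF *(2)]] *(3,4)
      by (metis B.M.a_closed)
  next
    fix r a b assume *: "c = ee (r \<odot>\<^bsub>A\<^esub> a) b \<ominus>\<^bsub>F\<^esub> (r \<odot>\<^bsub>F\<^esub> ee a b)"
      "r \<in> carrier R" "a \<in> carrier A" "b \<in> carrier B"
    have "?\<phi> c = \<beta> (r \<odot>\<^bsub>A\<^esub> a) b \<ominus>\<^bsub>E\<^esub> (r \<odot>\<^bsub>E\<^esub> \<beta> a b)"
      unfolding *(1) using *(2-) by (simp add: module_hom_minus[OF F E \<phi>] module_hom_smult[OF \<phi>] gen \<phi>g)
    then show ?thesis
      using module_hom_smult[OF \<beta>l[OF *(4)] *(2,3)] z module_hom_closed[OF \<beta>l[OF *(4)]] *(2,3)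
      by (metis A.smult_closed)
  next
    fix r a b assume *: "c = ee a (r \<odot>\<^bsub>B\<^esub> b) \<ominus>\<^bsub>F\<^esub> (r \<odot>\<^bsub>F\<^esub> ee a b)"
      "r \<in> carrier R" "a \<in> carrier A" "b \<in> carrier B"
    have "?\<phi> c = \<beta> a (r \<odot>\<^bsub>B\<^esub> b) \<ominus>\<^bsub>E\<^esub> (r \<odot>\<^bsub>E\<^esub> \<beta> a b)"
      unfolding *(1) using *(2-) by (simp add: module_hom_minus[OF F E \<phi>] module_hom_smult[OF \<phi>] gen \<phi>g)
    then show ?thesis
      using module_hom_smult[OF \<beta>r[OF *(3)] *(2,4)] z module_hom_closed[OF \<beta>r[OF *(3)]] *(2,4)
      by (metis B.smult_closed)
  qed
  then have "tensor_relators \<subseteq> hom_kernel F E ?\<phi>" using tensor_relators_closed by blast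
  then have "rel \<subseteq> hom_kernel F E ?\<phi>"
    unfolding tensor_relations_eq by (rule span_least[OF hom_kernel_submodule[OF F E \<phi>]])
  then have ker: "?\<phi> c = \<zero>\<^bsub>E\<^esub>" if "c \<in> rel" for c using that by blast
  obtain h where h: "h \<in> module_hom R (quot_module F rel) E"
      "\<forall>c\<in>carrier F. h (proj_quot F rel c) = ?\<phi> c"
    by (rule quot_factor[OF F tensor_relations_submodule E \<phi> ker])
  show thesis
    by (rule that[of h]) (use h gen \<phi>g in \<open>simp_all add: tensor_module_def pure_tensor_eq\<close>)
qed

lemma pure_tensor_bilinear: "bilinear_map R A B (tensor_module R A B) (pure_tensor R A B)"
proof -
  note H = tensor_relations_submodule
  have sup: "tensor_relators \<subseteq> rel" unfolding tensor_relations_eq by (rule span_superset)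
  have T: "tensor_module R A B = quot_module F rel" by (simp add: tensor_module_def)
  have eq: "proj_quot F rel u = proj_quot F rel v"
    if "u \<in> carrier F" "v \<in> carrier F" "u \<ominus>\<^bsub>F\<^esub> v \<in> tensor_relators" for u v
    using that proj_quot_eq_iff[OF F H that(1,2)] sup by blast
  show ?thesis
    unfolding bilinear_map_def
  proof (intro conjI ballI)
    fix b assume b: "b \<in> carrier B"
    show "(\<lambda>a. pure_tensor R A B a b) \<in> module_hom R A (tensor_module R A B)"
    proof (rule module_homI)
      show "pure_tensor R A B a b \<in> carrier (tensor_module R A B)" if "a \<in> carrier A" for a
        by (rule pure_tensor_closed[OF that b])
      show "pure_tensor R A B (a \<oplus>\<^bsub>A\<^esub> a') b = pure_tensor R A B a b \<oplus>\<^bsub>tensor_module R A B\<^esub> pure_tensor R A B a' b"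
        if a: "a \<in> carrier A" "a' \<in> carrier A" for a a'
        unfolding pure_tensor_eq T proj_quot_add[OF F H gen[OF a(1) b] gen[OF a(2) b]]
      proof (rule eq)
        show "ee (a \<oplus>\<^bsub>A\<^esub> a') b \<ominus>\<^bsub>F\<^esub> (ee a b \<oplus>\<^bsub>F\<^esub> ee a' b) \<in> tensor_relators"
          unfolding tensor_relators_def using a b by blast
      qed (use a b gen in simp_all)
      show "pure_tensor R A B (r \<odot>\<^bsub>A\<^esub> a) b = r \<odot>\<^bsub>tensor_module R A B\<^esub> pure_tensor R A B a b"
        if a: "r \<in> carrier R" "a \<in> carrier A" for r a
        unfolding pure_tensor_eq T proj_quot_smult[OF F H a(1) gen[OF a(2) b]]
      proof (rule eq)
        show "ee (r \<odot>\<^bsub>A\<^esub> a) b \<ominus>\<^bsub>F\<^esub> (r \<odot>\<^bsub>F\<^esub> ee a b) \<in> tensor_relators"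
          unfolding tensor_relators_def using a b by blast
      qed (use a b gen in simp_all)
    qed
  next
    fix a assume a: "a \<in> carrier A"
    show "pure_tensor R A B a \<in> module_hom R B (tensor_module R A B)"
    proof (rule module_homI)
      show "pure_tensor R A B a b \<in> carrier (tensor_module R A B)" if "b \<in> carrier B" for b
        by (rule pure_tensor_closed[OF a that])
      show "pure_tensor R A B a (b \<oplus>\<^bsub>B\<^esub> b') = pure_tensor R A B a b \<oplus>\<^bsub>tensor_module R A B\<^esub> pure_tensor R A B a b'"
        if b: "b \<in> carrier B" "b' \<in> carrier B" for b b'
        unfolding pure_tensor_eq T proj_quot_add[OF F H gen[OF a b(1)] gen[OF a b(2)]]
      proof (rule eq)
        show "ee a (b \<oplus>\<^bsub>B\<^esub> b') \<ominus>\<^bsub>F\<^esub> (ee a b \<oplus>\<^bsub>F\<^esub> ee a b') \<in> tensor_relators"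
          unfolding tensor_relators_def using a b by blast
      qed (use a b gen in simp_all)
      show "pure_tensor R A B a (r \<odot>\<^bsub>B\<^esub> b) = r \<odot>\<^bsub>tensor_module R A B\<^esub> pure_tensor R A B a b"
        if b: "r \<in> carrier R" "b \<in> carrier B" for r b
        unfolding pure_tensor_eq T proj_quot_smult[OF F H b(1) gen[OF a b(2)]]
      proof (rule eq)
        show "ee a (r \<odot>\<^bsub>B\<^esub> b) \<ominus>\<^bsub>F\<^esub> (r \<odot>\<^bsub>F\<^esub> ee a b) \<in> tensor_relators"
          unfolding tensor_relators_def using a b by blast
      qed (use a b gen in simp_all)
    qed
  qed
qed

end

lemma bilinear_map_comp_left:
  assumes "bilinear_map R A B E \<beta>" "f \<in> module_hom R A' A"
  shows "bilinear_map R A' B E (\<lambda>a. \<beta> (f a))"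
  unfolding bilinear_map_def
proof (intro conjI ballI)
  fix b assume "b \<in> carrier B"
  then show "(\<lambda>a. \<beta> (f a) b) \<in> module_hom R A' E"
    using assms module_hom_comp[of f R A' A "\<lambda>a. \<beta> a b" E] by (simp add: bilinear_map_def)
next
  fix a assume "a \<in> carrier A'"
  then show "\<beta> (f a) \<in> module_hom R B E"
    using assms module_hom_closed[OF assms(2)] by (simp add: bilinear_map_def)
qed

lemma bilinear_map_comp:
  assumes "bilinear_map R A B E \<beta>" "h \<in> module_hom R E E'"
  shows "bilinear_map R A B E' (\<lambda>a b. h (\<beta> a b))"
  unfolding bilinear_map_def
proof (intro conjI ballI)
  fix b assume "b \<in> carrier B"
  then have "(\<lambda>a. \<beta> a b) \<in> module_hom R A E" using assms(1) by (simp add: bilinear_map_def)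
  then show "(\<lambda>a. h (\<beta> a b)) \<in> module_hom R A E'" by (rule module_hom_comp[OF _ assms(2)])
next
  fix a assume "a \<in> carrier A"
  then have "\<beta> a \<in> module_hom R B E" using assms(1) by (simp add: bilinear_map_def)
  then show "(\<lambda>b. h (\<beta> a b)) \<in> module_hom R B E'" by (rule module_hom_comp[OF _ assms(2)])
qed

text \<open>
  The description of \<open>tensor_map\<close> is by a definite choice; existence is the universal property, and
  uniqueness holds because pure tensors generate.
\<close>

lemma tensor_map_spec:
  assumes A: "module R A" and A': "module R A'" and B: "module R B" and f: "f \<in> module_hom R A A'"
  shows "tensor_map R A A' B f \<in> module_hom R (tensor_module R A B) (tensor_module R A' B)"
    and "\<And>a b. a \<in> carrier A \<Longrightarrow> b \<in> carrier B \<Longrightarrow>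
      tensor_map R A A' B f (pure_tensor R A B a b) = pure_tensor R A' B (f a) b"
proof -
  let ?T = "tensor_module R A B" and ?T' = "tensor_module R A' B"
  note T = tensor_module_module[OF A B] and T' = tensor_module_module[OF A' B]
  let ?P = "\<lambda>h. h \<in> module_hom R ?T ?T' \<and> h \<in> extensional (carrier ?T) \<and>
        (\<forall>a\<in>carrier A. \<forall>b\<in>carrier B. h (pure_tensor R A B a b) = pure_tensor R A' B (f a) b)"
  obtain h where h: "h \<in> module_hom R ?T ?T'"
      "\<forall>a\<in>carrier A. \<forall>b\<in>carrier B. h (pure_tensor R A B a b) = pure_tensor R A' B (f a) b"
    by (rule tensor_lift[OF A B T' bilinear_map_comp_left[OF pure_tensor_bilinear[OF A' B] f]])
  let ?h = "restrict h (carrier ?T)"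
  have hh: "?h \<in> module_hom R ?T ?T'" by (rule module_hom_cong[OF T h(1)]) simp
  have hp: "?h (pure_tensor R A B a b) = pure_tensor R A' B (f a) b" if "a \<in> carrier A" "b \<in> carrier B" for a b
    using h(2) that pure_tensor_closed[OF A B that] by simp
  have Ph: "?P ?h" using hh hp by blast
  have "?P (THE h. ?P h)"
  proof (rule theI[of ?P, OF Ph])
    fix g assume g: "?P g"
    show "g = ?h"
    proof (rule extensionalityI[of _ "carrier ?T"])
      fix z assume z: "z \<in> carrier ?T"
      show "g z = ?h z"
      proof (rule tensor_hom_eqI[OF A B T' conjunct1[OF g] hh _ z])
        fix a b assume ab: "a \<in> carrier A" "b \<in> carrier B"
        then have "g (pure_tensor R A B a b) = pure_tensor R A' B (f a) b" using g by blast
        then show "g (pure_tensor R A B a b) = ?h (pure_tensor R A B a b)" using hp[OF ab] by simp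
      qed
    qed (use g in blast, rule restrict_extensional)
  qed
  then have "?P (tensor_map R A A' B f)" unfolding tensor_map_def .
  then show "tensor_map R A A' B f \<in> module_hom R ?T ?T'"
    and "\<And>a b. a \<in> carrier A \<Longrightarrow> b \<in> carrier B \<Longrightarrow>
      tensor_map R A A' B f (pure_tensor R A B a b) = pure_tensor R A' B (f a) b" by simp_all
qed

lemma trivial_homology:
  assumes C: "module R C" and "trivial_module (quot_module (C\<lparr>carrier := Z\<rparr>) B)" "\<zero>\<^bsub>C\<^esub> \<in> B" "z \<in> Z" "z \<in> carrier C"
  shows "z \<in> B"
proof -
  interpret C: module R C by fact
  let ?Z = "C\<lparr>carrier := Z\<rparr>"
  have "B +>\<^bsub>?Z\<^esub> z \<in> a_rcosets\<^bsub>?Z\<^esub> B" using assms(4) by (auto simp: A_RCOSETS_def')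
  then have "B +>\<^bsub>?Z\<^esub> z = B" using assms(2) by (simp add: trivial_module_def quot_module_def)
  moreover have "\<zero>\<^bsub>C\<^esub> \<oplus>\<^bsub>C\<^esub> z \<in> B +>\<^bsub>?Z\<^esub> z" using assms(3) by (auto simp: a_r_coset_def')
  ultimately show ?thesis using assms(5) by simp
qed

lemma projective_resolutionD:
  assumes "projective_resolution R X P d e"
  shows "projective_module R (P n)" "module R (P n)" "e \<in> module_hom R (P 0) X"
    "d n \<in> module_hom R (P (Suc n)) (P n)" "e ` carrier (P 0) = carrier X"
    "d 0 ` carrier (P (Suc 0)) = hom_kernel (P 0) X e"
    "d (Suc n) ` carrier (P (Suc (Suc n))) = hom_kernel (P (Suc n)) (P n) (d n)"
proof -
  show P: "projective_module R (P n)" using assms by (simp add: projective_resolution_def)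
  then show "module R (P n)" by (simp add: projective_module_def)
qed (use assms in \<open>simp_all add: projective_resolution_def a_kernel_eq\<close>)

lemma Ext_trivial_extend:
  assumes res: "projective_resolution R X (fst (some_resolution R X)) (snd (some_resolution R X)) e"
    and N: "module R N" and tr: "trivial_module (Ext R (Suc n) X N)"
  defines "P \<equiv> fst (some_resolution R X)" and "d \<equiv> snd (some_resolution R X)"
  assumes f: "f \<in> module_hom R (P (Suc n)) N"
    and fd: "\<And>x. x \<in> carrier (P (Suc (Suc n))) \<Longrightarrow> f (d (Suc n) x) = \<zero>\<^bsub>N\<^esub>"
  obtains g where "g \<in> module_hom R (P n) N" "\<forall>x\<in>carrier (P (Suc n)). f x = g (d n x)"
proof -
  interpret N: module R N by fact
  note res' = res[folded P_def d_def]
  note P = projective_resolutionD(2)[OF res'] and d = projective_resolutionD(4)[OF res']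
  let ?C = "\<lambda>k. hom_module R (P k) N"
  let ?\<delta> = "\<lambda>k f. compose (carrier (P (Suc k))) f (d k)"
  have tr': "trivial_module (quot_module ((?C (Suc n))\<lparr>carrier := a_kernel (?C (Suc n)) (?C (Suc (Suc n))) (?\<delta> (Suc n))\<rparr>)
      (?\<delta> n ` carrier (?C n)))"
    using tr unfolding Ext_def Let_def P_def d_def by simp
  let ?f = "restrict f (carrier (P (Suc n)))"
  have fC: "?f \<in> carrier (?C (Suc n))" by (rule hom_module_restrict[OF P f])
  have dc: "d k x \<in> carrier (P k)" if "x \<in> carrier (P (Suc k))" for k x by (rule module_hom_closed[OF d that])
  have fk: "?f \<in> a_kernel (?C (Suc n)) (?C (Suc (Suc n))) (?\<delta> (Suc n))"
    unfolding a_kernel_eq hom_module_simps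
    using fC by (auto simp: compose_def fd dc intro!: restrict_ext)
  have "\<zero>\<^bsub>?C (Suc n)\<^esub> = ?\<delta> n \<zero>\<^bsub>?C n\<^esub>"
    unfolding hom_module_simps by (auto simp: compose_def dc intro!: restrict_ext)
  then have "\<zero>\<^bsub>?C (Suc n)\<^esub> \<in> ?\<delta> n ` carrier (?C n)"
    using module_zero_closed[OF hom_module_module[OF P N], of n] by (rule image_eqI)
  then have "?f \<in> ?\<delta> n ` carrier (?C n)"
    by (rule trivial_homology[OF hom_module_module[OF P N] tr' _ fk fC])
  then obtain g where g: "g \<in> carrier (?C n)" "?f = ?\<delta> n g" by blast
  have "f x = g (d n x)" if "x \<in> carrier (P (Suc n))" for x
    using fun_cong[OF g(2), of x] that by (simp add: compose_def)
  then show thesis using that[of g] g(1) by (simp add: hom_module_carrier_iff)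
qed

text \<open>
  A bilinear map that vanishes on boundaries extends along the differential once Tor is trivial,
  because it factors through an injective map into the next tensor product.
\<close>

lemma Tor_trivial_extend:
  assumes res: "projective_resolution R X (fst (some_resolution R X)) (snd (some_resolution R X)) e"
    and N: "module R N" and E: "baer_module R E" and tr: "trivial_module (Tor R (Suc n) X N)"
  defines "P \<equiv> fst (some_resolution R X)" and "d \<equiv> snd (some_resolution R X)"
  assumes \<beta>: "bilinear_map R (P (Suc n)) N E \<beta>"
    and \<beta>d: "\<And>x y. x \<in> carrier (P (Suc (Suc n))) \<Longrightarrow> y \<in> carrier N \<Longrightarrow> \<beta> (d (Suc n) x) y = \<zero>\<^bsub>E\<^esub>"
  obtains \<gamma> where "bilinear_map R (P n) N E \<gamma>"
    "\<forall>x\<in>carrier (P (Suc n)). \<forall>y\<in>carrier N. \<beta> x y = \<gamma> (d n x) y"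
proof -
  have Em: "module R E" by (rule baer_moduleD[OF E])
  note res' = res[folded P_def d_def]
  note P = projective_resolutionD(2)[OF res'] and d = projective_resolutionD(4)[OF res']
  let ?C = "\<lambda>k. tensor_module R (P k) N"
  let ?\<delta> = "\<lambda>k. tensor_map R (P (Suc k)) (P k) N (d k)"
  note C = tensor_module_module[OF P N]
  note \<delta> = tensor_map_spec[OF P P N d]
  have tr': "trivial_module (quot_module ((?C (Suc n))\<lparr>carrier := a_kernel (?C (Suc n)) (?C n) (?\<delta> n)\<rparr>)
      (?\<delta> (Suc n) ` carrier (?C (Suc (Suc n)))))"
    using tr unfolding Tor_def Let_def P_def d_def by simp
  obtain h where h: "h \<in> module_hom R (?C (Suc n)) E"
      "\<forall>a\<in>carrier (P (Suc n)). \<forall>b\<in>carrier N. h (pure_tensor R (P (Suc n)) N a b) = \<beta> a b"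
    by (rule tensor_lift[OF P N Em \<beta>])
  have h\<delta>: "h (?\<delta> (Suc n) w) = \<zero>\<^bsub>E\<^esub>" if w: "w \<in> carrier (?C (Suc (Suc n)))" for w
  proof (rule tensor_hom_eqI[OF P N Em module_hom_comp[OF \<delta>(1) h(1)] module_hom_zero_map[OF Em] _ w])
    fix a b assume ab: "a \<in> carrier (P (Suc (Suc n)))" "b \<in> carrier N"
    then show "h (?\<delta> (Suc n) (pure_tensor R (P (Suc (Suc n))) N a b)) = \<zero>\<^bsub>E\<^esub>"
      using h(2) \<delta>(2)[OF ab] \<beta>d[OF ab] module_hom_closed[OF d ab(1)] by simp
  qed
  have "h z = \<zero>\<^bsub>E\<^esub>" if z: "z \<in> carrier (?C (Suc n))" "?\<delta> n z = \<zero>\<^bsub>?C n\<^esub>" for z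
  proof -
    have zero: "\<zero>\<^bsub>?C (Suc n)\<^esub> \<in> ?\<delta> (Suc n) ` carrier (?C (Suc (Suc n)))"
      using module_hom_zero[OF C C \<delta>(1)] module_zero_closed[OF C] by (metis image_eqI)
    have zk: "z \<in> a_kernel (?C (Suc n)) (?C n) (?\<delta> n)" unfolding a_kernel_eq using z by simp
    have "z \<in> ?\<delta> (Suc n) ` carrier (?C (Suc (Suc n)))"
      by (rule trivial_homology[OF C tr' zero zk z(1)])
    then show ?thesis using h\<delta> by blast
  qed
  then obtain k where k: "k \<in> module_hom R (?C n) E" "\<And>z. z \<in> carrier (?C (Suc n)) \<Longrightarrow> k (?\<delta> n z) = h z"
    using baer_extend[OF E C C \<delta>(1) h(1)] by metis
  show thesis
  proof (rule that)
    show "bilinear_map R (P n) N E (\<lambda>a b. k (pure_tensor R (P n) N a b))"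
      by (rule bilinear_map_comp[OF pure_tensor_bilinear[OF P N] k(1)])
    show "\<forall>x\<in>carrier (P (Suc n)). \<forall>y\<in>carrier N. \<beta> x y = k (pure_tensor R (P n) N (d n x) y)"
    proof (intro ballI)
      fix x y assume xy: "x \<in> carrier (P (Suc n))" "y \<in> carrier N"
      have "k (?\<delta> n (pure_tensor R (P (Suc n)) N x y)) = h (pure_tensor R (P (Suc n)) N x y)"
        by (rule k(2)[OF pure_tensor_closed[OF P N xy]])
      then show "\<beta> x y = k (pure_tensor R (P n) N (d n x) y)" using \<delta>(2)[OF xy] h(2) xy by simp
    qed
  qed
qed

section \<open>Balancing Ext between projective and injective resolutions\<close>

lemma (in module) minus_self: "v \<in> carrier M \<Longrightarrow> v \<ominus>\<^bsub>M\<^esub> v = \<zero>\<^bsub>M\<^esub>"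
  by (simp add: a_minus_def M.r_neg)

lemma (in module) add_minus_cancel: "a \<in> carrier M \<Longrightarrow> b \<in> carrier M \<Longrightarrow> b \<oplus>\<^bsub>M\<^esub> (a \<ominus>\<^bsub>M\<^esub> b) = a"
  by (simp add: a_minus_def M.a_lcomm M.r_neg)

text \<open>
  An injective resolution of the kernel of \<open>\<delta> 0\<close>. The kernel is not named, because for the dual of a
  free resolution it is more convenient to work with the complex alone.
\<close>

locale baer_complex =
  fixes R :: "('a, 'r) ring_scheme" and E :: "nat \<Rightarrow> ('a, 'e) module" and \<delta> :: "nat \<Rightarrow> 'e \<Rightarrow> 'e"
  assumes E: "\<And>n. baer_module R (E n)"
    and \<delta>: "\<And>n. \<delta> n \<in> module_hom R (E n) (E (Suc n))"
    and exactE: "\<And>n. \<delta> n ` carrier (E n) = hom_kernel (E (Suc n)) (E (Suc (Suc n))) (\<delta> (Suc n))"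
begin

lemma Em: "module R (E n)"
  by (rule baer_moduleD[OF E])

lemma \<delta>_closed [simp]: "x \<in> carrier (E n) \<Longrightarrow> \<delta> n x \<in> carrier (E (Suc n))"
  by (rule module_hom_closed[OF \<delta>])

lemma \<delta>\<delta> [simp]: "x \<in> carrier (E n) \<Longrightarrow> \<delta> (Suc n) (\<delta> n x) = \<zero>\<^bsub>E (Suc (Suc n))\<^esub>"
  using exactE[of n] by blast

lemma \<delta>_zero [simp]: "\<delta> n \<zero>\<^bsub>E n\<^esub> = \<zero>\<^bsub>E (Suc n)\<^esub>"
  by (rule module_hom_zero[OF Em Em \<delta>])

end

text \<open>
  The double complex of homomorphisms from \<open>P\<close> to \<open>E\<close>. Exactness of \<open>P\<close> in positive degrees allows
  extending along \<open>d\<close>, and projectivity of \<open>P\<close> allows lifting along \<open>\<delta>\<close>.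
\<close>

locale hom_double_complex = baer_complex R E \<delta>
  for R :: "('a, 'r) ring_scheme" and E :: "nat \<Rightarrow> ('a, 'e) module" and \<delta> +
  fixes P :: "nat \<Rightarrow> ('a, 'p) module" and d :: "nat \<Rightarrow> 'p \<Rightarrow> 'p"
  assumes Pm: "\<And>n. module R (P n)"
    and d: "\<And>n. d n \<in> module_hom R (P (Suc n)) (P n)"
    and exactP: "\<And>n. d (Suc n) ` carrier (P (Suc (Suc n))) = hom_kernel (P (Suc n)) (P n) (d n)"
    and lift: "\<And>j i f. f \<in> module_hom R (P j) (E (Suc i)) \<Longrightarrow>
      \<forall>p\<in>carrier (P j). \<delta> (Suc i) (f p) = \<zero>\<^bsub>E (Suc (Suc i))\<^esub> \<Longrightarrow>
      \<exists>h\<in>module_hom R (P j) (E i). \<forall>p\<in>carrier (P j). \<delta> i (h p) = f p"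
begin

lemma d_closed [simp]: "p \<in> carrier (P (Suc n)) \<Longrightarrow> d n p \<in> carrier (P n)"
  by (rule module_hom_closed[OF d])

lemma dd [simp]: "p \<in> carrier (P (Suc (Suc n))) \<Longrightarrow> d n (d (Suc n) p) = \<zero>\<^bsub>P n\<^esub>"
  using exactP[of n] by blast

definition row_cocycle :: "nat \<Rightarrow> nat \<Rightarrow> ('p \<Rightarrow> 'e) \<Rightarrow> bool" where
  "row_cocycle j i f \<longleftrightarrow> f \<in> module_hom R (P j) (E i) \<and> (\<forall>p\<in>carrier (P j). \<delta> i (f p) = \<zero>\<^bsub>E (Suc i)\<^esub>)"

definition column_cocycle :: "nat \<Rightarrow> nat \<Rightarrow> ('p \<Rightarrow> 'e) \<Rightarrow> bool" where
  "column_cocycle j i f \<longleftrightarrow> f \<in> module_hom R (P j) (E i) \<and> (\<forall>p\<in>carrier (P (Suc j)). f (d j p) = \<zero>\<^bsub>E i\<^esub>)"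

text \<open>
  Both conditions express that multiplication by \<open>x\<close> is surjective on an Ext group, once computed in
  the direction of \<open>E\<close> and once in the direction of \<open>P\<close>; for \<open>x = 0\<close> this is vanishing.
\<close>

definition row_generated :: "'a \<Rightarrow> nat \<Rightarrow> nat \<Rightarrow> bool" where
  "row_generated x j i \<longleftrightarrow> (\<forall>f. row_cocycle j (Suc i) f \<and> column_cocycle j (Suc i) f \<longrightarrow>
     (\<exists>g h. row_cocycle j (Suc i) g \<and> column_cocycle j (Suc i) g \<and> column_cocycle j i h \<and>
       (\<forall>p\<in>carrier (P j). f p = x \<odot>\<^bsub>E (Suc i)\<^esub> g p \<oplus>\<^bsub>E (Suc i)\<^esub> \<delta> i (h p))))"

definition column_generated :: "'a \<Rightarrow> nat \<Rightarrow> nat \<Rightarrow> bool" where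
  "column_generated x j i \<longleftrightarrow> (\<forall>f. row_cocycle (Suc j) i f \<and> column_cocycle (Suc j) i f \<longrightarrow>
     (\<exists>g h. row_cocycle (Suc j) i g \<and> column_cocycle (Suc j) i g \<and> row_cocycle j i h \<and>
       (\<forall>p\<in>carrier (P (Suc j)). f p = x \<odot>\<^bsub>E i\<^esub> g p \<oplus>\<^bsub>E i\<^esub> h (d j p))))"

lemma extend:
  assumes "column_cocycle (Suc j) i h"
  obtains h' where "h' \<in> module_hom R (P j) (E i)" "\<forall>p\<in>carrier (P (Suc j)). h' (d j p) = h p"
proof -
  have h: "h \<in> module_hom R (P (Suc j)) (E i)" using assms by (simp add: column_cocycle_def)
  have "h p = \<zero>\<^bsub>E i\<^esub>" if p: "p \<in> carrier (P (Suc j))" "d j p = \<zero>\<^bsub>P j\<^esub>" for p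
  proof -
    have "p \<in> d (Suc j) ` carrier (P (Suc (Suc j)))" unfolding exactP using p by simp
    then show ?thesis using assms by (auto simp: column_cocycle_def)
  qed
  then obtain h' where "h' \<in> module_hom R (P j) (E i)" "\<And>p. p \<in> carrier (P (Suc j)) \<Longrightarrow> h' (d j p) = h p"
    using baer_extend[OF E Pm Pm d h] by metis
  then show thesis using that by simp
qed

lemma lift_row:
  assumes "row_cocycle j (Suc i) f"
  obtains h where "h \<in> module_hom R (P j) (E i)" "\<forall>p\<in>carrier (P j). \<delta> i (h p) = f p"
  using lift[of f j i] assms unfolding row_cocycle_def by blast

lemma pull_cocycle:
  assumes h: "h \<in> module_hom R (P j) (E i)" and z: "\<forall>p\<in>carrier (P (Suc j)). \<delta> i (h (d j p)) = \<zero>\<^bsub>E (Suc i)\<^esub>"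
  shows "row_cocycle (Suc j) i (\<lambda>p. h (d j p))" "column_cocycle (Suc j) i (\<lambda>p. h (d j p))"
  using module_hom_comp[OF d h] z module_hom_zero[OF Pm Em h]
  by (simp_all add: row_cocycle_def column_cocycle_def)

lemma push_cocycle:
  assumes h: "h \<in> module_hom R (P j) (E i)" and z: "\<forall>p\<in>carrier (P (Suc j)). \<delta> i (h (d j p)) = \<zero>\<^bsub>E (Suc i)\<^esub>"
  shows "row_cocycle j (Suc i) (\<lambda>p. \<delta> i (h p))" "column_cocycle j (Suc i) (\<lambda>p. \<delta> i (h p))"
  using module_hom_comp[OF h \<delta>] z module_hom_closed[OF h]
  by (simp_all add: row_cocycle_def column_cocycle_def)

text \<open>
  A cocycle \<open>\<phi>\<close> in degree \<open>(j + 1, i)\<close> extends along \<open>d\<close> to some \<open>h\<close>, and \<open>\<delta> h\<close> is a cocycle in degree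
  \<open>(j, i + 1)\<close>; conversely a cocycle there lifts along \<open>\<delta>\<close> to some \<open>h\<close>, and \<open>h d\<close> is a cocycle in degree
  \<open>(j + 1, i)\<close>. This correspondence is linear and inverts itself up to coboundaries.
\<close>

lemma row_iff_column:
  assumes x: "x \<in> carrier R"
  shows "row_generated x j i \<longleftrightarrow> column_generated x j i"
proof
  interpret Ei: module R "E i" by (rule Em)
  interpret Es: module R "E (Suc i)" by (rule Em)
  assume A: "row_generated x j i"
  show "column_generated x j i"
    unfolding column_generated_def
  proof (intro allI impI, elim conjE)
    fix \<phi> assume \<phi>: "row_cocycle (Suc j) i \<phi>" "column_cocycle (Suc j) i \<phi>"
    obtain h where h: "h \<in> module_hom R (P j) (E i)" "\<forall>p\<in>carrier (P (Suc j)). h (d j p) = \<phi> p"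
      by (rule extend[OF \<phi>(2)])
    have z: "\<forall>p\<in>carrier (P (Suc j)). \<delta> i (h (d j p)) = \<zero>\<^bsub>E (Suc i)\<^esub>"
      using h(2) \<phi>(1) by (simp add: row_cocycle_def)
    obtain g l where g: "row_cocycle j (Suc i) g" "column_cocycle j (Suc i) g" and l: "column_cocycle j i l"
      and hgl: "\<forall>p\<in>carrier (P j). \<delta> i (h p) = x \<odot>\<^bsub>E (Suc i)\<^esub> g p \<oplus>\<^bsub>E (Suc i)\<^esub> \<delta> i (l p)"
      using A[unfolded row_generated_def, THEN spec, of "\<lambda>p. \<delta> i (h p)"] push_cocycle[OF h(1) z] by blast
    obtain g' where g': "g' \<in> module_hom R (P j) (E i)" "\<forall>p\<in>carrier (P j). \<delta> i (g' p) = g p"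
      by (rule lift_row[OF g(1)])
    have lh: "l \<in> module_hom R (P j) (E i)" using l by (simp add: column_cocycle_def)
    note cl = module_hom_closed[OF h(1)] module_hom_closed[OF g'(1)] module_hom_closed[OF lh]
    let ?s = "\<lambda>p. x \<odot>\<^bsub>E i\<^esub> g' p \<oplus>\<^bsub>E i\<^esub> l p"
    let ?k = "\<lambda>p. h p \<ominus>\<^bsub>E i\<^esub> ?s p"
    have s: "?s \<in> module_hom R (P j) (E i)"
      by (intro module_hom_plus[OF Em] module_hom_scale[OF Em] g'(1) lh x)
    have k: "?k \<in> module_hom R (P j) (E i)" by (rule module_hom_diff[OF Em h(1) s])
    have "\<delta> i (?k p) = \<zero>\<^bsub>E (Suc i)\<^esub>" if p: "p \<in> carrier (P j)" for p
    proof -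
      have "\<delta> i (?s p) = \<delta> i (h p)"
        using p x cl hgl g'(2) by (simp add: module_hom_add[OF \<delta>] module_hom_smult[OF \<delta>])
      then show ?thesis
        using p x cl by (simp add: module_hom_minus[OF Em Em \<delta>] Es.minus_self)
    qed
    then have kc: "row_cocycle j i ?k" using k by (simp add: row_cocycle_def)
    have "\<forall>p\<in>carrier (P (Suc j)). \<delta> i (g' (d j p)) = \<zero>\<^bsub>E (Suc i)\<^esub>"
      using g'(2) g(2) by (simp add: column_cocycle_def)
    note G = pull_cocycle[OF g'(1) this]
    have "\<phi> p = x \<odot>\<^bsub>E i\<^esub> g' (d j p) \<oplus>\<^bsub>E i\<^esub> ?k (d j p)" if p: "p \<in> carrier (P (Suc j))" for p
      using cl(1)[of "d j p"] p x cl l h(2) Ei.add_minus_cancel[of "h (d j p)" "x \<odot>\<^bsub>E i\<^esub> g' (d j p)"]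
      by (simp add: column_cocycle_def)
    then show "\<exists>g h. row_cocycle (Suc j) i g \<and> column_cocycle (Suc j) i g \<and> row_cocycle j i h \<and>
       (\<forall>p\<in>carrier (P (Suc j)). \<phi> p = x \<odot>\<^bsub>E i\<^esub> g p \<oplus>\<^bsub>E i\<^esub> h (d j p))"
      using G kc by (intro exI[of _ "\<lambda>p. g' (d j p)"] exI[of _ ?k]) simp
  qed
next
  interpret Ei: module R "E i" by (rule Em)
  interpret Es: module R "E (Suc i)" by (rule Em)
  assume B: "column_generated x j i"
  show "row_generated x j i"
    unfolding row_generated_def
  proof (intro allI impI, elim conjE)
    fix f assume f: "row_cocycle j (Suc i) f" "column_cocycle j (Suc i) f"
    obtain h where h: "h \<in> module_hom R (P j) (E i)" "\<forall>p\<in>carrier (P j). \<delta> i (h p) = f p"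
      by (rule lift_row[OF f(1)])
    have z: "\<forall>p\<in>carrier (P (Suc j)). \<delta> i (h (d j p)) = \<zero>\<^bsub>E (Suc i)\<^esub>"
      using h(2) f(2) by (simp add: column_cocycle_def)
    obtain g l where g: "row_cocycle (Suc j) i g" "column_cocycle (Suc j) i g" and l: "row_cocycle j i l"
      and hgl: "\<forall>p\<in>carrier (P (Suc j)). h (d j p) = x \<odot>\<^bsub>E i\<^esub> g p \<oplus>\<^bsub>E i\<^esub> l (d j p)"
      using B[unfolded column_generated_def, THEN spec, of "\<lambda>p. h (d j p)"] pull_cocycle[OF h(1) z] by blast
    obtain g' where g': "g' \<in> module_hom R (P j) (E i)" "\<forall>p\<in>carrier (P (Suc j)). g' (d j p) = g p"
      by (rule extend[OF g(2)])
    have lh: "l \<in> module_hom R (P j) (E i)" using l by (simp add: row_cocycle_def)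
    note cl = module_hom_closed[OF h(1)] module_hom_closed[OF g'(1)] module_hom_closed[OF lh]
    let ?s = "\<lambda>p. x \<odot>\<^bsub>E i\<^esub> g' p \<oplus>\<^bsub>E i\<^esub> l p"
    let ?k = "\<lambda>p. h p \<ominus>\<^bsub>E i\<^esub> ?s p"
    have s: "?s \<in> module_hom R (P j) (E i)"
      by (intro module_hom_plus[OF Em] module_hom_scale[OF Em] g'(1) lh x)
    have k: "?k \<in> module_hom R (P j) (E i)" by (rule module_hom_diff[OF Em h(1) s])
    have "?k (d j p) = \<zero>\<^bsub>E i\<^esub>" if p: "p \<in> carrier (P (Suc j))" for p
    proof -
      have "?s (d j p) = h (d j p)" using p hgl g'(2) by simp
      then show ?thesis using p cl by (simp add: Ei.minus_self)
    qed
    then have kc: "column_cocycle j i ?k" using k by (simp add: column_cocycle_def)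
    have "\<forall>p\<in>carrier (P (Suc j)). \<delta> i (g' (d j p)) = \<zero>\<^bsub>E (Suc i)\<^esub>"
      using g'(2) g(1) by (simp add: row_cocycle_def)
    note G = push_cocycle[OF g'(1) this]
    have "f p = x \<odot>\<^bsub>E (Suc i)\<^esub> \<delta> i (g' p) \<oplus>\<^bsub>E (Suc i)\<^esub> \<delta> i (?k p)" if p: "p \<in> carrier (P j)" for p
    proof -
      have "\<delta> i (?k p) = f p \<ominus>\<^bsub>E (Suc i)\<^esub> x \<odot>\<^bsub>E (Suc i)\<^esub> \<delta> i (g' p)"
        using p x cl h(2) l
        by (simp add: row_cocycle_def module_hom_minus[OF Em Em \<delta>] module_hom_add[OF \<delta>] module_hom_smult[OF \<delta>])
      moreover have "f p \<in> carrier (E (Suc i))" using f(1) p by (auto simp: row_cocycle_def intro: module_hom_closed)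
      ultimately show ?thesis
        using p x cl Es.add_minus_cancel[of "f p" "x \<odot>\<^bsub>E (Suc i)\<^esub> \<delta> i (g' p)"] by simp
    qed
    then show "\<exists>g h. row_cocycle j (Suc i) g \<and> column_cocycle j (Suc i) g \<and> column_cocycle j i h \<and>
       (\<forall>p\<in>carrier (P j). f p = x \<odot>\<^bsub>E (Suc i)\<^esub> g p \<oplus>\<^bsub>E (Suc i)\<^esub> \<delta> i (h p))"
      using G kc by (intro exI[of _ "\<lambda>p. \<delta> i (g' p)"] exI[of _ ?k]) simp
  qed
qed

text \<open>
  In positive rows the row condition and the column condition in the same degree coincide: a column
  boundary of a row cocycle is a row boundary of a column cocycle, by lifting the row cocycle.
\<close>

lemma column_iff_row_shift:
  assumes x: "x \<in> carrier R"
  shows "column_generated x j (Suc i) \<longleftrightarrow> row_generated x (Suc j) i"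
proof
  assume B: "column_generated x j (Suc i)"
  show "row_generated x (Suc j) i"
    unfolding row_generated_def
  proof (intro allI impI)
    fix f assume f: "row_cocycle (Suc j) (Suc i) f \<and> column_cocycle (Suc j) (Suc i) f"
    obtain g h where g: "row_cocycle (Suc j) (Suc i) g" "column_cocycle (Suc j) (Suc i) g"
      and h: "row_cocycle j (Suc i) h"
      and eq: "\<forall>p\<in>carrier (P (Suc j)). f p = x \<odot>\<^bsub>E (Suc i)\<^esub> g p \<oplus>\<^bsub>E (Suc i)\<^esub> h (d j p)"
      using B[unfolded column_generated_def, THEN spec, of f] f by blast
    obtain h' where h': "h' \<in> module_hom R (P j) (E i)" "\<forall>p\<in>carrier (P j). \<delta> i (h' p) = h p"
      by (rule lift_row[OF h])
    have "column_cocycle (Suc j) i (\<lambda>p. h' (d j p))"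
      using module_hom_comp[OF d h'(1)] module_hom_zero[OF Pm Em h'(1)] by (simp add: column_cocycle_def)
    then show "\<exists>g h. row_cocycle (Suc j) (Suc i) g \<and> column_cocycle (Suc j) (Suc i) g \<and>
       column_cocycle (Suc j) i h \<and>
       (\<forall>p\<in>carrier (P (Suc j)). f p = x \<odot>\<^bsub>E (Suc i)\<^esub> g p \<oplus>\<^bsub>E (Suc i)\<^esub> \<delta> i (h p))"
      using g eq h'(2) by (intro exI[of _ g] exI[of _ "\<lambda>p. h' (d j p)"]) simp
  qed
next
  assume A: "row_generated x (Suc j) i"
  show "column_generated x j (Suc i)"
    unfolding column_generated_def
  proof (intro allI impI)
    fix f assume f: "row_cocycle (Suc j) (Suc i) f \<and> column_cocycle (Suc j) (Suc i) f"
    obtain g h where g: "row_cocycle (Suc j) (Suc i) g" "column_cocycle (Suc j) (Suc i) g"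
      and h: "column_cocycle (Suc j) i h"
      and eq: "\<forall>p\<in>carrier (P (Suc j)). f p = x \<odot>\<^bsub>E (Suc i)\<^esub> g p \<oplus>\<^bsub>E (Suc i)\<^esub> \<delta> i (h p)"
      using A[unfolded row_generated_def, THEN spec, of f] f by blast
    obtain h' where h': "h' \<in> module_hom R (P j) (E i)" "\<forall>p\<in>carrier (P (Suc j)). h' (d j p) = h p"
      by (rule extend[OF h])
    have "row_cocycle j (Suc i) (\<lambda>p. \<delta> i (h' p))"
      using module_hom_comp[OF h'(1) \<delta>] module_hom_closed[OF h'(1)] by (simp add: row_cocycle_def)
    then show "\<exists>g h. row_cocycle (Suc j) (Suc i) g \<and> column_cocycle (Suc j) (Suc i) g \<and>
       row_cocycle j (Suc i) h \<and>
       (\<forall>p\<in>carrier (P (Suc j)). f p = x \<odot>\<^bsub>E (Suc i)\<^esub> g p \<oplus>\<^bsub>E (Suc i)\<^esub> h (d j p))"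
      using g eq h'(2) by (intro exI[of _ g] exI[of _ "\<lambda>p. \<delta> i (h' p)"]) simp
  qed
qed

text \<open>
  One step of the zigzag from the row of \<open>Hom(P 0, E)\<close> to the column of \<open>Hom(P, E 0)\<close> lowers the row
  by one and raises the column by one.
\<close>

theorem balance:
  assumes x: "x \<in> carrier R"
  shows "row_generated x 0 n \<longleftrightarrow> column_generated x n 0"
proof -
  have "row_generated x j i \<longleftrightarrow> column_generated x (j + i) 0" for i j
  proof (induction i arbitrary: j)
    case 0
    show ?case using row_iff_column[OF x, of j 0] by simp
  next
    case (Suc i)
    have "row_generated x j (Suc i) \<longleftrightarrow> row_generated x (Suc j) i"
      using row_iff_column[OF x] column_iff_row_shift[OF x] by simp
    then show ?case using Suc.IH[of "Suc j"] by simp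
  qed
  from this[of 0 n] show ?thesis by simp
qed

end

section \<open>Vanishing of Ext on subquotients\<close>

text \<open>
  \<open>ext_vanishes M n K K'\<close> is the vanishing of \<open>Ext\<close> in degree \<open>n + 1\<close> on \<open>K/K'\<close>. Homomorphisms on
  \<open>K/K'\<close> extend to \<open>M/K'\<close> because the modules \<open>E n\<close> are injective, so it is enough to speak about
  homomorphisms on \<open>M\<close>; no restriction of maps is then needed in the diagram chases.
\<close>

context baer_complex
begin

definition ext_vanishes :: "('a, 'b, 'm) module_scheme \<Rightarrow> nat \<Rightarrow> 'b set \<Rightarrow> 'b set \<Rightarrow> bool" where
  "ext_vanishes M n K K' \<longleftrightarrow> (\<forall>f\<in>module_hom R M (E (Suc n)).
     (\<forall>k\<in>K'. f k = \<zero>\<^bsub>E (Suc n)\<^esub>) \<and> (\<forall>k\<in>K. \<delta> (Suc n) (f k) = \<zero>\<^bsub>E (Suc (Suc n))\<^esub>) \<longrightarrow>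
     (\<exists>g\<in>module_hom R M (E n). (\<forall>k\<in>K'. g k = \<zero>\<^bsub>E n\<^esub>) \<and> (\<forall>k\<in>K. \<delta> n (g k) = f k)))"

definition ext_eventually_vanishes :: "('a, 'b, 'm) module_scheme \<Rightarrow> 'b set \<Rightarrow> 'b set \<Rightarrow> bool" where
  "ext_eventually_vanishes M K K' \<longleftrightarrow> (\<exists>n0. \<forall>n\<ge>n0. ext_vanishes M n K K')"

lemma ext_vanishesI:
  assumes "\<And>f. f \<in> module_hom R M (E (Suc n)) \<Longrightarrow> \<forall>k\<in>K'. f k = \<zero>\<^bsub>E (Suc n)\<^esub> \<Longrightarrow>
      \<forall>k\<in>K. \<delta> (Suc n) (f k) = \<zero>\<^bsub>E (Suc (Suc n))\<^esub> \<Longrightarrow>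
      \<exists>g\<in>module_hom R M (E n). (\<forall>k\<in>K'. g k = \<zero>\<^bsub>E n\<^esub>) \<and> (\<forall>k\<in>K. \<delta> n (g k) = f k)"
  shows "ext_vanishes M n K K'"
  using assms by (simp add: ext_vanishes_def)

lemma ext_vanishesE:
  assumes "ext_vanishes M n K K'" "f \<in> module_hom R M (E (Suc n))" "\<forall>k\<in>K'. f k = \<zero>\<^bsub>E (Suc n)\<^esub>"
    "\<forall>k\<in>K. \<delta> (Suc n) (f k) = \<zero>\<^bsub>E (Suc (Suc n))\<^esub>"
  obtains g where "g \<in> module_hom R M (E n)" "\<forall>k\<in>K'. g k = \<zero>\<^bsub>E n\<^esub>" "\<forall>k\<in>K. \<delta> n (g k) = f k"
  using assms unfolding ext_vanishes_def by blast

context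
  fixes M :: "('a, 'b, 'm) module_scheme" and K K' K'' :: "'b set"
  assumes M: "module R M" and sub: "K'' \<subseteq> K'" "K' \<subseteq> K" "K \<subseteq> carrier M"
begin

text \<open>
  This lemma and the next two express the exactness of the long exact sequence of \<open>K'/K''\<close>, \<open>K/K''\<close> and \<open>K/K'\<close>
  around two vanishing terms. Connecting homomorphisms need no construction: if a map \<open>f\<close> on \<open>M\<close>
  is a cocycle on \<open>K'\<close>, then \<open>\<delta> f\<close> represents the image of its class.
\<close>

lemma ext_vanishes_extension:
  assumes V1: "ext_vanishes M n K' K''" and V2: "ext_vanishes M n K K'"
  shows "ext_vanishes M n K K''"
proof (rule ext_vanishesI)
  interpret Es: module R "E (Suc n)" by (rule Em)
  interpret En: module R "E n" by (rule Em)
  fix f assume f: "f \<in> module_hom R M (E (Suc n))" "\<forall>k\<in>K''. f k = \<zero>\<^bsub>E (Suc n)\<^esub>"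
    "\<forall>k\<in>K. \<delta> (Suc n) (f k) = \<zero>\<^bsub>E (Suc (Suc n))\<^esub>"
  have "\<forall>k\<in>K'. \<delta> (Suc n) (f k) = \<zero>\<^bsub>E (Suc (Suc n))\<^esub>" using f(3) sub by blast
  then obtain g where g: "g \<in> module_hom R M (E n)" "\<forall>k\<in>K''. g k = \<zero>\<^bsub>E n\<^esub>" "\<forall>k\<in>K'. \<delta> n (g k) = f k"
    by (rule ext_vanishesE[OF V1 f(1,2)])
  let ?f = "\<lambda>k. f k \<ominus>\<^bsub>E (Suc n)\<^esub> \<delta> n (g k)"
  have fh: "?f \<in> module_hom R M (E (Suc n))" by (rule module_hom_diff[OF Em f(1) module_hom_comp[OF g(1) \<delta>]])
  have cl: "f k \<in> carrier (E (Suc n))" "g k \<in> carrier (E n)" "k \<in> carrier M" if "k \<in> K" for k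
    using that sub module_hom_closed[OF f(1)] module_hom_closed[OF g(1)] by blast+
  have 1: "\<forall>k\<in>K'. ?f k = \<zero>\<^bsub>E (Suc n)\<^esub>" using g(3) cl sub by (auto simp: Es.minus_self)
  interpret Ess: module R "E (Suc (Suc n))" by (rule Em)
  have 2: "\<forall>k\<in>K. \<delta> (Suc n) (?f k) = \<zero>\<^bsub>E (Suc (Suc n))\<^esub>"
    using f(3) cl by (simp add: module_hom_minus[OF Em Em \<delta>] Ess.minus_self)
  obtain h where h: "h \<in> module_hom R M (E n)" "\<forall>k\<in>K'. h k = \<zero>\<^bsub>E n\<^esub>" "\<forall>k\<in>K. \<delta> n (h k) = ?f k"
    by (rule ext_vanishesE[OF V2 fh 1 2])
  have hc: "h k \<in> carrier (E n)" if "k \<in> K" for k using that cl module_hom_closed[OF h(1)] by blast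
  show "\<exists>g\<in>module_hom R M (E n). (\<forall>k\<in>K''. g k = \<zero>\<^bsub>E n\<^esub>) \<and> (\<forall>k\<in>K. \<delta> n (g k) = f k)"
  proof (intro bexI conjI ballI)
    show "(\<lambda>k. g k \<oplus>\<^bsub>E n\<^esub> h k) \<in> module_hom R M (E n)" by (rule module_hom_plus[OF Em g(1) h(1)])
    show "g k \<oplus>\<^bsub>E n\<^esub> h k = \<zero>\<^bsub>E n\<^esub>" if "k \<in> K''" for k
    proof -
      have "k \<in> K'" using that sub by blast
      then show ?thesis using that g(2) h(2) by simp
    qed
    show "\<delta> n (g k \<oplus>\<^bsub>E n\<^esub> h k) = f k" if "k \<in> K" for k
      using that h(3) cl hc by (simp add: module_hom_add[OF \<delta>] Es.add_minus_cancel)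
  qed
qed

lemma ext_vanishes_sub:
  assumes V1: "ext_vanishes M n K K''" and V2: "ext_vanishes M (Suc n) K K'"
  shows "ext_vanishes M n K' K''"
proof (rule ext_vanishesI)
  interpret Es: module R "E (Suc n)" by (rule Em)
  interpret Ess: module R "E (Suc (Suc n))" by (rule Em)
  fix f assume f: "f \<in> module_hom R M (E (Suc n))" "\<forall>k\<in>K''. f k = \<zero>\<^bsub>E (Suc n)\<^esub>"
    "\<forall>k\<in>K'. \<delta> (Suc n) (f k) = \<zero>\<^bsub>E (Suc (Suc n))\<^esub>"
  have fc: "f k \<in> carrier (E (Suc n))" if "k \<in> K" for k
    using that sub module_hom_closed[OF f(1)] by blast
  have 1: "\<forall>k\<in>K. \<delta> (Suc (Suc n)) (\<delta> (Suc n) (f k)) = \<zero>\<^bsub>E (Suc (Suc (Suc n)))\<^esub>" using fc by simp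
  obtain h where h: "h \<in> module_hom R M (E (Suc n))" "\<forall>k\<in>K'. h k = \<zero>\<^bsub>E (Suc n)\<^esub>"
      "\<forall>k\<in>K. \<delta> (Suc n) (h k) = \<delta> (Suc n) (f k)"
    by (rule ext_vanishesE[OF V2 module_hom_comp[OF f(1) \<delta>] f(3) 1])
  let ?f = "\<lambda>k. f k \<ominus>\<^bsub>E (Suc n)\<^esub> h k"
  have fh: "?f \<in> module_hom R M (E (Suc n))" by (rule module_hom_diff[OF Em f(1) h(1)])
  have hc: "h k \<in> carrier (E (Suc n))" if "k \<in> K" for k
    using that sub module_hom_closed[OF h(1)] by blast
  have 2: "\<forall>k\<in>K''. ?f k = \<zero>\<^bsub>E (Suc n)\<^esub>"
  proof
    fix k assume k: "k \<in> K''"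
    then have "k \<in> K'" using sub by blast
    then show "?f k = \<zero>\<^bsub>E (Suc n)\<^esub>" using k f(2) h(2) by (simp add: Es.minus_self)
  qed
  have 3: "\<forall>k\<in>K. \<delta> (Suc n) (?f k) = \<zero>\<^bsub>E (Suc (Suc n))\<^esub>"
    using h(3) fc hc by (simp add: module_hom_minus[OF Em Em \<delta>] Ess.minus_self)
  obtain g where g: "g \<in> module_hom R M (E n)" "\<forall>k\<in>K''. g k = \<zero>\<^bsub>E n\<^esub>" "\<forall>k\<in>K. \<delta> n (g k) = ?f k"
    by (rule ext_vanishesE[OF V1 fh 2 3])
  have "\<delta> n (g k) = f k" if k: "k \<in> K'" for k
  proof -
    have "k \<in> K" using k sub by blast
    then show ?thesis using g(3) h(2) k fc Es.add_minus_cancel[of "f k" "\<zero>\<^bsub>E (Suc n)\<^esub>"] by simp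
  qed
  then show "\<exists>g\<in>module_hom R M (E n). (\<forall>k\<in>K''. g k = \<zero>\<^bsub>E n\<^esub>) \<and> (\<forall>k\<in>K'. \<delta> n (g k) = f k)"
    using g(1,2) by blast
qed

lemma ext_vanishes_quot:
  assumes V1: "ext_vanishes M (Suc n) K K''" and V2: "ext_vanishes M n K' K''"
  shows "ext_vanishes M (Suc n) K K'"
proof (rule ext_vanishesI)
  interpret Es: module R "E (Suc n)" by (rule Em)
  interpret Ess: module R "E (Suc (Suc n))" by (rule Em)
  fix f assume f: "f \<in> module_hom R M (E (Suc (Suc n)))" "\<forall>k\<in>K'. f k = \<zero>\<^bsub>E (Suc (Suc n))\<^esub>"
    "\<forall>k\<in>K. \<delta> (Suc (Suc n)) (f k) = \<zero>\<^bsub>E (Suc (Suc (Suc n)))\<^esub>"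
  have 1: "\<forall>k\<in>K''. f k = \<zero>\<^bsub>E (Suc (Suc n))\<^esub>" using f(2) sub by blast
  obtain g where g: "g \<in> module_hom R M (E (Suc n))" "\<forall>k\<in>K''. g k = \<zero>\<^bsub>E (Suc n)\<^esub>"
      "\<forall>k\<in>K. \<delta> (Suc n) (g k) = f k"
    by (rule ext_vanishesE[OF V1 f(1) 1 f(3)])
  have 2: "\<forall>k\<in>K'. \<delta> (Suc n) (g k) = \<zero>\<^bsub>E (Suc (Suc n))\<^esub>"
  proof
    fix k assume k: "k \<in> K'"
    then have "k \<in> K" using sub by blast
    then show "\<delta> (Suc n) (g k) = \<zero>\<^bsub>E (Suc (Suc n))\<^esub>" using k f(2) g(3) by simp
  qed
  obtain h where h: "h \<in> module_hom R M (E n)" "\<forall>k\<in>K''. h k = \<zero>\<^bsub>E n\<^esub>" "\<forall>k\<in>K'. \<delta> n (h k) = g k"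
    by (rule ext_vanishesE[OF V2 g(1,2) 2])
  have cl: "g k \<in> carrier (E (Suc n))" "h k \<in> carrier (E n)" "f k \<in> carrier (E (Suc (Suc n)))" if "k \<in> K" for k
    using that sub module_hom_closed[OF g(1)] module_hom_closed[OF h(1)] module_hom_closed[OF f(1)] by blast+
  let ?g = "\<lambda>k. g k \<ominus>\<^bsub>E (Suc n)\<^esub> \<delta> n (h k)"
  have gh: "?g \<in> module_hom R M (E (Suc n))" by (rule module_hom_diff[OF Em g(1) module_hom_comp[OF h(1) \<delta>]])
  have 3: "\<forall>k\<in>K'. ?g k = \<zero>\<^bsub>E (Suc n)\<^esub>" using h(3) cl sub by (auto simp: Es.minus_self)
  have "\<delta> (Suc n) (?g k) = f k" if k: "k \<in> K" for k
    using g(3) cl[OF k] k Ess.add_minus_cancel[of "f k" "\<zero>\<^bsub>E (Suc (Suc n))\<^esub>"]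
    by (simp add: module_hom_minus[OF Em Em \<delta>])
  then show "\<exists>g\<in>module_hom R M (E (Suc n)). (\<forall>k\<in>K'. g k = \<zero>\<^bsub>E (Suc n)\<^esub>) \<and> (\<forall>k\<in>K. \<delta> (Suc n) (g k) = f k)"
    using gh 3 by (intro bexI[of _ ?g]) simp_all
qed

lemma ext_eventually_two_of_three:
  shows "ext_eventually_vanishes M K' K'' \<Longrightarrow> ext_eventually_vanishes M K K' \<Longrightarrow> ext_eventually_vanishes M K K''"
    and "ext_eventually_vanishes M K K'' \<Longrightarrow> ext_eventually_vanishes M K K' \<Longrightarrow> ext_eventually_vanishes M K' K''"
    and "ext_eventually_vanishes M K K'' \<Longrightarrow> ext_eventually_vanishes M K' K'' \<Longrightarrow> ext_eventually_vanishes M K K'"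
proof -
  assume "ext_eventually_vanishes M K' K''" "ext_eventually_vanishes M K K'"
  then obtain a b where ab: "\<forall>n\<ge>a. ext_vanishes M n K' K''" "\<forall>n\<ge>b. ext_vanishes M n K K'"
    by (auto simp: ext_eventually_vanishes_def)
  have "\<forall>n\<ge>max a b. ext_vanishes M n K K''"
    using ab by (intro allI impI ext_vanishes_extension) simp_all
  then show "ext_eventually_vanishes M K K''" unfolding ext_eventually_vanishes_def ..
next
  assume "ext_eventually_vanishes M K K''" "ext_eventually_vanishes M K K'"
  then obtain a b where ab: "\<forall>n\<ge>a. ext_vanishes M n K K''" "\<forall>n\<ge>b. ext_vanishes M n K K'"
    by (auto simp: ext_eventually_vanishes_def)
  have "\<forall>n\<ge>max a b. ext_vanishes M n K' K''"
    using ab by (intro allI impI ext_vanishes_sub) simp_all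
  then show "ext_eventually_vanishes M K' K''" unfolding ext_eventually_vanishes_def ..
next
  assume "ext_eventually_vanishes M K K''" "ext_eventually_vanishes M K' K''"
  then obtain a b where ab: "\<forall>n\<ge>a. ext_vanishes M n K K''" "\<forall>n\<ge>b. ext_vanishes M n K' K''"
    by (auto simp: ext_eventually_vanishes_def)
  have "ext_vanishes M n K K'" if n: "n \<ge> Suc (max a b)" for n
  proof -
    obtain k where k: "n = Suc k" using n by (cases n) auto
    show ?thesis unfolding k using ab n k by (intro ext_vanishes_quot) simp_all
  qed
  then show "ext_eventually_vanishes M K K'" unfolding ext_eventually_vanishes_def by blast
qed

end

text \<open>Multiplication by \<open>u\<close> identifies \<open>L/(K : u)\<close> with \<open>(K + u L)/K\<close>.\<close>

lemma divide_hom: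
  assumes M: "module R M" and K: "submodule K R M" and u: "u \<in> carrier R"
    and f: "f \<in> module_hom R M (E n)" and fK: "\<forall>x\<in>colon M K u. f x = \<zero>\<^bsub>E n\<^esub>"
  obtains f' where "f' \<in> module_hom R M (E n)" "\<forall>k\<in>K. f' k = \<zero>\<^bsub>E n\<^esub>" "\<forall>x\<in>carrier M. f' (u \<odot>\<^bsub>M\<^esub> x) = f x"
proof -
  interpret M: module R M by fact
  let ?Q = "quot_module M K"
  have Q: "module R ?Q" by (rule quot_module_module[OF M K])
  have p: "proj_quot M K \<in> module_hom R M ?Q" by (rule proj_quot_hom[OF M K])
  have \<phi>: "(\<lambda>x. proj_quot M K (u \<odot>\<^bsub>M\<^esub> x)) \<in> module_hom R M ?Q"
    by (rule module_hom_comp[OF M.smult_self_hom[OF u] p])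
  have "f x = \<zero>\<^bsub>E n\<^esub>" if "x \<in> carrier M" "proj_quot M K (u \<odot>\<^bsub>M\<^esub> x) = \<zero>\<^bsub>?Q\<^esub>" for x
    using that fK u by (simp add: proj_quot_eq_zero_iff[OF M K] colon_def)
  then obtain h where h: "h \<in> module_hom R ?Q (E n)" "\<And>x. x \<in> carrier M \<Longrightarrow> h (proj_quot M K (u \<odot>\<^bsub>M\<^esub> x)) = f x"
    using baer_extend[OF E M Q \<phi> f] by metis
  have "h (proj_quot M K k) = \<zero>\<^bsub>E n\<^esub>" if "k \<in> K" for k
  proof -
    have "k \<in> carrier M" using that submodule_subset[OF K] by blast
    then have "proj_quot M K k = \<zero>\<^bsub>?Q\<^esub>" using proj_quot_eq_zero_iff[OF M K] that by simp
    then show ?thesis using module_hom_zero[OF Q Em h(1)] by simp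
  qed
  then show thesis using that[OF module_hom_comp[OF p h(1)]] h(2) by simp
qed

lemma ext_vanishes_multiple:
  assumes M: "module R M" and K: "submodule K R M" and L: "submodule L R M" and u: "u \<in> carrier R"
  shows "ext_vanishes M n L (colon M K u) \<longleftrightarrow> ext_vanishes M n (K <+>\<^bsub>M\<^esub> smult_image M u L) K"
proof
  interpret M: module R M by fact
  let ?T = "K <+>\<^bsub>M\<^esub> smult_image M u L"
  note Lc = submodule_subset[OF L] and Kc = submodule_subset[OF K]
  have T: "\<exists>k\<in>K. \<exists>l\<in>L. t = k \<oplus>\<^bsub>M\<^esub> u \<odot>\<^bsub>M\<^esub> l" if "t \<in> ?T" for t
    using that by (auto simp: set_add_iff smult_image_def)
  have uT: "u \<odot>\<^bsub>M\<^esub> l \<in> ?T" if "l \<in> L" for l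
    using M.sum_superset(2)[OF K M.smult_image_submodule[OF u L]] that by (auto simp: smult_image_def)
  {
    assume V: "ext_vanishes M n ?T K"
    show "ext_vanishes M n L (colon M K u)"
    proof (rule ext_vanishesI)
      fix f assume f: "f \<in> module_hom R M (E (Suc n))" "\<forall>x\<in>colon M K u. f x = \<zero>\<^bsub>E (Suc n)\<^esub>"
        "\<forall>k\<in>L. \<delta> (Suc n) (f k) = \<zero>\<^bsub>E (Suc (Suc n))\<^esub>"
      obtain f' where f': "f' \<in> module_hom R M (E (Suc n))" "\<forall>k\<in>K. f' k = \<zero>\<^bsub>E (Suc n)\<^esub>"
          "\<forall>x\<in>carrier M. f' (u \<odot>\<^bsub>M\<^esub> x) = f x"
        by (rule divide_hom[OF M K u f(1,2)])
      have 1: "\<forall>t\<in>?T. \<delta> (Suc n) (f' t) = \<zero>\<^bsub>E (Suc (Suc n))\<^esub>"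
      proof
        fix t assume "t \<in> ?T"
        then obtain k l where kl: "k \<in> K" "l \<in> L" "t = k \<oplus>\<^bsub>M\<^esub> u \<odot>\<^bsub>M\<^esub> l" using T by blast
        have c: "k \<in> carrier M" "l \<in> carrier M" using kl Lc Kc by blast+
        interpret Es: module R "E (Suc n)" by (rule Em)
        have "f' t = f l"
          using kl c u f'(2,3) module_hom_closed[OF f(1) c(2)] by (simp add: module_hom_add[OF f'(1)])
        then show "\<delta> (Suc n) (f' t) = \<zero>\<^bsub>E (Suc (Suc n))\<^esub>" using f(3) kl(2) by simp
      qed
      obtain g where g: "g \<in> module_hom R M (E n)" "\<forall>k\<in>K. g k = \<zero>\<^bsub>E n\<^esub>" "\<forall>k\<in>?T. \<delta> n (g k) = f' k"
        by (rule ext_vanishesE[OF V f'(1,2) 1])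
      show "\<exists>g\<in>module_hom R M (E n). (\<forall>k\<in>colon M K u. g k = \<zero>\<^bsub>E n\<^esub>) \<and> (\<forall>k\<in>L. \<delta> n (g k) = f k)"
      proof (intro bexI conjI ballI)
        show "(\<lambda>x. g (u \<odot>\<^bsub>M\<^esub> x)) \<in> module_hom R M (E n)" by (rule module_hom_comp[OF M.smult_self_hom[OF u] g(1)])
        show "g (u \<odot>\<^bsub>M\<^esub> x) = \<zero>\<^bsub>E n\<^esub>" if "x \<in> colon M K u" for x using that g(2) by (simp add: colon_def)
        show "\<delta> n (g (u \<odot>\<^bsub>M\<^esub> l)) = f l" if l: "l \<in> L" for l
        proof -
          have "l \<in> carrier M" using l Lc by blast
          then show ?thesis using g(3) uT[OF l] f'(3) by simp
        qed
      qed
    qed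
  next
    assume V: "ext_vanishes M n L (colon M K u)"
    show "ext_vanishes M n ?T K"
    proof (rule ext_vanishesI)
      fix f assume f: "f \<in> module_hom R M (E (Suc n))" "\<forall>k\<in>K. f k = \<zero>\<^bsub>E (Suc n)\<^esub>"
        "\<forall>k\<in>?T. \<delta> (Suc n) (f k) = \<zero>\<^bsub>E (Suc (Suc n))\<^esub>"
      have fu: "(\<lambda>x. f (u \<odot>\<^bsub>M\<^esub> x)) \<in> module_hom R M (E (Suc n))"
        by (rule module_hom_comp[OF M.smult_self_hom[OF u] f(1)])
      have 1: "\<forall>x\<in>colon M K u. f (u \<odot>\<^bsub>M\<^esub> x) = \<zero>\<^bsub>E (Suc n)\<^esub>" using f(2) by (simp add: colon_def)
      have 2: "\<forall>k\<in>L. \<delta> (Suc n) (f (u \<odot>\<^bsub>M\<^esub> k)) = \<zero>\<^bsub>E (Suc (Suc n))\<^esub>" using f(3) uT by simp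
      obtain g where g: "g \<in> module_hom R M (E n)" "\<forall>k\<in>colon M K u. g k = \<zero>\<^bsub>E n\<^esub>"
          "\<forall>k\<in>L. \<delta> n (g k) = f (u \<odot>\<^bsub>M\<^esub> k)"
        by (rule ext_vanishesE[OF V fu 1 2])
      obtain g' where g': "g' \<in> module_hom R M (E n)" "\<forall>k\<in>K. g' k = \<zero>\<^bsub>E n\<^esub>"
          "\<forall>x\<in>carrier M. g' (u \<odot>\<^bsub>M\<^esub> x) = g x"
        by (rule divide_hom[OF M K u g(1,2)])
      have "\<delta> n (g' t) = f t" if "t \<in> ?T" for t
      proof -
        obtain k l where kl: "k \<in> K" "l \<in> L" "t = k \<oplus>\<^bsub>M\<^esub> u \<odot>\<^bsub>M\<^esub> l" using T[OF \<open>t \<in> ?T\<close>] by blast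
        have c: "k \<in> carrier M" "l \<in> carrier M" using kl Lc Kc by blast+
        interpret En: module R "E n" by (rule Em)
        interpret Es: module R "E (Suc n)" by (rule Em)
        have "g' t = g l"
          using kl c u g'(2,3) module_hom_closed[OF g(1) c(2)] by (simp add: module_hom_add[OF g'(1)])
        moreover have "f t = f (u \<odot>\<^bsub>M\<^esub> l)"
          using kl c u f(2) module_hom_closed[OF fu c(2)] by (simp add: module_hom_add[OF f(1)])
        ultimately show ?thesis using g(3) kl(2) by simp
      qed
      then show "\<exists>g\<in>module_hom R M (E n). (\<forall>k\<in>K. g k = \<zero>\<^bsub>E n\<^esub>) \<and> (\<forall>k\<in>?T. \<delta> n (g k) = f k)"
        using g'(1,2) by blast
    qed
  }
qed

end

context hom_double_complex
begin

text \<open>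
  By balancing, the column condition becomes the row condition on \<open>Hom(P 0, E)\<close>, and column cocycles
  on \<open>P 0\<close> are the homomorphisms on \<open>M/K\<close>.
\<close>

lemma ext_vanishes_of_column:
  assumes M: "module R M" and K: "submodule K R M"
    and e: "e \<in> module_hom R (P 0) (quot_module M K)" "e ` carrier (P 0) = carrier (quot_module M K)"
    and ker: "d 0 ` carrier (P (Suc 0)) = hom_kernel (P 0) (quot_module M K) e"
    and B: "column_generated \<zero>\<^bsub>R\<^esub> n 0"
  shows "ext_vanishes M n (carrier M) K"
proof (rule ext_vanishesI)
  interpret M: module R M by fact
  let ?Q = "quot_module M K" and ?p = "proj_quot M K"
  have Q: "module R ?Q" by (rule quot_module_module[OF M K])
  have p: "?p \<in> module_hom R M ?Q" by (rule proj_quot_hom[OF M K])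
  interpret Es: module R "E (Suc n)" by (rule Em)
  fix f assume f: "f \<in> module_hom R M (E (Suc n))" "\<forall>k\<in>K. f k = \<zero>\<^bsub>E (Suc n)\<^esub>"
    "\<forall>k\<in>carrier M. \<delta> (Suc n) (f k) = \<zero>\<^bsub>E (Suc (Suc n))\<^esub>"
  have fK: "f k = \<zero>\<^bsub>E (Suc n)\<^esub>" if "k \<in> K" for k using f(2) that by blast
  obtain F where F: "F \<in> module_hom R ?Q (E (Suc n))" "\<forall>x\<in>carrier M. F (?p x) = f x"
    by (rule quot_factor[OF M K Em f(1) fK])
  have eM: "\<exists>x\<in>carrier M. e q = ?p x" if "q \<in> carrier (P 0)" for q
    using module_hom_closed[OF e(1) that] unfolding quot_carrier[OF M K] by blast
  have Fe: "(\<lambda>q. F (e q)) \<in> module_hom R (P 0) (E (Suc n))" by (rule module_hom_comp[OF e(1) F(1)])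
  have row: "row_cocycle 0 (Suc n) (\<lambda>q. F (e q))"
    unfolding row_cocycle_def
  proof (intro conjI Fe ballI)
    fix q assume "q \<in> carrier (P 0)"
    then obtain x where "x \<in> carrier M" "e q = ?p x" using eM by blast
    then show "\<delta> (Suc n) (F (e q)) = \<zero>\<^bsub>E (Suc (Suc n))\<^esub>" using F(2) f(3) by simp
  qed
  have ed: "e (d 0 q) = \<zero>\<^bsub>?Q\<^esub>" if "q \<in> carrier (P (Suc 0))" for q
  proof -
    have "d 0 q \<in> d 0 ` carrier (P (Suc 0))" using that by (rule imageI)
    then show ?thesis unfolding ker by simp
  qed
  have col: "column_cocycle 0 (Suc n) (\<lambda>q. F (e q))"
    using Fe ed module_hom_zero[OF Q Em F(1)] by (simp add: column_cocycle_def)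
  have "row_generated \<zero>\<^bsub>R\<^esub> 0 n" using balance[of "\<zero>\<^bsub>R\<^esub>" n] B by simp
  then obtain g h where g: "row_cocycle 0 (Suc n) g" and h: "column_cocycle 0 n h"
      and eq: "\<forall>q\<in>carrier (P 0). F (e q) = \<zero>\<^bsub>R\<^esub> \<odot>\<^bsub>E (Suc n)\<^esub> g q \<oplus>\<^bsub>E (Suc n)\<^esub> \<delta> n (h q)"
    unfolding row_generated_def using row col by blast
  have hh: "h \<in> module_hom R (P 0) (E n)" and gh: "g \<in> module_hom R (P 0) (E (Suc n))"
    using h g by (simp_all add: column_cocycle_def row_cocycle_def)
  have eq': "F (e q) = \<delta> n (h q)" if "q \<in> carrier (P 0)" for q
    using eq that module_hom_closed[OF gh that] module_hom_closed[OF hh that] by simp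
  have "h q = \<zero>\<^bsub>E n\<^esub>" if "q \<in> carrier (P 0)" "e q = \<zero>\<^bsub>?Q\<^esub>" for q
  proof -
    have "q \<in> d 0 ` carrier (P (Suc 0))" unfolding ker using that by simp
    then show ?thesis using h by (auto simp: column_cocycle_def)
  qed
  then obtain G where G: "G \<in> module_hom R ?Q (E n)" "\<And>q. q \<in> carrier (P 0) \<Longrightarrow> G (e q) = h q"
    using baer_extend[OF E Pm Q e(1) hh] by metis
  show "\<exists>g\<in>module_hom R M (E n). (\<forall>k\<in>K. g k = \<zero>\<^bsub>E n\<^esub>) \<and> (\<forall>k\<in>carrier M. \<delta> n (g k) = f k)"
  proof (intro bexI conjI ballI)
    show "(\<lambda>x. G (?p x)) \<in> module_hom R M (E n)" by (rule module_hom_comp[OF p G(1)])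
    show "G (?p k) = \<zero>\<^bsub>E n\<^esub>" if k: "k \<in> K" for k
    proof -
      have "k \<in> carrier M" using k submodule_subset[OF K] by blast
      then have "?p k = \<zero>\<^bsub>?Q\<^esub>" using proj_quot_eq_zero_iff[OF M K] k by simp
      then show ?thesis using module_hom_zero[OF Q Em G(1)] by simp
    qed
    show "\<delta> n (G (?p x)) = f x" if x: "x \<in> carrier M" for x
    proof -
      have "?p x \<in> e ` carrier (P 0)" unfolding e(2) by (rule module_hom_closed[OF p x])
      then obtain q where q: "q \<in> carrier (P 0)" "?p x = e q" by blast
      have "\<delta> n (G (?p x)) = F (e q)" using q G(2) eq' by simp
      then show ?thesis using F(2) x q(2) by metis
    qed
  qed
qed

end

section \<open>From regular sequences to the residue field\<close>

lemma (in module) nonzerodivisor_mult: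
  assumes "a \<in> carrier R" "b \<in> carrier R" "nonzerodivisor M K a" "nonzerodivisor M K b"
  shows "nonzerodivisor M K (a \<otimes> b)"
  unfolding nonzerodivisor_def
proof (intro ballI impI)
  fix z assume z: "z \<in> carrier M" "(a \<otimes> b) \<odot>\<^bsub>M\<^esub> z \<in> K"
  then have "a \<odot>\<^bsub>M\<^esub> (b \<odot>\<^bsub>M\<^esub> z) \<in> K" using assms(1,2) by (simp add: smult_assoc1)
  then have "b \<odot>\<^bsub>M\<^esub> z \<in> K" using nonzerodivisorD[OF assms(3)] assms(2) z(1) by blast
  then show "z \<in> K" using nonzerodivisorD[OF assms(4)] z(1) by blast
qed

lemma (in baer_complex) ext_eventually_multiple:
  assumes "module R M" "submodule K R M" "submodule L R M" "u \<in> carrier R"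
  shows "ext_eventually_vanishes M L (colon M K u) \<longleftrightarrow>
    ext_eventually_vanishes M (K <+>\<^bsub>M\<^esub> smult_image M u L) K"
  unfolding ext_eventually_vanishes_def using ext_vanishes_multiple[OF assms] by simp

context noetherian_local_ring
begin

text \<open>
  A submodule maximal among those on which each element of \<open>\<mm>\<close> acts nilpotently modulo \<open>K\<close>; a
  socle element modulo it would enlarge it.
\<close>

lemma torsion_submodule:
  assumes M: "noetherian_module R M" and K: "submodule K R M"
  obtains L where "submodule L R M" "K \<subseteq> L" "\<forall>y\<in>\<mm>. \<exists>n::nat. \<forall>l\<in>L. (y [^] n) \<odot>\<^bsub>M\<^esub> l \<in> K"
    "\<not> socle_after M \<mm> 0 L"
proof -
  note Mm = noetherian_moduleD[OF M]
  interpret M: module R M by fact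
  note Kc = submodule_subset[OF K]
  let ?F = "{L. submodule L R M \<and> K \<subseteq> L \<and> (\<forall>y\<in>\<mm>. \<exists>n::nat. \<forall>l\<in>L. (y [^] n) \<odot>\<^bsub>M\<^esub> l \<in> K)}"
  have "\<forall>y\<in>\<mm>. \<exists>n::nat. \<forall>l\<in>K. (y [^] n) \<odot>\<^bsub>M\<^esub> l \<in> K"
  proof (intro ballI exI)
    fix y l assume "y \<in> \<mm>" "l \<in> K"
    then show "(y [^] (0::nat)) \<odot>\<^bsub>M\<^esub> l \<in> K" using Kc by (simp add: subsetD)
  qed
  then have "K \<in> ?F" unfolding mem_Collect_eq using K by (intro conjI subset_refl)
  then have ne: "?F \<noteq> {}" by blast
  obtain L where L: "L \<in> ?F" and Lmax: "\<And>H. H \<in> ?F \<Longrightarrow> L \<subseteq> H \<Longrightarrow> H = L"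
  proof (rule noetherian_module_maximal[OF M ne])
    show "submodule H R M" if "H \<in> ?F" for H
      using that unfolding mem_Collect_eq by (elim conjE)
    fix L assume "L \<in> ?F" "\<And>H. H \<in> ?F \<Longrightarrow> L \<subseteq> H \<Longrightarrow> H = L"
    then show thesis by (rule that)
  qed
  have Ls: "submodule L R M" using L by (elim CollectE conjE)
  have KL: "K \<subseteq> L" using L by (elim CollectE conjE)
  have Lt: "\<forall>y\<in>\<mm>. \<exists>n::nat. \<forall>l\<in>L. (y [^] n) \<odot>\<^bsub>M\<^esub> l \<in> K" using L by (elim CollectE conjE)
  note Lc = submodule_subset[OF Ls]
  have "\<not> socle_after M \<mm> 0 L"
  proof
    assume "socle_after M \<mm> 0 L"
    then obtain z where z: "z \<in> carrier M" "z \<notin> L" "\<forall>a\<in>\<mm>. a \<odot>\<^bsub>M\<^esub> z \<in> L"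
      unfolding socle_after.simps by blast
    let ?C = "(\<lambda>r. r \<odot>\<^bsub>M\<^esub> z) ` carrier R"
    note C = M.cyclic_submodule[OF z(1)]
    have zC: "z \<in> ?C" using z(1) by (intro image_eqI[of _ _ \<one>]) simp_all
    have "\<exists>n::nat. \<forall>h\<in>L <+>\<^bsub>M\<^esub> ?C. (y [^] n) \<odot>\<^bsub>M\<^esub> h \<in> K" if y: "y \<in> \<mm>" for y
    proof -
      have yR: "y \<in> carrier R" using y m_sub by blast
      obtain n :: nat where n: "\<forall>l\<in>L. (y [^] n) \<odot>\<^bsub>M\<^esub> l \<in> K" using Lt y by blast
      have "(y [^] Suc n) \<odot>\<^bsub>M\<^esub> h \<in> K" if h: "h \<in> L <+>\<^bsub>M\<^esub> ?C" for h
      proof -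
        obtain l r where lr: "l \<in> L" "r \<in> carrier R" "h = l \<oplus>\<^bsub>M\<^esub> r \<odot>\<^bsub>M\<^esub> z"
          using h unfolding set_add_iff by blast
        have lM: "l \<in> carrier M" using lr Lc by blast
        have yz: "y \<odot>\<^bsub>M\<^esub> z \<in> L" using z(3) y by blast
        have "y \<odot>\<^bsub>M\<^esub> h = y \<odot>\<^bsub>M\<^esub> l \<oplus>\<^bsub>M\<^esub> r \<odot>\<^bsub>M\<^esub> (y \<odot>\<^bsub>M\<^esub> z)"
          using lr lM yR z(1) by (simp add: M.smult_r_distr M.smult_assoc1[symmetric] m_comm)
        then have "y \<odot>\<^bsub>M\<^esub> h \<in> L"
          using submodule_add[OF Ls submodule_smult[OF Ls yR lr(1)] submodule_smult[OF Ls lr(2) yz]] by simp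
        moreover have "h \<in> carrier M" using lr lM z(1) by simp
        ultimately show ?thesis using n yR by (simp add: M.smult_assoc1)
      qed
      then show ?thesis by blast
    qed
    then have "L <+>\<^bsub>M\<^esub> ?C \<in> ?F"
      unfolding mem_Collect_eq
      using M.sum_submodule[OF Ls C] order_trans[OF KL M.sum_superset(1)[OF Ls C]] by (intro conjI ballI)
    then have "L <+>\<^bsub>M\<^esub> ?C = L" using Lmax M.sum_superset(1)[OF Ls C] by blast
    then show False using z(2) zC M.sum_superset(2)[OF Ls C] by blast
  qed
  then show thesis by (rule that[OF Ls KL Lt])
qed

text \<open>
  If Ext eventually vanishes on \<open>M/K\<close> and on the submodules \<open>(K : u)/K\<close> for all \<open>u\<close> regular on
  \<open>R/I\<close>, it eventually vanishes on a nonzero module annihilated by \<open>\<mm>\<close>: multiply the torsion of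
  \<open>M/K\<close> by a product \<open>u\<close> of such elements, chosen so that the result is nonzero but dies under
  every further factor. These factors generate \<open>\<mm>\<close>.
\<close>

lemma ext_vanishes_on_socle_part:
  assumes C: "baer_complex R E \<delta>" and M: "noetherian_module R M"
    and K: "submodule K R M" and s: "socle_after M \<mm> 0 K"
    and I: "submodule I R (self_module R)" "I \<noteq> carrier R" "\<not> socle_after (self_module R) \<mm> 0 I"
    and T0: "baer_complex.ext_eventually_vanishes R E \<delta> M (carrier M) K"
    and T1: "\<And>u. u \<in> \<mm> \<Longrightarrow> nonzerodivisor (self_module R) I u \<Longrightarrow>
      baer_complex.ext_eventually_vanishes R E \<delta> M (colon M K u) K"
  obtains H where "submodule H R M" "K \<subseteq> H" "H \<noteq> K" "\<forall>a\<in>\<mm>. \<forall>h\<in>H. a \<odot>\<^bsub>M\<^esub> h \<in> K"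
    "baer_complex.ext_eventually_vanishes R E \<delta> M H K"
proof -
  interpret C: baer_complex R E \<delta> by fact
  let ?A = "self_module R" and ?T = "C.ext_eventually_vanishes M"
  note Mm = noetherian_moduleD[OF M]
  interpret M: module R M by fact
  note Am = self_module_module
  note Kc = submodule_subset[OF K]
  obtain L where L: "submodule L R M" "K \<subseteq> L" "\<forall>y\<in>\<mm>. \<exists>n::nat. \<forall>l\<in>L. (y [^] n) \<odot>\<^bsub>M\<^esub> l \<in> K"
    "\<not> socle_after M \<mm> 0 L"
    by (rule torsion_submodule[OF M K])
  note Lc = submodule_subset[OF L(1)]
  define G where "G = {y \<in> \<mm>. nonzerodivisor ?A I y \<and> nonzerodivisor M L y}"
  have Gm: "y \<in> \<mm>" "y \<in> carrier R" if "y \<in> G" for y using that m_sub by (auto simp: G_def)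
  have Gmult: "u \<otimes> v \<in> G" if "u \<in> G" "v \<in> G" for u v
  proof -
    have "u \<otimes> v \<in> \<mm>" using m.I_l_closed[OF Gm(1)[OF that(2)] Gm(2)[OF that(1)]] .
    moreover have "nonzerodivisor ?A I (u \<otimes> v)"
      using that by (intro module.nonzerodivisor_mult[OF Am] Gm(2)) (simp_all only: G_def mem_Collect_eq)
    moreover have "nonzerodivisor M L (u \<otimes> v)"
      using that by (intro M.nonzerodivisor_mult Gm(2)) (simp_all only: G_def mem_Collect_eq)
    ultimately show ?thesis by (simp only: G_def mem_Collect_eq)
  qed
  have GJ: "\<exists>y\<in>G. y \<notin> J" if J: "ideal J R" "\<not> \<mm> \<subseteq> J" for J
  proof -
    obtain y where "y \<in> \<mm>" "y \<notin> J" "nonzerodivisor M L y" "nonzerodivisor ?A I y"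
    proof (rule common_nonzerodivisor[OF M _ _ _ self_noetherian _ _ _ J, of "{L}" "{I}"])
      fix y assume "y \<in> \<mm>" "y \<notin> J" "\<And>K. K \<in> {L} \<Longrightarrow> nonzerodivisor M K y"
        "\<And>K. K \<in> {I} \<Longrightarrow> nonzerodivisor ?A K y"
      then show thesis by (intro that) simp_all
    next
      show "submodule N R M" if "N \<in> {L}" for N using that L(1) by simp
      show "\<not> socle_after M \<mm> 0 N" if "N \<in> {L}" for N using that L(4) by simp
      show "submodule N R ?A" if "N \<in> {I}" for N using that I(1) by simp
      show "\<not> socle_after ?A \<mm> 0 N" if "N \<in> {I}" for N using that I(3) by simp
    qed simp_all
    then have "y \<in> G" by (simp only: G_def mem_Collect_eq)
    then show ?thesis using \<open>y \<notin> J\<close> by blast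
  qed
  have colL: "colon M K u \<subseteq> L" if "u \<in> G" for u
  proof
    fix z assume z: "z \<in> colon M K u"
    then have "z \<in> carrier M" "u \<odot>\<^bsub>M\<^esub> z \<in> K" by (simp_all only: colon_def mem_Collect_eq)
    moreover have "nonzerodivisor M L u" using that by (simp only: G_def mem_Collect_eq)
    ultimately show "z \<in> L" using L(2) nonzerodivisorD[of M L u z] by blast
  qed
  have nz: "\<not> \<mm> \<subseteq> {\<zero>}" using no_socle_m_nonzero[OF Am I(1) _ I(3)] I(2) by simp
  obtain w where w: "w \<in> G" using GJ[OF zeroideal nz] by blast
  obtain n :: nat where n: "\<forall>l\<in>L. (w [^] n) \<odot>\<^bsub>M\<^esub> l \<in> K" using L(3) Gm(1)[OF w] by blast
  \<comment> \<open>a power of \<open>w\<close> kills the torsion, and no regular element kills more than the torsion\<close>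
  have wpow: "w [^] Suc k \<in> G" for k :: nat
  proof (induction k)
    case 0
    show ?case using w Gm(2)[OF w] by simp
  next
    case (Suc k)
    show ?case using Gmult[OF Suc.IH w] by simp
  qed
  have "L \<subseteq> colon M K (w [^] Suc n)"
  proof
    fix l assume l: "l \<in> L"
    have wR: "w \<in> carrier R" by (rule Gm(2)[OF w])
    have lM: "l \<in> carrier M" using l Lc by blast
    have "(w [^] n) \<odot>\<^bsub>M\<^esub> (w \<odot>\<^bsub>M\<^esub> l) \<in> K" using n submodule_smult[OF L(1) wR l] by blast
    then show "l \<in> colon M K (w [^] Suc n)" using lM wR by (simp add: colon_def M.smult_assoc1)
  qed
  then have "L = colon M K (w [^] Suc n)" using colL[OF wpow] by blast
  then have TL: "?T L K" using T1[OF Gm(1)[OF wpow]] wpow by (simp add: G_def)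
  have col1: "colon M K \<one> = K"
  proof
    show "K \<subseteq> colon M K \<one>" by (rule M.colon_superset[OF one_closed K])
    show "colon M K \<one> \<subseteq> K"
    proof
      fix x assume "x \<in> colon M K \<one>"
      then have "x \<in> carrier M" "\<one> \<odot>\<^bsub>M\<^esub> x \<in> K" by (simp_all only: colon_def mem_Collect_eq)
      then show "x \<in> K" by simp
    qed
  qed
  have TuL: "?T (K <+>\<^bsub>M\<^esub> smult_image M u L) K" if u: "u \<in> insert \<one> G" for u
  proof -
    have uR: "u \<in> carrier R" using u Gm(2) by (elim insertE) simp_all
    have "?T L (colon M K u)"
    proof (cases "u = \<one>")
      case True
      then show ?thesis using TL col1 by simp
    next
      case False
      then have uG: "u \<in> G" using u by simp
      then have "nonzerodivisor ?A I u" by (simp only: G_def mem_Collect_eq)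
      then have "?T (colon M K u) K" by (rule T1[OF Gm(1)[OF uG]])
      then show ?thesis
        by (rule C.ext_eventually_two_of_three(3)[OF Mm M.colon_superset[OF uR K] colL[OF uG] Lc TL])
    qed
    then show ?thesis using C.ext_eventually_multiple[OF Mm K L(1) uR] by simp
  qed
  \<comment> \<open>maximality of \<open>(K : u)\<close> makes \<open>(K : u v) = (K : u)\<close> unless \<open>u v\<close> kills \<open>L\<close>; powers of \<open>v\<close> decide\<close>
  let ?F = "{colon M K u | u. u \<in> insert \<one> G \<and> \<not> L \<subseteq> colon M K u}"
  have "\<not> L \<subseteq> K"
  proof
    assume "L \<subseteq> K"
    then have "L = K" using L(2) by blast
    then show False using L(4) s by simp
  qed
  then have "\<one> \<in> insert \<one> G \<and> \<not> L \<subseteq> colon M K \<one>" unfolding col1 by simp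
  then have "colon M K \<one> \<in> ?F" by blast
  then have ne: "?F \<noteq> {}" by blast
  have Fsub: "submodule X R M" if "X \<in> ?F" for X
  proof -
    from that have "\<exists>u. u \<in> insert \<one> G \<and> X = colon M K u" by (elim CollectE exE conjE) (intro exI conjI)
    then obtain u where u: "u \<in> insert \<one> G" "X = colon M K u" by (elim exE conjE)
    have "u \<in> carrier R" using u(1) Gm(2) by (elim insertE) simp_all
    then show ?thesis unfolding u(2) by (rule M.colon_submodule[OF _ K])
  qed
  obtain X where X: "X \<in> ?F" and Xmax: "\<And>Y. Y \<in> ?F \<Longrightarrow> X \<subseteq> Y \<Longrightarrow> Y = X"
  proof (rule noetherian_module_maximal[OF M ne Fsub])
    fix X assume "X \<in> ?F" "\<And>Y. Y \<in> ?F \<Longrightarrow> X \<subseteq> Y \<Longrightarrow> Y = X"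
    then show thesis by (rule that)
  qed
  obtain u where u: "u \<in> insert \<one> G" "\<not> L \<subseteq> colon M K u" "X = colon M K u"
  proof -
    from X obtain u where uX: "X = colon M K u \<and> u \<in> insert \<one> G \<and> \<not> L \<subseteq> colon M K u"
      by (elim CollectE exE)
    show thesis using that[of u] uX by blast
  qed
  have uR: "u \<in> carrier R" using u(1) Gm(2) by (elim insertE) simp_all
  have kill: "L \<subseteq> colon M K (u \<otimes> v)" if v: "v \<in> G" for v
  proof (rule ccontr)
    assume nL: "\<not> L \<subseteq> colon M K (u \<otimes> v)"
    have vR: "v \<in> carrier R" by (rule Gm(2)[OF v])
    have "u \<otimes> v \<in> insert \<one> G" using u(1) v Gmult vR by auto
    then have inF: "colon M K (u \<otimes> v) \<in> ?F" using nL by blast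
    have "X \<subseteq> colon M K (u \<otimes> v)"
    proof
      fix z assume "z \<in> X"
      then have z: "z \<in> carrier M" "u \<odot>\<^bsub>M\<^esub> z \<in> K" by (simp_all add: u(3) colon_def)
      have "(u \<otimes> v) \<odot>\<^bsub>M\<^esub> z = v \<odot>\<^bsub>M\<^esub> (u \<odot>\<^bsub>M\<^esub> z)"
        using z(1) uR vR by (simp add: M.smult_assoc1[symmetric] m_comm)
      then show "z \<in> colon M K (u \<otimes> v)" using z submodule_smult[OF K vR] by (simp add: colon_def)
    qed
    then have eq: "colon M K (u \<otimes> v) = colon M K u" using Xmax[OF inF] u(3) by simp
    have step: "z \<in> colon M K u" if "z \<in> carrier M" "(u \<otimes> v [^] k) \<odot>\<^bsub>M\<^esub> z \<in> K" for k :: nat and z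
      using that
    proof (induction k arbitrary: z)
      case 0
      then show ?case using uR by (simp add: colon_def)
    next
      case (Suc k)
      have "(u \<otimes> v [^] k) \<odot>\<^bsub>M\<^esub> (v \<odot>\<^bsub>M\<^esub> z) \<in> K"
        using Suc.prems uR vR by (simp add: M.smult_assoc1[symmetric] m_assoc)
      then have "v \<odot>\<^bsub>M\<^esub> z \<in> colon M K u" using Suc.IH Suc.prems(1) vR by simp
      then have "z \<in> colon M K (u \<otimes> v)"
        using Suc.prems(1) uR vR by (simp add: colon_def M.smult_assoc1)
      then show ?case using eq by simp
    qed
    obtain k :: nat where k: "\<forall>l\<in>L. (v [^] k) \<odot>\<^bsub>M\<^esub> l \<in> K" using L(3) Gm(1)[OF v] by blast
    have "L \<subseteq> colon M K u"
    proof
      fix l assume l: "l \<in> L"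
      have lM: "l \<in> carrier M" using l Lc by blast
      have "u \<odot>\<^bsub>M\<^esub> ((v [^] k) \<odot>\<^bsub>M\<^esub> l) \<in> K" using submodule_smult[OF K uR] k l by blast
      then show "l \<in> colon M K u" using step[OF lM, of k] lM uR vR by (simp add: M.smult_assoc1)
    qed
    then show False using u(2) by simp
  qed
  let ?J = "{a \<in> carrier R. \<forall>l\<in>L. a \<odot>\<^bsub>M\<^esub> (u \<odot>\<^bsub>M\<^esub> l) \<in> K}"
  have LM: "l \<in> carrier M" if "l \<in> L" for l using that Lc by blast
  have J: "ideal ?J R"
  proof (rule idealI')
    show "\<zero> \<in> ?J" using LM uR submodule_zero[OF Mm K] by simp
    show "a \<oplus> b \<in> ?J" if "a \<in> ?J" "b \<in> ?J" for a b
      using that LM uR submodule_add[OF K] by (simp add: M.smult_l_distr)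
    show "r \<otimes> a \<in> ?J" if "r \<in> carrier R" "a \<in> ?J" for r a
      using that LM uR submodule_smult[OF K] by (simp add: M.smult_assoc1)
  qed simp
  have mJ: "\<mm> \<subseteq> ?J"
  proof (rule ccontr)
    assume "\<not> \<mm> \<subseteq> ?J"
    then obtain v where v: "v \<in> G" "v \<notin> ?J" using GJ[OF J] by blast
    have "v \<odot>\<^bsub>M\<^esub> (u \<odot>\<^bsub>M\<^esub> l) \<in> K" if "l \<in> L" for l
    proof -
      have "(u \<otimes> v) \<odot>\<^bsub>M\<^esub> l \<in> K" using kill[OF v(1)] that by (auto simp: colon_def)
      then show ?thesis using LM[OF that] uR Gm(2)[OF v(1)] by (simp add: M.smult_assoc1[symmetric] m_comm)
    qed
    then show False using v(2) Gm(2)[OF v(1)] by simp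
  qed
  let ?H = "K <+>\<^bsub>M\<^esub> smult_image M u L"
  note uL = M.smult_image_submodule[OF uR L(1)]
  show thesis
  proof (rule that[of ?H])
    show "submodule ?H R M" by (rule M.sum_submodule[OF K uL])
    show "K \<subseteq> ?H" by (rule M.sum_superset(1)[OF K uL])
    show "?H \<noteq> K"
    proof
      assume "?H = K"
      then have "smult_image M u L \<subseteq> K" using M.sum_superset(2)[OF K uL] by simp
      then have "L \<subseteq> colon M K u" using LM by (auto simp: smult_image_def colon_def)
      then show False using u(2) by simp
    qed
    show "\<forall>a\<in>\<mm>. \<forall>h\<in>?H. a \<odot>\<^bsub>M\<^esub> h \<in> K"
    proof (intro ballI)
      fix a h assume a: "a \<in> \<mm>" and "h \<in> ?H"
      then obtain k l where kl: "k \<in> K" "l \<in> L" "h = k \<oplus>\<^bsub>M\<^esub> u \<odot>\<^bsub>M\<^esub> l"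
        by (auto simp: set_add_iff smult_image_def)
      have aJ: "a \<in> ?J" using mJ a by blast
      then have aR: "a \<in> carrier R" and au: "a \<odot>\<^bsub>M\<^esub> (u \<odot>\<^bsub>M\<^esub> l) \<in> K" using kl(2) by simp_all
      have "k \<in> carrier M" using kl(1) Kc by blast
      then show "a \<odot>\<^bsub>M\<^esub> h \<in> K"
        using kl LM[OF kl(2)] uR aR submodule_add[OF K submodule_smult[OF K aR kl(1)] au]
        by (simp add: M.smult_r_distr)
    qed
    show "?T ?H K" by (rule TuL[OF u(1)])
  qed
qed

text \<open>Exactness, at \<open>E (n + 1)\<close>, of the subcomplex of elements annihilated by \<open>\<mm>\<close>.\<close>

abbreviation socle_exact_at :: "(nat \<Rightarrow> ('a, 'e) module) \<Rightarrow> (nat \<Rightarrow> 'e \<Rightarrow> 'e) \<Rightarrow> nat \<Rightarrow> bool" where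
  "socle_exact_at E \<delta> n \<equiv> \<forall>e\<in>carrier (E (Suc n)). (\<forall>a\<in>\<mm>. a \<odot>\<^bsub>E (Suc n)\<^esub> e = \<zero>\<^bsub>E (Suc n)\<^esub>) \<and>
     \<delta> (Suc n) e = \<zero>\<^bsub>E (Suc (Suc n))\<^esub> \<longrightarrow> (\<exists>g\<in>carrier (E n). (\<forall>a\<in>\<mm>. a \<odot>\<^bsub>E n\<^esub> g = \<zero>\<^bsub>E n\<^esub>) \<and> \<delta> n g = e)"

text \<open>
  Let \<open>xs\<close> be regular on \<open>R\<close> such that \<open>M/K\<close>, for \<open>K = xs M\<close>, has a nonzero socle and \<open>R/xs R\<close> has not.
  For every \<open>u \<in> \<mm>\<close> regular modulo \<open>xs R\<close> the hypothesis covers both \<open>M/K\<close> and \<open>M/(K + u M)\<close>. Hence the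
  multiple \<open>u (M/K)\<close>, which is isomorphic to \<open>M/(K : u)\<close>, and then \<open>(K : u)/K\<close> inherit eventual
  vanishing. So a nonzero module annihilated by \<open>\<mm>\<close> has this property, and the residue field is a
  direct summand of it. A cocycle on the residue field is an element \<open>e\<close> of the socle of \<open>E (n + 1)\<close>
  with \<open>\<delta> e = 0\<close>.
\<close>

theorem socle_exact:
  assumes C: "baer_complex R E \<delta>" and M: "noetherian_module R M"
    and dep: "depth R M < depth R (self_module R)"
    and van: "\<And>ys. regular_seq R (self_module R) ys \<Longrightarrow> enat (length ys) \<le> depth R M + 1 \<Longrightarrow>
      baer_complex.ext_eventually_vanishes R E \<delta> M (carrier M) (seq_submodule R M ys)"
  shows "\<exists>n0. \<forall>n\<ge>n0. socle_exact_at E \<delta> n"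
proof -
  interpret C: baer_complex R E \<delta> by fact
  let ?A = "self_module R" and ?T = "C.ext_eventually_vanishes M"
  note Mm = noetherian_moduleD[OF M]
  interpret M: module R M by fact
  note Am = self_module_module
  obtain xs where xs: "regular_seq R ?A xs" "enat (length xs) \<le> depth R M"
    "socle_after M \<mm> 0 (seq_submodule R M xs)" "\<not> socle_after ?A \<mm> 0 (seq_submodule R ?A xs)"
    by (rule exists_regular_seq_to_socle[OF M dep])
  have xsm: "set xs \<subseteq> \<mm>" and Ine: "seq_submodule R ?A xs \<noteq> carrier ?A"
    using xs(1) by (simp_all add: regular_seq_iff[OF Am])
  have xsR: "set xs \<subseteq> carrier R" using xsm m_sub by blast
  define K where "K = seq_submodule R M xs"
  define I where "I = seq_submodule R ?A xs"
  have K: "submodule K R M" unfolding K_def by (rule seq_submodule_submodule[OF Mm xsR])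
  have I: "submodule I R ?A" unfolding I_def by (rule seq_submodule_submodule[OF Am xsR])
  note Kc = submodule_subset[OF K]
  have len: "enat (length xs) \<le> depth R M + 1" "enat (Suc (length xs)) \<le> depth R M + 1"
    using xs(2) by (cases "depth R M"; simp add: one_enat_def)+
  have T0: "?T (carrier M) K" unfolding K_def by (rule van[OF xs(1) len(1)])
  have "?T (colon M K u) K" if u: "u \<in> \<mm>" "nonzerodivisor ?A I u" for u
  proof -
    have uR: "u \<in> carrier R" using u(1) m_sub by blast
    have nt: "\<not> trivial_module ?A"
    proof
      assume "trivial_module ?A"
      then have "carrier R = {\<zero>}" by (simp add: trivial_module_def)
      then have "\<one> = \<zero>" using one_closed by blast
      then show False using one_notin_m m.zero_closed by simp
    qed
    have "set (xs @ [u]) \<subseteq> \<mm>" using xsm u(1) by simp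
    note proper = seq_submodule_proper[OF self_noetherian nt this]
    have reg: "regular_seq R ?A (xs @ [u])"
      by (rule regular_seq_snoc[OF Am xs(1) u(1) u(2)[unfolded I_def] proper])
    have "?T (carrier M) (seq_submodule R M (xs @ [u]))" by (rule van[OF reg]) (use len(2) in simp)
    then have "?T (carrier M) (K <+>\<^bsub>M\<^esub> multiples M u)"
      unfolding seq_submodule_snoc[OF Mm xsR uR] K_def .
    note uM = M.smult_image_submodule[OF uR M.carrier_is_submodule]
    have "?T (K <+>\<^bsub>M\<^esub> multiples M u) K"
      by (rule C.ext_eventually_two_of_three(2)[OF Mm M.sum_superset(1)[OF K uM]
            submodule_subset[OF M.sum_submodule[OF K uM]] subset_refl T0]) fact
    then have "?T (carrier M) (colon M K u)"
      using C.ext_eventually_multiple[OF Mm K M.carrier_is_submodule uR] by simp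
    then show ?thesis
      by (rule C.ext_eventually_two_of_three(2)[OF Mm M.colon_superset[OF uR K]
            submodule_subset[OF M.colon_submodule[OF uR K]] subset_refl T0])
  qed
  note T1 = this
  have Ine': "I \<noteq> carrier R" using Ine by (simp add: I_def)
  obtain H where H: "submodule H R M" "K \<subseteq> H" "H \<noteq> K" "\<forall>a\<in>\<mm>. \<forall>h\<in>H. a \<odot>\<^bsub>M\<^esub> h \<in> K" "?T H K"
    by (rule ext_vanishes_on_socle_part[OF C M K xs(3)[folded K_def] I Ine' xs(4)[folded I_def] T0 T1])
  note Hc = submodule_subset[OF H(1)]
  have KH: "K \<noteq> H" using H(3) by simp
  obtain N where N: "submodule N R M" "K \<subseteq> N" "N \<subseteq> H" "N \<noteq> H"
      and dec: "\<And>z h. z \<in> H \<Longrightarrow> z \<notin> N \<Longrightarrow> h \<in> H \<Longrightarrow> \<exists>r\<in>carrier R. \<exists>l\<in>N. h = l \<oplus>\<^bsub>M\<^esub> r \<odot>\<^bsub>M\<^esub> z"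
  proof (rule exists_residue_quotient[OF M K H(1,2) KH])
    fix L assume "submodule L R M" "K \<subseteq> L" "L \<subseteq> H" "L \<noteq> H"
      "\<And>z h. z \<in> H \<Longrightarrow> z \<notin> L \<Longrightarrow> h \<in> H \<Longrightarrow> \<exists>r\<in>carrier R. \<exists>l\<in>L. h = l \<oplus>\<^bsub>M\<^esub> r \<odot>\<^bsub>M\<^esub> z"
    then show thesis by (rule that)
  qed
  obtain z where z: "z \<in> H" "z \<notin> N" using N(3,4) by blast
  have zM: "z \<in> carrier M" using z(1) Hc by blast
  obtain n0 where n0: "\<forall>n\<ge>n0. C.ext_vanishes M n H K"
    using H(5) unfolding C.ext_eventually_vanishes_def by blast
  show ?thesis
  proof (intro exI[of _ n0] allI impI ballI, elim conjE)
    fix n e assume n: "n0 \<le> n" and e: "e \<in> carrier (E (Suc n))"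
      and me: "\<forall>a\<in>\<mm>. a \<odot>\<^bsub>E (Suc n)\<^esub> e = \<zero>\<^bsub>E (Suc n)\<^esub>" and de: "\<delta> (Suc n) e = \<zero>\<^bsub>E (Suc (Suc n))\<^esub>"
    interpret Es: module R "E (Suc n)" by (rule C.Em)
    interpret Ess: module R "E (Suc (Suc n))" by (rule C.Em)
    let ?Q = "quot_module M N" and ?p = "proj_quot M N"
    have Q: "module R ?Q" by (rule quot_module_module[OF Mm N(1)])
    have p: "?p \<in> module_hom R M ?Q" by (rule proj_quot_hom[OF Mm N(1)])
    have \<phi>: "(\<lambda>r. ?p (r \<odot>\<^bsub>M\<^esub> z)) \<in> module_hom R ?A ?Q"
      by (rule module_hom_comp[OF M.smult_point_hom[OF zM] p])
    have "r \<odot>\<^bsub>E (Suc n)\<^esub> e = \<zero>\<^bsub>E (Suc n)\<^esub>" if r: "r \<in> carrier ?A" "?p (r \<odot>\<^bsub>M\<^esub> z) = \<zero>\<^bsub>?Q\<^esub>" for r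
    proof -
      have "r \<in> annihilator R M N z"
        using r zM by (simp add: annihilator_def proj_quot_eq_zero_iff[OF Mm N(1)])
      then have "r \<in> \<mm>" using ann_le_m[OF Mm N(1) zM z(2)] by blast
      then show ?thesis using me by simp
    qed
    then obtain h where h: "h \<in> module_hom R ?Q (E (Suc n))"
        "\<And>r. r \<in> carrier ?A \<Longrightarrow> h (?p (r \<odot>\<^bsub>M\<^esub> z)) = r \<odot>\<^bsub>E (Suc n)\<^esub> e"
      using baer_extend[OF C.E Am Q \<phi> Es.smult_point_hom[OF e]] by metis
    let ?f = "\<lambda>x. h (?p x)"
    have f: "?f \<in> module_hom R M (E (Suc n))" by (rule module_hom_comp[OF p h(1)])
    have fN: "?f k = \<zero>\<^bsub>E (Suc n)\<^esub>" if k: "k \<in> N" for k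
    proof -
      have "k \<in> carrier M" using k submodule_subset[OF N(1)] by blast
      then have "?p k = \<zero>\<^bsub>?Q\<^esub>" using proj_quot_eq_zero_iff[OF Mm N(1)] k by simp
      then show ?thesis using module_hom_zero[OF Q C.Em h(1)] by simp
    qed
    have fz: "?f z = e" using h(2)[of \<one>] zM e by simp
    have 1: "\<forall>k\<in>K. ?f k = \<zero>\<^bsub>E (Suc n)\<^esub>" using fN N(2) by blast
    have 2: "\<forall>k\<in>H. \<delta> (Suc n) (?f k) = \<zero>\<^bsub>E (Suc (Suc n))\<^esub>"
    proof
      fix k assume "k \<in> H"
      then obtain r l where rl: "r \<in> carrier R" "l \<in> N" "k = l \<oplus>\<^bsub>M\<^esub> r \<odot>\<^bsub>M\<^esub> z" using dec[OF z] by blast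
      have "l \<in> carrier M" using rl(2) submodule_subset[OF N(1)] by blast
      then have "?f k = r \<odot>\<^bsub>E (Suc n)\<^esub> e"
        unfolding rl(3) module_hom_add[OF f \<open>l \<in> carrier M\<close> M.smult_closed[OF rl(1) zM]]
        using fN[OF rl(2)] h(2)[of r] rl(1) e by simp
      then show "\<delta> (Suc n) (?f k) = \<zero>\<^bsub>E (Suc (Suc n))\<^esub>"
        using module_hom_smult[OF C.\<delta> rl(1) e] de rl(1) by simp
    qed
    have V: "C.ext_vanishes M n H K" using n0 n by blast
    obtain g where g: "g \<in> module_hom R M (E n)" "\<forall>k\<in>K. g k = \<zero>\<^bsub>E n\<^esub>" "\<forall>k\<in>H. \<delta> n (g k) = ?f k"
      by (rule C.ext_vanishesE[OF V f 1 2])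
    show "\<exists>g\<in>carrier (E n). (\<forall>a\<in>\<mm>. a \<odot>\<^bsub>E n\<^esub> g = \<zero>\<^bsub>E n\<^esub>) \<and> \<delta> n g = e"
    proof (intro bexI conjI ballI)
      show "g z \<in> carrier (E n)" by (rule module_hom_closed[OF g(1) zM])
      show "\<delta> n (g z) = e" using g(3) z(1) fz by simp
      show "a \<odot>\<^bsub>E n\<^esub> g z = \<zero>\<^bsub>E n\<^esub>" if a: "a \<in> \<mm>" for a
      proof -
        have "a \<in> carrier R" using a m_sub by blast
        then have "a \<odot>\<^bsub>E n\<^esub> g z = g (a \<odot>\<^bsub>M\<^esub> z)" using module_hom_smult[OF g(1) _ zM] by simp
        then show ?thesis using g(2) H(4) a z(1) by simp
      qed
    qed
  qed
qed

end

section \<open>Enough injective modules\<close>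

text \<open>
  Abelian groups are treated as modules over the integers, so that the extension theorem for Baer
  modules also gives the extension of additive maps into divisible groups.
\<close>

definition int_module :: "('b, 'm) ring_scheme \<Rightarrow> (int, 'b) module" where
  "int_module A = \<lparr>carrier = carrier A, mult = undefined, one = undefined, zero = zero A, add = add A,
     smult = (\<lambda>k x. add_pow A k x)\<rparr>"

lemma int_module_simps [simp]:
  "carrier (int_module A) = carrier A" "\<zero>\<^bsub>int_module A\<^esub> = \<zero>\<^bsub>A\<^esub>"
  "x \<oplus>\<^bsub>int_module A\<^esub> y = x \<oplus>\<^bsub>A\<^esub> y" "k \<odot>\<^bsub>int_module A\<^esub> x = [k] \<cdot>\<^bsub>A\<^esub> x"
  by (simp_all add: int_module_def)

lemma int_module_module:
  assumes "abelian_group A"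
  shows "module \<Z> (int_module A)"
proof -
  interpret A: abelian_group A by fact
  show ?thesis
  proof (rule moduleI)
    show "cring \<Z>" by (rule int_is_cring)
    show "abelian_group (int_module A)"
    proof (rule abelian_groupI)
      show "\<exists>y\<in>carrier (int_module A). y \<oplus>\<^bsub>int_module A\<^esub> x = \<zero>\<^bsub>int_module A\<^esub>"
        if "x \<in> carrier (int_module A)" for x
        using that by (intro bexI[of _ "\<ominus>\<^bsub>A\<^esub> x"]) (simp_all add: A.l_neg)
    qed (simp_all add: A.a_ac)
  qed (simp_all add: A.add.int_pow_mult A.add.int_pow_distrib A.add.int_pow_pow mult.commute)
qed

text \<open>Homogeneity for integer multiples follows from additivity, by induction on the multiple.\<close>

lemma additive_int_hom:
  assumes A: "abelian_group A" and B: "module \<Z> B"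
    and f: "\<And>x. x \<in> carrier A \<Longrightarrow> f x \<in> carrier B"
      "\<And>x y. x \<in> carrier A \<Longrightarrow> y \<in> carrier A \<Longrightarrow> f (x \<oplus>\<^bsub>A\<^esub> y) = f x \<oplus>\<^bsub>B\<^esub> f y"
  shows "f \<in> module_hom \<Z> (int_module A) B"
proof (rule module_homI)
  interpret A: abelian_group A by fact
  interpret B: module \<Z> B by fact
  note Am = int_module_module[OF A]
  interpret Am: module \<Z> "int_module A" by fact
  fix k :: int and x assume x: "x \<in> carrier (int_module A)"
  have xA: "x \<in> carrier A" using x by simp
  have f0: "f \<zero>\<^bsub>A\<^esub> = \<zero>\<^bsub>B\<^esub>"
  proof -
    have "f \<zero>\<^bsub>A\<^esub> \<oplus>\<^bsub>B\<^esub> f \<zero>\<^bsub>A\<^esub> = f \<zero>\<^bsub>A\<^esub>" using f(2)[of "\<zero>\<^bsub>A\<^esub>" "\<zero>\<^bsub>A\<^esub>"] by simp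
    then show ?thesis using f(1)[of "\<zero>\<^bsub>A\<^esub>"] by (metis A.zero_closed B.M.add.r_cancel_one')
  qed
  have nat: "f (int n \<odot>\<^bsub>int_module A\<^esub> x) = int n \<odot>\<^bsub>B\<^esub> f x" for n
  proof (induction n)
    case 0
    show ?case using f0 Am.smult_l_null[OF x] B.smult_l_null[OF f(1)[OF xA]] by simp
  next
    case (Suc n)
    have "int (Suc n) \<odot>\<^bsub>int_module A\<^esub> x = int n \<odot>\<^bsub>int_module A\<^esub> x \<oplus>\<^bsub>A\<^esub> x"
      using Am.smult_l_distr[of "int n" 1 x] Am.smult_one[OF x] x by (simp add: add.commute)
    moreover have "int (Suc n) \<odot>\<^bsub>B\<^esub> f x = int n \<odot>\<^bsub>B\<^esub> f x \<oplus>\<^bsub>B\<^esub> f x"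
      using B.smult_l_distr[of "int n" 1 "f x"] B.smult_one[OF f(1)[OF xA]] f(1)[OF xA]
      by (simp add: add.commute)
    moreover have "int n \<odot>\<^bsub>int_module A\<^esub> x \<in> carrier A"
      using Am.smult_closed[of "int n" x] x by simp
    ultimately show ?case using f(2)[of "int n \<odot>\<^bsub>int_module A\<^esub> x" x] xA Suc.IH by simp
  qed
  show "f (k \<odot>\<^bsub>int_module A\<^esub> x) = k \<odot>\<^bsub>B\<^esub> f x"
  proof (cases "0 \<le> k")
    case True
    then show ?thesis using nat[of "nat k"] by simp
  next
    case False
    define n where "n = nat (- k)"
    have k: "k = - int n" using False by (simp add: n_def)
    have c: "int n \<odot>\<^bsub>int_module A\<^esub> x \<in> carrier A" "k \<odot>\<^bsub>int_module A\<^esub> x \<in> carrier A"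
      using Am.smult_closed[of _ x] x by simp_all
    have fx: "f x \<in> carrier B" by (rule f(1)[OF xA])
    have "k \<odot>\<^bsub>int_module A\<^esub> x \<oplus>\<^bsub>A\<^esub> int n \<odot>\<^bsub>int_module A\<^esub> x = \<zero>\<^bsub>A\<^esub>"
      using Am.smult_l_distr[of k "int n" x] Am.smult_l_null[OF x] x k by simp
    then have "f (k \<odot>\<^bsub>int_module A\<^esub> x) \<oplus>\<^bsub>B\<^esub> int n \<odot>\<^bsub>B\<^esub> f x = \<zero>\<^bsub>B\<^esub>"
      using f(2)[OF c(2,1)] f0 nat[of n] by simp
    then have "f (k \<odot>\<^bsub>int_module A\<^esub> x) = \<ominus>\<^bsub>B\<^esub> (int n \<odot>\<^bsub>B\<^esub> f x)"
      using B.M.minus_equality[of "f (k \<odot>\<^bsub>int_module A\<^esub> x)" "int n \<odot>\<^bsub>B\<^esub> f x"] f(1)[OF c(2)] fx by simp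
    moreover have "k \<odot>\<^bsub>B\<^esub> f x \<oplus>\<^bsub>B\<^esub> int n \<odot>\<^bsub>B\<^esub> f x = \<zero>\<^bsub>B\<^esub>"
      using B.smult_l_distr[of k "int n" "f x"] B.smult_l_null[OF fx] fx k by simp
    then have "k \<odot>\<^bsub>B\<^esub> f x = \<ominus>\<^bsub>B\<^esub> (int n \<odot>\<^bsub>B\<^esub> f x)"
      using B.M.minus_equality[of "k \<odot>\<^bsub>B\<^esub> f x" "int n \<odot>\<^bsub>B\<^esub> f x"] fx by simp
    ultimately show ?thesis by simp
  qed
qed (use f in simp_all)

text \<open>
  Ideals of the integers are principal, so a homomorphism on an ideal extends by dividing the image
  of a generator.
\<close>

lemma divisible_baer:
  assumes D: "module \<Z> D"
    and div: "\<And>n x. n \<noteq> 0 \<Longrightarrow> x \<in> carrier D \<Longrightarrow> \<exists>y\<in>carrier D. n \<odot>\<^bsub>D\<^esub> y = x"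
  shows "baer_module \<Z> D"
  unfolding baer_module_def
proof (intro conjI allI impI D, elim conjE)
  interpret D: module \<Z> D by fact
  fix I f
  assume I: "ideal I \<Z>" and f: "f \<in> I \<rightarrow> carrier D"
    and sm: "\<forall>r\<in>carrier \<Z>. \<forall>a\<in>I. f (r \<otimes>\<^bsub>\<Z>\<^esub> a) = r \<odot>\<^bsub>D\<^esub> f a"
  interpret I: ideal I \<Z> by fact
  obtain m where mI: "m \<in> I" and m: "\<forall>a\<in>I. m dvd a"
  proof -
    show thesis
    proof (cases "\<exists>a\<in>I. a \<noteq> 0")
      case False
      have "(0::int) \<in> I" using I.zero_closed by simp
      then show thesis using False that[of 0] by auto
    next
      case True
      then obtain b where b: "b \<in> I" "b \<noteq> 0" by blast
      have neg: "- a \<in> I" if "a \<in> I" for a using I.I_l_closed[OF that, of "-1"] by simp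
      have ex: "\<exists>n::nat. 0 < n \<and> int n \<in> I"
      proof (cases "b > 0")
        case True
        then show ?thesis using b by (intro exI[of _ "nat b"]) simp
      next
        case False
        then show ?thesis using b neg[OF b(1)] by (intro exI[of _ "nat (- b)"]) simp
      qed
      define n where "n = (LEAST n::nat. 0 < n \<and> int n \<in> I)"
      have n: "0 < n" "int n \<in> I" using LeastI_ex[OF ex] by (simp_all add: n_def)
      have "int n dvd a" if a: "a \<in> I" for a
      proof (rule ccontr)
        assume nd: "\<not> int n dvd a"
        have "- (a div int n) * int n \<in> I" using I.I_l_closed[OF n(2), of "- (a div int n)"] by simp
        then have "a \<oplus>\<^bsub>\<Z>\<^esub> (- (a div int n) * int n) \<in> I" by (rule I.a_closed[OF a])
        then have r: "a mod int n \<in> I" by (simp add: minus_div_mult_eq_mod)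
        have "0 < a mod int n" using nd n(1) by (metis dvd_eq_mod_eq_0 of_nat_0_less_iff order_le_less pos_mod_sign)
        then have "0 < nat (a mod int n) \<and> int (nat (a mod int n)) \<in> I" using r by simp
        then have "n \<le> nat (a mod int n)" unfolding n_def by (rule Least_le)
        moreover have "a mod int n < int n" using n(1) by simp
        moreover have "0 \<le> a mod int n" using n(1) by simp
        ultimately show False by (simp add: le_nat_iff)
      qed
      then show thesis using that[OF n(2)] by blast
    qed
  qed
  have fm: "f m \<in> carrier D" using f mI by auto
  have "\<exists>e\<in>carrier D. m \<odot>\<^bsub>D\<^esub> e = f m"
  proof (cases "m = 0")
    case True
    have "f (0 \<otimes>\<^bsub>\<Z>\<^esub> m) = 0 \<odot>\<^bsub>D\<^esub> f m" using sm mI by blast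
    then have "f m = \<zero>\<^bsub>D\<^esub>" using True D.smult_l_null[OF fm] by simp
    then show ?thesis using True D.smult_l_null[of "\<zero>\<^bsub>D\<^esub>"] by (intro bexI[of _ "\<zero>\<^bsub>D\<^esub>"]) simp_all
  next
    case False
    then show ?thesis using div fm by blast
  qed
  then obtain e where e: "e \<in> carrier D" "m \<odot>\<^bsub>D\<^esub> e = f m" by blast
  have "f a = a \<odot>\<^bsub>D\<^esub> e" if a: "a \<in> I" for a
  proof -
    obtain q where q: "a = m * q" using m a by (auto simp: dvd_def)
    have "f (q \<otimes>\<^bsub>\<Z>\<^esub> m) = q \<odot>\<^bsub>D\<^esub> f m" using sm mI by auto
    then have "f a = q \<odot>\<^bsub>D\<^esub> (m \<odot>\<^bsub>D\<^esub> e)" using e(2) by (simp add: q mult.commute)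
    then show ?thesis using D.smult_assoc1[of q m e] e(1) by (simp add: q mult.commute)
  qed
  then show "\<exists>e\<in>carrier D. \<forall>a\<in>I. f a = a \<odot>\<^bsub>D\<^esub> e" using e(1) by blast
qed

text \<open>A quotient is coded by codes of representatives.\<close>

lemma quot_code:
  fixes M :: "('a, 'b, 'm) module_scheme"
  assumes M: "module R M" and H: "submodule H R M" and i: "inj_on (i :: 'b \<Rightarrow> 'u) (carrier M)"
  obtains k where "inj_on (k :: _ \<Rightarrow> 'u) (carrier (quot_module M H))"
proof -
  define k where "k = (\<lambda>q. i (SOME x. x \<in> carrier M \<and> proj_quot M H x = q))"
  have ch: "(SOME x. x \<in> carrier M \<and> proj_quot M H x = q) \<in> carrier M \<and>
      proj_quot M H (SOME x. x \<in> carrier M \<and> proj_quot M H x = q) = q"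
    if "q \<in> carrier (quot_module M H)" for q
  proof (rule someI_ex[of "\<lambda>x. x \<in> carrier M \<and> proj_quot M H x = q"])
    show "\<exists>x. x \<in> carrier M \<and> proj_quot M H x = q"
      using that unfolding quot_carrier[OF M H] by (elim imageE) (rule exI, rule conjI, assumption, simp)
  qed
  have "inj_on k (carrier (quot_module M H))"
  proof (rule inj_onI)
    fix q q' assume q: "q \<in> carrier (quot_module M H)" "q' \<in> carrier (quot_module M H)" "k q = k q'"
    have "i (SOME x. x \<in> carrier M \<and> proj_quot M H x = q) = i (SOME x. x \<in> carrier M \<and> proj_quot M H x = q')"
      using q(3) by (simp only: k_def)
    then have "(SOME x. x \<in> carrier M \<and> proj_quot M H x = q) = (SOME x. x \<in> carrier M \<and> proj_quot M H x = q')"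
      by (rule inj_onD[OF i _ conjunct1[OF ch[OF q(1)]] conjunct1[OF ch[OF q(2)]]])
    then show "q = q'" using ch[OF q(1)] ch[OF q(2)] by metis
  qed
  then show thesis by (rule that)
qed

subsection \<open>The divisible group \<open>\<rat>\<^sup>(\<^sup>A\<^sup>)\<close> modulo the relations of \<open>A\<close>\<close>

definition rat_module :: "'b set \<Rightarrow> (int, 'b \<Rightarrow> rat) module" where
  "rat_module S = \<lparr>carrier = {c. finite {s. c s \<noteq> 0} \<and> {s. c s \<noteq> 0} \<subseteq> S}, mult = undefined, one = undefined,
     zero = (\<lambda>s. 0), add = (\<lambda>c d s. c s + d s), smult = (\<lambda>k c s. of_int k * c s)\<rparr>"

lemma rat_module_simps [simp]:
  "\<zero>\<^bsub>rat_module S\<^esub> = (\<lambda>s. 0)" "c \<oplus>\<^bsub>rat_module S\<^esub> d = (\<lambda>s. c s + d s)"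
  "k \<odot>\<^bsub>rat_module S\<^esub> c = (\<lambda>s. of_int k * c s)"
  by (simp_all add: rat_module_def)

lemma rat_module_carrier: "c \<in> carrier (rat_module S) \<longleftrightarrow> finite {s. c s \<noteq> 0} \<and> {s. c s \<noteq> 0} \<subseteq> S"
  by (simp add: rat_module_def)

lemma rat_module_combine:
  assumes "c \<in> carrier (rat_module S)" "d \<in> carrier (rat_module S)"
    and z: "\<And>s. c s = 0 \<Longrightarrow> d s = 0 \<Longrightarrow> e s = 0"
  shows "e \<in> carrier (rat_module S)"
proof -
  have "{s. e s \<noteq> 0} \<subseteq> {s. c s \<noteq> 0} \<union> {s. d s \<noteq> 0}" using z by blast
  then show ?thesis
    using assms(1,2) finite_subset[of "{s. e s \<noteq> 0}" "{s. c s \<noteq> 0} \<union> {s. d s \<noteq> 0}"]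
    unfolding rat_module_carrier by blast
qed

lemma rat_module_module: "module \<Z> (rat_module S)"
proof (rule moduleI)
  let ?F = "rat_module S"
  show "cring \<Z>" by (rule int_is_cring)
  show "abelian_group ?F"
  proof (rule abelian_groupI)
    show "c \<oplus>\<^bsub>?F\<^esub> d \<in> carrier ?F" if "c \<in> carrier ?F" "d \<in> carrier ?F" for c d
      by (rule rat_module_combine[OF that]) simp
    show "\<zero>\<^bsub>?F\<^esub> \<in> carrier ?F" by (simp add: rat_module_carrier)
    show "\<exists>d\<in>carrier ?F. d \<oplus>\<^bsub>?F\<^esub> c = \<zero>\<^bsub>?F\<^esub>" if c: "c \<in> carrier ?F" for c
    proof (rule bexI)
      show "(\<lambda>s. - c s) \<in> carrier ?F" by (rule rat_module_combine[OF c c]) simp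
    qed simp
  qed (simp_all add: add.assoc add.commute add.left_commute)
  show "k \<odot>\<^bsub>?F\<^esub> c \<in> carrier ?F" if "c \<in> carrier ?F" for k c
    by (rule rat_module_combine[OF that that]) simp
qed (simp_all add: algebra_simps)

text \<open>
  With \<open>A = F/K\<close> for a free group \<open>F\<close>, the group \<open>A\<close> embeds into the divisible quotient by \<open>K\<close> of the
  rational vector space spanned by \<open>F\<close>. The code \<open>k\<close> keeps this group within the test type.
\<close>

lemma divisible_hull:
  fixes A :: "('b, 'm) ring_scheme" and i :: "'b \<Rightarrow> ('a, 'c) univ"
  assumes A: "abelian_group A" and i: "inj_on i (carrier A)"
  obtains D :: "(int, ('b \<Rightarrow> rat) set) module" and \<iota> and k :: "('b \<Rightarrow> rat) set \<Rightarrow> ('a, 'c) univ"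
  where "baer_module \<Z> D" "\<iota> \<in> module_hom \<Z> (int_module A) D" "inj_on \<iota> (carrier A)" "inj_on k (carrier D)"
proof -
  let ?A = "int_module A"
  note Am = int_module_module[OF A]
  interpret A: module \<Z> ?A by (rule Am)
  let ?F = "rat_module (carrier A)"
  note Fm = rat_module_module[of "carrier A"]
  let ?Z = "free_module \<Z> (carrier A)"
  have Zm: "module \<Z> ?Z" by (rule cring.free_module_module[OF int_is_cring])
  have idc: "s \<in> carrier A \<Longrightarrow> s \<in> carrier ?A" for s by simp
  define \<pi> where "\<pi> = free_lift \<Z> ?A (\<lambda>s. s)"
  have \<pi>: "\<pi> \<in> module_hom \<Z> ?Z ?A" unfolding \<pi>_def by (rule cring.free_lift_hom[OF int_is_cring Am idc])
  have \<pi>g: "\<pi> (free_gen \<Z> s) = s" if "s \<in> carrier A" for s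
    unfolding \<pi>_def by (rule cring.free_lift_gen[OF int_is_cring Am idc that])
  define r where "r c = (\<lambda>s. of_int (c s) :: rat)" for c :: "'b \<Rightarrow> int"
  have r: "r \<in> module_hom \<Z> ?Z ?F"
  proof (rule module_homI)
    show "r c \<in> carrier ?F" if "c \<in> carrier ?Z" for c
      using that by (simp add: free_carrier_iff rat_module_carrier r_def)
  qed (simp_all add: r_def free_module_simps)
  have r_inj: "c = d" if "r c = r d" for c d
  proof
    fix s
    show "c s = d s" using fun_cong[OF that, of s] by (simp add: r_def)
  qed
  define K where "K = r ` hom_kernel ?Z ?A \<pi>"
  have K: "submodule K \<Z> ?F"
    unfolding K_def by (rule hom_image_submodule[OF Zm Fm r hom_kernel_submodule[OF Zm Am \<pi>]])
  let ?D = "quot_module ?F K" and ?p = "proj_quot ?F K"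
  have Dm: "module \<Z> ?D" by (rule quot_module_module[OF Fm K])
  have p: "?p \<in> module_hom \<Z> ?F ?D" by (rule proj_quot_hom[OF Fm K])
  have rK: "r c \<in> K \<longleftrightarrow> \<pi> c = \<zero>\<^bsub>A\<^esub>" if "c \<in> carrier ?Z" for c
  proof
    assume "r c \<in> K"
    then obtain d where d: "d \<in> carrier ?Z" "\<pi> d = \<zero>\<^bsub>?A\<^esub>" "r c = r d" unfolding K_def by blast
    then show "\<pi> c = \<zero>\<^bsub>A\<^esub>" using r_inj[OF d(3)] by simp
  next
    assume "\<pi> c = \<zero>\<^bsub>A\<^esub>"
    then show "r c \<in> K" unfolding K_def using that by (intro imageI) simp
  qed
  define \<iota> where "\<iota> a = ?p (r (free_gen \<Z> a))" for a
  have gz: "free_gen \<Z> a \<in> carrier ?Z" if "a \<in> carrier A" for a by (rule cring.free_gen_closed[OF int_is_cring that])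
  have rg: "r (free_gen \<Z> a) \<in> carrier ?F" if "a \<in> carrier A" for a by (rule module_hom_closed[OF r gz[OF that]])
  have eq: "?p (r u) = ?p (r v) \<longleftrightarrow> \<pi> u = \<pi> v" if u: "u \<in> carrier ?Z" and v: "v \<in> carrier ?Z" for u v
  proof -
    interpret Z: module \<Z> ?Z by (rule Zm)
    have "?p (r u) = ?p (r v) \<longleftrightarrow> r (u \<ominus>\<^bsub>?Z\<^esub> v) \<in> K"
      using proj_quot_eq_iff[OF Fm K module_hom_closed[OF r u] module_hom_closed[OF r v]]
        module_hom_minus[OF Zm Fm r u v] by simp
    also have "\<dots> \<longleftrightarrow> \<pi> (u \<ominus>\<^bsub>?Z\<^esub> v) = \<zero>\<^bsub>?A\<^esub>"
      using rK[of "u \<ominus>\<^bsub>?Z\<^esub> v"] u v by (simp add: Z.M.minus_closed)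
    also have "\<dots> \<longleftrightarrow> \<pi> u = \<pi> v"
      using module_hom_minus[OF Zm Am \<pi> u v]
        module_minus_eq_zero_iff[OF Am module_hom_closed[OF \<pi> u] module_hom_closed[OF \<pi> v]] by simp
    finally show ?thesis .
  qed
  have \<iota>: "\<iota> \<in> module_hom \<Z> ?A ?D"
  proof (rule additive_int_hom[OF A Dm])
    interpret Z: module \<Z> ?Z by (rule Zm)
    show "\<iota> x \<in> carrier ?D" if "x \<in> carrier A" for x
      unfolding \<iota>_def by (rule module_hom_closed[OF p rg[OF that]])
    fix x y assume x: "x \<in> carrier A" and y: "y \<in> carrier A"
    have xy: "x \<oplus>\<^bsub>A\<^esub> y \<in> carrier A" using A.M.a_closed[of x y] x y by simp
    have "\<iota> (x \<oplus>\<^bsub>A\<^esub> y) = ?p (r (free_gen \<Z> x \<oplus>\<^bsub>?Z\<^esub> free_gen \<Z> y))"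
      unfolding \<iota>_def eq[OF gz[OF xy] Z.M.a_closed[OF gz[OF x] gz[OF y]]]
      using module_hom_add[OF \<pi> gz[OF x] gz[OF y]] \<pi>g x y xy by simp
    also have "\<dots> = \<iota> x \<oplus>\<^bsub>?D\<^esub> \<iota> y"
      unfolding \<iota>_def module_hom_add[OF r gz[OF x] gz[OF y]] module_hom_add[OF p rg[OF x] rg[OF y]] ..
    finally show "\<iota> (x \<oplus>\<^bsub>A\<^esub> y) = \<iota> x \<oplus>\<^bsub>?D\<^esub> \<iota> y" .
  qed
  have \<iota>_inj: "inj_on \<iota> (carrier A)"
  proof (rule inj_onI)
    fix x y assume x: "x \<in> carrier A" and y: "y \<in> carrier A" and "\<iota> x = \<iota> y"
    then have "\<pi> (free_gen \<Z> x) = \<pi> (free_gen \<Z> y)" unfolding \<iota>_def eq[OF gz[OF x] gz[OF y]] by simp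
    then show "x = y" using \<pi>g[OF x] \<pi>g[OF y] by simp
  qed
  have baer: "baer_module \<Z> ?D"
  proof (rule divisible_baer[OF Dm])
    fix n :: int and x assume n: "n \<noteq> 0" and "x \<in> carrier ?D"
    then obtain c where c: "c \<in> carrier ?F" "x = ?p c" using quot_carrier[OF Fm K] by blast
    have d: "(\<lambda>s. c s / of_int n) \<in> carrier ?F" by (rule rat_module_combine[OF c(1) c(1)]) simp
    have "n \<odot>\<^bsub>?F\<^esub> (\<lambda>s. c s / of_int n) = c" using n by simp
    then have "n \<odot>\<^bsub>?D\<^esub> ?p (\<lambda>s. c s / of_int n) = x"
      using module_hom_smult[OF p _ d, of n] c(2) by simp
    then show "\<exists>y\<in>carrier ?D. n \<odot>\<^bsub>?D\<^esub> y = x" using module_hom_closed[OF p d] by blast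
  qed
  define code where "code = finsupp_code i (\<lambda>q::rat. nat_code (to_nat q)) 0"
  have code: "inj_on code (carrier ?F)"
    unfolding code_def
  proof (rule finsupp_code_inj[OF i])
    show "inj_on (\<lambda>q::rat. nat_code (to_nat q)) UNIV"
      by (rule inj_onI, drule nat_code_inj) simp
    show "finite {s. c s \<noteq> 0} \<and> {s. c s \<noteq> 0} \<subseteq> carrier A \<and> range c \<subseteq> UNIV" if "c \<in> carrier ?F" for c
      using that by (simp add: rat_module_carrier)
  qed
  obtain k :: "('b \<Rightarrow> rat) set \<Rightarrow> ('a, 'c) univ" where "inj_on k (carrier ?D)"
    by (rule quot_code[OF Fm K code])
  then show thesis by (rule that[OF baer \<iota> \<iota>_inj])
qed

text \<open>
  The \<open>R\<close>-module of additive maps from \<open>R\<close> into a divisible group is injective, by evaluation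
  at \<open>\<one>\<close>.
\<close>

definition coinduced :: "('a, 'r) ring_scheme \<Rightarrow> (int, 'd) module \<Rightarrow> ('a, 'a \<Rightarrow> 'd) module" where
  "coinduced R D = \<lparr>carrier = module_hom \<Z> (int_module R) D \<inter> extensional (carrier R), mult = undefined,
     one = undefined, zero = (\<lambda>s\<in>carrier R. \<zero>\<^bsub>D\<^esub>), add = (\<lambda>f g. \<lambda>s\<in>carrier R. f s \<oplus>\<^bsub>D\<^esub> g s),
     smult = (\<lambda>r f. \<lambda>s\<in>carrier R. f (r \<otimes>\<^bsub>R\<^esub> s))\<rparr>"

lemma coinduced_simps:
  "f \<in> carrier (coinduced R D) \<longleftrightarrow> f \<in> module_hom \<Z> (int_module R) D \<and> f \<in> extensional (carrier R)"
  "\<zero>\<^bsub>coinduced R D\<^esub> = (\<lambda>s\<in>carrier R. \<zero>\<^bsub>D\<^esub>)"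
  "f \<oplus>\<^bsub>coinduced R D\<^esub> g = (\<lambda>s\<in>carrier R. f s \<oplus>\<^bsub>D\<^esub> g s)"
  "r \<odot>\<^bsub>coinduced R D\<^esub> f = (\<lambda>s\<in>carrier R. f (r \<otimes>\<^bsub>R\<^esub> s))"
  by (simp_all add: coinduced_def)

context cring
begin

lemma int_module_R: "module \<Z> (int_module R)"
  by (rule int_module_module[OF is_abelian_group])

lemma mult_int_hom: "r \<in> carrier R \<Longrightarrow> (\<lambda>s. r \<otimes> s) \<in> module_hom \<Z> (int_module R) (int_module R)"
  by (rule additive_int_hom[OF is_abelian_group int_module_R]) (simp_all add: r_distr)

lemma coinduced_module:
  assumes D: "module \<Z> D"
  shows "module R (coinduced R D)"
proof -
  let ?H = "coinduced R D" and ?h = "hom_module \<Z> (int_module R) D"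
  interpret D: module \<Z> D by fact
  interpret h: module \<Z> ?h by (rule hom_module_module[OF int_module_R D])
  have same: "carrier ?H = carrier ?h" "\<zero>\<^bsub>?H\<^esub> = \<zero>\<^bsub>?h\<^esub>" "add ?H = add ?h"
    by (simp_all add: coinduced_def hom_module_def)
  have hom: "f \<in> module_hom \<Z> (int_module R) D" "f \<in> extensional (carrier R)" if "f \<in> carrier ?H" for f
    using that by (simp_all add: coinduced_simps(1))
  have val: "f s \<in> carrier D" if "f \<in> carrier ?H" "s \<in> carrier R" for f s
    using module_hom_closed[OF hom(1)[OF that(1)], of s] that(2) by simp
  have ad: "f (s \<oplus> t) = f s \<oplus>\<^bsub>D\<^esub> f t" if "f \<in> carrier ?H" "s \<in> carrier R" "t \<in> carrier R" for f s t
    using module_hom_add[OF hom(1)[OF that(1)], of s t] that(2,3) by simp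
  have sm: "r \<odot>\<^bsub>?H\<^esub> f \<in> carrier ?H" if r: "r \<in> carrier R" and f: "f \<in> carrier ?H" for r f
  proof -
    have "(\<lambda>s. f (r \<otimes> s)) \<in> module_hom \<Z> (int_module R) D"
      by (rule module_hom_comp[OF mult_int_hom[OF r] hom(1)[OF f]])
    then have "(\<lambda>s\<in>carrier (int_module R). f (r \<otimes> s)) \<in> carrier ?h"
      by (rule hom_module_restrict[OF int_module_R])
    then show ?thesis unfolding same coinduced_simps(4) by simp
  qed
  have pl: "f \<oplus>\<^bsub>?H\<^esub> g \<in> carrier ?H" if "f \<in> carrier ?H" "g \<in> carrier ?H" for f g
    using h.M.a_closed that unfolding same by blast
  note eqI = extensionalityI[where A = "carrier R"]
  show ?thesis
  proof (rule moduleI)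
    show "cring R" by (rule is_cring)
    show "abelian_group ?H"
    proof (rule abelian_groupI)
      show "\<exists>g\<in>carrier ?H. g \<oplus>\<^bsub>?H\<^esub> f = \<zero>\<^bsub>?H\<^esub>" if "f \<in> carrier ?H" for f
        using that h.M.l_neg[of f] h.M.a_inv_closed[of f] unfolding same by blast
    qed (simp_all add: same h.M.a_assoc, rule h.M.a_comm)
    show "r \<odot>\<^bsub>?H\<^esub> f \<in> carrier ?H" if "r \<in> carrier R" "f \<in> carrier ?H" for r f
      by (rule sm[OF that])
    show "(a \<oplus> b) \<odot>\<^bsub>?H\<^esub> f = a \<odot>\<^bsub>?H\<^esub> f \<oplus>\<^bsub>?H\<^esub> b \<odot>\<^bsub>?H\<^esub> f"
      if "a \<in> carrier R" "b \<in> carrier R" "f \<in> carrier ?H" for a b f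
      by (rule eqI) (use that ad in \<open>simp_all add: coinduced_simps(3,4) l_distr\<close>)
    show "a \<odot>\<^bsub>?H\<^esub> (f \<oplus>\<^bsub>?H\<^esub> g) = a \<odot>\<^bsub>?H\<^esub> f \<oplus>\<^bsub>?H\<^esub> a \<odot>\<^bsub>?H\<^esub> g"
      if "a \<in> carrier R" "f \<in> carrier ?H" "g \<in> carrier ?H" for a f g
      by (rule eqI) (use that in \<open>simp_all add: coinduced_simps(3,4)\<close>)
    show "(a \<otimes> b) \<odot>\<^bsub>?H\<^esub> f = a \<odot>\<^bsub>?H\<^esub> (b \<odot>\<^bsub>?H\<^esub> f)"
      if "a \<in> carrier R" "b \<in> carrier R" "f \<in> carrier ?H" for a b f
      by (rule eqI) (use that in \<open>simp_all add: coinduced_simps(4) m_assoc m_comm m_lcomm\<close>)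
    show "\<one> \<odot>\<^bsub>?H\<^esub> f = f" if "f \<in> carrier ?H" for f
      by (rule eqI) (use hom(2)[OF that] in \<open>simp_all add: coinduced_simps(4)\<close>)
  qed
qed

lemma coinduced_baer:
  assumes D: "baer_module \<Z> D"
  shows "baer_module R (coinduced R D)"
  unfolding baer_module_def
proof (intro conjI allI impI, goal_cases)
  case 1
  show ?case by (rule coinduced_module[OF baer_moduleD[OF D]])
next
  case (2 I f)
  let ?H = "coinduced R D"
  have Dm: "module \<Z> D" by (rule baer_moduleD[OF D])
  have I: "ideal I R" and fI: "\<And>a. a \<in> I \<Longrightarrow> f a \<in> carrier ?H"
    and add: "\<And>a b. a \<in> I \<Longrightarrow> b \<in> I \<Longrightarrow> f (a \<oplus> b) = f a \<oplus>\<^bsub>?H\<^esub> f b"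
    and sm: "\<And>r a. r \<in> carrier R \<Longrightarrow> a \<in> I \<Longrightarrow> f (r \<otimes> a) = r \<odot>\<^bsub>?H\<^esub> f a"
    using 2 by auto
  interpret I: ideal I R by fact
  let ?S = "(self_module R)\<lparr>carrier := I\<rparr>"
  have IA: "abelian_group ?S"
    by (rule module.axioms(2)[OF submodule_module[OF self_module_module]]) (simp add: self_submodule_iff I)
  let ?I = "int_module ?S"
  have Im: "module \<Z> ?I" by (rule int_module_module[OF IA])
  have IR: "a \<in> carrier R" if "a \<in> I" for a by (rule I.Icarr[OF that])
  have val: "f a s \<in> carrier D" if "a \<in> I" "s \<in> carrier R" for a s
    using fI[OF that(1)] module_hom_closed[of "f a" \<Z> "int_module R" D s] that(2) by (simp add: coinduced_simps(1))
  have inc: "(\<lambda>a. a) \<in> module_hom \<Z> ?I (int_module R)"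
    by (rule additive_int_hom[OF IA int_module_R]) (simp_all add: IR)
  have \<psi>: "(\<lambda>a. f a \<one>) \<in> module_hom \<Z> ?I D"
    by (rule additive_int_hom[OF IA Dm]) (simp_all add: val add coinduced_simps(3))
  have "f a \<one> = \<zero>\<^bsub>D\<^esub>" if "a \<in> carrier ?I" "a = \<zero>\<^bsub>int_module R\<^esub>" for a
    using module_hom_zero[OF Im Dm \<psi>] that by simp
  then obtain \<Psi> where \<Psi>: "\<Psi> \<in> module_hom \<Z> (int_module R) D" "\<And>a. a \<in> carrier ?I \<Longrightarrow> \<Psi> a = f a \<one>"
    using baer_extend[OF D Im int_module_R inc \<psi>] by metis
  let ?e = "restrict \<Psi> (carrier R)"
  have e: "?e \<in> carrier ?H"
    using module_hom_cong[OF int_module_R \<Psi>(1), of ?e] by (simp add: coinduced_simps(1))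
  have "f a = a \<odot>\<^bsub>?H\<^esub> ?e" if a: "a \<in> I" for a
  proof (rule extensionalityI[where A = "carrier R"])
    show "f a \<in> extensional (carrier R)" using fI[OF a] by (simp add: coinduced_simps(1))
    show "a \<odot>\<^bsub>?H\<^esub> ?e \<in> extensional (carrier R)" by (simp add: coinduced_simps(4))
    fix s assume s: "s \<in> carrier R"
    have sa: "s \<otimes> a \<in> I" using I.I_l_closed[OF a s] .
    have "f a s = (s \<odot>\<^bsub>?H\<^esub> f a) \<one>" using s by (simp add: coinduced_simps(4))
    also have "\<dots> = \<Psi> (a \<otimes> s)" using sm[OF s a] \<Psi>(2)[of "s \<otimes> a"] sa m_comm[OF s IR[OF a]] by simp
    finally show "f a s = (a \<odot>\<^bsub>?H\<^esub> ?e) s" using s IR[OF a] by (simp add: coinduced_simps(4))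
  qed
  then show ?case using e by blast
qed

text \<open>
  An abelian group \<open>A\<close> embeds into a divisible group \<open>D\<close>, and \<open>a \<mapsto> (r \<mapsto> r a)\<close> embeds the module \<open>A\<close> into
  the module of additive maps from \<open>R\<close> to \<open>D\<close>, whose copy on the test type is taken.
\<close>

theorem enough_injectives:
  fixes A :: "('a, 'x, 'm) module_scheme" and i :: "'x \<Rightarrow> ('a, 'c) univ"
  assumes A: "module R A" and i: "inj_on i (carrier A)"
  obtains E :: "('a, ('a, 'c) univ) module" and \<iota>
  where "baer_module R E" "\<iota> \<in> module_hom R A E" "inj_on \<iota> (carrier A)"
proof -
  interpret A: module R A by fact
  have Aa: "abelian_group A" by (rule module.axioms(2)[OF A])
  obtain D :: "(int, ('x \<Rightarrow> rat) set) module" and \<epsilon> and k :: "('x \<Rightarrow> rat) set \<Rightarrow> ('a, 'c) univ"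
    where D: "baer_module \<Z> D" and \<epsilon>: "\<epsilon> \<in> module_hom \<Z> (int_module A) D" "inj_on \<epsilon> (carrier A)"
      and k: "inj_on k (carrier D)"
    by (rule divisible_hull[OF Aa i])
  have Dm: "module \<Z> D" by (rule baer_moduleD[OF D])
  let ?H = "coinduced R D"
  have H: "module R ?H" by (rule coinduced_module[OF Dm])
  define \<eta> where "\<eta> x = (\<lambda>s\<in>carrier R. \<epsilon> (s \<odot>\<^bsub>A\<^esub> x))" for x
  have \<epsilon>a: "\<epsilon> (x \<oplus>\<^bsub>A\<^esub> y) = \<epsilon> x \<oplus>\<^bsub>D\<^esub> \<epsilon> y" if "x \<in> carrier A" "y \<in> carrier A" for x y
    using module_hom_add[OF \<epsilon>(1), of x y] that by simp
  have \<epsilon>c: "\<epsilon> x \<in> carrier D" if "x \<in> carrier A" for x using module_hom_closed[OF \<epsilon>(1), of x] that by simp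
  have \<eta>: "\<eta> \<in> module_hom R A ?H"
  proof (rule module_homI)
    show "\<eta> x \<in> carrier ?H" if x: "x \<in> carrier A" for x
    proof -
      have "\<eta> x \<in> module_hom \<Z> (int_module R) D"
        by (rule additive_int_hom[OF is_abelian_group Dm])
          (use x in \<open>simp_all add: \<eta>_def \<epsilon>c \<epsilon>a A.smult_l_distr\<close>)
      then show ?thesis by (simp add: coinduced_simps(1) \<eta>_def)
    qed
    show "\<eta> (x \<oplus>\<^bsub>A\<^esub> y) = \<eta> x \<oplus>\<^bsub>?H\<^esub> \<eta> y" if "x \<in> carrier A" "y \<in> carrier A" for x y
      by (rule extensionalityI[where A = "carrier R"])
        (use that in \<open>simp_all add: \<eta>_def coinduced_simps(3) A.smult_r_distr \<epsilon>a\<close>)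
    show "\<eta> (r \<odot>\<^bsub>A\<^esub> x) = r \<odot>\<^bsub>?H\<^esub> \<eta> x" if "r \<in> carrier R" "x \<in> carrier A" for r x
      by (rule extensionalityI[where A = "carrier R"])
        (use that in \<open>simp_all add: \<eta>_def coinduced_simps(4) A.smult_assoc1[symmetric] m_comm\<close>)
  qed
  have \<eta>_inj: "inj_on \<eta> (carrier A)"
  proof (rule inj_onI)
    fix x y assume xy: "x \<in> carrier A" "y \<in> carrier A" "\<eta> x = \<eta> y"
    have "\<epsilon> (\<one> \<odot>\<^bsub>A\<^esub> x) = \<epsilon> (\<one> \<odot>\<^bsub>A\<^esub> y)" using fun_cong[OF xy(3), of \<one>] by (simp add: \<eta>_def)
    then show "x = y" using inj_onD[OF \<epsilon>(2)] xy(1,2) by simp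
  qed
  define j where "j f = (Fun (\<lambda>l. k (f (hd l))) :: ('a, 'c) univ)" for f :: "'a \<Rightarrow> ('x \<Rightarrow> rat) set"
  have j: "inj_on j (carrier ?H)"
  proof (rule inj_onI)
    fix f g assume fg: "f \<in> carrier ?H" "g \<in> carrier ?H" "j f = j g"
    show "f = g"
    proof (rule extensionalityI[where A = "carrier R"])
      show "f \<in> extensional (carrier R)" "g \<in> extensional (carrier R)"
        using fg(1,2) by (simp_all add: coinduced_simps(1))
      fix s assume s: "s \<in> carrier R"
      have "k (f s) = k (g s)"
        using fun_cong[OF fg(3)[unfolded j_def univ.inject], of "[s]"] by simp
      moreover have "f s \<in> carrier D" "g s \<in> carrier D"
        using fg(1,2) module_hom_closed[of _ \<Z> "int_module R" D s] s by (simp_all add: coinduced_simps(1))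
      ultimately show "f s = g s" by (rule inj_onD[OF k])
    qed
  qed
  show thesis
  proof (rule that)
    show "baer_module R (transport_module j ?H)" by (rule transport_baer[OF H j coinduced_baer[OF D]])
    show "(\<lambda>x. j (\<eta> x)) \<in> module_hom R A (transport_module j ?H)"
      by (rule module_hom_comp[OF \<eta> transport_hom[OF H j]])
    show "inj_on (\<lambda>x. j (\<eta> x)) (carrier A)"
      using \<eta>_inj j module_hom_closed[OF \<eta>] unfolding inj_on_def by simp
  qed
qed

end

section \<open>Resolutions by Baer modules\<close>

lemma noetherian_quot:
  assumes M: "noetherian_module R M" and K: "submodule K R M"
  shows "noetherian_module R (quot_module M K)"
proof -
  note Mm = noetherian_moduleD[OF M]
  let ?Q = "quot_module M K" and ?p = "proj_quot M K"
  have Q: "module R ?Q" by (rule quot_module_module[OF Mm K])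
  have p: "?p \<in> module_hom R M ?Q" by (rule proj_quot_hom[OF Mm K])
  have "\<exists>S. finite S \<and> S \<subseteq> carrier ?Q \<and> module_span R ?Q S = H" if H: "submodule H R ?Q" for H
  proof -
    let ?H = "{x \<in> carrier M. ?p x \<in> H}"
    have Hs: "submodule ?H R M" by (rule hom_preimage_submodule[OF Mm Q p H])
    then have "\<exists>S. finite S \<and> S \<subseteq> carrier M \<and> module_span R M S = ?H"
      by (rule M[unfolded noetherian_module_def, THEN conjunct2, THEN spec, THEN mp])
    then obtain S where S: "finite S" "S \<subseteq> carrier M" "module_span R M S = ?H" by (elim exE conjE)
    have pS: "?p ` S \<subseteq> carrier ?Q" unfolding quot_carrier[OF Mm K] by (rule image_mono[OF S(2)])
    have SH: "S \<subseteq> ?H" unfolding S(3)[symmetric] by (rule span_superset)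
    note sp = span_submodule[OF Q pS]
    have "module_span R ?Q (?p ` S) = H"
    proof
      have "?p ` S \<subseteq> H"
      proof (rule image_subsetI)
        fix s assume "s \<in> S"
        then have "s \<in> ?H" by (rule subsetD[OF SH])
        then show "?p s \<in> H" by (elim CollectE conjE)
      qed
      then show "module_span R ?Q (?p ` S) \<subseteq> H" by (rule span_least[OF H])
      have "S \<subseteq> {x \<in> carrier M. ?p x \<in> module_span R ?Q (?p ` S)}"
      proof (intro subsetI CollectI conjI)
        fix s assume s: "s \<in> S"
        show "s \<in> carrier M" by (rule subsetD[OF S(2) s])
        show "?p s \<in> module_span R ?Q (?p ` S)" by (rule subsetD[OF span_superset imageI[OF s]])
      qed
      then have "?H \<subseteq> {x \<in> carrier M. ?p x \<in> module_span R ?Q (?p ` S)}"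
        unfolding S(3)[symmetric] by (rule span_least[OF hom_preimage_submodule[OF Mm Q p sp]])
      then have le: "?p x \<in> module_span R ?Q (?p ` S)" if "x \<in> carrier M" "?p x \<in> H" for x
        using that by blast
      show "H \<subseteq> module_span R ?Q (?p ` S)"
      proof
        fix q assume q: "q \<in> H"
        have "q \<in> ?p ` carrier M"
          unfolding quot_carrier[OF Mm K, symmetric] by (rule subsetD[OF submodule_subset[OF H] q])
        then obtain x where x: "x \<in> carrier M" "q = ?p x" by (elim imageE)
        show "q \<in> module_span R ?Q (?p ` S)" unfolding x(2) by (rule le[OF x(1) q[unfolded x(2)]])
      qed
    qed
    then show ?thesis using S(1) pS by (intro exI[of _ "?p ` S"]) simp
  qed
  then show ?thesis using Q by (simp add: noetherian_module_def)
qed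

text \<open>
  An injective resolution, built by embedding the cokernel of each differential into the next term.
  The choice carries the image that is to become the next kernel.
\<close>

lemma (in cring) exists_baer_complex:
  fixes N :: "('a, 'c, 'n) module_scheme"
  assumes N: "module R N"
  obtains E :: "nat \<Rightarrow> ('a, ('a, 'c) univ) module" and \<delta> \<epsilon>
  where "baer_complex R E \<delta>" "\<epsilon> \<in> module_hom R N (E 0)" "inj_on \<epsilon> (carrier N)"
    "\<epsilon> ` carrier N = hom_kernel (E 0) (E (Suc 0)) (\<delta> 0)"
proof -
  define P where "P n x \<longleftrightarrow> baer_module R (fst x) \<and> submodule (snd x) R (fst x) \<and>
      (n = 0 \<longrightarrow> (\<exists>\<epsilon>\<in>module_hom R N (fst x). inj_on \<epsilon> (carrier N) \<and> \<epsilon> ` carrier N = snd x))"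
    for n :: nat and x :: "('a, ('a, 'c) univ) module \<times> ('a, 'c) univ set"
  define Q where "Q n x y \<longleftrightarrow> (\<exists>\<delta>\<in>module_hom R (fst x) (fst y).
      hom_kernel (fst x) (fst y) \<delta> = snd x \<and> snd y = \<delta> ` carrier (fst x))"
    for n :: nat and x y :: "('a, ('a, 'c) univ) module \<times> ('a, 'c) univ set"
  have "\<exists>f. \<forall>n. P n (f n) \<and> Q n (f n) (f (Suc n))"
  proof (rule dependent_nat_choice)
    have i: "inj_on (Elem :: 'c \<Rightarrow> ('a, 'c) univ) (carrier N)" by (simp add: inj_on_def)
    obtain E0 :: "('a, ('a, 'c) univ) module" and \<epsilon> where E0: "baer_module R E0" "\<epsilon> \<in> module_hom R N E0" "inj_on \<epsilon> (carrier N)"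
      by (rule enough_injectives[OF N i])
    have "submodule (\<epsilon> ` carrier N) R E0"
      by (rule hom_image_submodule[OF N baer_moduleD[OF E0(1)] E0(2) module.carrier_is_submodule[OF N]])
    then have "P 0 (E0, \<epsilon> ` carrier N)" using E0 unfolding P_def by auto
    then show "\<exists>x. P 0 x" ..
  next
    fix x n assume "P n x"
    then have E: "baer_module R (fst x)" and H: "submodule (snd x) R (fst x)" by (simp_all add: P_def)
    have Em: "module R (fst x)" by (rule baer_moduleD[OF E])
    let ?Q = "quot_module (fst x) (snd x)" and ?p = "proj_quot (fst x) (snd x)"
    have Qm: "module R ?Q" by (rule quot_module_module[OF Em H])
    have p: "?p \<in> module_hom R (fst x) ?Q" by (rule proj_quot_hom[OF Em H])
    have "inj_on (\<lambda>u. u) (carrier (fst x))" by simp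
    then obtain k :: "('a, 'c) univ set \<Rightarrow> ('a, 'c) univ" where k: "inj_on k (carrier ?Q)"
      by (rule quot_code[OF Em H])
    obtain E' :: "('a, ('a, 'c) univ) module" and \<iota> where E': "baer_module R E'" "\<iota> \<in> module_hom R ?Q E'" "inj_on \<iota> (carrier ?Q)"
      by (rule enough_injectives[OF Qm k])
    have E'm: "module R E'" by (rule baer_moduleD[OF E'(1)])
    let ?\<delta> = "\<lambda>u. \<iota> (?p u)"
    have \<delta>: "?\<delta> \<in> module_hom R (fst x) E'" by (rule module_hom_comp[OF p E'(2)])
    have z: "\<iota> q = \<zero>\<^bsub>E'\<^esub> \<longleftrightarrow> q = \<zero>\<^bsub>?Q\<^esub>" if q: "q \<in> carrier ?Q" for q
      using inj_onD[OF E'(3) _ q module_zero_closed[OF Qm]] module_hom_zero[OF Qm E'm E'(2)] by metis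
    have "hom_kernel (fst x) E' ?\<delta> = snd x"
      using submodule_subset[OF H] z[OF module_hom_closed[OF p]] proj_quot_eq_zero_iff[OF Em H] by blast
    then have "Q n x (E', ?\<delta> ` carrier (fst x))"
      unfolding Q_def fst_conv snd_conv by (intro bexI[OF _ \<delta>] conjI refl)
    moreover have "submodule (?\<delta> ` carrier (fst x)) R E'"
      by (rule hom_image_submodule[OF Em E'm \<delta> module.carrier_is_submodule[OF Em]])
    then have "P (Suc n) (E', ?\<delta> ` carrier (fst x))" using E'(1) by (simp add: P_def)
    ultimately show "\<exists>y. P (Suc n) y \<and> Q n x y" by blast
  qed
  then obtain f where f: "\<And>n. P n (f n)" "\<And>n. Q n (f n) (f (Suc n))" by blast
  define E where "E n = fst (f n)" for n
  define H where "H n = snd (f n)" for n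
  have "\<exists>\<delta>. \<delta> \<in> module_hom R (E n) (E (Suc n)) \<and> hom_kernel (E n) (E (Suc n)) \<delta> = H n \<and>
      H (Suc n) = \<delta> ` carrier (E n)" for n
    using f(2)[of n] unfolding Q_def E_def H_def by blast
  then have "\<exists>\<delta>. \<forall>n. \<delta> n \<in> module_hom R (E n) (E (Suc n)) \<and>
      hom_kernel (E n) (E (Suc n)) (\<delta> n) = H n \<and> H (Suc n) = \<delta> n ` carrier (E n)"
    by (rule choice[OF allI])
  then obtain \<delta> where \<delta>: "\<And>n. \<delta> n \<in> module_hom R (E n) (E (Suc n))"
      "\<And>n. hom_kernel (E n) (E (Suc n)) (\<delta> n) = H n" "\<And>n. H (Suc n) = \<delta> n ` carrier (E n)"
    by blast
  have "\<exists>\<epsilon>\<in>module_hom R N (E 0). inj_on \<epsilon> (carrier N) \<and> \<epsilon> ` carrier N = H 0"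
    using f(1)[of 0] by (simp add: P_def E_def H_def)
  then obtain \<epsilon> where \<epsilon>: "\<epsilon> \<in> module_hom R N (E 0)" "inj_on \<epsilon> (carrier N)" "\<epsilon> ` carrier N = H 0" by blast
  have "baer_complex R E \<delta>"
  proof
    show "baer_module R (E n)" for n using f(1)[of n] by (simp add: P_def E_def)
    show "\<delta> n \<in> module_hom R (E n) (E (Suc n))" for n by (rule \<delta>(1))
    show "\<delta> n ` carrier (E n) = hom_kernel (E (Suc n)) (E (Suc (Suc n))) (\<delta> (Suc n))" for n
      using \<delta>(2)[of "Suc n"] \<delta>(3)[of n] by simp
  qed
  then show thesis using \<epsilon> unfolding \<delta>(2)[symmetric] by (rule that)
qed

text \<open>The lifting problem is against the surjection onto the cocycles.\<close>

lemma (in baer_complex) lift_cocycle: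
  assumes f: "f \<in> module_hom R P (E (Suc i))"
    and z: "\<forall>p\<in>carrier P. \<delta> (Suc i) (f p) = \<zero>\<^bsub>E (Suc (Suc i))\<^esub>"
    and lifting: "\<And>B :: ('a, 'e) module. module R B \<Longrightarrow> \<delta> i \<in> module_hom R (E i) B \<Longrightarrow> \<delta> i ` carrier (E i) = carrier B \<Longrightarrow>
      f \<in> module_hom R P B \<Longrightarrow> \<exists>h\<in>module_hom R P (E i). \<forall>p\<in>carrier P. \<delta> i (h p) = f p"
  shows "\<exists>h\<in>module_hom R P (E i). \<forall>p\<in>carrier P. \<delta> i (h p) = f p"
proof -
  let ?K = "hom_kernel (E (Suc i)) (E (Suc (Suc i))) (\<delta> (Suc i))"
  let ?B = "(E (Suc i))\<lparr>carrier := ?K\<rparr>"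
  have K: "submodule ?K R (E (Suc i))" by (rule hom_kernel_submodule[OF Em Em \<delta>])
  show ?thesis
  proof (rule lifting[of ?B])
    show "module R ?B" by (rule submodule_module[OF Em K])
    show "\<delta> i \<in> module_hom R (E i) ?B"
      by (rule module_homI) (simp_all add: module_hom_add[OF \<delta>] module_hom_smult[OF \<delta>])
    show "\<delta> i ` carrier (E i) = carrier ?B" using exactE[of i] by simp
    show "f \<in> module_hom R P ?B"
      by (rule module_homI) (use z in \<open>simp_all add: module_hom_closed[OF f] module_hom_add[OF f] module_hom_smult[OF f]\<close>)
  qed
qed

lemma (in baer_complex) free_rank_lift:
  assumes R: "cring R" and f: "f \<in> module_hom R (free_rank R m) (E (Suc i))"
    and z: "\<forall>p\<in>carrier (free_rank R m). \<delta> (Suc i) (f p) = \<zero>\<^bsub>E (Suc (Suc i))\<^esub>"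
  shows "\<exists>h\<in>module_hom R (free_rank R m) (E i). \<forall>p\<in>carrier (free_rank R m). \<delta> i (h p) = f p"
  by (rule lift_cocycle[OF f z], erule cring.free_lifting[OF R Em], assumption+) blast

lemma (in baer_complex) resolution_double_complex:
  assumes "projective_resolution R X P d e"
  shows "hom_double_complex R E \<delta> P d"
proof (rule hom_double_complex.intro[OF baer_complex_axioms], rule hom_double_complex_axioms.intro)
  show "module R (P n)" for n by (rule projective_resolutionD(2)[OF assms])
  show "d n \<in> module_hom R (P (Suc n)) (P n)" for n by (rule projective_resolutionD(4)[OF assms])
  show "d (Suc n) ` carrier (P (Suc (Suc n))) = hom_kernel (P (Suc n)) (P n) (d n)" for n
    by (rule projective_resolutionD(7)[OF assms])
  show "\<exists>h\<in>module_hom R (P j) (E i). \<forall>p\<in>carrier (P j). \<delta> i (h p) = f p"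
    if "f \<in> module_hom R (P j) (E (Suc i))"
      "\<forall>p\<in>carrier (P j). \<delta> (Suc i) (f p) = \<zero>\<^bsub>E (Suc (Suc i))\<^esub>" for j i f
    by (rule lift_cocycle[OF that], erule projective_lifting[OF projective_resolutionD(1)[OF assms] Em], assumption+)
      blast
qed

lemma (in hom_double_complex) column_vanishI:
  assumes "\<And>f. row_cocycle (Suc n) 0 f \<Longrightarrow> column_cocycle (Suc n) 0 f \<Longrightarrow>
    \<exists>h. row_cocycle n 0 h \<and> (\<forall>p\<in>carrier (P (Suc n)). f p = h (d n p))"
  shows "column_generated \<zero>\<^bsub>R\<^esub> n 0"
  unfolding column_generated_def
proof (intro allI impI, elim conjE)
  interpret E0: module R "E 0" by (rule Em)
  fix f assume f: "row_cocycle (Suc n) 0 f" "column_cocycle (Suc n) 0 f"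
  obtain h where h: "row_cocycle n 0 h" "\<forall>p\<in>carrier (P (Suc n)). f p = h (d n p)"
    using assms[OF f] by blast
  have hc: "h p \<in> carrier (E 0)" if "p \<in> carrier (P n)" for p
    using h(1) that unfolding row_cocycle_def by (blast intro: module_hom_closed)
  let ?g = "\<lambda>p. \<zero>\<^bsub>E 0\<^esub>"
  have g: "row_cocycle (Suc n) 0 ?g" "column_cocycle (Suc n) 0 ?g"
    using module_hom_zero_map[OF Em] by (simp_all add: row_cocycle_def column_cocycle_def)
  show "\<exists>g h. row_cocycle (Suc n) 0 g \<and> column_cocycle (Suc n) 0 g \<and> row_cocycle n 0 h \<and>
     (\<forall>p\<in>carrier (P (Suc n)). f p = \<zero>\<^bsub>R\<^esub> \<odot>\<^bsub>E 0\<^esub> g p \<oplus>\<^bsub>E 0\<^esub> h (d n p))"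
    using g h hc by (intro exI[of _ ?g] exI[of _ h]) simp
qed

lemma hom_inverse_on_image:
  assumes N: "module R N" and e: "e \<in> module_hom R N E" "inj_on e (carrier N)"
    and P: "module R P" and f: "f \<in> module_hom R P E" "\<forall>p\<in>carrier P. f p \<in> e ` carrier N"
  obtains f' where "f' \<in> module_hom R P N" "\<forall>p\<in>carrier P. e (f' p) = f p"
proof -
  interpret N: module R N by fact
  interpret P: module R P by fact
  let ?f = "\<lambda>p. inv_into (carrier N) e (f p)"
  have ef: "e (?f p) = f p" and fc: "?f p \<in> carrier N" if "p \<in> carrier P" for p
    using f(2) that by (simp_all add: f_inv_into_f inv_into_into)
  have "?f \<in> module_hom R P N"
  proof (rule module_homI)
    show "?f p \<in> carrier N" if "p \<in> carrier P" for p by (rule fc[OF that])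
    show "?f (p \<oplus>\<^bsub>P\<^esub> q) = ?f p \<oplus>\<^bsub>N\<^esub> ?f q" if pq: "p \<in> carrier P" "q \<in> carrier P" for p q
    proof (rule inj_onD[OF e(2)])
      show "e (?f (p \<oplus>\<^bsub>P\<^esub> q)) = e (?f p \<oplus>\<^bsub>N\<^esub> ?f q)"
        unfolding ef[OF P.M.a_closed[OF pq]] module_hom_add[OF e(1) fc[OF pq(1)] fc[OF pq(2)]]
        by (simp only: ef[OF pq(1)] ef[OF pq(2)] module_hom_add[OF f(1) pq])
    qed (use pq fc in simp_all)
    show "?f (r \<odot>\<^bsub>P\<^esub> p) = r \<odot>\<^bsub>N\<^esub> ?f p" if rp: "r \<in> carrier R" "p \<in> carrier P" for r p
    proof (rule inj_onD[OF e(2)])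
      show "e (?f (r \<odot>\<^bsub>P\<^esub> p)) = e (r \<odot>\<^bsub>N\<^esub> ?f p)"
        unfolding ef[OF P.smult_closed[OF rp]] module_hom_smult[OF e(1) rp(1) fc[OF rp(2)]]
        by (simp only: ef[OF rp(2)] module_hom_smult[OF f(1) rp])
    qed (use rp fc in simp_all)
  qed
  then show thesis using that[of ?f] ef by simp
qed

text \<open>Homomorphisms from a free module of finite rank to \<open>N\<close> are tuples of elements of \<open>N\<close>.\<close>

lemma (in cring) hom_free_rank_fin_gen:
  assumes N: "fin_gen_module R N"
  shows "fin_gen_module R (hom_module R (free_rank R n) N)"
proof -
  let ?F = "free_rank R n"
  let ?H = "hom_module R ?F N"
  have Nm: "module R N" using N by (simp add: fin_gen_module_def)
  interpret N: module R N by fact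
  obtain S where S: "finite S" "S \<subseteq> carrier N" "module_span R N S = carrier N"
    using N unfolding fin_gen_module_def by blast
  have F: "module R ?F" by (rule free_module_module)
  have H: "module R ?H" by (rule hom_module_module[OF F Nm])
  interpret H: module R ?H by (rule H)
  define \<phi> where "\<phi> t y = restrict (free_lift R N (\<lambda>j. if j = t then y else \<zero>\<^bsub>N\<^esub>)) (carrier ?F)" for t :: nat and y
  have x: "(if j = t then y else \<zero>\<^bsub>N\<^esub>) \<in> carrier N" if "y \<in> carrier N" for j t :: nat and y
    using that by simp
  have lh: "free_lift R N (\<lambda>j. if j = t then y else \<zero>\<^bsub>N\<^esub>) \<in> module_hom R ?F N" if "y \<in> carrier N" for t :: nat and y
    by (rule free_lift_hom[OF Nm]) (rule x[OF that])
  have \<phi>H: "\<phi> t y \<in> carrier ?H" if "y \<in> carrier N" for t y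
    unfolding \<phi>_def by (rule hom_module_restrict[OF F lh[OF that]])
  have \<phi>g: "\<phi> t y (free_gen R j) = (if j = t then y else \<zero>\<^bsub>N\<^esub>)" if "y \<in> carrier N" "j \<in> {..<n}" for t y j
  proof -
    have "free_lift R N (\<lambda>j. if j = t then y else \<zero>\<^bsub>N\<^esub>) (free_gen R j) = (if j = t then y else \<zero>\<^bsub>N\<^esub>)"
      by (rule free_lift_gen[OF Nm _ that(2)]) (rule x[OF that(1)])
    then show ?thesis using free_gen_closed[OF that(2)] by (simp add: \<phi>_def)
  qed
  have homH: "f \<in> module_hom R ?F N" "f \<in> extensional (carrier ?F)" if "f \<in> carrier ?H" for f
    using that by (simp_all add: hom_module_carrier_iff)
  have eqH: "f = g" if fg: "f \<in> carrier ?H" "g \<in> carrier ?H"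
    and eq: "\<And>j. j \<in> {..<n} \<Longrightarrow> f (free_gen R j) = g (free_gen R j)" for f g
  proof (rule extensionalityI[OF homH(2)[OF fg(1)] homH(2)[OF fg(2)]])
    fix c assume c: "c \<in> carrier ?F"
    show "f c = g c" by (rule free_hom_eqI[OF Nm homH(1)[OF fg(1)] homH(1)[OF fg(2)] _ c]) (rule eq)
  qed
  have val: "f (free_gen R j) \<in> carrier N" if "f \<in> carrier ?H" "j \<in> {..<n}" for f j
    by (rule module_hom_closed[OF homH(1)[OF that(1)] free_gen_closed[OF that(2)]])
  have addg: "(f \<oplus>\<^bsub>?H\<^esub> g) (free_gen R j) = f (free_gen R j) \<oplus>\<^bsub>N\<^esub> g (free_gen R j)" if "j \<in> {..<n}" for f g j
    using free_gen_closed[OF that] by (simp add: hom_module_simps)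
  have smg: "(r \<odot>\<^bsub>?H\<^esub> f) (free_gen R j) = r \<odot>\<^bsub>N\<^esub> f (free_gen R j)" if "j \<in> {..<n}" for f r j
    using free_gen_closed[OF that] by (simp add: hom_module_simps)
  let ?G = "(\<lambda>(t, y). \<phi> t y) ` ({..<n} \<times> S)"
  have G: "?G \<subseteq> carrier ?H" using S(2) \<phi>H by auto
  note sp = span_submodule[OF H G]
  have \<phi>hom: "\<phi> t \<in> module_hom R N ?H" for t
  proof (rule module_homI)
    show "\<phi> t y \<in> carrier ?H" if "y \<in> carrier N" for y by (rule \<phi>H[OF that])
    show "\<phi> t (y \<oplus>\<^bsub>N\<^esub> y') = \<phi> t y \<oplus>\<^bsub>?H\<^esub> \<phi> t y'" if y: "y \<in> carrier N" "y' \<in> carrier N" for y y'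
      by (rule eqH) (use y \<phi>H in \<open>simp_all add: addg \<phi>g\<close>)
    show "\<phi> t (r \<odot>\<^bsub>N\<^esub> y) = r \<odot>\<^bsub>?H\<^esub> \<phi> t y" if y: "r \<in> carrier R" "y \<in> carrier N" for r y
      by (rule eqH) (use y \<phi>H in \<open>simp_all add: smg \<phi>g\<close>)
  qed
  have \<phi>sp: "\<phi> t y \<in> module_span R ?H ?G" if t: "t \<in> {..<n}" and y: "y \<in> carrier N" for t y
  proof -
    have "S \<subseteq> {y \<in> carrier N. \<phi> t y \<in> module_span R ?H ?G}"
    proof
      fix s assume s: "s \<in> S"
      have "\<phi> t s \<in> ?G" using t s by (intro image_eqI[of _ _ "(t, s)"]) simp_all
      then have "\<phi> t s \<in> module_span R ?H ?G" using span_superset by (rule rev_subsetD)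
      then show "s \<in> {y \<in> carrier N. \<phi> t y \<in> module_span R ?H ?G}" using S(2) s by blast
    qed
    then have "module_span R N S \<subseteq> {y \<in> carrier N. \<phi> t y \<in> module_span R ?H ?G}"
      by (rule span_least[OF hom_preimage_submodule[OF Nm H \<phi>hom sp]])
    then show ?thesis using y unfolding S(3) by blast
  qed
  have all: "f \<in> module_span R ?H ?G"
    if "finite T" "T \<subseteq> {..<n}" "f \<in> carrier ?H" "\<forall>j\<in>{..<n} - T. f (free_gen R j) = \<zero>\<^bsub>N\<^esub>" for T f
    using that
  proof (induction T arbitrary: f rule: finite_induct)
    case empty
    have "f = \<zero>\<^bsub>?H\<^esub>"
    proof (rule eqH[OF empty.prems(2) H.M.zero_closed])
      show "f (free_gen R j) = \<zero>\<^bsub>?H\<^esub> (free_gen R j)" if "j \<in> {..<n}" for j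
        using empty.prems(3) that free_gen_closed[OF that] by (simp add: hom_module_simps)
    qed
    then show ?case using submodule_zero[OF H sp] by simp
  next
    case (insert t T)
    have t: "t \<in> {..<n}" using insert.prems(1) by simp
    let ?y = "f (free_gen R t)"
    have y: "?y \<in> carrier N" by (rule val[OF insert.prems(2) t])
    let ?f = "f \<oplus>\<^bsub>?H\<^esub> (\<ominus> \<one>) \<odot>\<^bsub>?H\<^esub> \<phi> t ?y"
    have fH: "?f \<in> carrier ?H" using insert.prems(2) \<phi>H[OF y] by simp
    have "\<forall>j\<in>{..<n} - T. ?f (free_gen R j) = \<zero>\<^bsub>N\<^esub>"
    proof
      fix j assume j: "j \<in> {..<n} - T"
      then have jn: "j \<in> {..<n}" by simp
      show "?f (free_gen R j) = \<zero>\<^bsub>N\<^esub>"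
      proof (cases "j = t")
        case True
        then show ?thesis using y jn by (simp add: addg smg \<phi>g N.smult_l_minus N.M.r_neg)
      next
        case False
        then have "f (free_gen R j) = \<zero>\<^bsub>N\<^esub>" using insert.prems(3) j by simp
        then show ?thesis using False y jn by (simp add: addg smg \<phi>g)
      qed
    qed
    then have "?f \<in> module_span R ?H ?G" using insert.IH fH insert.prems(1) by simp
    then have "?f \<oplus>\<^bsub>?H\<^esub> \<phi> t ?y \<in> module_span R ?H ?G" by (rule submodule_add[OF sp _ \<phi>sp[OF t y]])
    moreover have "?f \<oplus>\<^bsub>?H\<^esub> \<phi> t ?y = f"
      using insert.prems(2) \<phi>H[OF y] by (simp add: H.smult_l_minus H.M.a_assoc H.M.l_neg)
    ultimately show ?case by simp
  qed
  have "module_span R ?H ?G = carrier ?H"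
  proof
    show "module_span R ?H ?G \<subseteq> carrier ?H" by (rule submodule_subset[OF sp])
    show "carrier ?H \<subseteq> module_span R ?H ?G" using all[of "{..<n}"] by auto
  qed
  moreover have "finite ?G" using S(1) by simp
  ultimately show ?thesis using H G unfolding fin_gen_module_def by blast
qed

section \<open>Vanishing of Ext on cyclic modules\<close>

context noetherian_local_ring
begin

text \<open>
  The Ext groups of a resolution by free modules of finite rank are subquotients of finite sums of
  copies of \<open>N\<close>; they are finitely generated, so Nakayama's lemma applies to them.
\<close>

lemma column_nakayama:
  assumes C: "baer_complex R E \<delta>" and N: "fin_gen_module R N"
    and \<epsilon>: "\<epsilon> \<in> module_hom R N (E 0)" "inj_on \<epsilon> (carrier N)"
      "\<epsilon> ` carrier N = hom_kernel (E 0) (E (Suc 0)) (\<delta> 0)"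
    and D: "hom_double_complex R E \<delta> (\<lambda>n. free_rank R (r n)) d"
    and x: "x \<in> \<mm>"
    and gen: "hom_double_complex.column_generated R E \<delta> (\<lambda>n. free_rank R (r n)) d x n 0"
  shows "hom_double_complex.column_generated R E \<delta> (\<lambda>n. free_rank R (r n)) d \<zero> n 0"
proof -
  interpret D: hom_double_complex R E \<delta> "\<lambda>n. free_rank R (r n)" d by (rule D)
  have Nm: "module R N" using N by (simp add: fin_gen_module_def)
  interpret N: module R N by fact
  interpret E0: module R "E 0" by (rule D.Em)
  let ?F = "\<lambda>n. free_rank R (r n)"
  let ?H = "hom_module R (?F (Suc n)) N"
  have Fm: "module R (?F k)" for k by (rule free_module_module)
  have H: "module R ?H" by (rule hom_module_module[OF Fm Nm])
  interpret H: module R ?H by (rule H)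
  have Hn: "noetherian_module R ?H"
    by (rule fin_gen_noetherian[OF noetherian_ring_axioms hom_free_rank_fin_gen[OF N]])
  have xR: "x \<in> carrier R" using x m_sub by blast
  have hH: "f \<in> module_hom R (?F (Suc n)) N" "f \<in> extensional (carrier (?F (Suc n)))" if "f \<in> carrier ?H" for f
    using that by (simp_all add: hom_module_carrier_iff)
  define Z where "Z = {f \<in> carrier ?H. \<forall>p\<in>carrier (?F (Suc (Suc n))). f (d (Suc n) p) = \<zero>\<^bsub>N\<^esub>}"
  define B where "B = {f \<in> carrier ?H. \<exists>h\<in>module_hom R (?F n) N. \<forall>p\<in>carrier (?F (Suc n)). f p = h (d n p)}"
  have dc: "d k p \<in> carrier (?F k)" if "p \<in> carrier (?F (Suc k))" for k p using D.d_closed[OF that] .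
  have Z: "submodule Z R ?H"
  proof (rule submoduleI'[OF H])
    show "Z \<subseteq> carrier ?H" by (auto simp: Z_def)
    show "\<zero>\<^bsub>?H\<^esub> \<in> Z" using H.M.zero_closed dc by (simp add: Z_def hom_module_simps)
    show "f \<oplus>\<^bsub>?H\<^esub> g \<in> Z" if "f \<in> Z" "g \<in> Z" for f g
      using that H.M.a_closed[of f g] dc by (simp add: Z_def hom_module_simps)
    show "a \<odot>\<^bsub>?H\<^esub> f \<in> Z" if "a \<in> carrier R" "f \<in> Z" for a f
      using that H.smult_closed[of a f] dc by (simp add: Z_def hom_module_simps)
  qed
  have B: "submodule B R ?H"
  proof (rule submoduleI'[OF H])
    show "B \<subseteq> carrier ?H" by (auto simp: B_def)
    have "\<forall>p\<in>carrier (?F (Suc n)). \<zero>\<^bsub>?H\<^esub> p = (\<lambda>c. \<zero>\<^bsub>N\<^esub>) (d n p)" by (simp add: hom_module_simps)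
    then show "\<zero>\<^bsub>?H\<^esub> \<in> B"
      unfolding B_def by (intro CollectI conjI H.M.zero_closed bexI[OF _ module_hom_zero_map[OF Nm]])
    show "f \<oplus>\<^bsub>?H\<^esub> g \<in> B" if fg: "f \<in> B" "g \<in> B" for f g
    proof -
      obtain h where h: "h \<in> module_hom R (?F n) N" "\<forall>p\<in>carrier (?F (Suc n)). f p = h (d n p)"
        using fg(1) unfolding B_def by blast
      obtain k where k: "k \<in> module_hom R (?F n) N" "\<forall>p\<in>carrier (?F (Suc n)). g p = k (d n p)"
        using fg(2) unfolding B_def by blast
      have "\<forall>p\<in>carrier (?F (Suc n)). (f \<oplus>\<^bsub>?H\<^esub> g) p = (\<lambda>c. h c \<oplus>\<^bsub>N\<^esub> k c) (d n p)"
        using h(2) k(2) by (simp add: hom_module_simps)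
      moreover have "f \<oplus>\<^bsub>?H\<^esub> g \<in> carrier ?H" using fg by (simp add: B_def)
      ultimately show ?thesis unfolding B_def by (intro CollectI conjI bexI[OF _ module_hom_plus[OF Nm h(1) k(1)]])
    qed
    show "a \<odot>\<^bsub>?H\<^esub> f \<in> B" if af: "a \<in> carrier R" "f \<in> B" for a f
    proof -
      obtain h where h: "h \<in> module_hom R (?F n) N" "\<forall>p\<in>carrier (?F (Suc n)). f p = h (d n p)"
        using af(2) unfolding B_def by blast
      have "\<forall>p\<in>carrier (?F (Suc n)). (a \<odot>\<^bsub>?H\<^esub> f) p = (\<lambda>c. a \<odot>\<^bsub>N\<^esub> h c) (d n p)"
        using h(2) by (simp add: hom_module_simps)
      moreover have "a \<odot>\<^bsub>?H\<^esub> f \<in> carrier ?H" using af by (simp add: B_def)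
      ultimately show ?thesis unfolding B_def by (intro CollectI conjI bexI[OF _ module_hom_scale[OF Nm h(1) af(1)]])
    qed
  qed
  have e\<epsilon>: "\<epsilon> y \<in> carrier (E 0)" "\<delta> 0 (\<epsilon> y) = \<zero>\<^bsub>E (Suc 0)\<^esub>" if "y \<in> carrier N" for y
  proof -
    have "\<epsilon> y \<in> hom_kernel (E 0) (E (Suc 0)) (\<delta> 0)" unfolding \<epsilon>(3)[symmetric] using that by (rule imageI)
    then show "\<epsilon> y \<in> carrier (E 0)" "\<delta> 0 (\<epsilon> y) = \<zero>\<^bsub>E (Suc 0)\<^esub>" by simp_all
  qed
  \<comment> \<open>cocycles with values in \<open>E 0\<close> are homomorphisms to \<open>N\<close>\<close>
  have cocycle_hom: "\<exists>f'\<in>module_hom R (?F j) N. \<forall>p\<in>carrier (?F j). \<epsilon> (f' p) = f p" if "D.row_cocycle j 0 f" for f j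
  proof -
    have f: "f \<in> module_hom R (?F j) (E 0)" "\<forall>p\<in>carrier (?F j). f p \<in> \<epsilon> ` carrier N"
      using that unfolding \<epsilon>(3) D.row_cocycle_def using module_hom_closed[where f = f] by auto
    show ?thesis by (rule hom_inverse_on_image[OF Nm \<epsilon>(1,2) Fm f]) blast
  qed
  have inj: "y = y'" if "y \<in> carrier N" "y' \<in> carrier N" "\<epsilon> y = \<epsilon> y'" for y y'
    using inj_onD[OF \<epsilon>(2) that(3,1,2)] .
  have split: "\<exists>g\<in>Z. \<exists>b\<in>B. f = x \<odot>\<^bsub>?H\<^esub> g \<oplus>\<^bsub>?H\<^esub> b" if f: "f \<in> Z" for f
  proof -
    have fH: "f \<in> carrier ?H" and fd: "\<forall>p\<in>carrier (?F (Suc (Suc n))). f (d (Suc n) p) = \<zero>\<^bsub>N\<^esub>"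
      using f by (simp_all add: Z_def)
    note fc = module_hom_closed[OF hH(1)[OF fH]]
    have \<epsilon>0: "\<epsilon> \<zero>\<^bsub>N\<^esub> = \<zero>\<^bsub>E 0\<^esub>" by (rule module_hom_zero[OF Nm D.Em \<epsilon>(1)])
    have coc: "D.row_cocycle (Suc n) 0 (\<lambda>p. \<epsilon> (f p))" "D.column_cocycle (Suc n) 0 (\<lambda>p. \<epsilon> (f p))"
      unfolding D.row_cocycle_def D.column_cocycle_def
      using module_hom_comp[OF hH(1)[OF fH] \<epsilon>(1)] fc e\<epsilon>(2) fd \<epsilon>0 by simp_all
    obtain g h where g: "D.row_cocycle (Suc n) 0 g" "D.column_cocycle (Suc n) 0 g" and h: "D.row_cocycle n 0 h"
      and eq: "\<forall>p\<in>carrier (?F (Suc n)). \<epsilon> (f p) = x \<odot>\<^bsub>E 0\<^esub> g p \<oplus>\<^bsub>E 0\<^esub> h (d n p)"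
      using gen[unfolded D.column_generated_def, THEN spec, of "\<lambda>p. \<epsilon> (f p)"] coc by blast
    obtain g' where g': "g' \<in> module_hom R (?F (Suc n)) N" "\<forall>p\<in>carrier (?F (Suc n)). \<epsilon> (g' p) = g p"
      using cocycle_hom[OF g(1)] by blast
    obtain h' where h': "h' \<in> module_hom R (?F n) N" "\<forall>p\<in>carrier (?F n). \<epsilon> (h' p) = h p"
      using cocycle_hom[OF h] by blast
    note gc = module_hom_closed[OF g'(1)] and hc = module_hom_closed[OF h'(1)]
    let ?g = "restrict g' (carrier (?F (Suc n)))" and ?b = "restrict (\<lambda>p. h' (d n p)) (carrier (?F (Suc n)))"
    have gH: "?g \<in> carrier ?H" by (rule hom_module_restrict[OF Fm g'(1)])
    have bH: "?b \<in> carrier ?H" by (rule hom_module_restrict[OF Fm module_hom_comp[OF D.d h'(1)]])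
    have "g' (d (Suc n) p) = \<zero>\<^bsub>N\<^esub>" if p: "p \<in> carrier (?F (Suc (Suc n)))" for p
    proof (rule inj[OF gc[OF dc[OF p]] N.M.zero_closed])
      show "\<epsilon> (g' (d (Suc n) p)) = \<epsilon> \<zero>\<^bsub>N\<^esub>"
        using g'(2) dc[OF p] g(2) p \<epsilon>0 by (simp add: D.column_cocycle_def)
    qed
    then have gZ: "?g \<in> Z" using gH dc by (simp add: Z_def)
    have "\<forall>p\<in>carrier (?F (Suc n)). ?b p = h' (d n p)" by simp
    then have bB: "?b \<in> B" unfolding B_def using bH h'(1) by blast
    have "f = x \<odot>\<^bsub>?H\<^esub> ?g \<oplus>\<^bsub>?H\<^esub> ?b"
    proof (rule extensionalityI[OF hH(2)[OF fH]])
      show "x \<odot>\<^bsub>?H\<^esub> ?g \<oplus>\<^bsub>?H\<^esub> ?b \<in> extensional (carrier (?F (Suc n)))" by (simp add: hom_module_simps)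
      fix p assume p: "p \<in> carrier (?F (Suc n))"
      have "f p = x \<odot>\<^bsub>N\<^esub> g' p \<oplus>\<^bsub>N\<^esub> h' (d n p)"
      proof (rule inj[OF fc[OF p]])
        show "x \<odot>\<^bsub>N\<^esub> g' p \<oplus>\<^bsub>N\<^esub> h' (d n p) \<in> carrier N" using xR gc[OF p] hc[OF dc[OF p]] by simp
        show "\<epsilon> (f p) = \<epsilon> (x \<odot>\<^bsub>N\<^esub> g' p \<oplus>\<^bsub>N\<^esub> h' (d n p))"
          using eq p g'(2) h'(2) dc[OF p] xR gc[OF p] hc[OF dc[OF p]]
          by (simp add: module_hom_add[OF \<epsilon>(1)] module_hom_smult[OF \<epsilon>(1)])
      qed
      then show "f p = (x \<odot>\<^bsub>?H\<^esub> ?g \<oplus>\<^bsub>?H\<^esub> ?b) p" using p by (simp add: hom_module_simps)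
    qed
    then show ?thesis using gZ bB by blast
  qed
  have "Z \<subseteq> B"
  proof (rule nakayama[OF Hn B Z])
    fix L assume L: "submodule L R ?H" "B \<subseteq> L" "\<And>a h. a \<in> \<mm> \<Longrightarrow> h \<in> Z \<Longrightarrow> a \<odot>\<^bsub>?H\<^esub> h \<in> L"
    show "Z \<subseteq> L"
    proof
      fix f assume "f \<in> Z"
      then obtain g b where gb: "g \<in> Z" "b \<in> B" "f = x \<odot>\<^bsub>?H\<^esub> g \<oplus>\<^bsub>?H\<^esub> b" using split by blast
      have "b \<in> L" using gb(2) L(2) by blast
      then show "f \<in> L" unfolding gb(3) by (rule submodule_add[OF L(1) L(3)[OF x gb(1)]])
    qed
  qed
  show ?thesis
  proof (rule D.column_vanishI)
    fix f assume f: "D.row_cocycle (Suc n) 0 f" "D.column_cocycle (Suc n) 0 f"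
    obtain f' where f': "f' \<in> module_hom R (?F (Suc n)) N" "\<forall>p\<in>carrier (?F (Suc n)). \<epsilon> (f' p) = f p"
      using cocycle_hom[OF f(1)] by blast
    let ?f = "restrict f' (carrier (?F (Suc n)))"
    have fH: "?f \<in> carrier ?H" by (rule hom_module_restrict[OF Fm f'(1)])
    have "f' (d (Suc n) p) = \<zero>\<^bsub>N\<^esub>" if p: "p \<in> carrier (?F (Suc (Suc n)))" for p
    proof (rule inj[OF module_hom_closed[OF f'(1) dc[OF p]] N.M.zero_closed])
      show "\<epsilon> (f' (d (Suc n) p)) = \<epsilon> \<zero>\<^bsub>N\<^esub>"
        using f'(2) dc[OF p] f(2) p module_hom_zero[OF Nm D.Em \<epsilon>(1)] by (simp add: D.column_cocycle_def)
    qed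
    then have "?f \<in> Z" using fH dc by (simp add: Z_def)
    then have "?f \<in> B" using \<open>Z \<subseteq> B\<close> by blast
    then obtain h where h: "h \<in> module_hom R (?F n) N" "\<forall>p\<in>carrier (?F (Suc n)). ?f p = h (d n p)"
      unfolding B_def by blast
    have "D.row_cocycle n 0 (\<lambda>p. \<epsilon> (h p))"
      unfolding D.row_cocycle_def using module_hom_comp[OF h(1) \<epsilon>(1)] e\<epsilon>(2) module_hom_closed[OF h(1)] by simp
    moreover have "\<forall>p\<in>carrier (?F (Suc n)). f p = \<epsilon> (h (d n p))"
    proof
      fix p assume p: "p \<in> carrier (?F (Suc n))"
      then have "f' p = h (d n p)" using h(2) by simp
      then show "f p = \<epsilon> (h (d n p))" using f'(2) p by metis
    qed
    ultimately show "\<exists>h. D.row_cocycle n 0 h \<and> (\<forall>p\<in>carrier (?F (Suc n)). f p = h (d n p))"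
      by (intro exI[of _ "\<lambda>p. \<epsilon> (h p)"]) simp
  qed
qed

text \<open>
  Noetherian induction on \<open>I\<close>. If \<open>I\<close> is not prime, \<open>R/I\<close> is an extension of two proper quotients;
  if it is prime and \<open>x \<in> \<mm> - I\<close>, vanishing on \<open>R/(I + x R)\<close> one degree higher makes
  multiplication by \<open>x\<close> surjective.
\<close>

theorem ext_vanishes_cyclic:
  assumes C: "baer_complex R E \<delta>" and N: "fin_gen_module R N"
    and \<epsilon>: "\<epsilon> \<in> module_hom R N (E 0)" "inj_on \<epsilon> (carrier N)"
      "\<epsilon> ` carrier N = hom_kernel (E 0) (E (Suc 0)) (\<delta> 0)"
    and soc: "\<forall>n\<ge>n0. socle_exact_at E \<delta> n"
    and n: "n0 \<le> n" and I: "ideal I R"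
  shows "baer_complex.ext_vanishes R E \<delta> (self_module R) n (carrier R) I"
proof (rule ccontr)
  interpret C: baer_complex R E \<delta> by (rule C)
  let ?A = "self_module R"
  let ?V = "\<lambda>n. C.ext_vanishes ?A n (carrier R)"
  note Am = self_module_module
  interpret A: module R ?A by (rule Am)
  assume "\<not> ?V n I"
  let ?F = "{J. ideal J R \<and> (\<exists>n\<ge>n0. \<not> ?V n J)}"
  have ne: "?F \<noteq> {}" using I n \<open>\<not> ?V n I\<close> by blast
  have sub: "submodule J R ?A" if "J \<in> ?F" for J using that by (simp add: self_submodule_iff)
  obtain J where J: "J \<in> ?F" and Jmax: "\<And>K. K \<in> ?F \<Longrightarrow> J \<subseteq> K \<Longrightarrow> K = J"
  proof (rule noetherian_module_maximal[OF self_noetherian ne sub])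
    fix J assume "J \<in> ?F" "\<And>K. K \<in> ?F \<Longrightarrow> J \<subseteq> K \<Longrightarrow> K = J"
    then show thesis by (rule that)
  qed
  have Ji: "ideal J R" and "\<exists>n\<ge>n0. \<not> ?V n J" using J by simp_all
  then obtain k where k: "n0 \<le> k" "\<not> ?V k J" by blast
  interpret J: ideal J R by (rule Ji)
  have Js: "submodule J R ?A" using Ji by (simp add: self_submodule_iff)
  have big: "?V k' K" if "ideal K R" "J \<subseteq> K" "K \<noteq> J" "n0 \<le> k'" for K k'
  proof (rule ccontr)
    assume "\<not> ?V k' K"
    then have "K \<in> ?F" using that by blast
    then show False using Jmax that by blast
  qed
  have f1: "f r = r \<odot>\<^bsub>E j\<^esub> f \<one>" if "f \<in> module_hom R ?A (E j)" "r \<in> carrier R" for f r j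
    using module_hom_smult[OF that(1) that(2), of \<one>] that(2) by simp
  have JR: "J \<noteq> carrier R"
  proof
    assume JR: "J = carrier R"
    have "?V k J"
    proof (rule C.ext_vanishesI)
      fix f assume "\<forall>r\<in>J. f r = \<zero>\<^bsub>E (Suc k)\<^esub>"
      then show "\<exists>g\<in>module_hom R ?A (E k). (\<forall>r\<in>J. g r = \<zero>\<^bsub>E k\<^esub>) \<and> (\<forall>r\<in>carrier R. \<delta> k (g r) = f r)"
        unfolding JR using module_hom_zero_map[OF C.Em] by (intro bexI[of _ "\<lambda>r. \<zero>\<^bsub>E k\<^esub>"]) simp_all
    qed
    then show False using k(2) by simp
  qed
  have Jm: "J \<noteq> \<mm>"
  proof
    assume Jm: "J = \<mm>"
    have "?V k J"
    proof (rule C.ext_vanishesI)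
      interpret Ek: module R "E k" by (rule C.Em)
      interpret Es: module R "E (Suc k)" by (rule C.Em)
      fix f assume f: "f \<in> module_hom R ?A (E (Suc k))" "\<forall>r\<in>J. f r = \<zero>\<^bsub>E (Suc k)\<^esub>"
        "\<forall>r\<in>carrier R. \<delta> (Suc k) (f r) = \<zero>\<^bsub>E (Suc (Suc k))\<^esub>"
      have f1c: "f \<one> \<in> carrier (E (Suc k))" using module_hom_closed[OF f(1), of \<one>] by simp
      have "\<forall>a\<in>\<mm>. a \<odot>\<^bsub>E (Suc k)\<^esub> f \<one> = \<zero>\<^bsub>E (Suc k)\<^esub>"
      proof
        fix a assume a: "a \<in> \<mm>"
        have "a \<in> carrier R" using a m_sub by blast
        then show "a \<odot>\<^bsub>E (Suc k)\<^esub> f \<one> = \<zero>\<^bsub>E (Suc k)\<^esub>" using f1[OF f(1), of a] f(2) a Jm by simp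
      qed
      moreover have "\<delta> (Suc k) (f \<one>) = \<zero>\<^bsub>E (Suc (Suc k))\<^esub>" using f(3) by simp
      ultimately obtain g where g: "g \<in> carrier (E k)" "\<forall>a\<in>\<mm>. a \<odot>\<^bsub>E k\<^esub> g = \<zero>\<^bsub>E k\<^esub>" "\<delta> k g = f \<one>"
        using soc[THEN spec, THEN mp, OF k(1), THEN bspec, OF f1c] by blast
      show "\<exists>g\<in>module_hom R ?A (E k). (\<forall>r\<in>J. g r = \<zero>\<^bsub>E k\<^esub>) \<and> (\<forall>r\<in>carrier R. \<delta> k (g r) = f r)"
      proof (intro bexI conjI ballI)
        show "(\<lambda>r. r \<odot>\<^bsub>E k\<^esub> g) \<in> module_hom R ?A (E k)" by (rule Ek.smult_point_hom[OF g(1)])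
        show "r \<odot>\<^bsub>E k\<^esub> g = \<zero>\<^bsub>E k\<^esub>" if "r \<in> J" for r using that g(2) Jm by simp
        show "\<delta> k (r \<odot>\<^bsub>E k\<^esub> g) = f r" if r: "r \<in> carrier R" for r
          using module_hom_smult[OF C.\<delta> r g(1)] g(3) f1[OF f(1) r] by simp
      qed
    qed
    then show False using k(2) by simp
  qed
  have "J \<subseteq> \<mm>" by (rule proper_ideal_le_m[OF Ji JR])
  then obtain x where x: "x \<in> \<mm>" "x \<notin> J" using Jm by blast
  have xR: "x \<in> carrier R" using x(1) m_sub by blast
  have plus: "submodule (J <+>\<^bsub>?A\<^esub> smult_image ?A a (carrier R)) R ?A"
      "J \<subseteq> J <+>\<^bsub>?A\<^esub> smult_image ?A a (carrier R)" "a \<in> J <+>\<^bsub>?A\<^esub> smult_image ?A a (carrier R)"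
    if a: "a \<in> carrier R" for a
  proof -
    have im: "submodule (smult_image ?A a (carrier R)) R ?A"
      using A.smult_image_submodule[OF a A.carrier_is_submodule] by simp
    show "submodule (J <+>\<^bsub>?A\<^esub> smult_image ?A a (carrier R)) R ?A" by (rule A.sum_submodule[OF Js im])
    show "J \<subseteq> J <+>\<^bsub>?A\<^esub> smult_image ?A a (carrier R)" by (rule A.sum_superset(1)[OF Js im])
    have "a \<in> smult_image ?A a (carrier R)"
      unfolding smult_image_def using a by (intro image_eqI[of _ _ \<one>]) simp_all
    then show "a \<in> J <+>\<^bsub>?A\<^esub> smult_image ?A a (carrier R)" using A.sum_superset(2)[OF Js im] by blast
  qed
  have bigplus: "?V k' (J <+>\<^bsub>?A\<^esub> smult_image ?A a (carrier R))" if a: "a \<in> carrier R" "a \<notin> J" "n0 \<le> k'" for a k'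
  proof (rule big[OF _ plus(2)[OF a(1)] _ a(3)])
    show "ideal (J <+>\<^bsub>?A\<^esub> smult_image ?A a (carrier R)) R" using plus(1)[OF a(1)] by (simp add: self_submodule_iff)
    show "J <+>\<^bsub>?A\<^esub> smult_image ?A a (carrier R) \<noteq> J" using plus(3)[OF a(1)] a(2) by blast
  qed
  have prime: "a \<in> J \<or> b \<in> J" if ab: "a \<in> carrier R" "b \<in> carrier R" "a \<otimes> b \<in> J" for a b
  proof (rule ccontr)
    assume "\<not> (a \<in> J \<or> b \<in> J)"
    then have n: "a \<notin> J" "b \<notin> J" by simp_all
    let ?c = "colon ?A J a"
    have c: "submodule ?c R ?A" by (rule A.colon_submodule[OF ab(1) Js])
    have "b \<in> ?c" using ab by (simp add: colon_def)
    then have cne: "?c \<noteq> J" using n(2) by blast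
    have ci: "ideal ?c R" using c by (simp add: self_submodule_iff)
    have "?V k ?c" by (rule big[OF ci A.colon_superset[OF ab(1) Js] cne k(1)])
    then have V1: "C.ext_vanishes ?A k (J <+>\<^bsub>?A\<^esub> smult_image ?A a (carrier R)) J"
      using C.ext_vanishes_multiple[OF Am Js A.carrier_is_submodule ab(1)] by simp
    have "?V k J"
      by (rule C.ext_vanishes_extension[OF Am plus(2)[OF ab(1)] _ _ V1 bigplus[OF ab(1) n(1) k(1)]])
        (use submodule_subset[OF plus(1)[OF ab(1)]] in simp_all)
    then show False using k(2) by simp
  qed
  let ?Q = "quot_module ?A J" and ?p = "proj_quot ?A J"
  have Q: "module R ?Q" by (rule quot_module_module[OF Am Js])
  have p: "?p \<in> module_hom R ?A ?Q" by (rule proj_quot_hom[OF Am Js])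
  obtain r d e where res: "free_resolution R ?Q r d e"
    by (rule minimal_resolution[OF noetherian_quot[OF self_noetherian Js]])
  let ?P = "\<lambda>n. free_rank R (r n)"
  note res = res[unfolded free_resolution_def]
  have e: "e \<in> module_hom R (?P 0) ?Q" and esurj: "e ` carrier (?P 0) = carrier ?Q"
    and d: "\<And>n. d n \<in> module_hom R (?P (Suc n)) (?P n)"
    and ex0: "d 0 ` carrier (?P (Suc 0)) = hom_kernel (?P 0) ?Q e"
    and ex: "\<And>n. d (Suc n) ` carrier (?P (Suc (Suc n))) = hom_kernel (?P (Suc n)) (?P n) (d n)"
    using res by simp_all
  have Pm: "module R (?P n)" for n by (rule free_module_module)
  have D: "hom_double_complex R E \<delta> ?P d"
  proof (rule hom_double_complex.intro[OF C], rule hom_double_complex_axioms.intro)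
    show "module R (?P n)" for n by (rule Pm)
    show "d n \<in> module_hom R (?P (Suc n)) (?P n)" for n by (rule d)
    show "d (Suc n) ` carrier (?P (Suc (Suc n))) = hom_kernel (?P (Suc n)) (?P n) (d n)" for n by (rule ex)
    show "\<exists>h\<in>module_hom R (?P j) (E i). \<forall>p\<in>carrier (?P j). \<delta> i (h p) = f p"
      if "f \<in> module_hom R (?P j) (E (Suc i))"
        "\<forall>p\<in>carrier (?P j). \<delta> (Suc i) (f p) = \<zero>\<^bsub>E (Suc (Suc i))\<^esub>" for j i f
      by (rule C.free_rank_lift[OF is_cring that])
  qed
  interpret D: hom_double_complex R E \<delta> ?P d by (rule D)
  have "D.row_generated x 0 k"
    unfolding D.row_generated_def
  proof (intro allI impI, elim conjE)
    interpret Es: module R "E (Suc k)" by (rule C.Em)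
    interpret Ess: module R "E (Suc (Suc k))" by (rule C.Em)
    fix f0 assume f0: "D.row_cocycle 0 (Suc k) f0" "D.column_cocycle 0 (Suc k) f0"
    have f0h: "f0 \<in> module_hom R (?P 0) (E (Suc k))" using f0(1) by (simp add: D.row_cocycle_def)
    have "f0 c = \<zero>\<^bsub>E (Suc k)\<^esub>" if c: "c \<in> carrier (?P 0)" "e c = \<zero>\<^bsub>?Q\<^esub>" for c
    proof -
      have "c \<in> d 0 ` carrier (?P (Suc 0))" unfolding ex0 using c by simp
      then show ?thesis using f0(2) unfolding D.column_cocycle_def by blast
    qed
    then obtain F where F: "F \<in> module_hom R ?Q (E (Suc k))" "\<And>c. c \<in> carrier (?P 0) \<Longrightarrow> F (e c) = f0 c"
      using baer_extend[OF C.E Pm Q e f0h] by metis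
    have Fp: "(\<lambda>r. F (?p r)) \<in> module_hom R ?A (E (Suc k))" by (rule module_hom_comp[OF p F(1)])
    have pz: "?p a = \<zero>\<^bsub>?Q\<^esub>" if "a \<in> J" for a
      using proj_quot_eq_zero_iff[OF Am Js, of a] that J.Icarr[OF that] by simp
    have FJ: "F (?p a) = \<zero>\<^bsub>E (Suc k)\<^esub>" if "a \<in> J" for a
      using pz[OF that] module_hom_zero[OF Q C.Em F(1)] by simp
    have "\<forall>a\<in>colon ?A J x. F (?p a) = \<zero>\<^bsub>E (Suc k)\<^esub>"
    proof
      fix a assume "a \<in> colon ?A J x"
      then have "a \<in> carrier R" "x \<otimes> a \<in> J" by (simp_all add: colon_def)
      then have "a \<in> J" using prime[OF xR] x(2) by blast
      then show "F (?p a) = \<zero>\<^bsub>E (Suc k)\<^esub>" by (rule FJ)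
    qed
    then obtain f' where f': "f' \<in> module_hom R ?A (E (Suc k))" "\<forall>a\<in>J. f' a = \<zero>\<^bsub>E (Suc k)\<^esub>"
        "\<forall>a\<in>carrier ?A. f' (x \<odot>\<^bsub>?A\<^esub> a) = F (?p a)"
      by (rule C.divide_hom[OF Am Js xR Fp])
    have Qe: "\<exists>c\<in>carrier (?P 0). q = e c" if "q \<in> carrier ?Q" for q
      using that unfolding esurj[symmetric] by blast
    have \<delta>F: "\<delta> (Suc k) (F q) = \<zero>\<^bsub>E (Suc (Suc k))\<^esub>" if q: "q \<in> carrier ?Q" for q
    proof -
      obtain c where "c \<in> carrier (?P 0)" "q = e c" using Qe[OF q] by blast
      then show ?thesis using F(2) f0(1) by (simp add: D.row_cocycle_def)
    qed
    let ?K = "J <+>\<^bsub>?A\<^esub> smult_image ?A x (carrier R)"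
    have 1: "\<forall>a\<in>?K. \<delta> (Suc k) (f' a) = \<zero>\<^bsub>E (Suc (Suc k))\<^esub>"
    proof
      fix a assume "a \<in> ?K"
      then obtain j b where jb: "j \<in> J" "b \<in> carrier R" "a = j \<oplus>\<^bsub>?A\<^esub> x \<odot>\<^bsub>?A\<^esub> b"
        by (auto simp: set_add_iff smult_image_def)
      have bA: "b \<in> carrier ?A" and jA: "j \<in> carrier ?A" using jb J.Icarr by simp_all
      have "f' a = F (?p b)"
        unfolding jb(3) module_hom_add[OF f'(1) jA A.smult_closed[OF xR bA]]
        using f'(2,3) jb(1) bA module_hom_closed[OF Fp bA] by simp
      then show "\<delta> (Suc k) (f' a) = \<zero>\<^bsub>E (Suc (Suc k))\<^esub>" using \<delta>F[OF module_hom_closed[OF p bA]] by simp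
    qed
    have 2: "\<forall>a\<in>carrier R. \<delta> (Suc (Suc k)) (\<delta> (Suc k) (f' a)) = \<zero>\<^bsub>E (Suc (Suc (Suc k)))\<^esub>"
      using module_hom_closed[OF f'(1)] by simp
    have "n0 \<le> Suc k" using k(1) by simp
    obtain h where h: "h \<in> module_hom R ?A (E (Suc k))" "\<forall>a\<in>?K. h a = \<zero>\<^bsub>E (Suc k)\<^esub>"
        "\<forall>a\<in>carrier R. \<delta> (Suc k) (h a) = \<delta> (Suc k) (f' a)"
      by (rule C.ext_vanishesE[OF bigplus[OF xR x(2) \<open>n0 \<le> Suc k\<close>] module_hom_comp[OF f'(1) C.\<delta>] 1 2])
    let ?g = "\<lambda>a. f' a \<ominus>\<^bsub>E (Suc k)\<^esub> h a"
    have gh: "?g \<in> module_hom R ?A (E (Suc k))" by (rule module_hom_diff[OF C.Em f'(1) h(1)])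
    have cl: "f' a \<in> carrier (E (Suc k))" "h a \<in> carrier (E (Suc k))" if "a \<in> carrier R" for a
      using module_hom_closed[OF f'(1), of a] module_hom_closed[OF h(1), of a] that by simp_all
    have gJ: "?g a = \<zero>\<^bsub>E (Suc k)\<^esub>" if a: "a \<in> J" for a
    proof -
      have "a \<in> ?K" using plus(2)[OF xR] a by blast
      then show ?thesis using f'(2) h(2) a by (simp add: Es.minus_self)
    qed
    have g\<delta>: "\<delta> (Suc k) (?g a) = \<zero>\<^bsub>E (Suc (Suc k))\<^esub>" if a: "a \<in> carrier R" for a
      using h(3) a cl[OF a] by (simp add: module_hom_minus[OF C.Em C.Em C.\<delta>] Ess.minus_self)
    have gx: "x \<odot>\<^bsub>E (Suc k)\<^esub> ?g a = F (?p a)" if a: "a \<in> carrier R" for a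
    proof -
      have aA: "a \<in> carrier ?A" using a by simp
      have im: "submodule (smult_image ?A x (carrier R)) R ?A"
        using A.smult_image_submodule[OF xR A.carrier_is_submodule] by simp
      have "x \<odot>\<^bsub>?A\<^esub> a \<in> smult_image ?A x (carrier R)" unfolding smult_image_def using a by (rule imageI)
      then have "x \<odot>\<^bsub>?A\<^esub> a \<in> ?K" using A.sum_superset(2)[OF Js im] by blast
      then have "h (x \<odot>\<^bsub>?A\<^esub> a) = \<zero>\<^bsub>E (Suc k)\<^esub>" using h(2) by blast
      moreover have "f' (x \<odot>\<^bsub>?A\<^esub> a) = F (?p a)" using f'(3) aA by blast
      ultimately have "?g (x \<odot>\<^bsub>?A\<^esub> a) = F (?p a)"
        using module_hom_closed[OF Fp aA] Es.add_minus_cancel[of "F (?p a)" "\<zero>\<^bsub>E (Suc k)\<^esub>"] by simp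
      then show ?thesis using module_hom_smult[OF gh xR aA] by simp
    qed
    obtain G where G: "G \<in> module_hom R ?Q (E (Suc k))" "\<forall>a\<in>carrier ?A. G (?p a) = ?g a"
      by (rule quot_factor[OF Am Js C.Em gh gJ])
    have Qp: "\<exists>a\<in>carrier R. e c = ?p a" if "c \<in> carrier (?P 0)" for c
      using module_hom_closed[OF e that] unfolding quot_carrier[OF Am Js] by auto
    have Ge: "(\<lambda>c. G (e c)) \<in> module_hom R (?P 0) (E (Suc k))" by (rule module_hom_comp[OF e G(1)])
    have row: "D.row_cocycle 0 (Suc k) (\<lambda>c. G (e c))"
      unfolding D.row_cocycle_def
    proof (intro conjI Ge ballI)
      fix c assume "c \<in> carrier (?P 0)"
      then obtain a where "a \<in> carrier R" "e c = ?p a" using Qp by blast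
      then show "\<delta> (Suc k) (G (e c)) = \<zero>\<^bsub>E (Suc (Suc k))\<^esub>" using G(2) g\<delta> by simp
    qed
    have col: "D.column_cocycle 0 (Suc k) (\<lambda>c. G (e c))"
      unfolding D.column_cocycle_def
    proof (intro conjI Ge ballI)
      fix c assume "c \<in> carrier (?P (Suc 0))"
      then have "d 0 c \<in> hom_kernel (?P 0) ?Q e" unfolding ex0[symmetric] by (rule imageI)
      then show "G (e (d 0 c)) = \<zero>\<^bsub>E (Suc k)\<^esub>" using module_hom_zero[OF Q C.Em G(1)] by simp
    qed
    have zc: "D.column_cocycle 0 k (\<lambda>c. \<zero>\<^bsub>E k\<^esub>)"
      using module_hom_zero_map[OF C.Em] by (simp add: D.column_cocycle_def)
    have "f0 c = x \<odot>\<^bsub>E (Suc k)\<^esub> G (e c) \<oplus>\<^bsub>E (Suc k)\<^esub> \<delta> k \<zero>\<^bsub>E k\<^esub>" if c: "c \<in> carrier (?P 0)" for c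
    proof -
      obtain a where a: "a \<in> carrier R" "e c = ?p a" using Qp[OF c] by blast
      have "f0 c = F (?p a)" using F(2)[OF c] a(2) by simp
      also have "\<dots> = x \<odot>\<^bsub>E (Suc k)\<^esub> G (e c)" using gx[OF a(1)] G(2) a by simp
      finally show ?thesis using module_hom_closed[OF Ge c] xR by simp
    qed
    then show "\<exists>g h. D.row_cocycle 0 (Suc k) g \<and> D.column_cocycle 0 (Suc k) g \<and> D.column_cocycle 0 k h \<and>
      (\<forall>p\<in>carrier (?P 0). f0 p = x \<odot>\<^bsub>E (Suc k)\<^esub> g p \<oplus>\<^bsub>E (Suc k)\<^esub> \<delta> k (h p))"
      using row col zc by (intro exI[of _ "\<lambda>c. G (e c)"] exI[of _ "\<lambda>c. \<zero>\<^bsub>E k\<^esub>"]) simp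
  qed
  then have "D.column_generated x k 0" using D.balance[OF xR] by simp
  then have "D.column_generated \<zero> k 0" by (rule column_nakayama[OF C N \<epsilon> D x(1)])
  then have "C.ext_vanishes ?A k (carrier ?A) J"
    by (rule D.ext_vanishes_of_column[OF Am Js e esurj ex0])
  then show False using k(2) by simp
qed

end

section \<open>The dual of a minimal resolution\<close>

text \<open>The dual of a free resolution of \<open>N\<close> resolves the dual of \<open>N\<close> by injective modules.\<close>

definition dual_term :: "('a, 'r) ring_scheme \<Rightarrow> (nat \<Rightarrow> nat) \<Rightarrow> ('a, 'e) module \<Rightarrow> nat \<Rightarrow> ('a, (nat \<Rightarrow> 'a) \<Rightarrow> 'e) module"
  where "dual_term R r E n = hom_module R (free_rank R (r n)) E"

definition dual_map ::
    "('a, 'r) ring_scheme \<Rightarrow> (nat \<Rightarrow> nat) \<Rightarrow> (nat \<Rightarrow> (nat \<Rightarrow> 'a) \<Rightarrow> (nat \<Rightarrow> 'a)) \<Rightarrow> nat \<Rightarrow>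
     ((nat \<Rightarrow> 'a) \<Rightarrow> 'e) \<Rightarrow> (nat \<Rightarrow> 'a) \<Rightarrow> 'e"
  where "dual_map R r d n f = (\<lambda>p\<in>carrier (free_rank R (r (Suc n))). f (d n p))"

context cring
begin

context
  fixes N :: "('a, 'c, 'n) module_scheme" and E :: "('a, 'e) module" and r d e
  assumes N: "module R N" and E: "baer_module R E" and res: "free_resolution R N r d e"
begin

lemma resolution_facts:
  "e \<in> module_hom R (free_rank R (r 0)) N" "e ` carrier (free_rank R (r 0)) = carrier N"
  "d n \<in> module_hom R (free_rank R (r (Suc n))) (free_rank R (r n))"
  "d 0 ` carrier (free_rank R (r (Suc 0))) = hom_kernel (free_rank R (r 0)) N e"
  "d (Suc n) ` carrier (free_rank R (r (Suc (Suc n)))) =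
    hom_kernel (free_rank R (r (Suc n))) (free_rank R (r n)) (d n)"
  using res unfolding free_resolution_def by simp_all

lemma dual_term_iff:
  "f \<in> carrier (dual_term R r E n) \<longleftrightarrow>
     f \<in> module_hom R (free_rank R (r n)) E \<and> f \<in> extensional (carrier (free_rank R (r n)))"
  by (simp add: dual_term_def hom_module_carrier_iff)

lemma dual_term_simps:
  "\<zero>\<^bsub>dual_term R r E n\<^esub> = (\<lambda>x\<in>carrier (free_rank R (r n)). \<zero>\<^bsub>E\<^esub>)"
  "f \<oplus>\<^bsub>dual_term R r E n\<^esub> g = (\<lambda>x\<in>carrier (free_rank R (r n)). f x \<oplus>\<^bsub>E\<^esub> g x)"
  "a \<odot>\<^bsub>dual_term R r E n\<^esub> f = (\<lambda>x\<in>carrier (free_rank R (r n)). a \<odot>\<^bsub>E\<^esub> f x)"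
  by (simp_all add: dual_term_def hom_module_simps)

lemma dual_term_restrict:
  "f \<in> module_hom R (free_rank R (r n)) E \<Longrightarrow>
     restrict f (carrier (free_rank R (r n))) \<in> carrier (dual_term R r E n)"
  unfolding dual_term_def by (rule hom_module_restrict[OF free_module_module])

lemma dual_map_eq_zero_iff:
  "dual_map R r d n f = \<zero>\<^bsub>dual_term R r E (Suc n)\<^esub> \<longleftrightarrow>
     (\<forall>p\<in>carrier (free_rank R (r (Suc n))). f (d n p) = \<zero>\<^bsub>E\<^esub>)"
proof
  assume *: "dual_map R r d n f = \<zero>\<^bsub>dual_term R r E (Suc n)\<^esub>"
  show "\<forall>p\<in>carrier (free_rank R (r (Suc n))). f (d n p) = \<zero>\<^bsub>E\<^esub>"
  proof
    fix p assume "p \<in> carrier (free_rank R (r (Suc n)))"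
    then show "f (d n p) = \<zero>\<^bsub>E\<^esub>" using fun_cong[OF *, of p] by (simp add: dual_map_def dual_term_simps)
  qed
qed (auto simp: dual_map_def dual_term_simps)

lemma dual_baer_complex: "baer_complex R (dual_term R r E) (dual_map R r d)"
proof
  let ?F = "\<lambda>n. free_rank R (r n)"
  have Fm: "module R (?F n)" for n by (rule free_module_module)
  have Em: "module R E" by (rule baer_moduleD[OF E])
  note d = resolution_facts(3)
  have dc: "d n p \<in> carrier (?F n)" if "p \<in> carrier (?F (Suc n))" for n p by (rule module_hom_closed[OF d that])
  show "baer_module R (dual_term R r E n)" for n unfolding dual_term_def by (rule hom_module_free_baer[OF E])
  show "dual_map R r d n \<in> module_hom R (dual_term R r E n) (dual_term R r E (Suc n))" for n
  proof (rule module_homI)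
    show "dual_map R r d n f \<in> carrier (dual_term R r E (Suc n))" if "f \<in> carrier (dual_term R r E n)" for f
      unfolding dual_map_def
      by (rule dual_term_restrict[OF module_hom_comp[OF d]]) (use that in \<open>simp add: dual_term_iff\<close>)
    show "dual_map R r d n (f \<oplus>\<^bsub>dual_term R r E n\<^esub> g) =
        dual_map R r d n f \<oplus>\<^bsub>dual_term R r E (Suc n)\<^esub> dual_map R r d n g" for f g
      by (rule ext) (simp add: dual_map_def dual_term_simps dc restrict_def)
    show "dual_map R r d n (a \<odot>\<^bsub>dual_term R r E n\<^esub> f) = a \<odot>\<^bsub>dual_term R r E (Suc n)\<^esub> dual_map R r d n f" for a f
      by (rule ext) (simp add: dual_map_def dual_term_simps dc restrict_def)
  qed
  show "dual_map R r d n ` carrier (dual_term R r E n) =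
      hom_kernel (dual_term R r E (Suc n)) (dual_term R r E (Suc (Suc n))) (dual_map R r d (Suc n))" for n
  proof
    show "dual_map R r d n ` carrier (dual_term R r E n) \<subseteq>
      hom_kernel (dual_term R r E (Suc n)) (dual_term R r E (Suc (Suc n))) (dual_map R r d (Suc n))"
    proof (intro image_subsetI CollectI conjI)
      fix f assume "f \<in> carrier (dual_term R r E n)"
      then have f: "f \<in> module_hom R (?F n) E" by (simp add: dual_term_iff)
      show "dual_map R r d n f \<in> carrier (dual_term R r E (Suc n))"
        unfolding dual_map_def by (rule dual_term_restrict[OF module_hom_comp[OF d f]])
      have "dual_map R r d n f (d (Suc n) p) = \<zero>\<^bsub>E\<^esub>" if p: "p \<in> carrier (?F (Suc (Suc n)))" for p
      proof -
        have "d (Suc n) p \<in> hom_kernel (?F (Suc n)) (?F n) (d n)"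
          unfolding resolution_facts(5)[symmetric] using p by (rule imageI)
        then show ?thesis using module_hom_zero[OF Fm Em f] by (simp add: dual_map_def)
      qed
      then show "dual_map R r d (Suc n) (dual_map R r d n f) = \<zero>\<^bsub>dual_term R r E (Suc (Suc n))\<^esub>"
        unfolding dual_map_eq_zero_iff by blast
    qed
    show "hom_kernel (dual_term R r E (Suc n)) (dual_term R r E (Suc (Suc n))) (dual_map R r d (Suc n))
      \<subseteq> dual_map R r d n ` carrier (dual_term R r E n)"
    proof
      fix f assume "f \<in> hom_kernel (dual_term R r E (Suc n)) (dual_term R r E (Suc (Suc n))) (dual_map R r d (Suc n))"
      then have f: "f \<in> module_hom R (?F (Suc n)) E" "f \<in> extensional (carrier (?F (Suc n)))"
        and z: "\<forall>p\<in>carrier (?F (Suc (Suc n))). f (d (Suc n) p) = \<zero>\<^bsub>E\<^esub>"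
        unfolding mem_Collect_eq dual_map_eq_zero_iff dual_term_iff by simp_all
      have "f c = \<zero>\<^bsub>E\<^esub>" if c: "c \<in> carrier (?F (Suc n))" "d n c = \<zero>\<^bsub>?F n\<^esub>" for c
      proof -
        have "c \<in> d (Suc n) ` carrier (?F (Suc (Suc n)))" unfolding resolution_facts(5) using c by simp
        then show ?thesis using z by blast
      qed
      then obtain h where h: "h \<in> module_hom R (?F n) E" "\<And>c. c \<in> carrier (?F (Suc n)) \<Longrightarrow> h (d n c) = f c"
        using baer_extend[OF E Fm Fm d f(1)] by metis
      have "f = dual_map R r d n (restrict h (carrier (?F n)))"
        by (rule extensionalityI[OF f(2)]) (simp_all add: dual_map_def dc h(2))
      then show "f \<in> dual_map R r d n ` carrier (dual_term R r E n)"
        using dual_term_restrict[OF h(1)] by (rule image_eqI)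
    qed
  qed
qed

end

end

text \<open>
  By adjunction, a cocycle \<open>P (n + 1) \<rightarrow> Hom(N, E)\<close> is a bilinear map on \<open>P (n + 1)\<close> and \<open>N\<close> with
  values in \<open>E\<close> that vanishes on boundaries. Vanishing of Tor extends it along the differential of
  \<open>P\<close>.
\<close>

lemma (in noetherian_local_ring) ext_eventually_vanishes_of_Tor:
  fixes M :: "('a, 'b, 'm) module_scheme" and N :: "('a, 'c, 'n) module_scheme" and E :: "('a, 'e) module"
  assumes N: "module R N" and E: "baer_module R E" and res: "free_resolution R N r d e"
    and M: "noetherian_module R M" and K: "submodule K R M"
    and tr: "Tor_eventually_zero R (quot_module M K) N"
  shows "baer_complex.ext_eventually_vanishes R (dual_term R r E) (dual_map R r d) M (carrier M) K"
proof -
  interpret C: baer_complex R "dual_term R r E" "dual_map R r d" by (rule dual_baer_complex[OF N E res])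
  note Mm = noetherian_moduleD[OF M]
  have Em: "module R E" by (rule baer_moduleD[OF E])
  interpret N: module R N by fact
  interpret E: module R E by (rule Em)
  let ?X = "quot_module M K"
  let ?P = "fst (some_resolution R ?X)" and ?d = "snd (some_resolution R ?X)"
  let ?F = "\<lambda>n. free_rank R (r n)"
  note rf = resolution_facts[OF N E res] and iff = dual_term_iff[OF N E res]
    and simps = dual_term_simps[OF N E res] and zero_iff = dual_map_eq_zero_iff[OF N E res]
  have Fm: "module R (?F n)" for n by (rule free_module_module)
  obtain a where resX: "projective_resolution R ?X ?P ?d a"
    by (rule some_resolution_resolves[OF noetherian_quot[OF M K]])
  interpret D: hom_double_complex R "dual_term R r E" "dual_map R r d" ?P ?d
    by (rule C.resolution_double_complex[OF resX])
  obtain n0 where n0: "\<forall>n\<ge>n0. trivial_module (Tor R n ?X N)" using tr unfolding Tor_eventually_zero_def by blast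
  have ec: "e c \<in> carrier N" if "c \<in> carrier (?F 0)" for c by (rule module_hom_closed[OF rf(1) that])
  have es: "\<exists>c\<in>carrier (?F 0). y = e c" if "y \<in> carrier N" for y using that unfolding rf(2)[symmetric] by blast
  have "C.ext_vanishes M n (carrier M) K" if n: "n \<ge> n0" for n
  proof (rule D.ext_vanishes_of_column[OF Mm K projective_resolutionD(3)[OF resX]
        projective_resolutionD(5)[OF resX] projective_resolutionD(6)[OF resX]])
    show "D.column_generated \<zero> n 0"
    proof (rule D.column_vanishI)
      fix f assume f: "D.row_cocycle (Suc n) 0 f" "D.column_cocycle (Suc n) 0 f"
      have fh: "f \<in> module_hom R (?P (Suc n)) (dual_term R r E 0)" using f(1) by (simp add: D.row_cocycle_def)
      have fp: "f p \<in> module_hom R (?F 0) E" "f p \<in> extensional (carrier (?F 0))" if "p \<in> carrier (?P (Suc n))" for p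
        using module_hom_closed[OF fh that] by (simp_all add: iff)
      have "\<exists>h. h \<in> module_hom R N E \<and> (\<forall>c\<in>carrier (?F 0). h (e c) = f p c)" if p: "p \<in> carrier (?P (Suc n))" for p
      proof -
        have z: "\<forall>c\<in>carrier (?F (Suc 0)). f p (d 0 c) = \<zero>\<^bsub>E\<^esub>"
          using f(1) p unfolding D.row_cocycle_def zero_iff by blast
        have "f p c = \<zero>\<^bsub>E\<^esub>" if c: "c \<in> carrier (?F 0)" "e c = \<zero>\<^bsub>N\<^esub>" for c
        proof -
          have "c \<in> d 0 ` carrier (?F (Suc 0))" unfolding rf(4) using c by simp
          then show ?thesis using z by blast
        qed
        then show ?thesis using baer_extend[OF E Fm N rf(1) fp(1)[OF p]] by metis
      qed
      then have "\<forall>p\<in>carrier (?P (Suc n)). \<exists>h. h \<in> module_hom R N E \<and> (\<forall>c\<in>carrier (?F 0). h (e c) = f p c)" by blast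
      then have "\<exists>\<beta>. \<forall>p\<in>carrier (?P (Suc n)). \<beta> p \<in> module_hom R N E \<and> (\<forall>c\<in>carrier (?F 0). \<beta> p (e c) = f p c)"
        by (rule bchoice)
      then obtain \<beta> where \<beta>: "\<forall>p\<in>carrier (?P (Suc n)). \<beta> p \<in> module_hom R N E \<and> (\<forall>c\<in>carrier (?F 0). \<beta> p (e c) = f p c)" ..
      have \<beta>h: "\<beta> p \<in> module_hom R N E" and \<beta>e: "\<And>c. c \<in> carrier (?F 0) \<Longrightarrow> \<beta> p (e c) = f p c"
        if "p \<in> carrier (?P (Suc n))" for p using \<beta> that by simp_all
      interpret P: module R "?P (Suc n)" by (rule projective_resolutionD(2)[OF resX])
      have bil: "bilinear_map R (?P (Suc n)) N E \<beta>"
        unfolding bilinear_map_def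
      proof (intro conjI ballI \<beta>h)
        fix y assume "y \<in> carrier N"
        then obtain c where c: "c \<in> carrier (?F 0)" "y = e c" using es by blast
        show "(\<lambda>p. \<beta> p y) \<in> module_hom R (?P (Suc n)) E"
          unfolding c(2)
        proof (rule module_homI)
          show "\<beta> p (e c) \<in> carrier E" if "p \<in> carrier (?P (Suc n))" for p
            by (rule module_hom_closed[OF \<beta>h[OF that] ec[OF c(1)]])
          show "\<beta> (p \<oplus>\<^bsub>?P (Suc n)\<^esub> q) (e c) = \<beta> p (e c) \<oplus>\<^bsub>E\<^esub> \<beta> q (e c)"
            if pq: "p \<in> carrier (?P (Suc n))" "q \<in> carrier (?P (Suc n))" for p q
            using c(1) by (simp add: \<beta>e pq module_hom_add[OF fh pq] simps)
          show "\<beta> (t \<odot>\<^bsub>?P (Suc n)\<^esub> p) (e c) = t \<odot>\<^bsub>E\<^esub> \<beta> p (e c)"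
            if tp: "t \<in> carrier R" "p \<in> carrier (?P (Suc n))" for t p
            using c(1) by (simp add: \<beta>e tp module_hom_smult[OF fh tp] simps)
        qed
      qed
      have bd: "\<beta> (?d (Suc n) p) y = \<zero>\<^bsub>E\<^esub>" if p: "p \<in> carrier (?P (Suc (Suc n)))" and y: "y \<in> carrier N" for p y
      proof -
        obtain c where c: "c \<in> carrier (?F 0)" "y = e c" using es[OF y] by blast
        have "f (?d (Suc n) p) = \<zero>\<^bsub>dual_term R r E 0\<^esub>" using f(2) p by (simp add: D.column_cocycle_def)
        then show ?thesis unfolding c(2) using \<beta>e[OF D.d_closed[OF p] c(1)] c(1) by (simp add: simps)
      qed
      have tr': "trivial_module (Tor R (Suc n) ?X N)" using n0 n by simp
      obtain \<gamma> where \<gamma>: "bilinear_map R (?P n) N E \<gamma>"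
          "\<forall>x\<in>carrier (?P (Suc n)). \<forall>y\<in>carrier N. \<beta> x y = \<gamma> (?d n x) y"
        by (rule Tor_trivial_extend[OF resX N E tr' bil bd])
      have \<gamma>h: "\<gamma> p \<in> module_hom R N E" if "p \<in> carrier (?P n)" for p using \<gamma>(1) that by (simp add: bilinear_map_def)
      have \<gamma>l: "(\<lambda>p. \<gamma> p y) \<in> module_hom R (?P n) E" if "y \<in> carrier N" for y using \<gamma>(1) that by (simp add: bilinear_map_def)
      define h where "h p = (\<lambda>c\<in>carrier (?F 0). \<gamma> p (e c))" for p
      have hh: "h \<in> module_hom R (?P n) (dual_term R r E 0)"
      proof (rule module_homI)
        show "h p \<in> carrier (dual_term R r E 0)" if "p \<in> carrier (?P n)" for p
          unfolding h_def by (rule dual_term_restrict[OF N E res module_hom_comp[OF rf(1) \<gamma>h[OF that]]])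
        show "h (p \<oplus>\<^bsub>?P n\<^esub> q) = h p \<oplus>\<^bsub>dual_term R r E 0\<^esub> h q" if pq: "p \<in> carrier (?P n)" "q \<in> carrier (?P n)" for p q
          by (rule ext) (simp add: h_def simps restrict_def module_hom_add[OF \<gamma>l[OF ec] pq])
        show "h (t \<odot>\<^bsub>?P n\<^esub> p) = t \<odot>\<^bsub>dual_term R r E 0\<^esub> h p" if tp: "t \<in> carrier R" "p \<in> carrier (?P n)" for t p
          by (rule ext) (simp add: h_def simps restrict_def module_hom_smult[OF \<gamma>l[OF ec] tp])
      qed
      have "dual_map R r d 0 (h p) = \<zero>\<^bsub>dual_term R r E (Suc 0)\<^esub>" if p: "p \<in> carrier (?P n)" for p
        unfolding zero_iff
      proof
        fix c assume "c \<in> carrier (?F (Suc 0))"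
        then have "d 0 c \<in> hom_kernel (?F 0) N e" unfolding rf(4)[symmetric] by (rule imageI)
        then show "h p (d 0 c) = \<zero>\<^bsub>E\<^esub>" using module_hom_zero[OF N Em \<gamma>h[OF p]] by (simp add: h_def)
      qed
      then have "D.row_cocycle n 0 h" unfolding D.row_cocycle_def using hh by simp
      moreover have "f p = h (?d n p)" if p: "p \<in> carrier (?P (Suc n))" for p
      proof (rule extensionalityI[OF fp(2)[OF p]])
        show "h (?d n p) \<in> extensional (carrier (?F 0))" by (simp add: h_def)
        fix c assume c: "c \<in> carrier (?F 0)"
        then show "f p c = h (?d n p) c" using \<beta>e[OF p c] \<gamma>(2) p ec[OF c] by (simp add: h_def)
      qed
      ultimately show "\<exists>h. D.row_cocycle n 0 h \<and> (\<forall>p\<in>carrier (?P (Suc n)). f p = h (?d n p))" by blast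
    qed
  qed
  then show ?thesis unfolding C.ext_eventually_vanishes_def by blast
qed

context noetherian_local_ring
begin

text \<open>Each value is a combination of images of basis elements with coefficients in \<open>\<mm>\<close>.\<close>

lemma socle_hom_vanishes:
  assumes B: "module R B" and g: "g \<in> module_hom R (free_rank R k) B"
    and soc: "\<And>a c. a \<in> \<mm> \<Longrightarrow> c \<in> carrier (free_rank R k) \<Longrightarrow> a \<odot>\<^bsub>B\<^esub> g c = \<zero>\<^bsub>B\<^esub>"
    and c: "c \<in> carrier (free_rank R k)" "range c \<subseteq> \<mm>"
  shows "g c = \<zero>\<^bsub>B\<^esub>"
proof -
  interpret B: module R B by fact
  let ?x = "\<lambda>s. g (free_gen R s)"
  have x: "?x s \<in> carrier B" if "s \<in> {..<k}" for s by (rule module_hom_closed[OF g free_gen_closed[OF that]])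
  have l: "free_lift R B ?x \<in> module_hom R (free_rank R k) B" by (rule free_lift_hom[OF B x])
  have "g c = free_lift R B ?x c"
  proof (rule free_hom_eqI[OF B g l _ c(1)])
    show "g (free_gen R s) = free_lift R B ?x (free_gen R s)" if s: "s \<in> {..<k}" for s
      by (rule free_lift_gen[OF B x s, symmetric])
  qed
  also have "\<dots> = \<zero>\<^bsub>B\<^esub>"
    unfolding free_lift_def
  proof (rule B.M.add.finprod_one_eqI)
    fix s assume "s \<in> {s. c s \<noteq> \<zero>}"
    then have s: "s \<in> {..<k}" using c(1) by (auto simp: free_carrier_iff)
    show "c s \<odot>\<^bsub>B\<^esub> g (free_gen R s) = \<zero>\<^bsub>B\<^esub>" by (rule soc[OF _ free_gen_closed[OF s]]) (use c(2) in blast)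
  qed
  finally show ?thesis .
qed

text \<open>The residue field embeds into an injective module; \<open>s\<close> is the image of its unit.\<close>

lemma exists_baer_with_socle:
  obtains E :: "('a, ('a, unit) univ) module" and s
  where "baer_module R E" "s \<in> carrier E" "s \<noteq> \<zero>\<^bsub>E\<^esub>" "\<forall>a\<in>\<mm>. a \<odot>\<^bsub>E\<^esub> s = \<zero>\<^bsub>E\<^esub>"
proof -
  let ?A = "self_module R" and ?Q = "quot_module (self_module R) \<mm>" and ?p = "proj_quot (self_module R) \<mm>"
  note Am = self_module_module
  have K: "submodule \<mm> R ?A" using m.is_ideal by (simp add: self_submodule_iff)
  have Q: "module R ?Q" by (rule quot_module_module[OF Am K])
  have p: "?p \<in> module_hom R ?A ?Q" by (rule proj_quot_hom[OF Am K])
  have "inj_on (Scalar :: 'a \<Rightarrow> ('a, unit) univ) (carrier ?A)" by (simp add: inj_on_def)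
  then obtain k :: "'a set \<Rightarrow> ('a, unit) univ" where k: "inj_on k (carrier ?Q)" by (rule quot_code[OF Am K])
  obtain E :: "('a, ('a, unit) univ) module" and \<iota>
    where E: "baer_module R E" "\<iota> \<in> module_hom R ?Q E" "inj_on \<iota> (carrier ?Q)"
    by (rule enough_injectives[OF Q k])
  note Em = baer_moduleD[OF E(1)]
  have one: "\<one> \<in> carrier ?A" by simp
  have p1: "?p \<one> \<in> carrier ?Q" by (rule module_hom_closed[OF p one])
  have "?p \<one> \<noteq> \<zero>\<^bsub>?Q\<^esub>" using proj_quot_eq_zero_iff[OF Am K one] one_notin_m by simp
  then have "\<iota> (?p \<one>) \<noteq> \<zero>\<^bsub>E\<^esub>"
    using inj_onD[OF E(3) _ p1 module_zero_closed[OF Q]] module_hom_zero[OF Q Em E(2)] by metis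
  moreover have "\<forall>a\<in>\<mm>. a \<odot>\<^bsub>E\<^esub> \<iota> (?p \<one>) = \<zero>\<^bsub>E\<^esub>"
  proof
    fix a assume a: "a \<in> \<mm>"
    then have aR: "a \<in> carrier R" using m_sub by blast
    have "a \<odot>\<^bsub>E\<^esub> \<iota> (?p \<one>) = \<iota> (?p a)"
      using module_hom_smult[OF E(2) aR p1] module_hom_smult[OF p aR one] aR by simp
    moreover have "?p a = \<zero>\<^bsub>?Q\<^esub>" using proj_quot_eq_zero_iff[OF Am K, of a] a aR by simp
    ultimately show "a \<odot>\<^bsub>E\<^esub> \<iota> (?p \<one>) = \<zero>\<^bsub>E\<^esub>" using module_hom_zero[OF Q Em E(2)] by simp
  qed
  ultimately show thesis using that[OF E(1) module_hom_closed[OF E(2) p1]] by simp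
qed

text \<open>
  On homomorphisms killed by \<open>\<mm>\<close>, the dual of a minimal resolution has zero differential. Exactness
  of these homomorphisms in high degrees therefore leaves none, although a free module of positive
  rank has a nonzero one.
\<close>

theorem proj_dim_finite:
  fixes M :: "('a, 'b, 'm) module_scheme" and N :: "('a, 'c, 'n) module_scheme"
  assumes M: "noetherian_module R M" and N: "noetherian_module R N"
    and dep: "depth R M < depth R (self_module R)"
    and tor: "\<And>ys. regular_seq R (self_module R) ys \<Longrightarrow> enat (length ys) \<le> depth R M + 1 \<Longrightarrow>
      Tor_eventually_zero R (quot_by_seq R M ys) N"
  shows "proj_dim R N < \<infinity>"
proof -
  have Mm: "module R M" and Nm: "module R N" using M N by (simp_all add: noetherian_module_def)
  obtain E :: "('a, ('a, unit) univ) module" and s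
    where E: "baer_module R E" and s: "s \<in> carrier E" "s \<noteq> \<zero>\<^bsub>E\<^esub>" "\<forall>a\<in>\<mm>. a \<odot>\<^bsub>E\<^esub> s = \<zero>\<^bsub>E\<^esub>"
    by (rule exists_baer_with_socle)
  have Em: "module R E" by (rule baer_moduleD[OF E])
  interpret E: module R E by (rule Em)
  obtain r d e where res: "free_resolution R N r d e"
    and min: "\<forall>n. \<forall>c\<in>carrier (free_rank R (r (Suc n))). range (d n c) \<subseteq> \<mm>"
    by (rule minimal_resolution[OF N])
  let ?F = "\<lambda>n. free_rank R (r n)" and ?E = "dual_term R r E" and ?\<delta> = "dual_map R r d"
  note rf = resolution_facts[OF Nm E res] and iff = dual_term_iff[OF Nm E res]
    and simps = dual_term_simps[OF Nm E res] and zero_iff = dual_map_eq_zero_iff[OF Nm E res]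
  have "\<exists>n0. \<forall>n\<ge>n0. socle_exact_at ?E ?\<delta> n"
  proof (rule socle_exact[OF dual_baer_complex[OF Nm E res] M dep])
    fix ys assume ys: "regular_seq R (self_module R) ys" "enat (length ys) \<le> depth R M + 1"
    then have "set ys \<subseteq> carrier R" using m_sub by (auto simp: regular_seq_def max_ideal_eq)
    then have K: "submodule (seq_submodule R M ys) R M" by (rule seq_submodule_submodule[OF Mm])
    show "baer_complex.ext_eventually_vanishes R ?E ?\<delta> M (carrier M) (seq_submodule R M ys)"
      using tor[OF ys] unfolding quot_by_seq_def
      by (rule ext_eventually_vanishes_of_Tor[OF Nm E res M K])
  qed
  then obtain n0 where n0: "\<And>n f. n \<ge> n0 \<Longrightarrow> f \<in> carrier (?E (Suc n)) \<Longrightarrow>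
      \<forall>a\<in>\<mm>. a \<odot>\<^bsub>?E (Suc n)\<^esub> f = \<zero>\<^bsub>?E (Suc n)\<^esub> \<Longrightarrow> ?\<delta> (Suc n) f = \<zero>\<^bsub>?E (Suc (Suc n))\<^esub> \<Longrightarrow>
      \<exists>g\<in>carrier (?E n). (\<forall>a\<in>\<mm>. a \<odot>\<^bsub>?E n\<^esub> g = \<zero>\<^bsub>?E n\<^esub>) \<and> ?\<delta> n g = f"
    by blast
  have r0: "r (Suc n) = 0" if n: "n \<ge> n0" for n
  proof (rule ccontr)
    assume "r (Suc n) \<noteq> 0"
    then have i0: "0 \<in> {..<r (Suc n)}" by simp
    let ?l = "free_lift R E (\<lambda>i. s)"
    let ?f = "restrict ?l (carrier (?F (Suc n)))"
    have l: "?l \<in> module_hom R (?F (Suc n)) E" by (rule free_lift_hom[OF Em s(1)])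
    have lg: "?l (free_gen R i) = s" if "i \<in> {..<r (Suc n)}" for i by (rule free_lift_gen[OF Em s(1) that])
    have la: "a \<odot>\<^bsub>E\<^esub> ?l c = \<zero>\<^bsub>E\<^esub>" if a: "a \<in> \<mm>" and c: "c \<in> carrier (?F (Suc n))" for a c
    proof -
      have aR: "a \<in> carrier R" using a m_sub by blast
      show ?thesis
      proof (rule free_hom_eqI[OF Em module_hom_scale[OF Em l aR] module_hom_zero_map[OF Em] _ c])
        show "a \<odot>\<^bsub>E\<^esub> ?l (free_gen R i) = \<zero>\<^bsub>E\<^esub>" if "i \<in> {..<r (Suc n)}" for i
          unfolding lg[OF that] using s(3) a by blast
      qed
    qed
    have fE: "?f \<in> carrier (?E (Suc n))" by (rule dual_term_restrict[OF Nm E res l])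
    have fa: "\<forall>a\<in>\<mm>. a \<odot>\<^bsub>?E (Suc n)\<^esub> ?f = \<zero>\<^bsub>?E (Suc n)\<^esub>"
      by (intro ballI ext) (simp add: simps restrict_def la)
    have "?\<delta> (Suc n) ?f = \<zero>\<^bsub>?E (Suc (Suc n))\<^esub>"
      unfolding zero_iff
    proof
      fix c assume c: "c \<in> carrier (?F (Suc (Suc n)))"
      have dc: "d (Suc n) c \<in> carrier (?F (Suc n))" by (rule module_hom_closed[OF rf(3) c])
      have rc: "range (d (Suc n) c) \<subseteq> \<mm>" using min c by blast
      have "?l (d (Suc n) c) = \<zero>\<^bsub>E\<^esub>" by (rule socle_hom_vanishes[OF Em l la dc rc])
      then show "?f (d (Suc n) c) = \<zero>\<^bsub>E\<^esub>" using dc by simp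
    qed
    then obtain g where g: "g \<in> carrier (?E n)" "\<forall>a\<in>\<mm>. a \<odot>\<^bsub>?E n\<^esub> g = \<zero>\<^bsub>?E n\<^esub>" "?\<delta> n g = ?f"
      using n0[OF n fE fa] by blast
    have gh: "g \<in> module_hom R (?F n) E" using g(1) by (simp add: iff)
    have ga: "a \<odot>\<^bsub>E\<^esub> g c = \<zero>\<^bsub>E\<^esub>" if a: "a \<in> \<mm>" and c: "c \<in> carrier (?F n)" for a c
      using fun_cong[OF bspec[OF g(2) a], of c] c by (simp add: simps)
    let ?u = "free_gen R (0 :: nat)"
    have u: "?u \<in> carrier (?F (Suc n))" by (rule free_gen_closed[OF i0])
    have ru: "range (d n ?u) \<subseteq> \<mm>" using min u by blast
    have "g (d n ?u) = \<zero>\<^bsub>E\<^esub>" by (rule socle_hom_vanishes[OF Em gh ga module_hom_closed[OF rf(3) u] ru])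
    moreover have "g (d n ?u) = s" using fun_cong[OF g(3), of ?u] u lg[OF i0] by (simp add: dual_map_def)
    ultimately show False using s(2) by simp
  qed
  let ?P = "\<lambda>n. transport_module (vec_code :: _ \<Rightarrow> ('a, 'c) univ) (?F n)"
  have "trivial_module (?P i)" if i: "i > n0" for i
  proof -
    obtain n where n: "i = Suc n" "n \<ge> n0" using i by (cases i) auto
    have "carrier (free_rank R 0) = {\<lambda>s. \<zero>}"
    proof
      show "carrier (free_rank R 0) \<subseteq> {\<lambda>s. \<zero>}" by (auto simp: free_carrier_iff)
    qed (simp add: free_carrier_iff)
    then show ?thesis
      unfolding trivial_module_def n(1) r0[OF n(2)] by (simp add: transport_module_def Let_def free_module_simps)
  qed
  then have "proj_dim R N \<le> enat n0"
    unfolding proj_dim_def using free_resolution_transport[OF Nm res] by (intro Inf_lower) blast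
  also have "\<dots> < \<infinity>" by simp
  finally show ?thesis .
qed

end

section \<open>Finite injective dimension\<close>

text \<open>Cocycles with values in the kernel of \<open>\<delta> 0\<close> are cocycles with values in \<open>N\<close>.\<close>

lemma (in noetherian_local_ring) ext_eventually_vanishes_of_Ext:
  fixes M :: "('a, 'b, 'm) module_scheme" and N :: "('a, 'c, 'n) module_scheme"
  assumes C: "baer_complex R E \<delta>" and N: "module R N"
    and \<epsilon>: "\<epsilon> \<in> module_hom R N (E 0)" "inj_on \<epsilon> (carrier N)"
      "\<epsilon> ` carrier N = hom_kernel (E 0) (E (Suc 0)) (\<delta> 0)"
    and M: "noetherian_module R M" and K: "submodule K R M"
    and ex: "Ext_eventually_zero R (quot_module M K) N"
  shows "baer_complex.ext_eventually_vanishes R E \<delta> M (carrier M) K"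
proof -
  interpret C: baer_complex R E \<delta> by (rule C)
  note Mm = noetherian_moduleD[OF M]
  let ?X = "quot_module M K"
  let ?P = "fst (some_resolution R ?X)" and ?d = "snd (some_resolution R ?X)"
  obtain a where res: "projective_resolution R ?X ?P ?d a"
    by (rule some_resolution_resolves[OF noetherian_quot[OF M K]])
  interpret D: hom_double_complex R E \<delta> ?P ?d by (rule C.resolution_double_complex[OF res])
  obtain n0 where n0: "\<forall>n\<ge>n0. trivial_module (Ext R n ?X N)" using ex unfolding Ext_eventually_zero_def by blast
  have \<epsilon>0: "\<epsilon> \<zero>\<^bsub>N\<^esub> = \<zero>\<^bsub>E 0\<^esub>" by (rule module_hom_zero[OF N C.Em \<epsilon>(1)])
  have \<delta>\<epsilon>: "\<delta> 0 (\<epsilon> y) = \<zero>\<^bsub>E (Suc 0)\<^esub>" if "y \<in> carrier N" for y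
  proof -
    have "\<epsilon> y \<in> hom_kernel (E 0) (E (Suc 0)) (\<delta> 0)" unfolding \<epsilon>(3)[symmetric] using that by (rule imageI)
    then show ?thesis by simp
  qed
  have "C.ext_vanishes M n (carrier M) K" if n: "n \<ge> n0" for n
  proof (rule D.ext_vanishes_of_column[OF Mm K projective_resolutionD(3)[OF res]
        projective_resolutionD(5)[OF res] projective_resolutionD(6)[OF res]])
    show "D.column_generated \<zero> n 0"
    proof (rule D.column_vanishI)
      fix f assume f: "D.row_cocycle (Suc n) 0 f" "D.column_cocycle (Suc n) 0 f"
      have fh: "f \<in> module_hom R (?P (Suc n)) (E 0)" using f(1) by (simp add: D.row_cocycle_def)
      have fN: "\<forall>p\<in>carrier (?P (Suc n)). f p \<in> \<epsilon> ` carrier N"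
        unfolding \<epsilon>(3) using f(1) module_hom_closed[OF fh] by (simp add: D.row_cocycle_def)
      obtain f' where f': "f' \<in> module_hom R (?P (Suc n)) N" "\<forall>p\<in>carrier (?P (Suc n)). \<epsilon> (f' p) = f p"
        by (rule hom_inverse_on_image[OF N \<epsilon>(1,2) D.Pm fh fN])
      have z: "f' (?d (Suc n) p) = \<zero>\<^bsub>N\<^esub>" if p: "p \<in> carrier (?P (Suc (Suc n)))" for p
      proof (rule inj_onD[OF \<epsilon>(2) _ module_hom_closed[OF f'(1) D.d_closed[OF p]] module_zero_closed[OF N]])
        show "\<epsilon> (f' (?d (Suc n) p)) = \<epsilon> \<zero>\<^bsub>N\<^esub>"
          using f'(2) D.d_closed[OF p] f(2) p \<epsilon>0 by (simp add: D.column_cocycle_def)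
      qed
      have tr: "trivial_module (Ext R (Suc n) ?X N)" using n0 n by simp
      obtain g where g: "g \<in> module_hom R (?P n) N" "\<forall>x\<in>carrier (?P (Suc n)). f' x = g (?d n x)"
        by (rule Ext_trivial_extend[OF res N tr f'(1) z])
      have "D.row_cocycle n 0 (\<lambda>p. \<epsilon> (g p))"
        unfolding D.row_cocycle_def using module_hom_comp[OF g(1) \<epsilon>(1)] \<delta>\<epsilon> module_hom_closed[OF g(1)] by simp
      moreover have "\<forall>p\<in>carrier (?P (Suc n)). f p = \<epsilon> (g (?d n p))"
        using f'(2) g(2) by metis
      ultimately show "\<exists>h. D.row_cocycle n 0 h \<and> (\<forall>p\<in>carrier (?P (Suc n)). f p = h (?d n p))"
        by (intro exI[of _ "\<lambda>p. \<epsilon> (g p)"]) simp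
    qed
  qed
  then show ?thesis unfolding C.ext_eventually_vanishes_def by blast
qed

lemma (in cring) baer_zero_module:
  assumes "module R B"
  shows "baer_module R (B\<lparr>carrier := {\<zero>\<^bsub>B\<^esub>}\<rparr>)"
proof -
  interpret B: module R B by fact
  have Z: "module R (B\<lparr>carrier := {\<zero>\<^bsub>B\<^esub>}\<rparr>)" by (rule submodule_module[OF assms zero_submodule[OF assms]])
  show ?thesis
    unfolding baer_module_def
  proof (intro conjI Z allI impI, elim conjE)
    fix I f assume I: "ideal I R" and f: "f \<in> I \<rightarrow> carrier (B\<lparr>carrier := {\<zero>\<^bsub>B\<^esub>}\<rparr>)"
    have "f a = a \<odot>\<^bsub>B\<^esub> \<zero>\<^bsub>B\<^esub>" if "a \<in> I" for a
      using funcset_mem[OF f that] ideal.Icarr[OF I that] by simp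
    then show "\<exists>e\<in>carrier (B\<lparr>carrier := {\<zero>\<^bsub>B\<^esub>}\<rparr>). \<forall>a\<in>I. f a = a \<odot>\<^bsub>B\<lparr>carrier := {\<zero>\<^bsub>B\<^esub>}\<rparr>\<^esub> e" by simp
  qed
qed

text \<open>
  The cocycles \<open>Z\<close> in degree \<open>m\<close> satisfy Baer's criterion: a homomorphism \<open>I \<rightarrow> Z\<close> is
  multiplication by some \<open>e\<close> in degree \<open>m\<close>, and \<open>\<delta> e\<close> defines a homomorphism from the ring that
  kills \<open>I\<close>; lifting it through \<open>\<delta>\<close> corrects \<open>e\<close> to a cocycle. The complex can be cut off at \<open>Z\<close>.
\<close>

theorem (in cring) inj_dim_le_of_ext_vanishes:
  fixes N :: "('a, 'c, 'n) module_scheme" and E :: "nat \<Rightarrow> ('a, ('a, 'c) univ) module"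
  assumes C: "baer_complex R E \<delta>" and N: "module R N"
    and \<epsilon>: "\<epsilon> \<in> module_hom R N (E 0)" "inj_on \<epsilon> (carrier N)"
      "\<epsilon> ` carrier N = hom_kernel (E 0) (E (Suc 0)) (\<delta> 0)"
    and V: "\<And>I. ideal I R \<Longrightarrow> baer_complex.ext_vanishes R E \<delta> (self_module R) m (carrier R) I"
  shows "inj_dim R N \<le> enat m"
proof -
  interpret C: baer_complex R E \<delta> by (rule C)
  let ?A = "self_module R"
  interpret Em: module R "E m" by (rule C.Em)
  interpret Es: module R "E (Suc m)" by (rule C.Em)
  define Z where "Z = hom_kernel (E m) (E (Suc m)) (\<delta> m)"
  have Zs: "submodule Z R (E m)" unfolding Z_def by (rule hom_kernel_submodule[OF C.Em C.Em C.\<delta>])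
  have Zm: "module R ((E m)\<lparr>carrier := Z\<rparr>)" by (rule submodule_module[OF C.Em Zs])
  have Z: "baer_module R ((E m)\<lparr>carrier := Z\<rparr>)"
    unfolding baer_module_def
  proof (intro conjI Zm allI impI, elim conjE)
    fix I f assume I: "ideal I R" and f: "f \<in> I \<rightarrow> carrier ((E m)\<lparr>carrier := Z\<rparr>)"
      and fadd: "\<forall>a\<in>I. \<forall>b\<in>I. f (a \<oplus> b) = f a \<oplus>\<^bsub>(E m)\<lparr>carrier := Z\<rparr>\<^esub> f b"
      and fsm: "\<forall>r\<in>carrier R. \<forall>a\<in>I. f (r \<otimes> a) = r \<odot>\<^bsub>(E m)\<lparr>carrier := Z\<rparr>\<^esub> f a"
    have fZ: "f a \<in> carrier (E m)" "\<delta> m (f a) = \<zero>\<^bsub>E (Suc m)\<^esub>" if "a \<in> I" for a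
      using funcset_mem[OF f that] by (simp_all add: Z_def)
    have "\<exists>e\<in>carrier (E m). \<forall>a\<in>I. f a = a \<odot>\<^bsub>E m\<^esub> e"
      using fZ(1) fadd fsm by (intro C.E[of m, unfolded baer_module_def, THEN conjunct2, rule_format]) (simp_all add: I)
    then obtain e where e: "e \<in> carrier (E m)" "\<forall>a\<in>I. f a = a \<odot>\<^bsub>E m\<^esub> e" by blast
    have \<delta>e: "\<delta> m e \<in> carrier (E (Suc m))" using e(1) by simp
    have 1: "\<forall>a\<in>I. a \<odot>\<^bsub>E (Suc m)\<^esub> \<delta> m e = \<zero>\<^bsub>E (Suc m)\<^esub>"
    proof
      fix a assume a: "a \<in> I"
      have "a \<odot>\<^bsub>E (Suc m)\<^esub> \<delta> m e = \<delta> m (f a)"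
        using module_hom_smult[OF C.\<delta> ideal.Icarr[OF I a] e(1)] e(2) a by simp
      then show "a \<odot>\<^bsub>E (Suc m)\<^esub> \<delta> m e = \<zero>\<^bsub>E (Suc m)\<^esub>" using fZ(2)[OF a] by simp
    qed
    have 2: "\<forall>r\<in>carrier R. \<delta> (Suc m) (r \<odot>\<^bsub>E (Suc m)\<^esub> \<delta> m e) = \<zero>\<^bsub>E (Suc (Suc m))\<^esub>"
    proof
      fix r assume r: "r \<in> carrier R"
      interpret Ess: module R "E (Suc (Suc m))" by (rule C.Em)
      show "\<delta> (Suc m) (r \<odot>\<^bsub>E (Suc m)\<^esub> \<delta> m e) = \<zero>\<^bsub>E (Suc (Suc m))\<^esub>"
        using module_hom_smult[OF C.\<delta> r \<delta>e] e(1) r by simp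
    qed
    obtain g where g: "g \<in> module_hom R ?A (E m)" "\<forall>a\<in>I. g a = \<zero>\<^bsub>E m\<^esub>"
        "\<forall>r\<in>carrier R. \<delta> m (g r) = r \<odot>\<^bsub>E (Suc m)\<^esub> \<delta> m e"
      by (rule C.ext_vanishesE[OF V[OF I] Es.smult_point_hom[OF \<delta>e] 1 2])
    let ?e = "e \<ominus>\<^bsub>E m\<^esub> g \<one>"
    have g1: "g \<one> \<in> carrier (E m)" using module_hom_closed[OF g(1), of \<one>] by simp
    have "\<delta> m ?e = \<delta> m e \<ominus>\<^bsub>E (Suc m)\<^esub> \<delta> m (g \<one>)" by (rule module_hom_minus[OF C.Em C.Em C.\<delta> e(1) g1])
    also have "\<dots> = \<zero>\<^bsub>E (Suc m)\<^esub>" using g(3) \<delta>e by (simp add: Es.minus_self)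
    finally have eZ: "?e \<in> Z" using e(1) g1 by (simp add: Z_def)
    have "f a = a \<odot>\<^bsub>E m\<^esub> ?e" if a: "a \<in> I" for a
    proof -
      have aR: "a \<in> carrier R" by (rule ideal.Icarr[OF I a])
      have "a \<odot>\<^bsub>E m\<^esub> g \<one> = \<zero>\<^bsub>E m\<^esub>"
        using module_hom_smult[OF g(1), of a \<one>] aR g(2) a by simp
      then have "a \<odot>\<^bsub>E m\<^esub> ?e = a \<odot>\<^bsub>E m\<^esub> e"
        using aR e(1) g1 by (simp add: a_minus_def Em.smult_r_distr Em.smult_r_minus)
      then show ?thesis using e(2) a by simp
    qed
    then show "\<exists>e\<in>carrier ((E m)\<lparr>carrier := Z\<rparr>). \<forall>a\<in>I. f a = a \<odot>\<^bsub>(E m)\<lparr>carrier := Z\<rparr>\<^esub> e" using eZ by auto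
  qed
  define E' where "E' i = (if i < m then E i else if i = m then (E m)\<lparr>carrier := Z\<rparr> else (E 0)\<lparr>carrier := {\<zero>\<^bsub>E 0\<^esub>}\<rparr>)" for i
  define d' where "d' i = (if i < m then \<delta> i else (\<lambda>x. \<zero>\<^bsub>E 0\<^esub>))" for i
  have E'B: "baer_module R (E' i)" for i
    using C.E Z baer_zero_module[OF C.Em] by (simp add: E'_def)
  have zero: "\<zero>\<^bsub>E' i\<^esub> = (if i \<le> m then \<zero>\<^bsub>E i\<^esub> else \<zero>\<^bsub>E 0\<^esub>)" for i by (simp add: E'_def)
  have carr: "carrier (E' i) = (if i < m then carrier (E i) else if i = m then Z else {\<zero>\<^bsub>E 0\<^esub>})" for i
    by (simp add: E'_def)
  have ops: "x \<oplus>\<^bsub>E' i\<^esub> y = x \<oplus>\<^bsub>E i\<^esub> y" "a \<odot>\<^bsub>E' i\<^esub> x = a \<odot>\<^bsub>E i\<^esub> x" if "i \<le> m" for i x y a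
    using that by (auto simp: E'_def)
  have d'hom: "d' i \<in> module_hom R (E' i) (E' (Suc i))" for i
  proof (cases "i < m")
    case True
    have \<delta>c: "\<delta> i x \<in> carrier (E' (Suc i))" if x: "x \<in> carrier (E i)" for x
    proof (cases "Suc i = m")
      case True
      then show ?thesis using x by (auto simp: carr Z_def)
    next
      case False
      then show ?thesis using x \<open>i < m\<close> by (simp add: carr)
    qed
    show ?thesis
      by (rule module_homI) (use True in \<open>simp_all add: d'_def carr[of i] ops \<delta>c module_hom_add[OF C.\<delta>] module_hom_smult[OF C.\<delta>]\<close>)
  next
    case False
    then have "d' i = (\<lambda>x. \<zero>\<^bsub>E' (Suc i)\<^esub>)" by (simp add: d'_def zero)
    then show ?thesis using module_hom_zero_map[OF baer_moduleD[OF E'B]] by simp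
  qed
  have d'exact: "d' i ` carrier (E' i) = hom_kernel (E' (Suc i)) (E' (Suc (Suc i))) (d' (Suc i))" for i
  proof -
    consider "Suc i < m" | "Suc i = m" | "m \<le> i" by linarith
    then show ?thesis
    proof cases
      case 1
      then show ?thesis using C.exactE[of i] by (simp add: carr d'_def zero)
    next
      case 2
      then show ?thesis using C.exactE[of i] by (auto simp: carr d'_def zero Z_def)
    next
      case 3
      have "carrier (E' i) \<noteq> {}" using module_zero_closed[OF baer_moduleD[OF E'B]] by blast
      then show ?thesis using 3 by (auto simp: carr[of "Suc i"] d'_def zero)
    qed
  qed
  have Z0: "\<epsilon> y \<in> carrier (E' 0)" if "y \<in> carrier N" for y
  proof -
    have "\<epsilon> y \<in> hom_kernel (E 0) (E (Suc 0)) (\<delta> 0)" unfolding \<epsilon>(3)[symmetric] using that by (rule imageI)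
    then show ?thesis by (auto simp: carr Z_def)
  qed
  have \<epsilon>hom: "\<epsilon> \<in> module_hom R N (E' 0)"
    by (rule module_homI) (simp_all add: Z0 ops module_hom_add[OF \<epsilon>(1)] module_hom_smult[OF \<epsilon>(1)])
  have \<epsilon>ker: "\<epsilon> ` carrier N = hom_kernel (E' 0) (E' (Suc 0)) (d' 0)"
    unfolding \<epsilon>(3) by (cases "m = 0") (auto simp: carr d'_def zero Z_def)
  have "injective_resolution R N E' d' \<epsilon>"
    unfolding injective_resolution_def a_kernel_eq One_nat_def
    using baer_injective[OF E'B] \<epsilon>hom d'hom \<epsilon>(2) \<epsilon>ker d'exact by simp
  moreover have "trivial_module (E' i)" if "i > m" for i
    using that by (simp add: trivial_module_def E'_def)
  ultimately show ?thesis unfolding inj_dim_def by (intro Inf_lower) blast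
qed

text \<open>
  Exactness on socles is the vanishing of Ext on the residue field. Since \<open>N\<close> is finitely generated, it
  spreads to all cyclic modules, with a bound on the degree that does not depend on the module.
\<close>

theorem (in noetherian_local_ring) inj_dim_finite:
  fixes M :: "('a, 'b, 'm) module_scheme" and N :: "('a, 'c, 'n) module_scheme"
  assumes M: "noetherian_module R M" and N: "fin_gen_module R N"
    and dep: "depth R M < depth R (self_module R)"
    and ext: "\<And>ys. regular_seq R (self_module R) ys \<Longrightarrow> enat (length ys) \<le> depth R M + 1 \<Longrightarrow>
      Ext_eventually_zero R (quot_by_seq R M ys) N"
  shows "inj_dim R N < \<infinity>"
proof -
  note Mm = noetherian_moduleD[OF M]
  have Nm: "module R N" using N by (simp add: fin_gen_module_def)
  obtain E :: "nat \<Rightarrow> ('a, ('a, 'c) univ) module" and \<delta> \<epsilon>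
    where C: "baer_complex R E \<delta>" and \<epsilon>: "\<epsilon> \<in> module_hom R N (E 0)" "inj_on \<epsilon> (carrier N)"
      "\<epsilon> ` carrier N = hom_kernel (E 0) (E (Suc 0)) (\<delta> 0)"
    by (rule exists_baer_complex[OF Nm])
  have "\<exists>n0. \<forall>n\<ge>n0. socle_exact_at E \<delta> n"
  proof (rule socle_exact[OF C M dep])
    fix ys assume ys: "regular_seq R (self_module R) ys" "enat (length ys) \<le> depth R M + 1"
    then have "set ys \<subseteq> carrier R" using m_sub by (auto simp: regular_seq_def max_ideal_eq)
    then have K: "submodule (seq_submodule R M ys) R M" by (rule seq_submodule_submodule[OF Mm])
    show "baer_complex.ext_eventually_vanishes R E \<delta> M (carrier M) (seq_submodule R M ys)"
      using ext[OF ys] unfolding quot_by_seq_def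
      by (rule ext_eventually_vanishes_of_Ext[OF C Nm \<epsilon> M K])
  qed
  then obtain n0 where n0: "\<forall>n\<ge>n0. socle_exact_at E \<delta> n" ..
  have "inj_dim R N \<le> enat n0"
    by (rule inj_dim_le_of_ext_vanishes[OF C Nm \<epsilon> ext_vanishes_cyclic[OF C N \<epsilon> n0 order_refl]])
  also have "\<dots> < \<infinity>" by simp
  finally show ?thesis .
qed

section \<open>Finiteness of the projective and the injective dimension\<close>

theorem corollary3p7:
  fixes R :: "('a, 'r) ring_scheme"
    and M :: "('a, 'b, 'm) module_scheme"
    and N :: "('a, 'c, 'n) module_scheme"
  assumes "noetherian_ring R" and "local_ring R"
    and "fin_gen_module R M" and "fin_gen_module R N"
    and "depth R (self_module R) > depth R M"
  shows
    "((\<forall>xs. regular_seq R (self_module R) xs \<and> enat (length xs) \<le> depth R M + 1 \<longrightarrow>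
          Tor_eventually_zero R (quot_by_seq R M xs) N)
        \<longrightarrow> proj_dim R N < \<infinity>) \<and>
     ((\<forall>xs. regular_seq R (self_module R) xs \<and> enat (length xs) \<le> depth R M + 1 \<longrightarrow>
          Ext_eventually_zero R (quot_by_seq R M xs) N)
        \<longrightarrow> inj_dim R N < \<infinity>)"
proof -
  have cr: "cring R" and "\<exists>!\<mm>. maximalideal \<mm> R" using assms(2) by (simp_all add: local_ring_def)
  then obtain \<mm> where \<mm>: "maximalideal \<mm> R" "\<And>J. maximalideal J R \<Longrightarrow> J = \<mm>" by metis
  interpret noetherian_local_ring R \<mm>
    by (intro noetherian_local_ring.intro noetherian_local_ring_axioms.intro cr assms(1) \<mm>)
  have M: "noetherian_module R M" and N: "noetherian_module R N"
    using assms(3,4) by (simp_all add: fin_gen_noetherian[OF assms(1)])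
  show ?thesis
  proof (intro conjI impI)
    assume tor: "\<forall>xs. regular_seq R (self_module R) xs \<and> enat (length xs) \<le> depth R M + 1 \<longrightarrow>
      Tor_eventually_zero R (quot_by_seq R M xs) N"
    show "proj_dim R N < \<infinity>" by (rule proj_dim_finite[OF M N assms(5)]) (use tor in simp)
  next
    assume ext: "\<forall>xs. regular_seq R (self_module R) xs \<and> enat (length xs) \<le> depth R M + 1 \<longrightarrow>
      Ext_eventually_zero R (quot_by_seq R M xs) N"
    show "inj_dim R N < \<infinity>" by (rule inj_dim_finite[OF M assms(4,5)]) (use ext in simp)
  qed
qed

end
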